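(* Let $e\ge1$ and $\Lambda\in\mathrm{Art}(\mathfrak{o})$. (a) For $\mathcal{F}\in\mathfrak{C}^{(e)}_0(\Lambda)$, the $\widehat{G}^{(e)}$-representation $H_0(X,\mathcal{F})$ belongs to $\widehat{\mathfrak{R}}^{(e)}_0(\Lambda)$. For $V\in\widehat{\mathfrak{R}}^{(e)}_0(\Lambda)$, the coefficient system $\widehat{\mathcal{F}}^{(e)}_V$ belongs to $\mathfrak{C}^{(e)}_0(\Lambda)$. (b) The assignments $\mathcal{F}\mapsto H_0(X,\mathcal{F})$ and $V\mapsto\widehat{\mathcal{F}}^{(e)}_V$ are functorial and form an adjoint pair: for $\mathcal{F}\in\mathfrak{C}^{(e)}_0(\Lambda)$ and $V\in\widehat{\mathfrak{R}}^{(e)}_0(\Lambda)$ there is a natural isomorphism $$\mathrm{Hom}_{\widehat{\mathfrak{R}}^{(e)}_0(\Lambda)}(H_0(X,\mathcal{F}),V)\cong\mathrm{Hom}_{\mathfrak{C}^{(e)}_0(\Lambda)}(\mathcal{F},\widehat{\mathcal{F}}^{(e)}_V).$$ (c) These functors are mutually quasi-inverse equivalences of categories between $\mathfrak{C}^{(e)}_0(\Lambda)$ and $\widehat{\mathfrak{R}}^{(e)}_0(\Lambda)$. (d) For $\mathcal{F}\in\mathfrak{C}^{(e)}_0(\Lambda)$ and $V\in\widehat{\mathfrak{R}}^{(e)}_0(\Lambda)$ the natural maps $\mathcal{F}\to\widehat{\mathcal{F}}^{(e)}_{H_0(X,\mathcal{F})}$ and $H_0(X,\widehat{\mathcal{F}}^{(e)}_V)\to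 V$ are isomorphisms.
   Context: Setting: $F$ is a non-archimedean local field with finite residue field of characteristic $p$; $G=\mathrm{GL}_2(F)$ with centre $Z$. $X$ is the Bruhat–Tits tree of $\mathrm{PGL}_2(F)$ (vertex set $X^0$, edge set $X^1$, edges identified with 2-element vertex sets, graph distance $d$; automorphisms are $d$-preserving permutations of $X^0$); $G$ acts on $X$ through $\mathrm{PGL}_2(F)$. For $x\in X^0$, $K_x$ is the maximal compact subgroup of $G$ fixing $x$, $U^{(1)}_x$ its maximal normal pro-$p$ subgroup, $U^{(e)}_x=\bigcap_{d(x,y)\le e-1}U^{(1)}_y$; for $\tau=\{x_1,x_2\}\in X^1$, $U^{(e)}_\tau=\langle U^{(e)}_{x_1},U^{(e)}_{x_2}\rangle$. $Z^{(e)}(x)=\{y:d(x,y)\le e\}$, $Z^{(e)}(\tau)=Z^{(e)}(x_1)\cup Z^{(e)}(x_2)$. Fix an edge $\sigma=\{x_+,x_-\}$. One has $X^0=\mathrm{SL}_2(F)x_+\sqcup\mathrm{SL}_2(F)x_-$; for an edge $\eta$ let $x_{\eta,+}$ be its vertex in $\mathrm{SL}_2(F)x_+$. $\mathfrak{o}$ is a complete discrete valuation ring with residue field $k$ of characteristic $p$; $\mathrm{Art}(\mathfrak{o})$ is the category of Artinian local $\mathfrak{o}$-algebras with residue field $k$. A homological coefficient system $\mathcal{F}$ of $\Lambda$-modules on $X$: modules $\mathcal{F}(\tau)$ for vertices and edges, maps $r^\tau_x:\mathcal{F}(\tau)\to\mathcal{F}(x)$ for $x\in\tau\in X^1$; $H_0(X,\mathcal{F})$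 is the cokernel of $\bigoplus_{\tau\in X^1}\mathcal{F}(\tau)\to\bigoplus_{x\in X^0}\mathcal{F}(x)$, $f\mapsto\sum_{x\in\tau}r^\tau_x(f)$. For a group $H$ acting on $X$, $\mathcal{F}$ is $H$-equivariant if given maps $g_\tau:\mathcal{F}(\tau)\to\mathcal{F}(g\tau)$ with $g_{h\tau}h_\tau=(gh)_\tau$, $1_\tau=\mathrm{id}$, $r^{g\tau}_{gx}g_x=g_\tau r^\tau_x$; then $H$ acts on $H_0(X,\mathcal{F})$. Morphisms are families of maps compatible with transition maps and actions. $\mathfrak{C}^{(e)}(\Lambda)$: $G$-equivariant systems with (a) $U^{(e)}_\tau$ acting trivially on $\mathcal{F}(\tau)$ for all vertices/edges $\tau$; (b) for $z\in\eta\in X^1$, $r^\eta_z$ injective with image $\mathcal{F}(z)^{U^{(e)}_\eta}$, and this image generates $\mathcal{F}(z)$ as $K_z$-representation. $\mathfrak{C}^{(e)}_0(\Lambda)$: full subcategory on which $Z$ acts trivially. $\widehat{G}^{(e)}$ is the group of automorphisms $g$ of $X$ such that for each $\mu\in X^1$ some $g'\in G$ agrees with $g$ on $Z^{(e)}(\mu)$; it contains $\mathrm{PGL}_2(F)$. $\widehat{U}^{(e)}_\eta$ ($\eta\in X^1$) is defined likewise with $g'\in U^{(e)}_\eta$. $\widehat{U}^{(e)}_\sigma$ is profinite as the inverse limit of its images in the permutation groups of the finite sets $Z^{(m)}(\sigma)$. For $\mathcal{F}\in\mathfrak{C}^{(e)}_0(\Lambda)$, $\widehat{G}^{(e)}$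 acts on $\mathcal{F}$ and $H_0(X,\mathcal{F})$: $g$ acts on $\mathcal{F}(\eta)$ (resp. $\mathcal{F}(x)$) as any $g'\in G$ agreeing with $g$ on $Z^{(e)}(\eta)$ (resp. $Z^{(e)}(x)$). $\widehat{\mathfrak{R}}^{(e)}_0(\Lambda)$ is the category of representations of $\widehat{G}^{(e)}$ on $\Lambda$-modules $V$ that are generated by $V^{\widehat{U}^{(e)}_\sigma}$ and are smooth as $\widehat{U}^{(e)}_\sigma$-representations (each vector fixed by an open subgroup); morphisms are equivariant $\Lambda$-linear maps. For such $V$, $\widehat{\mathcal{F}}^{(e)}_V$ is the coefficient system with $\widehat{\mathcal{F}}^{(e)}_V(\eta)=V^{\widehat{U}^{(e)}_\eta}$ for $\eta\in X^1$ and $\widehat{\mathcal{F}}^{(e)}_V(x)=\sum_{y:\{x,y\}\in X^1}V^{\widehat{U}^{(e)}_{\{x,y\}}}$ (sum inside $V$); the transition map $r^\eta_x$ is the inclusion if $x\in\mathrm{SL}_2(F)x_+$ and the negative of the inclusion if $x\in\mathrm{SL}_2(F)x_-$; $G$ acts via $g_\tau(v)=gv$ (through $G\to\mathrm{PGL}_2(F)\subset\widehat{G}^{(e)}$). The natural map $H_0(X,\widehat{\mathcal{F}}^{(e)}_V)\to V$ is induced by the sum of the inclusions $\widehat{\mathcal{F}}^{(e)}_V(x)\subset V$. The natural map $\mathcal{F}\to\widehat{\mathcal{F}}^{(e)}_{H_0(X,\mathcal{F})}$ sends $f\in\mathcal{F}(x)$ to its class in $H_0(X,\mathcal{F})$,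 and $f\in\mathcal{F}(\eta)$ to the class of $r^\eta_{x_{\eta,+}}(f)$.
   Formalization: On edges, g acts on F̂_V by v ↦ −gv (not gv) if g exchanges the two SL_2(F)-orbits of vertices; with gv throughout, F̂_V is not equivariant (e.g. V=Λ trivial, p odd). Equivariance is read as r^{gτ}_{gx} g_τ = g_x r^τ_x. *)

theory Defs
  imports "HOL-Analysis.Analysis" "HOL-Algebra.Algebra"
begin

section \<open>Rings of coefficients\<close>

definition local_cring :: "('a, 'b) ring_scheme \<Rightarrow> bool" where
  "local_cring R \<longleftrightarrow> cring R \<and> (\<exists>!I. maximalideal I R)"

definition max_ideal :: "('a, 'b) ring_scheme \<Rightarrow> 'a set" where
  "max_ideal R = (THE I. maximalideal I R)"

primrec ideal_power :: "('a, 'b) ring_scheme \<Rightarrow> 'a set \<Rightarrow> nat \<Rightarrow> 'a set" where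
  "ideal_power R I 0 = carrier R"
| "ideal_power R I (Suc n) = ideal_prod R I (ideal_power R I n)"

text \<open>The last conjunct says that \<open>R\<close> maps bijectively onto the inverse limit of the quotients
  of \<open>R\<close> by the powers of its maximal ideal, an element of the limit being given by a coherent
  sequence of representatives.\<close>

definition complete_dvr :: "('a, 'b) ring_scheme \<Rightarrow> bool" where
  "complete_dvr R \<longleftrightarrow>
     principal_domain R \<and> local_cring R \<and> max_ideal R \<noteq> {\<zero>\<^bsub>R\<^esub>} \<and>
     (\<forall>s :: nat \<Rightarrow> 'a.
        (\<forall>n. s n \<in> carrier R \<and> s (Suc n) \<ominus>\<^bsub>R\<^esub> s n \<in> ideal_power R (max_ideal R) n) \<longrightarrow>
        (\<exists>!a. a \<in> carrier R \<and> (\<forall>n. s n \<ominus>\<^bsub>R\<^esub> a \<in> ideal_power R (max_ideal R) n)))"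

definition residue_field_char :: "('a, 'b) ring_scheme \<Rightarrow> nat \<Rightarrow> bool" where
  "residue_field_char R p \<longleftrightarrow> Factorial_Ring.prime p \<and> add_pow R p \<one>\<^bsub>R\<^esub> \<in> max_ideal R"

definition artinian_cring :: "('a, 'b) ring_scheme \<Rightarrow> bool" where
  "artinian_cring R \<longleftrightarrow> cring R \<and>
     (\<forall>I :: nat \<Rightarrow> 'a set. (\<forall>n. ideal (I n) R \<and> I (Suc n) \<subseteq> I n) \<longrightarrow> (\<exists>n. \<forall>m\<ge>n. I m = I n))"

text \<open>Artinian local \<open>\<oo>\<close>-algebras with the same residue field as \<open>\<oo>\<close>: the last two conjuncts
  say that the structure map \<open>a \<mapsto> a \<odot> \<one>\<close> induces an (injective, surjective) isomorphism
  of residue fields.\<close>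

definition art_algebra :: "('o, 'b) ring_scheme \<Rightarrow> ('o, 'l) module \<Rightarrow> bool" where
  "art_algebra \<oo> \<Lambda> \<longleftrightarrow>
     Module.algebra \<oo> \<Lambda> \<and> artinian_cring \<Lambda> \<and> local_cring \<Lambda> \<and>
     (\<forall>a\<in>carrier \<oo>. a \<odot>\<^bsub>\<Lambda>\<^esub> \<one>\<^bsub>\<Lambda>\<^esub> \<in> max_ideal \<Lambda> \<longleftrightarrow> a \<in> max_ideal \<oo>) \<and>
     (\<forall>b\<in>carrier \<Lambda>. \<exists>a\<in>carrier \<oo>. b \<ominus>\<^bsub>\<Lambda>\<^esub> (a \<odot>\<^bsub>\<Lambda>\<^esub> \<one>\<^bsub>\<Lambda>\<^esub>) \<in> max_ideal \<Lambda>)"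


section \<open>Modules\<close>

text \<open>Linear maps are extensional, so that equality of morphisms is equality of functions.\<close>

definition lin_maps ::
  "('l, 'c) ring_scheme \<Rightarrow> ('l, 'a) module \<Rightarrow> ('l, 'b) module \<Rightarrow> ('a \<Rightarrow> 'b) set" where
  "lin_maps \<Lambda> M N = {f \<in> carrier M \<rightarrow>\<^sub>E carrier N.
     (\<forall>x\<in>carrier M. \<forall>y\<in>carrier M. f (x \<oplus>\<^bsub>M\<^esub> y) = f x \<oplus>\<^bsub>N\<^esub> f y) \<and>
     (\<forall>a\<in>carrier \<Lambda>. \<forall>x\<in>carrier M. f (a \<odot>\<^bsub>M\<^esub> x) = a \<odot>\<^bsub>N\<^esub> f x)}"

abbreviation linear_on ::
  "('l, 'c) ring_scheme \<Rightarrow> ('l, 'a) module \<Rightarrow> ('l, 'b) module \<Rightarrow> ('a \<Rightarrow> 'b) \<Rightarrow> bool" where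
  "linear_on \<Lambda> M N f \<equiv> restrict f (carrier M) \<in> lin_maps \<Lambda> M N"

text \<open>The fields \<^const>\<open>monoid.mult\<close> and \<^const>\<open>monoid.one\<close> of a record of type
  \<^typ>\<open>('l, 'm) module\<close> play no role for modules.\<close>

definition direct_sum :: "'i set \<Rightarrow> ('i \<Rightarrow> ('l, 'm) module) \<Rightarrow> ('l, 'i \<Rightarrow> 'm) module" where
  "direct_sum I M =
     \<lparr>carrier = {c \<in> (\<Pi>\<^sub>E i\<in>I. carrier (M i)). finite {i\<in>I. c i \<noteq> \<zero>\<^bsub>M i\<^esub>}},
      monoid.mult = undefined, one = undefined,
      ring.zero = (\<lambda>i\<in>I. \<zero>\<^bsub>M i\<^esub>),
      ring.add = (\<lambda>c d. \<lambda>i\<in>I. c i \<oplus>\<^bsub>M i\<^esub> d i),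
      module.smult = (\<lambda>a c. \<lambda>i\<in>I. a \<odot>\<^bsub>M i\<^esub> c i)\<rparr>"

text \<open>The map on cosets induced by a map \<open>f\<close> on representatives.\<close>

definition coset_map ::
  "('l, 'b) module \<Rightarrow> 'b set \<Rightarrow> ('a \<Rightarrow> 'b) \<Rightarrow> 'a set \<Rightarrow> 'b set" where
  "coset_map M N f A = (\<Union>c\<in>A. N +>\<^bsub>M\<^esub> f c)"

definition quot_module :: "('l, 'm) module \<Rightarrow> 'm set \<Rightarrow> ('l, 'm set) module" where
  "quot_module M N =
     \<lparr>carrier = a_rcosets\<^bsub>M\<^esub> N,
      monoid.mult = undefined, one = undefined,
      ring.zero = N,
      ring.add = (<+>\<^bsub>M\<^esub>),
      module.smult = (\<lambda>a. coset_map M N (\<lambda>c. a \<odot>\<^bsub>M\<^esub> c))\<rparr>"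

definition subrep_generated ::
  "('l, 'c) ring_scheme \<Rightarrow> ('l, 'm) module \<Rightarrow> 'h set \<Rightarrow> ('h \<Rightarrow> 'm \<Rightarrow> 'm) \<Rightarrow> 'm set \<Rightarrow> 'm set" where
  "subrep_generated \<Lambda> M H \<rho> S =
     \<Inter>{N. submodule N \<Lambda> M \<and> (\<forall>h\<in>H. \<forall>x\<in>N. \<rho> h x \<in> N) \<and> S \<subseteq> N}"


section \<open>The local field\<close>

text \<open>The normalised valuation \<open>v\<close> takes values in the integers; its value at \<open>0\<close> is irrelevant.\<close>

definition frac_ideal :: "('f::field \<Rightarrow> int) \<Rightarrow> int \<Rightarrow> 'f set" where
  "frac_ideal v n = {a. a = 0 \<or> n \<le> v a}"

definition nonarch_local_field :: "('f::field \<Rightarrow> int) \<Rightarrow> nat \<Rightarrow> bool" where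
  "nonarch_local_field v p \<longleftrightarrow>
     (\<forall>a b. a \<noteq> 0 \<longrightarrow> b \<noteq> 0 \<longrightarrow> v (a * b) = v a + v b) \<and>
     (\<forall>a b. a \<noteq> 0 \<longrightarrow> b \<noteq> 0 \<longrightarrow> a + b \<noteq> 0 \<longrightarrow> min (v a) (v b) \<le> v (a + b)) \<and>
     (\<exists>a. a \<noteq> 0 \<and> v a = 1) \<and>
     (\<forall>s :: nat \<Rightarrow> 'f. (\<forall>n. \<exists>N. \<forall>i\<ge>N. \<forall>j\<ge>N. s i - s j \<in> frac_ideal v n) \<longrightarrow>
        (\<exists>l. \<forall>n. \<exists>N. \<forall>i\<ge>N. s i - l \<in> frac_ideal v n)) \<and>
     finite (frac_ideal v 0 //
       {(a, b). a \<in> frac_ideal v 0 \<and> b \<in> frac_ideal v 0 \<and> a - b \<in> frac_ideal v 1}) \<and>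
     Factorial_Ring.prime p \<and> of_nat p \<in> frac_ideal v 1"

definition GL2 :: "('f::field ^ 2 ^ 2) monoid" where
  "GL2 = \<lparr>carrier = {A. invertible A}, monoid.mult = (**), one = mat 1\<rparr>"

definition GL2_centre :: "('f::field ^ 2 ^ 2) set" where
  "GL2_centre = {z \<in> carrier GL2. \<forall>g\<in>carrier GL2. z ** g = g ** z}"

definition matrix_topology :: "('f::field \<Rightarrow> int) \<Rightarrow> ('f ^ 2 ^ 2) topology" where
  "matrix_topology v =
     topology_generated_by {{B. \<forall>i j. B $ i $ j - A $ i $ j \<in> frac_ideal v n} | A n. True}"

text \<open>A compact subgroup of \<open>GL\<^sub>2(F)\<close> is profinite; it is pro-\<open>p\<close> if its open normal
  subgroups have \<open>p\<close>-power index.\<close>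

definition pro_p_subgroup :: "('f::field \<Rightarrow> int) \<Rightarrow> nat \<Rightarrow> ('f ^ 2 ^ 2) set \<Rightarrow> bool" where
  "pro_p_subgroup v p N \<longleftrightarrow>
     subgroup N GL2 \<and> compactin (matrix_topology v) N \<and>
     (\<forall>H. H \<lhd> (GL2\<lparr>carrier := N\<rparr>) \<and> openin (subtopology (matrix_topology v) N) H \<longrightarrow>
          (\<exists>k. card (rcosets\<^bsub>GL2\<lparr>carrier := N\<rparr>\<^esub> H) = p ^ k))"


section \<open>The Bruhat--Tits tree\<close>

text \<open>Vertices are homothety classes of lattices in \<open>F\<^sup>2\<close>.  Simplices are nonempty sets of
  vertices: the edges, and the vertices \<open>x\<close> in the guise of the singletons \<open>{x}\<close>.\<close>

type_synonym 'f vertex = "('f ^ 2) set set"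
type_synonym 'f tree_simplex = "'f vertex set"

definition lattices :: "('f::field \<Rightarrow> int) \<Rightarrow> ('f ^ 2) set set" where
  "lattices v = {{a *s u + b *s w | a b. a \<in> frac_ideal v 0 \<and> b \<in> frac_ideal v 0} | u w.
     vec.span {u, w} = UNIV}"

definition vertices :: "('f::field \<Rightarrow> int) \<Rightarrow> 'f vertex set" where
  "vertices v = (\<lambda>L. {(\<lambda>u. c *s u) ` L | c. c \<noteq> 0}) ` lattices v"

definition edges :: "('f::field \<Rightarrow> int) \<Rightarrow> 'f tree_simplex set" where
  "edges v = {{x, y} | x y. x \<in> vertices v \<and> y \<in> vertices v \<and>
     (\<exists>L\<in>x. \<exists>L'\<in>y. \<exists>t. t \<noteq> 0 \<and> v t = 1 \<and> (\<lambda>u. t *s u) ` L \<subset> L' \<and> L' \<subset> L)}"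

definition simplices :: "('f::field \<Rightarrow> int) \<Rightarrow> 'f tree_simplex set" where
  "simplices v = (\<lambda>x. {x}) ` vertices v \<union> edges v"

definition tree_dist :: "('f::field \<Rightarrow> int) \<Rightarrow> 'f vertex \<Rightarrow> 'f vertex \<Rightarrow> nat" where
  "tree_dist v x y = (LEAST n. (x, y) \<in> {(x, y). {x, y} \<in> edges v} ^^ n)"

definition act_vertex :: "'f::field ^ 2 ^ 2 \<Rightarrow> 'f vertex \<Rightarrow> 'f vertex" where
  "act_vertex g x = (\<lambda>L. (\<lambda>u. g *v u) ` L) ` x"

definition act_simplex :: "'f::field ^ 2 ^ 2 \<Rightarrow> 'f tree_simplex \<Rightarrow> 'f tree_simplex" where
  "act_simplex g \<tau> = act_vertex g ` \<tau>"

definition SL2_orbit :: "'f::field vertex \<Rightarrow> 'f vertex set" where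
  "SL2_orbit x = {act_vertex g x | g. det g = 1}"

definition plus_vertex :: "'f::field vertex \<Rightarrow> 'f tree_simplex \<Rightarrow> 'f vertex" where
  "plus_vertex xp \<eta> = (THE x. x \<in> \<eta> \<and> x \<in> SL2_orbit xp)"

definition tree_ball :: "('f::field \<Rightarrow> int) \<Rightarrow> nat \<Rightarrow> 'f tree_simplex \<Rightarrow> 'f vertex set" where
  "tree_ball v e \<tau> = {y \<in> vertices v. \<exists>x\<in>\<tau>. tree_dist v x y \<le> e}"

text \<open>\<^term>\<open>Greatest\<close> refers to the inclusion of subgroups.\<close>

definition K_group :: "('f::field \<Rightarrow> int) \<Rightarrow> 'f vertex \<Rightarrow> ('f ^ 2 ^ 2) set" where
  "K_group v x = (GREATEST K. subgroup K GL2 \<and> compactin (matrix_topology v) K \<and>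
     (\<forall>g\<in>K. act_vertex g x = x))"

definition U1_group :: "('f::field \<Rightarrow> int) \<Rightarrow> nat \<Rightarrow> 'f vertex \<Rightarrow> ('f ^ 2 ^ 2) set" where
  "U1_group v p x =
     (GREATEST N. N \<lhd> (GL2\<lparr>carrier := K_group v x\<rparr>) \<and> pro_p_subgroup v p N)"

text \<open>For \<open>\<tau> = {x}\<close> the following is the group \<open>U\<^sub>x\<^sup>(\<^sup>e\<^sup>)\<close> itself, for \<open>\<tau> = {x\<^sub>1, x\<^sub>2}\<close> it is
  the subgroup generated by \<open>U\<^bsub>x\<^sub>1\<^esub>\<^sup>(\<^sup>e\<^sup>)\<close> and \<open>U\<^bsub>x\<^sub>2\<^esub>\<^sup>(\<^sup>e\<^sup>)\<close>.\<close>

definition U_group :: "('f::field \<Rightarrow> int) \<Rightarrow> nat \<Rightarrow> nat \<Rightarrow> 'f tree_simplex \<Rightarrow> ('f ^ 2 ^ 2) set" where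
  "U_group v p e \<tau> = generate GL2
     (\<Union>x\<in>\<tau>. \<Inter>y\<in>{y \<in> vertices v. tree_dist v x y \<le> e - 1}. U1_group v p y)"


section \<open>Automorphisms of the tree\<close>

definition tree_aut :: "('f::field \<Rightarrow> int) \<Rightarrow> ('f vertex \<Rightarrow> 'f vertex) set" where
  "tree_aut v = {g \<in> Bij (vertices v).
     \<forall>x\<in>vertices v. \<forall>y\<in>vertices v. tree_dist v (g x) (g y) = tree_dist v x y}"

text \<open>The automorphisms agreeing on each \<open>Z\<^sup>(\<^sup>e\<^sup>)(\<mu>)\<close>, \<open>\<mu>\<close> an edge, with some element of \<open>S\<close>\<close>

definition local_closure ::
  "('f::field \<Rightarrow> int) \<Rightarrow> nat \<Rightarrow> ('f ^ 2 ^ 2) set \<Rightarrow> ('f vertex \<Rightarrow> 'f vertex) set" where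
  "local_closure v e S = {g \<in> tree_aut v.
     \<forall>\<mu>\<in>edges v. \<exists>g'\<in>S. \<forall>x\<in>tree_ball v e \<mu>. g x = act_vertex g' x}"

definition hat_G :: "('f::field \<Rightarrow> int) \<Rightarrow> nat \<Rightarrow> ('f vertex \<Rightarrow> 'f vertex) monoid" where
  "hat_G v e = (BijGroup (vertices v))\<lparr>carrier := local_closure v e (carrier GL2)\<rparr>"

definition hat_U ::
  "('f::field \<Rightarrow> int) \<Rightarrow> nat \<Rightarrow> nat \<Rightarrow> 'f tree_simplex \<Rightarrow> ('f vertex \<Rightarrow> 'f vertex) set" where
  "hat_U v p e \<eta> = local_closure v e (U_group v p e \<eta>)"

definition to_hat_G :: "('f::field \<Rightarrow> int) \<Rightarrow> 'f ^ 2 ^ 2 \<Rightarrow> 'f vertex \<Rightarrow> 'f vertex" where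
  "to_hat_G v g = restrict (act_vertex g) (vertices v)"

text \<open>The inverse limit topology: the coarsest one for which the restriction maps to the (discrete)
  permutation groups of the finite sets \<open>Z\<^sup>(\<^sup>m\<^sup>)(\<sigma>)\<close> are continuous; the generating sets are the
  nonempty fibres of these maps.\<close>

definition hat_U_topology ::
  "('f::field \<Rightarrow> int) \<Rightarrow> nat \<Rightarrow> nat \<Rightarrow> 'f tree_simplex \<Rightarrow> ('f vertex \<Rightarrow> 'f vertex) topology" where
  "hat_U_topology v p e \<sigma> = topology_generated_by
     {{g \<in> hat_U v p e \<sigma>. \<forall>x\<in>tree_ball v m \<sigma>. g x = h x} | h m. h \<in> hat_U v p e \<sigma>}"


section \<open>Coefficient systems\<close>

text \<open>A \<open>GL\<^sub>2(F)\<close>-equivariant homological coefficient system \<open>\<F>\<close>: the modules \<open>\<F>(\<tau>)\<close>, the maps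
  \<open>r\<^sup>\<tau>\<^sub>x\<close> and the maps \<open>g\<^sub>\<tau>\<close>.\<close>

record ('f, 'l, 'm) coeff_system =
  obj :: "'f tree_simplex \<Rightarrow> ('l, 'm) module"
  trans_map :: "'f tree_simplex \<Rightarrow> 'f vertex \<Rightarrow> 'm \<Rightarrow> 'm"
  act_map :: "'f ^ 2 ^ 2 \<Rightarrow> 'f tree_simplex \<Rightarrow> 'm \<Rightarrow> 'm"

definition equivariant_coeff_system ::
  "('f::field \<Rightarrow> int) \<Rightarrow> ('l, 'c) ring_scheme \<Rightarrow> ('f, 'l, 'm) coeff_system \<Rightarrow> bool" where
  "equivariant_coeff_system v \<Lambda> F \<longleftrightarrow>
     (\<forall>\<tau>\<in>simplices v. Module.module \<Lambda> (obj F \<tau>)) \<and>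
     (\<forall>\<tau>\<in>edges v. \<forall>x\<in>\<tau>. linear_on \<Lambda> (obj F \<tau>) (obj F {x}) (trans_map F \<tau> x)) \<and>
     (\<forall>g\<in>carrier GL2. \<forall>\<tau>\<in>simplices v.
        linear_on \<Lambda> (obj F \<tau>) (obj F (act_simplex g \<tau>)) (act_map F g \<tau>)) \<and>
     (\<forall>g\<in>carrier GL2. \<forall>h\<in>carrier GL2. \<forall>\<tau>\<in>simplices v. \<forall>f\<in>carrier (obj F \<tau>).
        act_map F g (act_simplex h \<tau>) (act_map F h \<tau> f) = act_map F (g ** h) \<tau> f) \<and>
     (\<forall>\<tau>\<in>simplices v. \<forall>f\<in>carrier (obj F \<tau>). act_map F (mat 1) \<tau> f = f) \<and>
     (\<forall>g\<in>carrier GL2. \<forall>\<tau>\<in>edges v. \<forall>x\<in>\<tau>. \<forall>f\<in>carrier (obj F \<tau>).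
        trans_map F (act_simplex g \<tau>) (act_vertex g x) (act_map F g \<tau> f) =
        act_map F g {x} (trans_map F \<tau> x f))"

definition cat_C ::
  "('f::field \<Rightarrow> int) \<Rightarrow> nat \<Rightarrow> nat \<Rightarrow> ('l, 'c) ring_scheme \<Rightarrow> ('f, 'l, 'm) coeff_system set" where
  "cat_C v p e \<Lambda> = {F. equivariant_coeff_system v \<Lambda> F \<and>
     (\<forall>\<tau>\<in>simplices v. \<forall>g\<in>U_group v p e \<tau>. \<forall>f\<in>carrier (obj F \<tau>). act_map F g \<tau> f = f) \<and>
     (\<forall>\<eta>\<in>edges v. \<forall>z\<in>\<eta>.
        inj_on (trans_map F \<eta> z) (carrier (obj F \<eta>)) \<and>
        trans_map F \<eta> z ` carrier (obj F \<eta>) =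
          {f \<in> carrier (obj F {z}). \<forall>g\<in>U_group v p e \<eta>. act_map F g {z} f = f} \<and>
        subrep_generated \<Lambda> (obj F {z}) (K_group v z) (\<lambda>g. act_map F g {z})
          (trans_map F \<eta> z ` carrier (obj F \<eta>)) = carrier (obj F {z}))}"

definition cat_C0 ::
  "('f::field \<Rightarrow> int) \<Rightarrow> nat \<Rightarrow> nat \<Rightarrow> ('l, 'c) ring_scheme \<Rightarrow> ('f, 'l, 'm) coeff_system set" where
  "cat_C0 v p e \<Lambda> = {F \<in> cat_C v p e \<Lambda>.
     \<forall>z\<in>GL2_centre. \<forall>\<tau>\<in>simplices v. \<forall>f\<in>carrier (obj F \<tau>). act_map F z \<tau> f = f}"

definition C_hom ::
  "('f::field \<Rightarrow> int) \<Rightarrow> ('l, 'c) ring_scheme \<Rightarrow>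
   ('f, 'l, 'm) coeff_system \<Rightarrow> ('f, 'l, 'n) coeff_system \<Rightarrow> ('f tree_simplex \<Rightarrow> 'm \<Rightarrow> 'n) set" where
  "C_hom v \<Lambda> F F' = {\<phi> \<in> (\<Pi>\<^sub>E \<tau>\<in>simplices v. lin_maps \<Lambda> (obj F \<tau>) (obj F' \<tau>)).
     (\<forall>\<tau>\<in>edges v. \<forall>x\<in>\<tau>. \<forall>f\<in>carrier (obj F \<tau>).
        \<phi> {x} (trans_map F \<tau> x f) = trans_map F' \<tau> x (\<phi> \<tau> f)) \<and>
     (\<forall>g\<in>carrier GL2. \<forall>\<tau>\<in>simplices v. \<forall>f\<in>carrier (obj F \<tau>).
        \<phi> (act_simplex g \<tau>) (act_map F g \<tau> f) = act_map F' g \<tau> (\<phi> \<tau> f))}"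

definition C_id ::
  "('f::field \<Rightarrow> int) \<Rightarrow> ('f, 'l, 'm) coeff_system \<Rightarrow> 'f tree_simplex \<Rightarrow> 'm \<Rightarrow> 'm" where
  "C_id v F = (\<lambda>\<tau>\<in>simplices v. \<lambda>f\<in>carrier (obj F \<tau>). f)"

text \<open>\<open>C_comp v F \<psi> \<phi>\<close> is \<open>\<psi> \<circ> \<phi>\<close>, where \<open>F\<close> is the source of \<open>\<phi>\<close>; the argument order is that of
  \<^const>\<open>compose\<close>.\<close>

definition C_comp ::
  "('f::field \<Rightarrow> int) \<Rightarrow> ('f, 'l, 'm) coeff_system \<Rightarrow> ('f tree_simplex \<Rightarrow> 'n \<Rightarrow> 'k) \<Rightarrow>
   ('f tree_simplex \<Rightarrow> 'm \<Rightarrow> 'n) \<Rightarrow> 'f tree_simplex \<Rightarrow> 'm \<Rightarrow> 'k" where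
  "C_comp v F \<psi> \<phi> = (\<lambda>\<tau>\<in>simplices v. compose (carrier (obj F \<tau>)) (\<psi> \<tau>) (\<phi> \<tau>))"

definition C_iso ::
  "('f::field \<Rightarrow> int) \<Rightarrow> ('l, 'c) ring_scheme \<Rightarrow>
   ('f, 'l, 'm) coeff_system \<Rightarrow> ('f, 'l, 'n) coeff_system \<Rightarrow> ('f tree_simplex \<Rightarrow> 'm \<Rightarrow> 'n) set" where
  "C_iso v \<Lambda> F F' = {\<phi> \<in> C_hom v \<Lambda> F F'. \<exists>\<psi>\<in>C_hom v \<Lambda> F' F.
     C_comp v F \<psi> \<phi> = C_id v F \<and> C_comp v F' \<phi> \<psi> = C_id v F'}"


section \<open>Representations of the completed group\<close>

record ('f, 'l, 'w) rep =
  rep_mod :: "('l, 'w) module"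
  rep_act :: "('f vertex \<Rightarrow> 'f vertex) \<Rightarrow> 'w \<Rightarrow> 'w"

definition hat_rep ::
  "('f::field \<Rightarrow> int) \<Rightarrow> nat \<Rightarrow> ('l, 'c) ring_scheme \<Rightarrow> ('f, 'l, 'w) rep \<Rightarrow> bool" where
  "hat_rep v e \<Lambda> V \<longleftrightarrow>
     Module.module \<Lambda> (rep_mod V) \<and>
     (\<forall>g\<in>carrier (hat_G v e). linear_on \<Lambda> (rep_mod V) (rep_mod V) (rep_act V g)) \<and>
     (\<forall>g\<in>carrier (hat_G v e). \<forall>h\<in>carrier (hat_G v e). \<forall>w\<in>carrier (rep_mod V).
        rep_act V (g \<otimes>\<^bsub>hat_G v e\<^esub> h) w = rep_act V g (rep_act V h w)) \<and>
     (\<forall>w\<in>carrier (rep_mod V). rep_act V \<one>\<^bsub>hat_G v e\<^esub> w = w)"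

definition rep_fixed :: "('f, 'l, 'w) rep \<Rightarrow> ('f vertex \<Rightarrow> 'f vertex) set \<Rightarrow> 'w set" where
  "rep_fixed V H = {w \<in> carrier (rep_mod V). \<forall>h\<in>H. rep_act V h w = w}"

definition cat_R0 ::
  "('f::field \<Rightarrow> int) \<Rightarrow> nat \<Rightarrow> nat \<Rightarrow> 'f tree_simplex \<Rightarrow> ('l, 'c) ring_scheme \<Rightarrow>
   ('f, 'l, 'w) rep set" where
  "cat_R0 v p e \<sigma> \<Lambda> = {V. hat_rep v e \<Lambda> V \<and>
     subrep_generated \<Lambda> (rep_mod V) (carrier (hat_G v e)) (rep_act V)
       (rep_fixed V (hat_U v p e \<sigma>)) = carrier (rep_mod V) \<and>
     (\<forall>w\<in>carrier (rep_mod V). \<exists>H. subgroup H (hat_G v e) \<and> openin (hat_U_topology v p e \<sigma>) H \<and>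
        (\<forall>h\<in>H. rep_act V h w = w))}"

definition R_hom ::
  "('f::field \<Rightarrow> int) \<Rightarrow> nat \<Rightarrow> ('l, 'c) ring_scheme \<Rightarrow>
   ('f, 'l, 'w) rep \<Rightarrow> ('f, 'l, 'u) rep \<Rightarrow> ('w \<Rightarrow> 'u) set" where
  "R_hom v e \<Lambda> V W = {\<phi> \<in> lin_maps \<Lambda> (rep_mod V) (rep_mod W).
     \<forall>g\<in>carrier (hat_G v e). \<forall>w\<in>carrier (rep_mod V). \<phi> (rep_act V g w) = rep_act W g (\<phi> w)}"

definition R_id :: "('f, 'l, 'w) rep \<Rightarrow> 'w \<Rightarrow> 'w" where
  "R_id V = (\<lambda>w\<in>carrier (rep_mod V). w)"

definition R_comp :: "('f, 'l, 'w) rep \<Rightarrow> ('u \<Rightarrow> 'k) \<Rightarrow> ('w \<Rightarrow> 'u) \<Rightarrow> 'w \<Rightarrow> 'k" where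
  "R_comp V \<psi> \<phi> = compose (carrier (rep_mod V)) \<psi> \<phi>"

definition R_iso ::
  "('f::field \<Rightarrow> int) \<Rightarrow> nat \<Rightarrow> ('l, 'c) ring_scheme \<Rightarrow>
   ('f, 'l, 'w) rep \<Rightarrow> ('f, 'l, 'u) rep \<Rightarrow> ('w \<Rightarrow> 'u) set" where
  "R_iso v e \<Lambda> V W = {\<phi> \<in> R_hom v e \<Lambda> V W. \<exists>\<psi>\<in>R_hom v e \<Lambda> W V.
     R_comp V \<psi> \<phi> = R_id V \<and> R_comp W \<phi> \<psi> = R_id W}"


section \<open>The functor \<open>H\<^sub>0\<close>\<close>

definition chains0 ::
  "('f::field \<Rightarrow> int) \<Rightarrow> ('f, 'l, 'm) coeff_system \<Rightarrow> ('l, 'f vertex \<Rightarrow> 'm) module" where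
  "chains0 v F = direct_sum (vertices v) (\<lambda>x. obj F {x})"

definition chains1 ::
  "('f::field \<Rightarrow> int) \<Rightarrow> ('f, 'l, 'm) coeff_system \<Rightarrow> ('l, 'f tree_simplex \<Rightarrow> 'm) module" where
  "chains1 v F = direct_sum (edges v) (obj F)"

definition boundary ::
  "('f::field \<Rightarrow> int) \<Rightarrow> ('f, 'l, 'm) coeff_system \<Rightarrow> ('f tree_simplex \<Rightarrow> 'm) \<Rightarrow> 'f vertex \<Rightarrow> 'm" where
  "boundary v F c = (\<lambda>x\<in>vertices v.
     finsum (obj F {x}) (\<lambda>\<tau>. trans_map F \<tau> x (c \<tau>)) {\<tau> \<in> edges v. x \<in> \<tau>})"

definition boundaries ::
  "('f::field \<Rightarrow> int) \<Rightarrow> ('f, 'l, 'm) coeff_system \<Rightarrow> ('f vertex \<Rightarrow> 'm) set" where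
  "boundaries v F = boundary v F ` carrier (chains1 v F)"

text \<open>The action of \<open>g\<close> in the completed group on \<open>F(\<tau>)\<close>, through any element of \<open>GL\<^sub>2(F)\<close>
  agreeing with \<open>g\<close> on \<open>Z\<^sup>(\<^sup>e\<^sup>)(\<tau>)\<close>; for \<open>F\<close> in \<^const>\<open>cat_C0\<close> the choice does not matter.\<close>

definition hat_act ::
  "('f::field \<Rightarrow> int) \<Rightarrow> nat \<Rightarrow> ('f, 'l, 'm) coeff_system \<Rightarrow> ('f vertex \<Rightarrow> 'f vertex) \<Rightarrow>
   'f tree_simplex \<Rightarrow> 'm \<Rightarrow> 'm" where
  "hat_act v e F g \<tau> = act_map F
     (SOME g'. g' \<in> carrier GL2 \<and> (\<forall>x\<in>tree_ball v e \<tau>. g x = act_vertex g' x)) \<tau>"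

definition chains0_act ::
  "('f::field \<Rightarrow> int) \<Rightarrow> nat \<Rightarrow> ('f, 'l, 'm) coeff_system \<Rightarrow> ('f vertex \<Rightarrow> 'f vertex) \<Rightarrow>
   ('f vertex \<Rightarrow> 'm) \<Rightarrow> 'f vertex \<Rightarrow> 'm" where
  "chains0_act v e F g c = (\<lambda>y\<in>vertices v.
     let x = inv_into (vertices v) g y in hat_act v e F g {x} (c x))"

definition H0 ::
  "('f::field \<Rightarrow> int) \<Rightarrow> nat \<Rightarrow> ('f, 'l, 'm) coeff_system \<Rightarrow>
   ('f, 'l, ('f vertex \<Rightarrow> 'm) set) rep" where
  "H0 v e F =
     \<lparr>rep_mod = quot_module (chains0 v F) (boundaries v F),
      rep_act = (\<lambda>g. coset_map (chains0 v F) (boundaries v F) (chains0_act v e F g))\<rparr>"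

definition H0_map ::
  "('f::field \<Rightarrow> int) \<Rightarrow> nat \<Rightarrow> ('f, 'l, 'm) coeff_system \<Rightarrow> ('f, 'l, 'n) coeff_system \<Rightarrow>
   ('f tree_simplex \<Rightarrow> 'm \<Rightarrow> 'n) \<Rightarrow> ('f vertex \<Rightarrow> 'm) set \<Rightarrow> ('f vertex \<Rightarrow> 'n) set" where
  "H0_map v e F F' \<phi> = restrict
     (coset_map (chains0 v F') (boundaries v F') (\<lambda>c. \<lambda>x\<in>vertices v. \<phi> {x} (c x)))
     (carrier (rep_mod (H0 v e F)))"

definition H0_class ::
  "('f::field \<Rightarrow> int) \<Rightarrow> ('f, 'l, 'm) coeff_system \<Rightarrow> 'f vertex \<Rightarrow> 'm \<Rightarrow>
   ('f vertex \<Rightarrow> 'm) set" where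
  "H0_class v F x f =
     boundaries v F +>\<^bsub>chains0 v F\<^esub> (\<lambda>y\<in>vertices v. if y = x then f else \<zero>\<^bsub>obj F {y}\<^esub>)"


section \<open>The functor from representations to coefficient systems\<close>

text \<open>\<open>F_hat_vertex v p e V x\<close> is the sum of the submodules of \<open>V\<close> fixed by the groups of the
  (finitely many) edges at \<open>x\<close>.\<close>

definition F_hat_vertex ::
  "('f::field \<Rightarrow> int) \<Rightarrow> nat \<Rightarrow> nat \<Rightarrow> ('f, 'l, 'w) rep \<Rightarrow> 'f vertex \<Rightarrow> 'w set" where
  "F_hat_vertex v p e V x =
     {finsum (rep_mod V) w {y. {x, y} \<in> edges v} | w.
        \<forall>y. {x, y} \<in> edges v \<longrightarrow> w y \<in> rep_fixed V (hat_U v p e {x, y})}"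

text \<open>On vertices \<open>g\<close> acts by \<open>w \<mapsto> g w\<close>.  On edges it acts by \<open>w \<mapsto> g w\<close> if \<open>g\<close> preserves the two
  \<open>SL\<^sub>2(F)\<close>-orbits of vertices and by \<open>w \<mapsto> - g w\<close> if it exchanges them.  As the transition maps
  are \<open>+\<close> or \<open>-\<close> the inclusion according to the orbit of the vertex, this is the only action on
  the edges for which \<open>r\<^bsub>gx\<^esub> (g w) = g (r\<^bsub>x\<^esub> w)\<close>.\<close>

definition F_hat ::
  "('f::field \<Rightarrow> int) \<Rightarrow> nat \<Rightarrow> nat \<Rightarrow> 'f vertex \<Rightarrow> ('f, 'l, 'w) rep \<Rightarrow>
   ('f, 'l, 'w) coeff_system" where
  "F_hat v p e xp V =
     \<lparr>obj = (\<lambda>\<tau>. (rep_mod V)\<lparr>carrier :=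
        if \<tau> \<in> edges v then rep_fixed V (hat_U v p e \<tau>)
        else F_hat_vertex v p e V (the_elem \<tau>)\<rparr>),
      trans_map = (\<lambda>\<eta> x w. if x \<in> SL2_orbit xp then w else \<ominus>\<^bsub>rep_mod V\<^esub> w),
      act_map = (\<lambda>g \<tau> w.
        if \<tau> \<in> edges v \<and> act_vertex g xp \<notin> SL2_orbit xp
        then \<ominus>\<^bsub>rep_mod V\<^esub> (rep_act V (to_hat_G v g) w)
        else rep_act V (to_hat_G v g) w)\<rparr>"

definition F_hat_map ::
  "('f::field \<Rightarrow> int) \<Rightarrow> nat \<Rightarrow> nat \<Rightarrow> 'f vertex \<Rightarrow> ('f, 'l, 'w) rep \<Rightarrow> ('w \<Rightarrow> 'u) \<Rightarrow>
   'f tree_simplex \<Rightarrow> 'w \<Rightarrow> 'u" where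
  "F_hat_map v p e xp V \<phi> =
     (\<lambda>\<tau>\<in>simplices v. restrict \<phi> (carrier (obj (F_hat v p e xp V) \<tau>)))"


section \<open>The natural maps\<close>

definition unit_map ::
  "('f::field \<Rightarrow> int) \<Rightarrow> 'f vertex \<Rightarrow> ('f, 'l, 'm) coeff_system \<Rightarrow>
   'f tree_simplex \<Rightarrow> 'm \<Rightarrow> ('f vertex \<Rightarrow> 'm) set" where
  "unit_map v xp F = (\<lambda>\<tau>\<in>simplices v. \<lambda>f\<in>carrier (obj F \<tau>).
     if \<tau> \<in> edges v then H0_class v F (plus_vertex xp \<tau>) (trans_map F \<tau> (plus_vertex xp \<tau>) f)
     else H0_class v F (the_elem \<tau>) f)"

definition counit_map ::
  "('f::field \<Rightarrow> int) \<Rightarrow> nat \<Rightarrow> nat \<Rightarrow> 'f vertex \<Rightarrow> ('f, 'l, 'w) rep \<Rightarrow>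
   ('f vertex \<Rightarrow> 'w) set \<Rightarrow> 'w" where
  "counit_map v p e xp V = (\<lambda>A\<in>carrier (rep_mod (H0 v e (F_hat v p e xp V))).
     the_elem ((\<lambda>c. finsum (rep_mod V) c {x \<in> vertices v. c x \<noteq> \<zero>\<^bsub>rep_mod V\<^esub>}) ` A))"

end

theory Submission
 imports Defs
begin

text \<open>Let \<open>H = H\<^sub>0(X, F)\<close>.  Everything rests on the computation of the vectors of \<open>H\<close> fixed by the
 completed groups: those fixed by the group of a vertex \<open>x\<close> are the classes of elements of \<open>F(x)\<close>, those
 fixed by the group of an edge \<open>\<eta>\<close> the classes of elements of \<open>F(\<eta>)\<close>.  A chain representing a fixed
 vector is pushed towards \<open>x\<close>, starting with the vertices of its support farthest from \<open>x\<close>; this works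
 because the completed group, unlike \<open>GL\<^sub>2(F)\<close>, contains the automorphisms that agree with a given
 \<open>u\<close> on one branch of the tree and are trivial on the others.  As \<open>X\<close> is a tree, \<open>F(x)\<close> embeds
 into \<open>H\<close>, so the unit \<open>F \<rightarrow> F_hat(H)\<close> is an isomorphism.  The counit \<open>H\<^sub>0(X, F_hat(V)) \<rightarrow> V\<close> is surjective
 since \<open>V\<close> is generated by the vectors fixed by an edge group.  If its kernel were nonzero, it
 would contain a nonzero vector killed by \<open>p\<close>, and hence, the edge group acting on the finite span of its
 orbit through a finite \<open>p\<close>-group, a nonzero vector fixed by that group; this vector comes from
 \<open>F_hat(V)(\<eta>)\<close>, on which the counit is injective.\<close>

text \<open>The groups \<open>K_group\<close> and \<open>U1_group\<close> are defined by maximality,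
  so they first have to be identified with explicit congruence groups in a frame, a matrix
  \<open>A\<close> whose columns span a lattice of the vertex. The Cartan decomposition ties frames
  to the tree distance. Two computations in frames carry the rest. If \<open>b\<close>,
  \<open>c\<close> are consecutive on a path leaving \<open>x\<close>, each element of U_b^(e) is a
  product of one lying also in U_x^(e) and one in U_c^(e) (\<open>Ux_decompose\<close>): a vector
  fixed at \<open>x\<close> only yields invariance under the first kind, and this factorisation
  extends it to U_b^(e), which pushing needs. And p-th powers carry U_x^(e) into the group of each
  neighbour (\<open>Ux_p_power\<close>), which is why the edge group acts on finite data through a
  finite p-group. The Artinian ring enters through the nilpotency of \<open>p\<close>. The boundary
  map has plus signs only, so the two ends of an edge carry opposite classes in homology; this is
  the origin of the signs of the transition maps of \<open>F_hat\<close> and of the sign, given by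
  the parity of \<open>v (det g)\<close>, in the action on edges.\<close>

abbreviation "actv \<equiv> act_vertex"

section \<open>The valuation\<close>

locale local_field =
 fixes v :: "'f::field => int" and p :: nat
 assumes nonarch: "nonarch_local_field v p"
begin

abbreviation Fi :: "int => 'f set" where "Fi \<equiv> frac_ideal v"

lemma v_mult: "a ~= 0 ==> b ~= 0 ==> v (a * b) = v a + v b"
 using nonarch unfolding nonarch_local_field_def by blast

lemma v_1: "v 1 = 0"
 using v_mult[of 1 1] by simp

lemma v_inverse: "a ~= 0 ==> v (inverse a) = - v a"
 using v_mult[of a "inverse a"] v_1 by simp

lemma v_divide: "a ~= 0 ==> b ~= 0 ==> v (a / b) = v a - v b"
 using v_mult[of a "inverse b"] v_inverse[of b] by (simp add: divide_inverse)

lemma v_minus_1: "v (- 1) = 0"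
 using v_mult[of "-1" "-1"] v_1 by simp

lemma v_minus: "v (- a) = v a"
proof (cases "a = 0")
 case False
 thus ?thesis using v_mult[of "-1" a] v_minus_1 by simp
qed simp

lemma v_power: "a ~= 0 ==> v (a ^ n) = int n * v a"
 by (induction n) (simp_all add: v_1 v_mult algebra_simps)

lemma v_powi: "a ~= 0 ==> v (a powi n) = n * v a"
 by (cases "n >= 0") (simp_all add: power_int_def v_power v_inverse)

lemma Fi_0 [simp]: "0 \<in> Fi n"
 by (simp add: frac_ideal_def)

lemma Fi_iff: "a ~= 0 ==> a \<in> Fi n \<longleftrightarrow> n <= v a"
 by (simp add: frac_ideal_def)

lemma Fi_add: assumes "a \<in> Fi n" "b \<in> Fi n" shows "a + b \<in> Fi n"
proof (cases "a = 0 \<or> b = 0 \<or> a + b = 0")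
 case False
 hence "min (v a) (v b) <= v (a + b)"
  using nonarch unfolding nonarch_local_field_def by blast
 thus ?thesis using assms False by (auto simp: frac_ideal_def)
qed (use assms in auto)

lemma Fi_minus: "a \<in> Fi n ==> - a \<in> Fi n"
 by (auto simp: frac_ideal_def v_minus)

lemma Fi_minus_iff [simp]: "- a \<in> Fi n \<longleftrightarrow> a \<in> Fi n"
 using Fi_minus[of a n] Fi_minus[of "-a" n] by auto

lemma Fi_diff: "a \<in> Fi n ==> b \<in> Fi n ==> a - b \<in> Fi n"
 using Fi_add[of a n "-b"] by simp

lemma Fi_diff_swap: "a - b \<in> Fi n \<longleftrightarrow> b - a \<in> Fi n"
 using Fi_minus_iff[of "a - b" n] by simp

lemma Fi_add_cancel: "b \<in> Fi n ==> a + b \<in> Fi n \<longleftrightarrow> a \<in> Fi n"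
 using Fi_add[of a n b] Fi_diff[of "a+b" n b] by auto

lemma Fi_mult: "a \<in> Fi m ==> b \<in> Fi n ==> k <= m + n ==> a * b \<in> Fi k"
 by (cases "a = 0 \<or> b = 0") (auto simp: frac_ideal_def v_mult)

lemma Fi_mult0: "a \<in> Fi 0 ==> b \<in> Fi n ==> a * b \<in> Fi n" "b \<in> Fi n ==> a \<in> Fi 0 ==> b * a \<in> Fi n"
 by (auto intro: Fi_mult)

lemma Fi_mono: "a \<in> Fi n ==> m <= n ==> a \<in> Fi m"
 by (auto simp: frac_ideal_def)

lemma Fi_1 [simp]: "1 \<in> Fi 0"
 by (simp add: frac_ideal_def v_1)

lemma Fi_of_nat: "of_nat n \<in> Fi 0"
 by (induction n) (auto intro: Fi_add)

lemma p_prime: "Factorial_Ring.prime p" and p_Fi: "of_nat p \<in> Fi 1"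
 using nonarch unfolding nonarch_local_field_def by blast+

definition \<pi> :: 'f where "\<pi> = (SOME a. a ~= 0 \<and> v a = 1)"

lemma pi: "\<pi> ~= 0" "v \<pi> = 1"
proof -
 have "\<exists>a. a ~= 0 \<and> v a = 1"
  using nonarch unfolding nonarch_local_field_def by blast
 from someI_ex[OF this] show "\<pi> ~= 0" "v \<pi> = 1" by (simp_all add: \<pi>_def)
qed

declare pi(1) [simp]

lemma pi_Fi: "\<pi> \<in> Fi 1" "\<pi> \<in> Fi 0"
 using pi by (auto simp: frac_ideal_def)

lemma pi_power_Fi: "\<pi> ^ n \<in> Fi (int n)" "\<pi> ^ n \<in> Fi 0"
 using pi by (auto simp: frac_ideal_def v_power)

lemma pi_power_mult_Fi: "\<pi> ^ n * a \<in> Fi (int n + k) \<longleftrightarrow> a \<in> Fi k"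
 using pi by (cases "a = 0") (auto simp: frac_ideal_def v_power v_mult)

lemma pi_power_mult_Fi': "\<pi> ^ n * a \<in> Fi k \<longleftrightarrow> a \<in> Fi (k - int n)"
 using pi_power_mult_Fi[of n a "k - int n"] by simp

lemma divide_pi_power_Fi: "a / \<pi> ^ n \<in> Fi k \<longleftrightarrow> a \<in> Fi (k + int n)"
 using pi_power_mult_Fi'[of n "a / \<pi> ^ n" "k + int n"] pi by simp

definition vu :: "'f => bool" where "vu a \<longleftrightarrow> a ~= 0 \<and> v a = 0"

lemma vu_iff: "vu a \<longleftrightarrow> a \<in> Fi 0 \<and> a \<notin> Fi 1"
 by (auto simp: vu_def frac_ideal_def)

lemma vu_1 [simp]: "vu 1"
 by (simp add: vu_def v_1)

lemma vu_nz: "vu a ==> a ~= 0" and vu_Fi: "vu a ==> a \<in> Fi 0" and vu_v: "vu a ==> v a = 0"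
 by (auto simp: vu_def frac_ideal_def)

lemma vu_mult: "vu a ==> vu b ==> vu (a * b)"
 by (auto simp: vu_def v_mult)

lemma vu_inverse: "vu a ==> vu (inverse a)"
 by (auto simp: vu_def v_inverse)

lemma vu_minus [simp]: "vu (- a) \<longleftrightarrow> vu a"
 by (auto simp: vu_def v_minus)

lemma vu_mult_Fi: assumes "vu u" shows "u * a \<in> Fi n \<longleftrightarrow> a \<in> Fi n"
 using assms by (cases "a = 0") (auto simp: vu_def frac_ideal_def v_mult)

lemma divide_vu_Fi: assumes "vu u" shows "a / u \<in> Fi n \<longleftrightarrow> a \<in> Fi n"
 using vu_mult_Fi[OF vu_inverse[OF assms], of a n] by (simp add: divide_inverse mult.commute)

lemma vu_add: assumes "vu a" "b \<in> Fi 1" shows "vu (a + b)"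
 using assms Fi_add_cancel[of b 1 a] Fi_add[of a 0 b] Fi_mono[of b 1 0] by (auto simp: vu_iff)

lemma vu_mult_iff: "a \<in> Fi 0 ==> b \<in> Fi 0 ==> vu (a * b) \<longleftrightarrow> vu a \<and> vu b"
 unfolding vu_def frac_ideal_def using v_mult[of a b] by auto

lemma vu_cong: "a - b \<in> Fi 1 ==> vu a \<longleftrightarrow> vu b"
 using vu_add[of a "b - a"] vu_add[of b "a - b"] Fi_diff_swap[of a b 1] by auto

lemma one_plus_Fi_vu: "a - 1 \<in> Fi 1 ==> vu a"
 using vu_cong[of a 1] by simp

text \<open>The residue field has no nilpotent elements.\<close>

lemma Fi1_prime: "a ^ Suc n \<in> Fi 1 ==> a \<in> Fi 1"
proof (rule ccontr)
 assume a: "a ^ Suc n \<in> Fi 1" "a \<notin> Fi 1"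
 hence "a ~= 0" "v a <= 0" by (auto simp: frac_ideal_def)
 moreover from this have "1 <= int (Suc n) * v a"
  using a v_power[of a "Suc n"] by (simp add: frac_ideal_def del: power_Suc of_nat_Suc)
 ultimately show False using mult_nonneg_nonpos[of "int (Suc n)" "v a"] by linarith
qed

end

section \<open>Matrices of size two\<close>

definition mk2 :: "'f => 'f => 'f => 'f => ('f::field)^2^2" where
 "mk2 a b c d = vector [vector [a, b], vector [c, d]]"

lemma mk2_entries [simp]:
 "mk2 a b c d $ 1 $ 1 = a" "mk2 a b c d $ 1 $ 2 = b" "mk2 a b c d $ 2 $ 1 = c" "mk2 a b c d $ 2 $ 2 = d"
 by (simp_all add: mk2_def)

lemma mult2 [simp]: "(A ** B) $ i $ j = A $ i $ 1 * B $ 1 $ j + A $ i $ 2 * (B::('f::field)^2^2) $ 2 $ j"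
 by (simp add: matrix_matrix_mult_def sum_2)

lemma mat2_1 [simp]: "(mat c :: ('f::field)^2^2) $ 1 $ 1 = c" "(mat c :: 'f^2^2) $ 1 $ 2 = 0"
 "(mat c :: 'f^2^2) $ 2 $ 1 = 0" "(mat c :: 'f^2^2) $ 2 $ 2 = c"
 by (simp_all add: mat_def)

lemma eq2: "(A :: ('f::field)^2^2) = B \<longleftrightarrow>
  A $ 1 $ 1 = B $ 1 $ 1 \<and> A $ 1 $ 2 = B $ 1 $ 2 \<and> A $ 2 $ 1 = B $ 2 $ 1 \<and> A $ 2 $ 2 = B $ 2 $ 2"
 by (auto simp: vec_eq_iff forall_2)

lemma vec2_eq: "(x :: ('f::field)^2) = y \<longleftrightarrow> x $ 1 = y $ 1 \<and> x $ 2 = y $ 2"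
 by (auto simp: vec_eq_iff forall_2)

lemma mv2 [simp]: "(A *v x) $ i = A $ i $ 1 * x $ 1 + A $ i $ 2 * (x::('f::field)^2) $ 2"
 by (simp add: matrix_vector_mult_def sum_2)

lemma det_mult2: "det (A ** B) = det A * det (B::('f::field)^2^2)"
 by (simp add: det_mul)

text \<open>The adjugate formula, so that valuations of the entries of an inverse can be read
  off.\<close>

definition minv :: "('f::field)^2^2 => 'f^2^2" where
 "minv A = mk2 (A $ 2 $ 2 / det A) (- A $ 1 $ 2 / det A) (- A $ 2 $ 1 / det A) (A $ 1 $ 1 / det A)"

lemma minv: assumes "det A ~= 0" shows "minv A ** A = mat 1" "A ** minv A = mat 1"
proof -
 have d: "A $ 1 $ 1 * A $ 2 $ 2 - A $ 1 $ 2 * A $ 2 $ 1 ~= 0"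
  using assms by (simp add: det_2)
 show "minv A ** A = mat 1" "A ** minv A = mat 1"
  using d by (simp_all add: eq2 minv_def det_2 divide_simps mult.commute)
qed

lemma minv_cancel: assumes "det A ~= 0"
 shows "minv A ** (A ** B) = B" "A ** (minv A ** B) = B" "B ** A ** minv A = B" "B ** minv A ** A = B"
 using minv[OF assms] by (metis matrix_mul_assoc matrix_mul_lid matrix_mul_rid)+

lemma det_minv: "det A ~= 0 ==> det (minv A) = inverse (det A)"
 by (metis det_I det_mult2 minv(1) inverse_unique mult.commute)

lemma det_minv_nz: "det A ~= 0 ==> det (minv A) ~= 0"
 by (simp add: det_minv)

lemma minv_unique: assumes "A ** B = mat 1" shows "B = minv A"
proof -
 have "det A ~= 0" using assms det_mult2[of A B] by (metis det_I mult_zero_left zero_neq_one)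
 thus ?thesis using minv_cancel(1)[of A B] assms by simp
qed

lemma minv_mult: "det A ~= 0 ==> det B ~= 0 ==> minv (A ** B) = minv B ** minv A"
 by (rule minv_unique[symmetric]) (simp add: matrix_mul_assoc minv_cancel minv)

lemma minv_minv: "det A ~= 0 ==> minv (minv A) = A"
 by (rule minv_unique[symmetric]) (simp add: minv)

lemma GL2_carrier: "carrier GL2 = {A::('f::field)^2^2. det A ~= 0}"
 by (simp add: GL2_def invertible_det_nz)

lemma GL2_mult [simp]: "A \<otimes>\<^bsub>GL2\<^esub> B = A ** B" and GL2_one [simp]: "\<one>\<^bsub>GL2\<^esub> = mat 1"
 by (simp_all add: GL2_def)

lemma GL2_group: "group (GL2 :: (('f::field)^2^2) monoid)"
proof (rule groupI)
 fix x :: "'f^2^2" assume "x \<in> carrier GL2"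
 thus "\<exists>y\<in>carrier GL2. y \<otimes>\<^bsub>GL2\<^esub> x = \<one>\<^bsub>GL2\<^esub>"
  by (intro bexI[of _ "minv x"]) (auto simp: GL2_carrier minv det_minv_nz)
qed (auto simp: GL2_carrier det_mult2 matrix_mul_assoc)

lemma GL2_inv: "A \<in> carrier GL2 ==> inv\<^bsub>GL2\<^esub> A = minv A"
 by (rule group.inv_equality[OF GL2_group]) (auto simp: GL2_carrier minv det_minv_nz)

abbreviation sc :: "'f => ('f::field)^2^2" where "sc c \<equiv> mat c"

lemma det_sc: "det (sc c) = c * (c::'f::field)"
 by (simp add: det_2)

lemma sc_commute: "sc c ** A = A ** sc (c::'f::field)"
 by (simp add: eq2 mult.commute)

lemma sc_pull: fixes A B :: "('f::field)^2^2"
 shows "A ** sc c = sc c ** A" "A ** (sc c ** B) = sc c ** (A ** B)"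
 by (simp_all add: eq2 algebra_simps)

lemma sc_sc: fixes A :: "('f::field)^2^2" shows "sc a ** (sc b ** A) = sc (a * b) ** A"
 by (simp add: eq2)

lemma minv_sc: "c ~= 0 ==> minv (sc c) = sc (inverse c)"
 by (rule minv_unique[symmetric]) (simp add: eq2)

lemma GL2_centre_eq: "GL2_centre = {sc c | c::'f::field. c ~= 0}"
proof (intro Set.set_eqI iffI)
 fix z :: "'f^2^2" assume z: "z \<in> GL2_centre"
 hence d: "det z ~= 0" and c: "!!g. det g ~= 0 ==> z ** g = g ** z"
  by (auto simp: GL2_centre_def GL2_carrier)
 \<comment> \<open>Commuting with the two elementary unipotent matrices already forces a matrix to
   be scalar.\<close>
 have "z ** mk2 1 1 0 1 = mk2 1 1 0 1 ** z" "z ** mk2 1 0 1 1 = mk2 1 0 1 1 ** z"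
  by (rule c, simp add: det_2)+
 hence "z = sc (z $ 1 $ 1)" by (auto simp: eq2)
 moreover have "z $ 1 $ 1 ~= 0" using d calculation by (metis det_sc mult_zero_left)
 ultimately show "z \<in> {sc c | c. c ~= 0}" by blast
qed (auto simp: GL2_centre_def GL2_carrier det_sc sc_commute)

fun mpow :: "('f::field)^2^2 => nat => 'f^2^2" where
 "mpow A 0 = mat 1" | "mpow A (Suc n) = mpow A n ** A"

lemma det_mpow: "det (mpow A n) = det A ^ n"
 by (induction n) (auto simp: det_mult2)

lemma mpow_add: "mpow A (m + n) = mpow A m ** mpow A n"
 by (induction n) (simp_all add: matrix_mul_assoc)

lemma mpow_mult: "mpow A (m * n) = mpow (mpow A m) n"
proof (induction n)
 case (Suc n)
 have "mpow A (m * Suc n) = mpow A (m * n) ** mpow A m" by (simp flip: mpow_add add: add.commute)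
 thus ?case using Suc by simp
qed simp

section \<open>Lattices and vertices\<close>

context local_field
begin

definition int2 :: "'f^2^2 => bool" where
 "int2 k \<longleftrightarrow> k $ 1 $ 1 \<in> Fi 0 \<and> k $ 1 $ 2 \<in> Fi 0 \<and> k $ 2 $ 1 \<in> Fi 0 \<and> k $ 2 $ 2 \<in> Fi 0"

text \<open>The group GL_2(O) over the valuation ring O, the stabiliser of the standard
  lattice.\<close>

definition GLO :: "'f^2^2 => bool" where
 "GLO k \<longleftrightarrow> int2 k \<and> vu (det k)"

lemma GLO_det: "GLO k ==> det k ~= 0"
 by (simp add: GLO_def vu_def)

lemma int2_mult: "int2 A ==> int2 B ==> int2 (A ** B)"
 unfolding int2_def by (auto intro!: Fi_add Fi_mult0)

lemma GLO_mult: "GLO k ==> GLO l ==> GLO (k ** l)"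
 by (simp add: GLO_def int2_mult det_mult2 vu_mult)

lemma GLO_1: "GLO (mat 1)"
 by (simp add: GLO_def int2_def det_2)

lemma GLO_minv: "GLO k ==> GLO (minv k)"
proof -
 assume k: "GLO k"
 hence "vu (det (minv k))" by (simp add: det_minv vu_inverse vu_nz GLO_def)
 thus ?thesis using k by (simp add: GLO_def int2_def) (simp add: minv_def divide_vu_Fi)
qed

lemma GLO_swap: "GLO (mk2 0 1 1 0)"
 by (simp add: GLO_def int2_def det_2)

lemma int2_det: "int2 k ==> det k \<in> Fi 0"
 by (auto simp: int2_def det_2 intro!: Fi_diff Fi_mult0)

definition lat :: "'f^2^2 => ('f^2) set" where
 "lat A = {A *v x | x. x $ 1 \<in> Fi 0 \<and> x $ 2 \<in> Fi 0}"

text \<open>The vertex of the lattice spanned by the columns of an invertible \<open>A\<close>. Such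
  an \<open>A\<close> is called a frame below; it is unique up to scalars and right multiplication
  by GL_2(O) (\<open>vx_eq\<close>), so questions about vertices become questions about cosets of
  matrices.\<close>

definition vx :: "'f^2^2 => 'f vertex" where
 "vx A = {(\<lambda>u. c *s u) ` lat A | c. c ~= 0}"

lemma lat_image: "lat A = (*v) A ` {x. x $ 1 \<in> Fi 0 \<and> x $ 2 \<in> Fi 0}"
 by (auto simp: lat_def)

lemma sc_lat: "(\<lambda>u. c *s u) ` lat A = lat (sc c ** A)"
proof -
 have "c *s (A *v x) = (sc c ** A) *v x" for x
  by (simp add: vec2_eq algebra_simps)
 thus ?thesis by (simp add: lat_image image_image)
qed

lemma vx_alt: "vx A = {lat (sc c ** A) | c. c ~= 0}"
 by (simp add: vx_def sc_lat)

lemma mv_image_lat: "(\<lambda>u. g *v u) ` lat A = lat (g ** A)"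
 by (simp add: lat_image image_image matrix_vector_mul_assoc)

lemma lat_subset: assumes "det A ~= 0"
 shows "lat B \<subseteq> lat A \<longleftrightarrow> int2 (minv A ** B)"
proof
 assume s: "lat B \<subseteq> lat A"
 have *: "(minv A ** B) *v x = y" if "B *v x = A *v y" for x y
  using that by (metis minv(1)[OF assms] matrix_vector_mul_assoc matrix_vector_mul_lid)
 have "B *v vector [1,0] \<in> lat A" "B *v vector [0,1] \<in> lat A"
  by (rule subsetD[OF s], force simp: lat_image)+
 then obtain x y where "B *v vector [1,0] = A *v x" "x $ 1 \<in> Fi 0" "x $ 2 \<in> Fi 0"
  "B *v vector [0,1] = A *v y" "y $ 1 \<in> Fi 0" "y $ 2 \<in> Fi 0"
  by (auto simp: lat_def)
 moreover from this have "(minv A ** B) *v vector [1,0] = x" "(minv A ** B) *v vector [0,1] = y"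
  by (simp_all add: *)
 ultimately show "int2 (minv A ** B)"
  by (auto simp: int2_def vec2_eq)
next
 assume i: "int2 (minv A ** B)"
 show "lat B \<subseteq> lat A"
 proof
  fix z assume "z \<in> lat B"
  then obtain x where x: "z = B *v x" "x $ 1 \<in> Fi 0" "x $ 2 \<in> Fi 0" by (auto simp: lat_def)
  have "z = A *v ((minv A ** B) *v x)"
   by (simp add: x matrix_vector_mul_assoc minv_cancel[OF assms] matrix_mul_assoc minv[OF assms] del: mult2 mv2)
  moreover have "((minv A ** B) *v x) $ i \<in> Fi 0" for i
   using i x exhaust_2[of i] unfolding int2_def mv2 by (auto intro!: Fi_add Fi_mult0 simp del: mult2)
  ultimately show "z \<in> lat A" unfolding lat_def by blast
 qed
qed

text \<open>Mutual inclusion makes the change of basis and its inverse both integral; their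
  determinants are integral with product 1, hence units.\<close>

lemma lat_eq: assumes "det A ~= 0" "det B ~= 0"
 shows "lat A = lat B \<longleftrightarrow> (\<exists>k. GLO k \<and> B = A ** k)"
proof
 assume "lat A = lat B"
 hence i: "int2 (minv A ** B)" "int2 (minv B ** A)"
  using lat_subset[OF assms(1), of B] lat_subset[OF assms(2), of A] by auto
 have "(minv A ** B) ** (minv B ** A) = mat 1"
  using minv[OF assms(1)] minv_cancel(2)[OF assms(2)] by (metis matrix_mul_assoc)
 hence "det (minv A ** B) * det (minv B ** A) = 1" by (metis det_mult2 det_I)
 hence "vu (det (minv A ** B))"
  using vu_mult_iff[OF int2_det[OF i(1)] int2_det[OF i(2)]] by simp
 hence "GLO (minv A ** B)" using i by (simp add: GLO_def)
 thus "\<exists>k. GLO k \<and> B = A ** k"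
  by (intro exI[of _ "minv A ** B"]) (simp add: minv_cancel[OF assms(1)])
next
 assume "\<exists>k. GLO k \<and> B = A ** k"
 then obtain k where k: "GLO k" "B = A ** k" by blast
 have "minv A ** B = k" "minv B ** A = minv k"
  using k assms GLO_det[OF k(1)] by (simp_all add: minv_cancel minv_mult minv flip: matrix_mul_assoc)
 thus "lat A = lat B"
  using k(1) GLO_minv[OF k(1)] lat_subset[OF assms(1), of B] lat_subset[OF assms(2), of A]
  by (auto simp: GLO_def)
qed

lemma vx_eq: assumes "det A ~= 0" "det B ~= 0"
 shows "vx A = vx B \<longleftrightarrow> (\<exists>c k. c ~= 0 \<and> GLO k \<and> B = sc c ** A ** k)"
proof
 assume "vx A = vx B"
 moreover have "lat (sc 1 ** B) \<in> vx B" unfolding vx_alt by (rule CollectI) (rule exI[of _ 1], simp)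
 ultimately have "lat (sc 1 ** B) \<in> vx A" by simp
 then obtain c where c: "c ~= 0" "lat B = lat (sc c ** A)" by (auto simp: vx_alt)
 thus "\<exists>c k. c ~= 0 \<and> GLO k \<and> B = sc c ** A ** k"
  using lat_eq[of "sc c ** A" B] assms by (auto simp: det_mult2 det_sc)
next
 assume "\<exists>c k. c ~= 0 \<and> GLO k \<and> B = sc c ** A ** k"
 then obtain c k where c: "c ~= 0" "GLO k" "B = sc c ** A ** k" by blast
 have l: "lat (sc a ** B) = lat (sc (a * c) ** A)" if "a ~= 0" for a
 proof -
  have "sc a ** B = (sc (a * c) ** A) ** k" using c by (simp add: eq2 algebra_simps)
  thus ?thesis
   using lat_eq[of "sc (a * c) ** A" "sc a ** B"] c that assms by (auto simp: det_mult2 det_sc)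
 qed
 show "vx A = vx B"
 proof (intro Set.set_eqI iffI)
  fix Y assume "Y \<in> vx A"
  then obtain a where "a ~= 0" "Y = lat (sc a ** A)" by (auto simp: vx_alt)
  hence "Y = lat (sc (a / c) ** B)" using l[of "a / c"] c by simp
  thus "Y \<in> vx B" using \<open>a ~= 0\<close> c unfolding vx_alt by (auto intro!: exI[of _ "a/c"])
 next
  fix Y assume "Y \<in> vx B"
  then obtain a where "a ~= 0" "Y = lat (sc a ** B)" by (auto simp: vx_alt)
  thus "Y \<in> vx A" using l[of a] c(1) unfolding vx_alt by (auto intro!: exI[of _ "a * c"])
 qed
qed

lemma vx_eqI: "c ~= 0 ==> GLO k ==> det A ~= 0 ==> B = sc c ** A ** k ==> vx B = vx A"
 by (subst eq_commute, subst vx_eq) (auto simp: det_mult2 det_sc GLO_det)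

lemma vx_right: "GLO k ==> det A ~= 0 ==> vx (A ** k) = vx A"
 by (rule vx_eqI[of 1 k]) auto

lemma vx_sc: "c ~= 0 ==> det A ~= 0 ==> vx (sc c ** A) = vx A"
 by (rule vx_eqI[of c "mat 1"]) (auto simp: GLO_1)

lemma lattices_eq: "lattices v = {lat A | A. det A ~= 0}"
proof (intro Set.set_eqI iffI)
 fix L assume "L \<in> lattices v"
 then obtain u w where L: "L = {a *s u + b *s w | a b. a \<in> Fi 0 \<and> b \<in> Fi 0}"
  and s: "vec.span {u, w} = UNIV" by (auto simp: lattices_def)
 define A where "A = mk2 (u$1) (w$1) (u$2) (w$2)"
 have A: "A *v x = x$1 *s u + x$2 *s w" for x
  by (simp add: vec2_eq A_def algebra_simps)
 have "\<exists>a b. z = a *s u + b *s w" for z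
 proof -
  have "z \<in> vec.span {u, w}" using s by simp
  thus ?thesis by (auto simp: vec.span_breakdown_eq algebra_simps)
 qed
 then obtain a b c d where "vector [1,0] = a *s u + b *s w" "vector [0,1] = c *s u + d *s w" by metis
 hence "A ** mk2 a c b d = mat 1" by (simp add: eq2 A_def vec2_eq algebra_simps)
 hence "det A ~= 0" by (metis det_I det_mult2 mult_zero_left zero_neq_one)
 moreover have "L = lat A"
 proof -
  have "\<exists>x::'f^2. a *s u + b *s w = x$1 *s u + x$2 *s w \<and> x$1 \<in> Fi 0 \<and> x$2 \<in> Fi 0" if "a \<in> Fi 0" "b \<in> Fi 0" for a b
   using that by (intro exI[of _ "vector [a,b]"]) simp
  thus ?thesis unfolding L lat_def A by blast
 qed
 ultimately show "L \<in> {lat A | A. det A ~= 0}" by blast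
next
 fix L assume "L \<in> {lat A | A. det A ~= 0}"
 then obtain A where A: "det A ~= 0" "L = lat A" by blast
 define u w :: "'f^2" where "u = vector [A$1$1, A$2$1]" and "w = vector [A$1$2, A$2$2]"
 have Au: "A *v x = x$1 *s u + x$2 *s w" for x
  by (simp add: vec2_eq u_def w_def algebra_simps)
 have "z \<in> vec.span {u, w}" for z
 proof -
  have "z = A *v (minv A *v z)"
   by (simp add: matrix_vector_mul_assoc minv[OF A(1)] del: mv2 mult2)
  thus ?thesis unfolding Au
   by (metis insertI1 insertI2 vec.span_add vec.span_base vec.span_scale)
 qed
 moreover have "L = {a *s u + b *s w | a b. a \<in> Fi 0 \<and> b \<in> Fi 0}"
 proof -
  have "\<exists>x::'f^2. a *s u + b *s w = x$1 *s u + x$2 *s w \<and> x$1 \<in> Fi 0 \<and> x$2 \<in> Fi 0" if "a \<in> Fi 0" "b \<in> Fi 0" for a b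
   using that by (intro exI[of _ "vector [a,b]"]) simp
  thus ?thesis unfolding A(2) lat_def Au by blast
 qed
 ultimately show "L \<in> lattices v" unfolding lattices_def by blast
qed

lemma vertices_eq: "vertices v = {vx A | A. det A ~= 0}"
 unfolding vertices_def lattices_eq vx_def by blast

lemma vx_vertex: "det A ~= 0 ==> vx A \<in> vertices v"
 unfolding vertices_eq by blast

lemma act_vx: "actv g (vx A) = vx (g ** A)"
proof -
 have "g ** (sc c ** A) = sc c ** (g ** A)" for c
  by (rule sc_pull)
 moreover have "vx B = (\<lambda>c. lat (sc c ** B)) ` {c. c ~= 0}" for B by (auto simp: vx_alt)
 ultimately show ?thesis by (simp add: act_vertex_def image_image mv_image_lat)
qed

text \<open>With \<open>A\<close> a frame, the matrices \<open>A ** D n\<close> run along a ray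
  leaving \<open>vx A\<close>. Inserting \<open>Lo c\<close> or \<open>Sw\<close> before
  \<open>D 1\<close> produces all neighbours: these matrices represent the lines of the residue
  plane.\<close>

definition D :: "nat => 'f^2^2" where "D n = mk2 1 0 0 (\<pi> ^ n)"
definition Lo :: "'f => 'f^2^2" where "Lo c = mk2 1 0 c 1"
definition Sw :: "'f^2^2" where "Sw = mk2 0 1 1 0"

lemma det_D: "det (D n) = \<pi> ^ n" "det (D n) ~= 0"
 using pi by (simp_all add: D_def det_2)

lemma D_0: "D 0 = mat 1" and D_add: "D m ** D n = D (m + n)"
 by (simp_all add: D_def eq2 power_add)

lemma GLO_Lo: "c \<in> Fi 0 ==> GLO (Lo c)" and GLO_Sw: "GLO Sw"
 by (simp_all add: Lo_def Sw_def GLO_def int2_def det_2)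

text \<open>Gaussian elimination: the corner entry divides all others, so the first row and column
  can be cleared with integral multipliers. The remaining entry \<open>\<delta>\<close>, relative to
  the corner, has valuation \<open>n\<close>, and its unit part goes into the right-hand
  factor.\<close>

lemma cartan_aux: assumes "det m ~= 0" "m $ 1 $ 1 ~= 0"
 "!!b. b \<in> {m $ 1 $ 2, m $ 2 $ 1, m $ 2 $ 2} ==> b \<in> Fi (v (m $ 1 $ 1))"
 shows "\<exists>k n k'. GLO k \<and> GLO k' \<and> m = k ** sc (m $ 1 $ 1) ** D n ** k'"
proof -
 define a b c d where abcd: "a = m $ 1 $ 1" "b = m $ 1 $ 2 / a" "c = m $ 2 $ 1 / a" "d = m $ 2 $ 2 / a"
 have q: "x / a \<in> Fi 0" if "x \<in> Fi (v a)" for x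
  using that assms(2) by (cases "x = 0") (auto simp: frac_ideal_def v_divide abcd)
 have i: "b \<in> Fi 0" "c \<in> Fi 0" "d \<in> Fi 0"
  using assms(3) by (auto simp: abcd intro!: q[unfolded abcd])
 define \<delta> where "\<delta> = d - b * c"
 have "a * a * \<delta> = det m"
  using assms(2) by (simp add: \<delta>_def abcd det_2 algebra_simps)
 hence d0: "\<delta> ~= 0" using assms(1) by auto
 have "\<delta> \<in> Fi 0" unfolding \<delta>_def using i by (auto intro!: Fi_diff Fi_mult0)
 define n where "n = nat (v \<delta>)"
 have n: "v \<delta> = int n" using d0 \<open>\<delta> \<in> Fi 0\<close> by (simp add: n_def frac_ideal_def)
 define u where "u = \<delta> / \<pi> ^ n"
 have u: "vu u" "\<delta> = \<pi> ^ n * u"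
  using d0 n pi by (simp_all add: vu_def u_def v_divide v_power)
 have "m = mk2 1 0 c 1 ** sc a ** D n ** mk2 1 b 0 u"
 proof -
  have "\<pi> ^ n * u + c * b = d" using u(2) by (simp add: \<delta>_def algebra_simps)
  moreover have "m $ 2 $ 2 = a * d" "m $ 1 $ 2 = a * b" "m $ 2 $ 1 = a * c"
   using assms(2) by (simp_all add: abcd)
  ultimately show ?thesis
   by (simp add: eq2 D_def abcd(1)[symmetric] algebra_simps) (metis distrib_left mult.commute mult.left_commute)
 qed
 moreover have "GLO (mk2 1 0 c 1)" "GLO (mk2 1 b 0 u)"
  using i u by (simp_all add: GLO_def int2_def det_2 vu_Fi)
 ultimately show ?thesis by (metis abcd(1))
qed

text \<open>The Cartan decomposition. The clause about integral \<open>m\<close> serves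
  \<open>edge_rp_aux\<close>, where it bounds the valuation of the scalar from below.\<close>

lemma cartan: assumes "det m ~= 0"
 shows "\<exists>k a n k'. GLO k \<and> GLO k' \<and> a ~= 0 \<and> (int2 m --> a \<in> Fi 0) \<and> m = k ** sc a ** D n ** k'"
proof -
 define S where "S = {m$1$1, m$1$2, m$2$1, m$2$2}"
 have ne: "S - {0} ~= {}" using assms by (auto simp: S_def det_2)
 have fin: "finite (S - {0})" by (simp add: S_def)
 have "Min (v ` (S - {0})) \<in> v ` (S - {0})" using ne fin by (intro Min_in) auto
 then obtain a where a: "a \<in> S - {0}" "v a = Min (v ` (S - {0}))" by (elim imageE) metis
 have min: "b \<in> Fi (v a)" if "b \<in> S" for b
  using that fin a(2) Min_le[of "v ` (S - {0})" "v b"] by (cases "b = 0") (auto simp: frac_ideal_def)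
 have SS: "Sw ** (Sw ** Y) = Y" "Y ** Sw ** Sw = Y" for Y
  by (simp_all add: eq2 Sw_def)
 \<comment> \<open>\<open>a\<close> is an entry of least valuation; \<open>k\<close> and
   \<open>l\<close> will be the identity or \<open>Sw\<close>, chosen to bring it to the corner.
   Both are involutions, so they can be undone on the outside.\<close>
 have *: ?thesis if kl: "GLO k" "GLO l" "k ** k = mat 1" "l ** l = mat 1" "(k ** m ** l) $ 1 $ 1 = a"
  "!!b. b \<in> {(k ** m ** l) $ 1 $ 2, (k ** m ** l) $ 2 $ 1, (k ** m ** l) $ 2 $ 2} ==> b \<in> S" for k l
 proof -
  have dm: "det (k ** m ** l) ~= 0" using assms kl GLO_det by (simp add: det_mult2)
  obtain k1 n k2 where k12: "GLO k1" "GLO k2" "k ** m ** l = k1 ** sc a ** D n ** k2"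
   using cartan_aux[OF dm] min kl a by (metis DiffE insertCI)
  have "m = k ** (k ** m ** l) ** l"
   using kl(3,4) by (metis matrix_mul_assoc matrix_mul_lid matrix_mul_rid)
  hence "m = (k ** k1) ** sc a ** D n ** (k2 ** l)"
   unfolding k12(3) by (simp add: matrix_mul_assoc)
  moreover have "int2 m --> a \<in> Fi 0" using a(1) by (auto simp: int2_def S_def)
  ultimately show ?thesis using kl k12 a
   by (intro exI[of _ "k ** k1"] exI[of _ a] exI[of _ n] exI[of _ "k2 ** l"]) (simp add: GLO_mult)
 qed
 have S1: "Sw ** Sw = mat 1" by (simp add: Sw_def eq2)
 have "a = m$1$1 \<or> a = m$1$2 \<or> a = m$2$1 \<or> a = m$2$2" using a by (auto simp: S_def)
 thus ?thesis
 proof (elim disjE)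
  assume "a = m$1$1" thus ?thesis by (intro *[of "mat 1" "mat 1"]) (auto simp: GLO_1 S_def)
 next
  assume "a = m$1$2" thus ?thesis using S1
   by (intro *[of "mat 1" Sw]) (auto simp: GLO_1 GLO_swap S_def Sw_def)
 next
  assume "a = m$2$1" thus ?thesis using S1
   by (intro *[of Sw "mat 1"]) (auto simp: GLO_1 GLO_swap S_def Sw_def)
 next
  assume "a = m$2$2" thus ?thesis using S1
   by (intro *[of Sw Sw]) (auto simp: GLO_1 GLO_swap S_def Sw_def)
 qed
qed

subsection \<open>Relative position of two vertices\<close>

text \<open>The relative position of two vertices: the exponent in the Cartan decomposition of the
  change of frame. \<open>d_rp\<close> identifies it with the graph distance.\<close>

definition rp :: "nat => 'f vertex => 'f vertex => bool" where
 "rp n x z \<longleftrightarrow> (\<exists>A. det A ~= 0 \<and> x = vx A \<and> z = vx (A ** D n))"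

lemma rpI: "det A ~= 0 ==> rp n (vx A) (vx (A ** D n))"
 unfolding rp_def by blast

lemma rp_vertices: "rp n x z ==> x \<in> vertices v \<and> z \<in> vertices v"
 by (auto simp: rp_def intro!: vx_vertex simp: det_mult2 det_D)

lemma rp_total: assumes "x \<in> vertices v" "z \<in> vertices v" shows "\<exists>n. rp n x z"
proof -
 obtain A B where AB: "det A ~= 0" "det B ~= 0" "x = vx A" "z = vx B"
  using assms by (auto simp: vertices_eq)
 then obtain k a n k' where k: "GLO k" "GLO k'" "a ~= 0" "minv A ** B = k ** sc a ** D n ** k'"
  using cartan[of "minv A ** B"] by (auto simp: det_mult2 det_minv_nz)
 have "B = A ** (minv A ** B)" by (simp add: minv_cancel AB)
 also have "\<dots> = sc a ** (A ** k ** D n) ** k'"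
  unfolding k(4) by (simp add: sc_pull flip: matrix_mul_assoc)
 finally have "vx B = vx (A ** k ** D n)"
  using k AB by (intro vx_eqI) (auto simp: det_mult2 GLO_det det_D)
 moreover have "vx A = vx (A ** k)" using k AB by (simp add: vx_right)
 ultimately show ?thesis unfolding rp_def AB
  using k AB by (intro exI[of _ n] exI[of _ "A ** k"]) (auto simp: det_mult2 GLO_det)
qed

text \<open>The corner entry 1 of \<open>D n\<close> is \<open>c\<close> times an integral number,
  which bounds \<open>v c\<close>; the second claim compares determinants.\<close>

lemma D_unique_aux: assumes "D n = sc c ** (k ** D m ** k')" "GLO k" "GLO k'" "c ~= 0"
 shows "v c <= 0" "int n = 2 * v c + int m"
proof -
 have "int2 (k ** D m ** k')"
  using assms pi_power_Fi by (intro int2_mult) (auto simp: GLO_def int2_def D_def)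
 hence "c * (k ** D m ** k') $ 1 $ 1 \<in> Fi (v c)"
  using assms(4) by (auto simp: int2_def frac_ideal_def v_mult simp del: mult2)
 moreover have "c * (k ** D m ** k') $ 1 $ 1 = 1"
  using arg_cong[OF assms(1), of "\<lambda>A. A $ 1 $ 1"] by (subst (asm) mult2) (simp add: D_def del: mult2)
 ultimately show "v c <= 0" using Fi_iff[of 1] v_1 by simp
 have "\<pi> ^ n = c * c * (det k * \<pi> ^ m * det k')"
  using arg_cong[OF assms(1), of det] by (simp add: det_mult2 det_D det_sc)
 from arg_cong[OF this, of v] show "int n = 2 * v c + int m"
  using assms pi by (simp add: v_mult v_power vu_def GLO_def)
qed

text \<open>\<open>D_unique_aux\<close> applies to the relation between the two frames and to its
  inverse, so the scalar has valuation 0, and the determinants then force equal exponents.\<close>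

lemma rp_unique: assumes "rp n x z" "rp m x z" shows "m = n"
proof -
 obtain A B where A: "det A ~= 0" "x = vx A" "z = vx (A ** D n)"
  and B: "det B ~= 0" "x = vx B" "z = vx (B ** D m)"
  using assms unfolding rp_def by blast
 obtain c k where c: "c ~= 0" "GLO k" "B = sc c ** A ** k"
  using vx_eq[of A B] A B by auto
 have "vx (B ** D m) = vx (A ** D n)" using A B by simp
 then obtain c' k' where c': "c' ~= 0" "GLO k'" "A ** D n = sc c' ** (B ** D m) ** k'"
  using vx_eq[of "B ** D m" "A ** D n"] A(1) B(1) by (auto simp: det_mult2 det_D)
 have "minv A ** (A ** D n) = minv A ** (sc c' ** (sc c ** A ** k ** D m) ** k')"
  using c c' by simp
 also have "sc c' ** (sc c ** A ** k ** D m) ** k' = A ** (sc (c' * c) ** (k ** D m ** k'))"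
  by (simp only: sc_pull(2)[of A] sc_sc matrix_mul_assoc[symmetric])
 finally have e: "D n = sc (c' * c) ** (k ** D m ** k')" by (simp only: minv_cancel[OF A(1)])
 have "minv k ** D n ** minv k' = sc (c' * c) ** (minv k ** (k ** D m ** k' ** minv k'))"
  unfolding e by (simp only: sc_pull(2)[of "minv k"] matrix_mul_assoc[symmetric])
 also have "\<dots> = sc (c' * c) ** D m"
  by (simp only: minv_cancel(3)[OF GLO_det[OF c'(2)]] minv_cancel(1)[OF GLO_det[OF c(2)]])
 finally have "sc (inverse (c' * c)) ** (minv k ** D n ** minv k') = sc (inverse (c' * c)) ** (sc (c' * c) ** D m)"
  by simp
 also have "\<dots> = D m"
 proof -
  have "inverse (c' * c) * (c' * c) = 1" using c(1) c'(1) by (intro left_inverse) simp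
  thus ?thesis by (simp only: sc_sc matrix_mul_lid)
 qed
 finally have e': "D m = sc (inverse (c' * c)) ** (minv k ** D n ** minv k')" by simp
 have "v (c' * c) <= 0" "int n = 2 * v (c' * c) + int m"
  using D_unique_aux[OF e] c c' by auto
 moreover have "v (inverse (c' * c)) <= 0"
  using D_unique_aux[OF e'] c c' GLO_minv by simp
 ultimately show ?thesis using c c' v_inverse[of "c' * c"] by simp
qed

lemma rp_sym: assumes "rp n x z" shows "rp n z x"
proof -
 obtain A where A: "det A ~= 0" "x = vx A" "z = vx (A ** D n)"
  using assms unfolding rp_def by blast
 \<comment> \<open>Reversal of the segment: \<open>D n ** Sw ** D n\<close> is
   \<open>\<pi> ^ n\<close> times \<open>Sw\<close>.\<close>
 define B where "B = A ** D n ** Sw"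
 have "vx B = z" unfolding B_def A using A(1) by (intro vx_right) (auto simp: GLO_Sw det_mult2 det_D)
 moreover have "B ** D n = sc (\<pi> ^ n) ** A ** Sw" by (simp add: B_def eq2 D_def Sw_def algebra_simps)
 hence "vx (B ** D n) = x"
  unfolding A using A(1) by (intro vx_eqI[of "\<pi> ^ n" Sw]) (auto simp: GLO_Sw)
 moreover have "det B ~= 0" using A GLO_det[OF GLO_Sw] by (simp add: B_def det_mult2 det_D)
 ultimately show ?thesis unfolding rp_def by blast
qed

lemma rp_0: "rp 0 x z \<longleftrightarrow> x \<in> vertices v \<and> z = x"
 by (auto simp: rp_def D_0 vertices_eq)

text \<open>Coset representatives for the neighbours of the standard vertex, that is for the
  projective line over the residue field: the line spanned by the first column of \<open>k\<close>
  has slope \<open>c\<close>, or is vertical when \<open>k$1$1\<close> is not a unit.\<close>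

lemma GLO_D1_cases: assumes "GLO k"
 shows "(\<exists>c k'. c \<in> Fi 0 \<and> GLO k' \<and> k ** D 1 = Lo c ** D 1 ** k') \<or> (\<exists>k'. GLO k' \<and> k ** D 1 = Sw ** D 1 ** k')"
proof -
 have i: "k$1$1 \<in> Fi 0" "k$1$2 \<in> Fi 0" "k$2$1 \<in> Fi 0" "k$2$2 \<in> Fi 0" and d: "vu (det k)"
  using assms by (auto simp: GLO_def int2_def)
 show ?thesis
 proof (cases "vu (k$1$1)")
  case True
  define c where "c = k$2$1 / k$1$1"
  define k' where "k' = mk2 (k$1$1) (\<pi> * k$1$2) 0 (k$2$2 - c * k$1$2)"
  have c: "c \<in> Fi 0" using i True by (simp add: c_def divide_vu_Fi)
  have "det k' = det k" using True by (simp add: k'_def c_def det_2 field_simps vu_nz)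
  hence "GLO k'" using i c d pi_Fi unfolding GLO_def int2_def
   by (auto simp: k'_def intro!: Fi_diff Fi_mult0)
  moreover have "k ** D 1 = Lo c ** D 1 ** k'"
   using True by (simp add: eq2 D_def Lo_def k'_def c_def vu_nz field_simps)
  ultimately show ?thesis using c by blast
 next
  case False
  hence f: "k$1$1 \<in> Fi 1" using i by (simp add: vu_iff)
  define k' where "k' = mk2 (k$2$1) (\<pi> * k$2$2) (k$1$1 / \<pi>) (k$1$2)"
  have "det k' = - det k" using pi by (simp add: k'_def det_2)
  moreover have "k$1$1 / \<pi> \<in> Fi 0" using f divide_pi_power_Fi[of "k$1$1" 1 0] by simp
  ultimately have "GLO k'" using i d pi_Fi unfolding GLO_def int2_def
   by (auto simp: k'_def intro!: Fi_mult0)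
  moreover have "k ** D 1 = Sw ** D 1 ** k'"
   using pi by (simp add: eq2 D_def Sw_def k'_def)
  ultimately show ?thesis by blast
 qed
qed

lemma rp_1_cases: assumes "det B ~= 0" "rp 1 (vx B) w"
 shows "(\<exists>c\<in>Fi 0. w = vx (B ** Lo c ** D 1)) \<or> w = vx (B ** Sw ** D 1)"
proof -
 obtain A where A: "det A ~= 0" "vx B = vx A" "w = vx (A ** D 1)"
  using assms(2) unfolding rp_def by blast
 then obtain a k where k: "a ~= 0" "GLO k" "A = sc a ** B ** k"
  using vx_eq[OF assms(1) A(1)] by auto
 have *: "w = vx (B ** Y ** D 1)" if "k ** D 1 = Y ** D 1 ** k'" "GLO k'" "GLO Y" for Y k'
  unfolding A(3) using k(1) that
  by (intro vx_eqI[of a k']) (auto simp: k(3) det_mult2 GLO_det det_D assms simp flip: matrix_mul_assoc)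
 from GLO_D1_cases[OF k(2)] show ?thesis
  using * GLO_Lo GLO_Sw by blast
qed

text \<open>This is what makes the graph a tree: from a vertex at distance \<open>Suc n\<close>
  every step either leads back or goes one farther out, in a frame in which \<open>x\<close> and
  \<open>z\<close> keep their standard form.\<close>

lemma rp_step: assumes "rp (Suc n) x z" "rp 1 z w"
 shows "\<exists>A. det A ~= 0 \<and> x = vx A \<and> z = vx (A ** D (Suc n)) \<and>
   (w = vx (A ** D (Suc (Suc n))) \<or> w = vx (A ** D n))"
proof -
 obtain A where A: "det A ~= 0" "x = vx A" "z = vx (A ** D (Suc n))"
  using assms unfolding rp_def by blast
 have B: "det (A ** D (Suc n)) ~= 0" using A(1) by (simp add: det_mult2 det_D)
 from rp_1_cases[OF B] assms(2) A(3) consider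
  (L) c where "c \<in> Fi 0" "w = vx (A ** D (Suc n) ** Lo c ** D 1)" | (S) "w = vx (A ** D (Suc n) ** Sw ** D 1)"
  by blast
 thus ?thesis
 proof cases
  case L
  \<comment> \<open>Moving \<open>Lo c\<close> to the left past \<open>D (Suc n)\<close> multiplies
    \<open>c\<close> by \<open>\<pi> ^ Suc n\<close>; the new factor still lies in GL_2(O), so the
    changed frame has the same vertex.\<close>
  define A' where "A' = A ** Lo (\<pi> ^ Suc n * c)"
  have g: "GLO (Lo (\<pi> ^ Suc n * c))" using L pi_power_Fi(2)[of "Suc n"] by (intro GLO_Lo Fi_mult0)
  have "A' ** D (Suc n) = A ** D (Suc n) ** Lo c"
   by (simp add: A'_def eq2 D_def Lo_def algebra_simps)
  moreover have "A' ** D (Suc (Suc n)) = A' ** D (Suc n) ** D 1"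
   using D_add[of "Suc n" 1] by (simp flip: matrix_mul_assoc)
  hence "w = vx (A' ** D (Suc (Suc n)))" using L calculation by simp
  moreover have "x = vx A'" "det A' ~= 0" using g A by (auto simp: A'_def vx_right det_mult2 GLO_det)
  ultimately show ?thesis using A B L(1) by (metis vx_right GLO_Lo)
 next
  case S
  have "A ** D (Suc n) ** Sw ** D 1 = sc \<pi> ** (A ** D n) ** Sw" by (simp add: eq2 D_def Sw_def algebra_simps)
  hence "w = vx (A ** D n)" unfolding S
   using A(1) by (intro vx_eqI[of \<pi> Sw]) (auto simp: GLO_Sw det_mult2 det_D)
  thus ?thesis using A by blast
 qed
qed

lemma residue_reps: "\<exists>R. finite R \<and> (\<forall>a\<in>Fi 0. \<exists>r\<in>R. a - r \<in> Fi 1)"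
proof -
 let ?E = "{(a, b). a \<in> Fi 0 \<and> b \<in> Fi 0 \<and> a - b \<in> Fi 1}"
 have fin: "finite (Fi 0 // ?E)" using nonarch unfolding nonarch_local_field_def by blast
 let ?R = "(\<lambda>C. SOME a. a \<in> C) ` (Fi 0 // ?E)"
 have "\<exists>r\<in>?R. a - r \<in> Fi 1" if "a \<in> Fi 0" for a
 proof -
  have "?E `` {a} \<in> Fi 0 // ?E" using that by (rule quotientI)
  moreover have "a \<in> ?E `` {a}" using that by simp
  hence "(SOME b. b \<in> ?E `` {a}) \<in> ?E `` {a}" by (rule someI)
  ultimately show ?thesis by blast
 qed
 thus ?thesis using fin by blast
qed

text \<open>The parameter \<open>c\<close> of a neighbour only matters modulo \<open>\<pi>\<close>,
  and the residue field is finite.\<close>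

lemma finite_nbrs: "finite {w. rp 1 x w}"
proof (cases "x \<in> vertices v")
 case True
 then obtain B where B: "det B ~= 0" "x = vx B" by (auto simp: vertices_eq)
 obtain R where R: "finite R" "!!a. a \<in> Fi 0 ==> \<exists>r\<in>R. a - r \<in> Fi 1" using residue_reps by blast
 have "w \<in> insert (vx (B ** Sw ** D 1)) ((\<lambda>c. vx (B ** Lo c ** D 1)) ` R)" if w: "rp 1 x w" for w
 proof -
  { fix c assume c: "c \<in> Fi 0" "w = vx (B ** Lo c ** D 1)"
   then obtain r where r: "r \<in> R" "c - r \<in> Fi 1" using R by blast
   hence "(c - r) / \<pi> \<in> Fi 0" using divide_pi_power_Fi[of "c - r" 1 0] by simp
   moreover have "B ** Lo c ** D 1 = B ** Lo r ** D 1 ** Lo ((c - r) / \<pi>)"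
    by (simp add: eq2 D_def Lo_def field_simps)
   ultimately have "w = vx (B ** Lo r ** D 1)" unfolding c(2) using B(1)
    by (intro vx_eqI[of 1 "Lo ((c - r) / \<pi>)"]) (auto simp: GLO_Lo det_mult2 det_D, simp add: Lo_def det_2)
   hence ?thesis using r by blast }
  thus ?thesis using rp_1_cases[OF B(1)] w B(2) by blast
 qed
 hence "{w. rp 1 x w} \<subseteq> insert (vx (B ** Sw ** D 1)) ((\<lambda>c. vx (B ** Lo c ** D 1)) ` R)" by blast
 thus ?thesis by (rule finite_subset) (use R(1) in simp)
next
 case False
 hence "{w. rp 1 x w} = {}" using rp_vertices by blast
 thus ?thesis by simp
qed

end

section \<open>The tree\<close>

context local_field
begin

abbreviation d :: "'f vertex => 'f vertex => nat" where "d \<equiv> tree_dist v"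
abbreviation VV :: "'f vertex set" where "VV \<equiv> vertices v"
abbreviation EE :: "'f vertex set set" where "EE \<equiv> edges v"
abbreviation "SS \<equiv> simplices v"

text \<open>The Cartan decomposition puts the two lattices of an edge in diagonal position. The
  chain of inclusions bounds the exponents, and strictness at both ends leaves only
  \<open>D 1\<close>.\<close>

lemma edge_rp_aux: assumes "x \<in> VV" "y \<in> VV" "L \<in> x" "L' \<in> y" "t ~= 0" "v t = 1"
 "(\<lambda>u. t *s u) ` L \<subset> L'" "L' \<subset> L"
 shows "rp 1 x y"
proof -
 obtain A0 B0 where 0: "det A0 ~= 0" "det B0 ~= 0" "x = vx A0" "y = vx B0"
  using assms by (auto simp: vertices_eq)
 obtain a b where ab: "a ~= 0" "b ~= 0" "L = lat (sc a ** A0)" "L' = lat (sc b ** B0)"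
  using assms(3,4) 0 by (auto simp: vx_alt)
 define A B where "A = sc a ** A0" and "B = sc b ** B0"
 have AB: "det A ~= 0" "det B ~= 0" "x = vx A" "y = vx B" "L = lat A" "L' = lat B"
  using 0 ab by (auto simp: A_def B_def det_mult2 det_sc vx_sc)
 have i: "int2 (minv A ** B)" using lat_subset[OF AB(1), of B] assms(8) AB by auto
 then obtain k c n k' where k: "GLO k" "GLO k'" "c ~= 0" "c \<in> Fi 0" "minv A ** B = k ** sc c ** D n ** k'"
  using cartan[of "minv A ** B"] AB by (auto simp: det_mult2 det_minv_nz)
 have "B = A ** (minv A ** B)" by (simp add: minv_cancel AB)
 also have "\<dots> = sc c ** (A ** k ** D n) ** k'"
  unfolding k(5) by (simp only: sc_pull(2)[of k] sc_pull(2)[of A] matrix_mul_assoc[symmetric])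
 finally have B: "B = sc c ** (A ** k ** D n) ** k'" .
 define A' where "A' = A ** k"
 have A': "det A' ~= 0" "x = vx A'" "L = lat A'"
  using AB k lat_eq[of A A'] by (auto simp: A'_def det_mult2 GLO_det vx_right)
 have L': "L' = lat (sc c ** A' ** D n)"
  using k lat_eq[of "sc c ** A' ** D n" B] AB(2,6) A'(1) unfolding B A'_def
  by (simp add: det_mult2 det_sc det_D matrix_mul_assoc) blast
 have y: "y = vx (A' ** D n)" unfolding AB(4) B A'_def[symmetric] using k A'
  by (intro vx_eqI) (auto simp: det_mult2 det_D)
 have cd: "det (sc c ** A' ** D n) ~= 0" using A' k by (simp add: det_mult2 det_sc det_D)
 have "int2 (minv (sc c ** A' ** D n) ** (sc t ** A'))"
  using assms(7) unfolding A'(3) L' sc_lat using lat_subset[OF cd] by blast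
 moreover have "minv (sc c ** A' ** D n) ** (sc t ** A') = mk2 (t / c) 0 0 (t / (c * \<pi> ^ n))"
 proof -
  have "sc c ** A' ** D n ** mk2 (t / c) 0 0 (t / (c * \<pi> ^ n)) = sc t ** A'"
   using k by (simp add: eq2 D_def)
  thus ?thesis by (metis minv_cancel(1)[OF cd])
 qed
 ultimately have "t / (c * \<pi> ^ n) \<in> Fi 0" by (simp add: int2_def)
 hence le: "v c + int n <= 1"
  using assms(5,6) k(3) pi by (simp add: Fi_iff v_divide v_mult v_power)
 \<comment> \<open>For \<open>n = 0\<close> the lattices would be homothetic by a scalar of
   valuation 0 or 1, which contradicts strictness of the upper or of the lower inclusion
   respectively.\<close>
 have "n = 1"
 proof (rule ccontr)
  assume "n ~= 1"
  moreover have "0 <= v c" using k by (simp add: Fi_iff)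
  ultimately have n0: "n = 0" and vc: "v c = 0 \<or> v c = 1" using le by auto
  have L'': "L' = lat (sc c ** A')" using L' n0 by (simp add: D_0)
  show False using vc
  proof
   assume "v c = 0"
   hence "lat (sc c ** A') = lat A'"
    using lat_eq[OF A'(1), of "sc c ** A'"] A'(1) k(3)
    by (auto simp: det_mult2 det_sc GLO_def int2_def Fi_iff vu_def v_mult sc_commute intro!: exI[of _ "sc c"])
   thus False using assms(8) L'' A'(3) by blast
  next
   assume vc: "v c = 1"
   have "sc t ** A' = sc c ** A' ** sc (t / c)" using k by (simp add: eq2)
   moreover have "GLO (sc (t / c))" using vc assms(5,6) k(3)
    by (auto simp: GLO_def int2_def Fi_iff vu_def v_mult v_divide det_sc)
   ultimately have "lat (sc c ** A') = lat (sc t ** A')"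
    using lat_eq[of "sc c ** A'" "sc t ** A'"] A'(1) k(3) assms(5) by (auto simp: det_mult2 det_sc)
   thus False using assms(7) L'' A'(3) by (simp add: sc_lat)
  qed
 qed
 thus ?thesis unfolding rp_def using A' y by blast
qed

lemma edge_iff: "{x, y} \<in> EE \<longleftrightarrow> rp 1 x y"
proof
 assume "{x, y} \<in> EE"
 then obtain x' y' where xy: "{x, y} = {x', y'}" "x' \<in> VV" "y' \<in> VV"
  "\<exists>L\<in>x'. \<exists>L'\<in>y'. \<exists>t. t ~= 0 \<and> v t = 1 \<and> (\<lambda>u. t *s u) ` L \<subset> L' \<and> L' \<subset> L"
  unfolding edges_def by (elim CollectE exE conjE) simp
 from xy(4) have "rp 1 x' y'" using edge_rp_aux[OF xy(2,3)] by (elim bexE exE conjE) simp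
 thus "rp 1 x y" using xy(1) by (auto simp: doubleton_eq_iff rp_sym)
next
 assume r: "rp 1 x y"
 then obtain A where A: "det A ~= 0" "x = vx A" "y = vx (A ** D 1)" by (auto simp: rp_def)
 have dA: "det (A ** D 1) ~= 0" using A by (simp add: det_mult2 det_D)
 have e1: "minv A ** (A ** D 1) = D 1" using A by (simp add: minv_cancel)
 have e2: "minv (A ** D 1) ** (sc \<pi> ** A) = mk2 \<pi> 0 0 1"
 proof -
  have "A ** D 1 ** mk2 \<pi> 0 0 1 = sc \<pi> ** A" by (simp add: eq2 D_def mult.commute)
  thus ?thesis by (metis minv_cancel(1)[OF dA])
 qed
 have s: "lat (A ** D 1) \<subseteq> lat A" "lat (sc \<pi> ** A) \<subseteq> lat (A ** D 1)"
  using lat_subset[OF A(1), of "A ** D 1"] lat_subset[OF dA, of "sc \<pi> ** A"] pi_Fi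
  unfolding e1 e2 by (auto simp: int2_def D_def)
 have n: "lat (A ** D 1) ~= lat A" "lat (sc \<pi> ** A) ~= lat (A ** D 1)"
 proof -
  have False if "lat (A ** D 1) = lat A"
  proof -
   obtain k where "GLO k" "A ** D 1 = A ** k" using lat_eq[OF A(1) dA] \<open>lat (A ** D 1) = lat A\<close> by auto
   hence "D 1 = k" by (metis minv_cancel(1)[OF A(1)])
   with \<open>GLO k\<close> show False using pi by (auto simp: GLO_def vu_def det_D)
  qed
  thus "lat (A ** D 1) ~= lat A" by blast
  have False if "lat (sc \<pi> ** A) = lat (A ** D 1)"
  proof -
   obtain k where "GLO k" "sc \<pi> ** A = A ** D 1 ** k"
    using \<open>lat (sc \<pi> ** A) = lat (A ** D 1)\<close> lat_eq[OF dA, of "sc \<pi> ** A"] A(1)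
    by (auto simp: det_mult2 det_sc)
   hence "mk2 \<pi> 0 0 1 = k" using e2 by (metis minv_cancel(1)[OF dA])
   with \<open>GLO k\<close> show False using pi by (auto simp: GLO_def vu_def det_2)
  qed
  thus "lat (sc \<pi> ** A) ~= lat (A ** D 1)" by blast
 qed
 have m: "lat B \<in> vx B" for B unfolding vx_alt by (rule CollectI, rule exI[of _ 1]) simp
 have "(\<lambda>u. \<pi> *s u) ` lat A \<subset> lat (A ** D 1)" "lat (A ** D 1) \<subset> lat A"
  using s n by (auto simp: sc_lat)
 thus "{x, y} \<in> EE"
  unfolding edges_def using rp_vertices[OF r] m[of A] m[of "A ** D 1"] A(2,3) pi
  by (intro CollectI exI[of _ x] exI[of _ y] conjI refl bexI[of _ "lat A"] bexI[of _ "lat (A ** D 1)"] exI[of _ \<pi>]) simp_all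
qed

section \<open>Graph distance and the tree property\<close>

lemma edge_rel_rp: "(x, y) \<in> {(x, y). {x, y} \<in> EE} ^^ n ==> x \<in> VV ==> \<exists>m\<le>n. rp m x y"
proof (induction n arbitrary: y)
 case 0 thus ?case using rp_0 by auto
next
 case (Suc n)
 then obtain z where z: "(x, z) \<in> {(x, y). {x, y} \<in> EE} ^^ n" "rp 1 z y" by (auto simp: edge_iff)
 then obtain m where m: "m <= n" "rp m x z" using Suc by blast
 show ?case
 proof (cases m)
  case 0 thus ?thesis using m z rp_0 by (intro exI[of _ 1]) auto
 next
  case (Suc m')
  from rp_step[OF m(2)[unfolded Suc] z(2)] obtain A where
   A: "det A ~= 0" "x = vx A" "y = vx (A ** D (Suc (Suc m'))) \<or> y = vx (A ** D m')" by blast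
  hence "rp (Suc (Suc m')) x y \<or> rp m' x y" unfolding rp_def by blast
  thus ?thesis using m Suc by (metis Suc_le_mono le_SucI Suc_leD)
 qed
qed

lemma rp_edge_rel: assumes "det A ~= 0"
 shows "(vx A, vx (A ** D n)) \<in> {(x, y). {x, y} \<in> EE} ^^ n"
proof (induction n)
 case 0 thus ?case by (simp add: D_0)
next
 case (Suc n)
 have "A ** D (Suc n) = A ** D n ** D 1" using D_add[of n 1] by (simp flip: matrix_mul_assoc)
 hence "rp 1 (vx (A ** D n)) (vx (A ** D (Suc n)))"
  using rpI[of "A ** D n" 1] assms by (simp add: det_mult2 det_D)
 thus ?case using Suc by (auto simp: edge_iff)
qed

text \<open>A path of length \<open>m\<close> yields a relative position of at most \<open>m\<close>
  (\<open>edge_rel_rp\<close>), and relative positions are unique; conversely the matrices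
  \<open>A ** D i\<close> trace a path of length \<open>n\<close>.\<close>

lemma d_rp: assumes "rp n x y" shows "d x y = n"
 unfolding tree_dist_def
proof (rule Least_equality)
 show "(x, y) \<in> {(x, y). {x, y} \<in> EE} ^^ n" using assms rp_edge_rel by (auto simp: rp_def)
 fix m assume "(x, y) \<in> {(x, y). {x, y} \<in> EE} ^^ m"
 then obtain m' where "m' <= m" "rp m' x y" using edge_rel_rp rp_vertices[OF assms] by blast
 thus "n <= m" using rp_unique[OF assms] by simp
qed

lemma rp_iff: "rp n x y \<longleftrightarrow> x \<in> VV \<and> y \<in> VV \<and> d x y = n"
 using d_rp rp_total rp_vertices by metis

lemma edge_d: "{x, y} \<in> EE \<longleftrightarrow> x \<in> VV \<and> y \<in> VV \<and> d x y = 1"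
 by (simp add: edge_iff rp_iff)

lemma d_sym: "x \<in> VV ==> y \<in> VV ==> d x y = d y x"
 using rp_sym rp_iff by metis

lemma d_0: "x \<in> VV ==> y \<in> VV ==> d x y = 0 \<longleftrightarrow> x = y"
 using rp_0[of x y] rp_iff[of 0 x y] by auto

lemma d_self [simp]: "x \<in> VV ==> d x x = 0"
 by (simp add: d_0)

lemma d_triangle: assumes "x \<in> VV" "y \<in> VV" "z \<in> VV" shows "d x z <= d x y + d y z"
proof -
 let ?R = "{(x, y). {x, y} \<in> EE}"
 have "(x, y) \<in> ?R ^^ d x y" "(y, z) \<in> ?R ^^ d y z"
  using assms rp_iff[of "d x y" x y] rp_iff[of "d y z" y z] rp_edge_rel by (metis rp_def)+
 hence "(x, z) \<in> ?R ^^ (d x y + d y z)" by (auto simp: relpow_add)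
 then obtain m where "m <= d x y + d y z" "rp m x z" using edge_rel_rp assms by blast
 thus ?thesis using d_rp by auto
qed

lemma edge_vertices: "{x, y} \<in> EE ==> x \<in> VV \<and> y \<in> VV"
 by (simp add: edge_d)

lemma edge_cases: assumes "\<mu> \<in> EE" obtains x y where "\<mu> = {x, y}" "x ~= y" "{x, y} \<in> EE"
proof -
 obtain x y where xy: "\<mu> = {x, y}" using assms by (auto simp: edges_def)
 moreover have "x ~= y" using assms xy edge_d[of x y] by auto
 ultimately show thesis using that assms by blast
qed

lemma edge_ne_vertex: "{x} \<notin> EE"
 by (rule notI) (erule edge_cases, auto)

lemma edge_subset: "\<mu> \<in> EE ==> x \<in> \<mu> ==> x \<in> VV"
 by (erule edge_cases) (use edge_vertices in auto)

lemma simplex_subset: "\<tau> \<in> SS ==> x \<in> \<tau> ==> x \<in> VV"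
 by (auto simp: simplices_def edge_subset)

lemma finite_edges_at: "finite {y. {x, y} \<in> EE}"
 using finite_nbrs by (simp add: edge_iff)

text \<open>No edge joins two vertices equidistant from \<open>x\<close>; this is the dichotomy of
  \<open>rp_step\<close>.\<close>

lemma nbr_dist: assumes "x \<in> VV" "{y, z} \<in> EE" shows "d x z = d x y + 1 \<or> d x y = d x z + 1"
proof -
 have yz: "y \<in> VV" "z \<in> VV" "rp 1 y z" using assms(2) by (auto simp: edge_iff rp_iff)
 show ?thesis
 proof (cases "d x y")
  case 0
  hence "x = y" using d_0 assms yz by blast
  thus ?thesis using yz by (simp add: rp_iff)
 next
  case (Suc n)
  hence "rp (Suc n) x y" using assms yz by (simp add: rp_iff)
  from rp_step[OF this yz(3)] obtain A where
   A: "det A ~= 0" "x = vx A" "z = vx (A ** D (Suc (Suc n))) \<or> z = vx (A ** D n)" by blast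
  hence "rp (Suc (Suc n)) x z \<or> rp n x z" unfolding rp_def by blast
  thus ?thesis using Suc d_rp by auto
 qed
qed

text \<open>Provides one frame in which \<open>x\<close> and both ends of an edge pointing away from
  it are diagonal; their congruence groups can be compared there entry by entry.\<close>

lemma geodesic_pair: assumes "x \<in> VV" "{b, c} \<in> EE" "d x c = d x b + 1"
 shows "\<exists>A. det A ~= 0 \<and> x = vx A \<and> b = vx (A ** D (d x b)) \<and> c = vx (A ** D (Suc (d x b)))"
proof (cases "d x b")
 case 0
 hence "x = b" using d_0 assms edge_vertices by blast
 thus ?thesis using assms(2) 0 by (auto simp: edge_iff rp_def D_0)
next
 case (Suc n)
 hence "rp (Suc n) x b" using assms edge_vertices by (simp add: rp_iff)
 from rp_step[OF this] assms(2) obtain A where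
  A: "det A ~= 0" "x = vx A" "b = vx (A ** D (Suc n))" "c = vx (A ** D (Suc (Suc n))) \<or> c = vx (A ** D n)"
  by (auto simp: edge_iff)
 moreover have "c ~= vx (A ** D n)"
  using A(2) assms(3) Suc d_rp[OF rpI[OF A(1), of n]] by auto
 ultimately show ?thesis using Suc by auto
qed

lemma prev_exists: assumes "x \<in> VV" "y \<in> VV" "x ~= y" shows "\<exists>b. {b, y} \<in> EE \<and> d x y = d x b + 1"
proof -
 obtain n where n: "d x y = Suc n" using assms d_0 by (cases "d x y") auto
 then obtain A where A: "det A ~= 0" "x = vx A" "y = vx (A ** D (Suc n))"
  using assms rp_iff[of "Suc n" x y] by (auto simp: rp_def)
 have "A ** D (Suc n) = A ** D n ** D 1" using D_add[of n 1] by (simp flip: matrix_mul_assoc)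
 hence "rp 1 (vx (A ** D n)) y"
  using rpI[of "A ** D n" 1] A by (simp add: det_mult2 det_D)
 thus ?thesis using n d_rp[OF rpI[OF A(1), of n]] A(2) by (auto simp: edge_iff)
qed

text \<open>In the frame of \<open>rp_step\<close> the neighbours of \<open>y\<close> given by some
  \<open>Lo c\<close> lie farther from \<open>x\<close>, so only the one given by \<open>Sw\<close>
  is closer. This excludes cycles.\<close>

lemma prev_unique: assumes "x \<in> VV" "{b, y} \<in> EE" "d x y = d x b + 1" "{c, y} \<in> EE" "d x y = d x c + 1"
 shows "b = c"
proof -
 have "rp (Suc (d x b)) x y" "rp 1 y b" "rp 1 y c"
  using assms(1,3) edge_vertices[OF assms(2)] rp_sym[of 1 b y] rp_sym[of 1 c y] assms(2,4)
  unfolding edge_iff[symmetric] by (simp_all add: rp_iff edge_iff)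
 from rp_step[OF this(1,2)] obtain A where
  A: "det A ~= 0" "x = vx A" "y = vx (A ** D (Suc (d x b)))"
   "b = vx (A ** D (Suc (Suc (d x b)))) \<or> b = vx (A ** D (d x b))" by blast
 have *: "w = vx (A ** D (d x b))" if "{w, y} \<in> EE" "d x w = d x b" for w
 proof -
  have yA: "det (A ** D (Suc (d x b))) ~= 0" using A by (simp add: det_mult2 det_D)
  have "rp 1 (vx (A ** D (Suc (d x b)))) w" using that A(3) rp_sym by (auto simp: edge_iff)
  from rp_1_cases[OF yA this] show ?thesis
  proof
   assume "\<exists>c\<in>Fi 0. w = vx (A ** D (Suc (d x b)) ** Lo c ** D 1)"
   then obtain c where c: "c \<in> Fi 0" "w = vx (A ** D (Suc (d x b)) ** Lo c ** D 1)" by blast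
   define A' where "A' = A ** Lo (\<pi> ^ Suc (d x b) * c)"
   have g: "GLO (Lo (\<pi> ^ Suc (d x b) * c))" using c pi_power_Fi(2)[of "Suc (d x b)"] by (intro GLO_Lo Fi_mult0)
   have "A ** D (Suc (d x b)) ** Lo c ** D 1 = A' ** D (Suc (Suc (d x b)))"
    by (simp add: A'_def eq2 D_def Lo_def algebra_simps)
   moreover have "x = vx A'" "det A' ~= 0" using g A by (auto simp: A'_def vx_right det_mult2 GLO_det)
   ultimately have "rp (Suc (Suc (d x b))) x w" using c rpI by metis
   hence False using d_rp that by fastforce
   thus ?thesis ..
  next
   assume "w = vx (A ** D (Suc (d x b)) ** Sw ** D 1)"
   moreover have "A ** D (Suc (d x b)) ** Sw ** D 1 = sc \<pi> ** (A ** D (d x b)) ** Sw"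
    by (simp add: eq2 D_def Sw_def algebra_simps)
   ultimately show ?thesis
    using A(1) vx_eqI[of \<pi> Sw "A ** D (d x b)" "sc \<pi> ** (A ** D (d x b)) ** Sw"]
    by (simp add: GLO_Sw det_mult2 det_D)
  qed
 qed
 have "b = vx (A ** D (d x b))" using *[of b] assms by auto
 moreover have "c = vx (A ** D (d x b))" using *[of c] assms by auto
 ultimately show ?thesis by simp
qed

text \<open>Induction along the path from \<open>b\<close> to \<open>z\<close>. If its last step,
  from \<open>y\<close> to \<open>z\<close>, led back towards \<open>w\<close>, then
  \<open>z\<close> would be the unique neighbour of \<open>y\<close> closer to \<open>w\<close>; but
  that neighbour is the predecessor of \<open>y\<close> on the path, or \<open>a\<close> when
  \<open>y = b\<close>.\<close>

lemma geodesic_through_edge: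
 assumes "{a, b} \<in> EE" "w \<in> VV" "d w b = d w a + 1"
 shows "z \<in> VV ==> d a z = d b z + 1 ==> d w z = d w a + 1 + d b z"
proof (induction "d b z" arbitrary: z rule: less_induct)
 case less
 note ab = edge_vertices[OF assms(1)]
 show ?case
 proof (cases "z = b")
  case True thus ?thesis using assms ab by simp
 next
  case False
  then obtain y where y: "{y, z} \<in> EE" "d b z = d b y + 1" using prev_exists[of b z] ab less by blast
  note yz = edge_vertices[OF y(1)]
  have ay: "d a y = d b y + 1"
   using d_triangle[of a b y] d_triangle[of a y z] assms(1) y less ab yz by (auto simp: edge_d)
  hence wy: "d w y = d w a + 1 + d b y" using less(1)[of y] y yz by simp
  have "d w y ~= d w z + 1"
  proof
   assume wz: "d w y = d w z + 1"
   have zy: "{z, y} \<in> EE" using y by (simp add: insert_commute)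
   show False
   proof (cases "y = b")
    case True
    have "a = z" using prev_unique[OF assms(2), of a b z] assms zy wz True by auto
    thus False using less ab by simp
   next
    case False
    then obtain y' where y': "{y', y} \<in> EE" "d b y = d b y' + 1" using prev_exists[of b y] ab yz by blast
    note y'v = edge_vertices[OF y'(1)]
    have "d a y' = d b y' + 1"
     using d_triangle[of a b y'] d_triangle[of a y' y] assms(1) y' ay ab yz y'v by (auto simp: edge_d)
    hence "d w y' = d w a + 1 + d b y'" using less(1)[of y'] y' y y'v by simp
    hence "y' = z" using prev_unique[OF assms(2), of y' y z] y' zy wz wy by auto
    thus False using y y' by simp
   qed
  qed
  hence "d w z = d w y + 1" using nbr_dist[OF assms(2) y(1)] by auto
  thus ?thesis using wy y by simp
 qed
qed

text \<open>The half-tree on the side of \<open>b\<close> when the edge \<open>{a, b}\<close> is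
  cut.\<close>

definition behind :: "'f vertex => 'f vertex => 'f vertex set" where
 "behind a b = {z \<in> VV. d a z = d b z + 1}"

lemma behind_or: "{a, b} \<in> EE ==> z \<in> VV ==> z \<in> behind a b \<or> z \<in> behind b a"
 using nbr_dist[of z a b] edge_vertices d_sym by (fastforce simp: behind_def)

lemma behind_disjoint: "z \<in> behind a b ==> z \<notin> behind b a"
 by (simp add: behind_def)

lemma d_across: assumes "{a, b} \<in> EE" "w \<in> behind b a" "z \<in> behind a b"
 shows "d w z = d w a + 1 + d b z"
proof -
 have "w \<in> VV" "d w b = d w a + 1"
  using assms(2) edge_vertices[OF assms(1)] d_sym[of w b] d_sym[of w a] by (simp_all add: behind_def)
 thus ?thesis using geodesic_through_edge[OF assms(1), of w z] assms(3) by (simp add: behind_def)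
qed

subsection \<open>The action on the tree\<close>

lemma act_vertex_VV: "det g ~= 0 ==> x \<in> VV ==> actv g x \<in> VV"
 by (auto simp: vertices_eq act_vx) (metis det_mult2 mult_eq_0_iff)

lemma act_vertex_mult: "x \<in> VV ==> actv (g ** h) x = actv g (actv h x)"
 by (auto simp: vertices_eq act_vx matrix_mul_assoc)

lemma act_vertex_1: "x \<in> VV ==> actv (mat 1) x = x"
 by (auto simp: vertices_eq act_vx)

lemma act_vertex_sc: "c ~= 0 ==> x \<in> VV ==> actv (sc c) x = x"
 by (auto simp: vertices_eq act_vx vx_sc)

lemma act_minv: assumes "det g ~= 0" "x \<in> VV"
 shows "actv (minv g) (actv g x) = x" "actv g (actv (minv g) x) = x"
 using assms minv[OF assms(1)] by (simp_all add: act_vertex_1 flip: act_vertex_mult)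

lemma rp_act: assumes "det g ~= 0" "rp n x y" shows "rp n (actv g x) (actv g y)"
proof -
 obtain A where "det A ~= 0" "x = vx A" "y = vx (A ** D n)" using assms(2) by (auto simp: rp_def)
 thus ?thesis using assms(1) rpI[of "g ** A" n] by (simp add: act_vx det_mult2 matrix_mul_assoc)
qed

lemma d_act: "det g ~= 0 ==> x \<in> VV ==> y \<in> VV ==> d (actv g x) (actv g y) = d x y"
 using rp_iff[of "d x y" x y] by (intro d_rp rp_act) auto

lemma edge_act: "det g ~= 0 ==> \<mu> \<in> EE ==> act_simplex g \<mu> \<in> EE"
 by (erule edge_cases) (auto simp: act_simplex_def edge_iff rp_act)

lemma act_simplex_vertex: "act_simplex g {x} = {actv g x}"
 by (simp add: act_simplex_def)

lemma simplex_act: "det g ~= 0 ==> \<tau> \<in> SS ==> act_simplex g \<tau> \<in> SS"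
 by (auto simp: simplices_def edge_act act_simplex_vertex act_vertex_VV)

lemma act_simplex_mult: "\<tau> \<in> SS ==> act_simplex (g ** h) \<tau> = act_simplex g (act_simplex h \<tau>)"
 unfolding act_simplex_def image_image by (rule image_cong) (auto simp: act_vertex_mult simplex_subset)

lemma act_simplex_1: "\<tau> \<in> SS ==> act_simplex (mat 1) \<tau> = \<tau>"
 unfolding act_simplex_def using simplex_subset act_vertex_1 by (auto simp: image_iff)

lemma act_simplex_minv: assumes "det g ~= 0" "\<tau> \<in> SS"
 shows "act_simplex (minv g) (act_simplex g \<tau>) = \<tau>" "act_simplex g (act_simplex (minv g) \<tau>) = \<tau>"
 using assms minv[OF assms(1)] by (simp_all add: act_simplex_1 flip: act_simplex_mult)

lemma edge_simplex: "\<tau> \<in> EE ==> \<tau> \<in> SS" and vertex_simplex: "x \<in> VV ==> {x} \<in> SS"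
 by (auto simp: simplices_def)

lemma edge_transitive: assumes "{x, y} \<in> EE" "{x', y'} \<in> EE"
 shows "\<exists>g. det g ~= 0 \<and> actv g x = x' \<and> actv g y = y'"
proof -
 obtain A B where "det A ~= 0" "x = vx A" "y = vx (A ** D 1)" "det B ~= 0" "x' = vx B" "y' = vx (B ** D 1)"
  using assms by (auto simp: edge_iff rp_def)
 thus ?thesis
  by (intro exI[of _ "B ** minv A"]) (auto simp: act_vx det_mult2 det_minv_nz minv_cancel matrix_mul_assoc)
qed

lemma vertex_on_edge: assumes "x \<in> VV" shows "\<exists>y. {x, y} \<in> EE"
proof -
 obtain A where "det A ~= 0" "x = vx A" using assms by (auto simp: vertices_eq)
 thus ?thesis using rpI[of A 1] edge_iff by blast
qed

text \<open>The two orbits of \<open>SL\<^sub>2(F)\<close> on vertices are told apart by the parity of \<open>v (det A)\<close>.\<close>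

lemma SL2_orbit_vx: assumes "det A ~= 0" "det B ~= 0"
 shows "vx B \<in> SL2_orbit (vx A) \<longleftrightarrow> even (v (det A) - v (det B))"
proof
 assume "vx B \<in> SL2_orbit (vx A)"
 then obtain g where g: "det g = 1" "vx B = vx (g ** A)" by (auto simp: SL2_orbit_def act_vx)
 then obtain c k where "c ~= 0" "GLO k" "g ** A = sc c ** B ** k"
  using vx_eq[of B "g ** A"] assms by (auto simp: det_mult2)
 moreover from this have "det A = c * c * det B * det k"
  using g(1) by (metis det_mult2 det_sc mult_1)
 ultimately have "v (det A) = 2 * v c + v (det B)"
  using assms by (auto simp: v_mult GLO_def vu_def)
 thus "even (v (det A) - v (det B))" by simp
next
 assume "even (v (det A) - v (det B))"
 then obtain n where n: "v (det A) - v (det B) = 2 * n" by blast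
 \<comment> \<open>The scalar takes half of the even difference of valuations and \<open>k\<close>
   the remaining unit, so that \<open>g\<close> has determinant 1.\<close>
 define c where "c = \<pi> powi n"
 have c: "c ~= 0" "v c = n" using pi by (simp_all add: c_def v_powi)
 define u where "u = det A / (c * c * det B)"
 have u: "vu u" using assms c n by (simp add: vu_def u_def v_divide v_mult)
 define k where "k = mk2 u 0 0 1"
 have k: "GLO k" using u by (simp add: k_def GLO_def int2_def det_2 vu_Fi)
 define g where "g = sc c ** B ** k ** minv A"
 have "det k = u" by (simp add: k_def det_2)
 hence "det g = 1" using assms c by (simp add: g_def det_mult2 det_sc det_minv u_def)
 moreover have "g ** A = sc c ** B ** k" using assms by (simp add: g_def minv_cancel)
 hence "vx (g ** A) = vx B" using c k assms by (simp add: vx_eqI)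
 ultimately show "vx B \<in> SL2_orbit (vx A)" unfolding SL2_orbit_def act_vx by (metis (mono_tags, lifting) act_vx mem_Collect_eq)
qed

end

section \<open>Finite and pro-p groups\<close>

text \<open>Cauchy's theorem, as Sylow's theorem for the exponent 1: a prime \<open>q\<close>
  dividing the order gives a nontrivial element whose order divides both \<open>q\<close> and a
  power of \<open>p\<close>, so \<open>q = p\<close>.\<close>

lemma (in group) prime_power_order:
 assumes "Factorial_Ring.prime (p::nat)" "finite (carrier G)"
  "!!x. x \<in> carrier G ==> \<exists>k. x [^] (p ^ k) = \<one>"
 shows "\<exists>r. order G = p ^ r"
proof -
 have pos: "order G > 0" using assms(2) by (simp add: order_gt_0_iff_finite)
 have "q = p" if q: "Factorial_Ring.prime q" "q dvd order G" for q
 proof -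
  obtain m where "order G = q ^ 1 * m" using q by auto
  then obtain H where H: "subgroup H G" "card H = q ^ 1"
   using sylow_thm[OF q(1) is_group _ assms(2)] by blast
  interpret H: group "G\<lparr>carrier := H\<rparr>" using H(1) subgroup_imp_group by blast
  have oH: "order (G\<lparr>carrier := H\<rparr>) = q" using H by (simp add: order_def)
  have "\<exists>x\<in>H. x ~= \<one>"
  proof (rule ccontr)
   assume "\<not> ?thesis"
   hence "H \<subseteq> {\<one>}" by blast
   hence "card H <= 1" using card_mono[of "{\<one>}" H] by simp
   thus False using H(2) prime_gt_1_nat[OF q(1)] by simp
  qed
  then obtain x where x: "x \<in> H" "x ~= \<one>" by blast
  hence xG: "x \<in> carrier G" using H subgroup.subset by blast
  obtain k where "x [^] (p ^ k) = \<one>" using assms(3)[OF xG] by blast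
  hence "ord x dvd p ^ k" by (simp add: pow_eq_id[OF xG])
  moreover have "x [^] q = \<one>"
   using H.pow_order_eq_1[of x] x oH nat_pow_consistent[of x q H] by simp
  hence "ord x dvd q" by (simp add: pow_eq_id[OF xG])
  moreover have "ord x ~= 1" using x ord_eq_1[OF xG] by simp
  ultimately have "q dvd p ^ k" using q by (metis prime_nat_iff)
  thus "q = p" using q assms(1) by (metis prime_dvd_power primes_dvd_imp_eq)
 qed
 thus ?thesis using pos
 proof (induction "order G" arbitrary: rule: less_induct)
  case less
  have "\<exists>r. n = p ^ r" if "n > 0" "!!q. Factorial_Ring.prime q ==> q dvd n ==> q = p" for n :: nat
   using that
  proof (induction n rule: less_induct)
   case (less n)
   show ?case
   proof (cases "n = 1")
    case True thus ?thesis by (intro exI[of _ 0]) simp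
   next
    case False
    then obtain q where q: "Factorial_Ring.prime q" "q dvd n" using prime_factor_nat by blast
    then obtain m where m: "n = p * m" using less(3) by blast
    have p1: "p > 1" using assms(1) prime_gt_1_nat by blast
    hence "m > 0" "m < n" using less(2) m by auto
    then obtain r where "m = p ^ r" using less(1)[of m] less(3) m by auto
    thus ?thesis using m by (intro exI[of _ "Suc r"]) simp
   qed
  qed
  thus ?case using less by blast
 qed
qed

text \<open>Lagrange's theorem in the factor group.\<close>

lemma (in normal) pow_index_mem:
 assumes "card (rcosets H) = n" "n > 0" "x \<in> carrier G" shows "x [^] n \<in> H"
proof -
 interpret Q: group "G Mod H" by (rule factorgroup_is_group)
 interpret h: group_hom G "G Mod H" "\<lambda>a. H #> a"
  by (unfold_locales) (rule r_coset_hom_Mod)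
 have c: "carrier (G Mod H) = rcosets H" by (simp add: FactGroup_def)
 have "(H #> x) [^]\<^bsub>G Mod H\<^esub> order (G Mod H) = \<one>\<^bsub>G Mod H\<^esub>"
  by (rule Q.pow_order_eq_1) (use assms in simp)
 hence "H #> (x [^] n) = H"
  using assms h.hom_nat_pow[of x n] by (simp add: order_def c FactGroup_def)
 thus ?thesis using assms(3) rcos_self[of "x [^] n" H] is_subgroup by auto
qed

section \<open>Congruences of matrices\<close>

context local_field
begin

text \<open>\<open>intn n (A - B)\<close> is congruence modulo the n-th power of the maximal ideal.
  Negative \<open>n\<close> is allowed and then expresses boundedness.\<close>

definition intn :: "int => 'f^2^2 => bool" where
 "intn n B \<longleftrightarrow> B $ 1 $ 1 \<in> Fi n \<and> B $ 1 $ 2 \<in> Fi n \<and> B $ 2 $ 1 \<in> Fi n \<and> B $ 2 $ 2 \<in> Fi n"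

lemma intn_0: "intn 0 B \<longleftrightarrow> int2 B"
 by (simp add: intn_def int2_def)

lemma intn_zero [simp]: "intn n 0"
 by (simp add: intn_def)

lemma intn_add: "intn n A ==> intn n B ==> intn n (A + B)"
 by (simp add: intn_def Fi_add)

lemma intn_diff: "intn n A ==> intn n B ==> intn n (A - B)"
 by (simp add: intn_def Fi_diff)

lemma intn_diff_swap: "intn n (A - B) \<longleftrightarrow> intn n (B - A)"
 by (simp add: intn_def Fi_diff_swap)

lemma intn_mult: "intn m A ==> intn n B ==> k <= m + n ==> intn k (A ** B)"
 unfolding intn_def mult2 by (intro conjI Fi_add) (auto intro: Fi_mult)

lemma intn_mono: "intn n A ==> m <= n ==> intn m A"
 by (auto simp: intn_def intro: Fi_mono)

lemma intn_sum: "(!!i. i \<in> S ==> intn n (f i)) ==> intn n (sum f S)"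
 by (induction S rule: infinite_finite_induct) (auto intro: intn_add)

lemma intn_trans: "intn n (A - B) ==> intn n (B - C) ==> intn n (A - C)"
 using intn_add[of n "A - B" "B - C"] by simp

lemma intn_exists: "\<exists>n. intn (- int n) A"
proof -
 have "\<exists>n. a \<in> Fi (- int n)" for a
  by (cases "a = 0") (auto simp: frac_ideal_def intro!: exI[of _ "nat (- v a)"])
 then obtain n1 n2 n3 n4 where "A$1$1 \<in> Fi (- int n1)" "A$1$2 \<in> Fi (- int n2)" "A$2$1 \<in> Fi (- int n3)" "A$2$2 \<in> Fi (- int n4)"
  by meson
 thus ?thesis
  by (intro exI[of _ "max (max n1 n2) (max n3 n4)"]) (auto simp: intn_def intro: Fi_mono)
qed

lemma add_mult2: fixes A B C :: "'f^2^2" shows "(B + C) ** A = B ** A + C ** A"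
 by (simp add: eq2 algebra_simps)

lemma minus_mult: fixes A :: "'f^2^2" shows "A ** (B - C) = A ** B - A ** C" "(B - C) ** A = B ** A - C ** A"
 by (simp_all add: eq2 algebra_simps)

lemma intn_cong_mult: assumes "intn n (A - A')" "intn n (B - B')" "int2 A'" "int2 B"
 shows "intn n (A ** B - A' ** B')"
proof -
 have "A ** B - A' ** B' = (A - A') ** B + A' ** (B - B')" by (simp add: minus_mult)
 thus ?thesis using assms by (auto intro!: intn_add intro: intn_mult simp flip: intn_0)
qed

lemma int2_mpow: "int2 A ==> int2 (mpow A n)"
 by (induction n) (use GLO_1 in "auto simp: int2_mult GLO_def")

lemma intn_cong_mpow: assumes "intn n (A - B)" "int2 A" "int2 B" shows "intn n (mpow A k - mpow B k)"
 by (induction k) (use assms in "auto intro!: intn_cong_mult simp: int2_mpow")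

lemma int2_1 [simp]: "int2 (mat 1)"
 using GLO_1 by (simp add: GLO_def)

lemma int2_diff: "int2 A ==> int2 B ==> int2 (A - B)"
 using intn_diff[of 0 A B] by (simp add: intn_0)

lemma int2_cong: "intn 0 (A - B) ==> int2 B ==> int2 A"
 using intn_add[of 0 "A - B" B] by (simp add: intn_0)

lemma det_cong: assumes "intn n (A - B)" "int2 A" "int2 B" "n >= 0" shows "det A - det B \<in> Fi n"
proof -
 have e: "det A - det B = (A$1$1 - B$1$1) * A$2$2 + B$1$1 * (A$2$2 - B$2$2)
   - ((A$1$2 - B$1$2) * A$2$1 + B$1$2 * (A$2$1 - B$2$1))"
  by (simp add: det_2 algebra_simps)
 show ?thesis unfolding e
  using assms by (intro Fi_diff Fi_add) (auto simp: intn_def int2_def intro: Fi_mult0)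
qed

section \<open>p-th powers of matrices and congruences\<close>

lemma binomial_mpow: fixes x :: "'f^2^2"
 shows "mpow (mat 1 + x) n = (\<Sum>k\<le>n. sc (of_nat (n choose k)) ** mpow x k)"
proof (induction n)
 case 0 thus ?case by simp
next
 case (Suc n)
 have dist: "sum f S ** x = (\<Sum>i\<in>S. f i ** x)" for f :: "nat => 'f^2^2" and S
  by (induction S rule: infinite_finite_induct) (simp_all add: add_mult2 eq2)
 have zero: "sc 0 ** A = 0" for A :: "'f^2^2" by (simp add: eq2)
 have plus: "sc a ** A + sc b ** A = sc (a + b) ** A" for a b and A :: "'f^2^2" by (simp add: eq2 algebra_simps)
 have "mpow (mat 1 + x) (Suc n) = mpow (mat 1 + x) n + mpow (mat 1 + x) n ** x"
  by (simp add: matrix_add_ldistrib)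
 also have "mpow (mat 1 + x) n = (\<Sum>k\<le>Suc n. sc (of_nat (n choose k)) ** mpow x k)"
  using Suc by (simp add: zero binomial_eq_0)
 also have "\<dots> ** x = (\<Sum>k\<le>n. sc (of_nat (n choose k)) ** mpow x (Suc k))"
  by (simp add: dist zero binomial_eq_0 matrix_mul_assoc add_mult2)
 also have "(\<Sum>k\<le>Suc n. sc (of_nat (n choose k)) ** mpow x k) =
   mat 1 + (\<Sum>k\<le>n. sc (of_nat (n choose Suc k)) ** mpow x (Suc k))"
  by (subst sum.atMost_Suc_shift) simp
 finally have "mpow (mat 1 + x) (Suc n) = mat 1 + ((\<Sum>k\<le>n. sc (of_nat (n choose Suc k)) ** mpow x (Suc k))
   + (\<Sum>k\<le>n. sc (of_nat (n choose k)) ** mpow x (Suc k)))" by (simp add: add.assoc)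
 also have "\<dots> = mat 1 + (\<Sum>k\<le>n. sc (of_nat (Suc n choose Suc k)) ** mpow x (Suc k))"
  unfolding sum.distrib[symmetric] plus by (simp add: add.commute)
 also have "\<dots> = (\<Sum>k\<le>Suc n. sc (of_nat (Suc n choose k)) ** mpow x k)"
  by (subst sum.atMost_Suc_shift) simp
 finally show ?case .
qed

text \<open>The inner binomial coefficients are divisible by \<open>p\<close>, which lies in the
  maximal ideal.\<close>

lemma frobenius_mpow: assumes "int2 x" shows "intn 1 (mpow (mat 1 + x) p - (mat 1 + mpow x p))"
proof -
 have p0: "p > 0" using p_prime prime_gt_0_nat by blast
 have "(\<Sum>k\<le>p. sc (of_nat (p choose k)) ** mpow x k) = mat 1 + mpow x p +
  (\<Sum>k\<in>{0<..<p}. sc (of_nat (p choose k)) ** mpow x k)"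
 proof -
  have "{..p} = insert 0 (insert p {0<..<p})" using p0 by auto
  thus ?thesis using p0 by (simp add: add.assoc)
 qed
 moreover have "intn 1 (sc (of_nat (p choose k)) ** mpow x k)" if "k \<in> {0<..<p}" for k
 proof -
  have "p dvd (p choose k)" using that p_prime by (intro dvd_choose_prime) auto
  then obtain q where "p choose k = p * q" by blast
  hence "of_nat (p choose k) \<in> Fi 1" using p_Fi Fi_of_nat[of q] by (simp add: Fi_mult0)
  hence "intn 1 (sc (of_nat (p choose k)))" by (simp add: intn_def)
  thus ?thesis using int2_mpow[OF assms, of k] intn_mult[of 1 _ 0 "mpow x k" 1] by (simp add: intn_0)
 qed
 ultimately show ?thesis unfolding binomial_mpow by (simp, intro intn_sum) simp
qed

lemma frobenius_mpow_iterate: assumes "int2 x"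
 shows "intn 1 (mpow (mat 1 + x) (p ^ j) - (mat 1 + mpow x (p ^ j)))"
proof (induction j)
 case 0 thus ?case by simp
next
 case (Suc j)
 have i: "int2 (mat 1 + y)" if "int2 y" for y using that intn_add[of 0 "mat 1" y] by (simp add: intn_0)
 have e: "mpow y (p ^ Suc j) = mpow (mpow y (p ^ j)) p" for y by (metis mpow_mult power_Suc2)
 have "intn 1 (mpow (mpow (mat 1 + x) (p ^ j)) p - mpow (mat 1 + mpow x (p ^ j)) p)"
  using Suc assms by (intro intn_cong_mpow) (auto simp: int2_mpow i)
 moreover have "intn 1 (mpow (mat 1 + mpow x (p ^ j)) p - (mat 1 + mpow (mpow x (p ^ j)) p))"
  using assms by (intro frobenius_mpow int2_mpow)
 ultimately show ?case unfolding e by (rule intn_trans)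
qed

text \<open>By the Frobenius congruence \<open>x\<close> is nilpotent modulo \<open>\<pi>\<close>;
  its determinant is then nilpotent in the residue field, hence zero there.\<close>

lemma unipotent_mod_pi: assumes "int2 x" "intn 1 (mpow (mat 1 + x) (p ^ j) - mat 1)"
 shows "det x \<in> Fi 1"
proof -
 have "intn 1 (mpow x (p ^ j))"
  using intn_diff[OF assms(2) frobenius_mpow_iterate[OF assms(1), of j]] by (simp add: algebra_simps)
 hence "det (mpow x (p ^ j)) \<in> Fi 1"
  using det_cong[of 1 "mpow x (p ^ j)" 0] int2_mpow[OF assms(1)] by (simp add: int2_def det_2)
 moreover obtain m where "p ^ j = Suc m" using p_prime prime_gt_0_nat by (metis gr0_implies_Suc zero_less_power)
 ultimately show ?thesis using Fi1_prime[of "det x" m] unfolding det_mpow by simp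
qed

text \<open>Over the residue field an element whose order is a power of \<open>p\<close> is
  unipotent. The determinant is handled by applying \<open>unipotent_mod_pi\<close> to the scalar
  matrix with entry \<open>det m\<close>; the trace then follows, since the characteristic
  polynomial at 1 links it to \<open>det m\<close> and \<open>det (m - mat 1)\<close>.\<close>

lemma p_power_mod_pi: assumes "int2 m" "intn 1 (mpow m (p ^ j) - mat 1)"
 shows "det (m - mat 1) \<in> Fi 1" "det m - 1 \<in> Fi 1" "m$1$1 + m$2$2 - 2 \<in> Fi 1"
proof -
 show 1: "det (m - mat 1) \<in> Fi 1"
  using assms by (intro unipotent_mod_pi[of _ j]) (simp_all add: int2_diff)
 have dm: "det m \<in> Fi 0" by (rule int2_det[OF assms(1)])
 have "mpow (sc (det m)) (p ^ j) = sc (det m ^ (p ^ j))"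
 proof -
  have "mpow (sc c) n = sc (c ^ n)" for c :: 'f and n by (induction n) (simp_all add: eq2 mult.commute)
  thus ?thesis .
 qed
 moreover have "det m ^ (p ^ j) - 1 \<in> Fi 1"
  using det_cong[OF assms(2)] int2_mpow[OF assms(1)] by (simp add: det_mpow)
 ultimately have "intn 1 (mpow (mat 1 + (sc (det m) - mat 1)) (p ^ j) - mat 1)"
  by (simp add: intn_def)
 hence "det (sc (det m) - mat 1) \<in> Fi 1"
  using dm by (intro unipotent_mod_pi) (auto simp: int2_def Fi_diff)
 moreover have "det (sc (det m) - mat 1) = (det m - 1) ^ Suc 1" by (simp add: det_2 power2_eq_square)
 ultimately show 2: "det m - 1 \<in> Fi 1" using Fi1_prime by metis
 have "m$1$1 + m$2$2 - 2 = (det m - 1) - det (m - mat 1)" by (simp add: det_2 algebra_simps)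
 thus "m$1$1 + m$2$2 - 2 \<in> Fi 1" using Fi_diff[OF 2 1] by (simp only:)
qed

text \<open>Write \<open>y\<close> as \<open>mat 1 + x\<close>. Modulo level \<open>n + 1\<close>
  the square of \<open>x\<close> vanishes because \<open>n >= 1\<close>, so powers of
  \<open>y\<close> are linear in \<open>x\<close>; at exponent \<open>p\<close> the linear term
  gains a factor from the maximal ideal.\<close>

lemma p_power_step: assumes "intn n (y - mat 1)" "n >= 1" shows "intn (n + 1) (mpow y p - mat 1)"
proof -
 define x where "x = y - mat 1"
 have x: "intn n x" using assms by (simp add: x_def)
 have ix: "int2 x" using x intn_mono[of _ x 0] assms by (simp flip: intn_0)
 have y: "y = mat 1 + x" by (simp add: x_def)
 have iy: "int2 y" unfolding y using ix intn_add[of 0 "mat 1" x] by (simp add: intn_0)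
 have n1: "intn (n + 1) (mpow y i - (mat 1 + sc (of_nat i) ** x))" for i
 proof (induction i)
  case 0 have "sc 0 ** x = 0" by (simp add: eq2) thus ?case by simp
 next
  case (Suc i)
  have i1: "int2 (mat 1 + sc (of_nat i) ** x)"
   using ix intn_add[of 0 "mat 1" "sc (of_nat i) ** x"] int2_mult[of "sc (of_nat i)" x]
   by (simp add: intn_0 int2_def Fi_of_nat)
  have "intn (n + 1) (mpow y i ** y - (mat 1 + sc (of_nat i) ** x) ** y)"
   using Suc i1 iy by (intro intn_cong_mult) auto
  moreover have "intn (n + 1) ((mat 1 + sc (of_nat i) ** x) ** y - (mat 1 + sc (of_nat (Suc i)) ** x))"
  proof -
   have "(mat 1 + sc (of_nat i) ** x) ** y - (mat 1 + sc (of_nat (Suc i)) ** x) = sc (of_nat i) ** (x ** x)"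
    unfolding y by (simp add: eq2 algebra_simps)
   moreover have "intn (n + 1) (x ** x)" using intn_mult[OF x x] assms by simp
   ultimately show ?thesis using intn_mult[of 0 "sc (of_nat i)" "n + 1" "x ** x" "n + 1"]
    by (simp add: intn_0 int2_def Fi_of_nat)
  qed
  ultimately have "intn (n + 1) (mpow y i ** y - (mat 1 + sc (of_nat (Suc i)) ** x))" by (rule intn_trans)
  thus ?case by simp
 qed
 have "intn (n + 1) (sc (of_nat p) ** x)"
  using p_Fi x by (intro intn_mult[of 1 _ n]) (simp_all add: intn_def)
 thus ?thesis
  using intn_add[OF n1[of p], of "sc (of_nat p) ** x"] by (simp add: algebra_simps)
qed

lemma p_power_tends_to_1: assumes "intn 1 (m - mat 1)" shows "intn (1 + int k) (mpow m (p ^ k) - mat 1)"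
proof (induction k)
 case 0 thus ?case using assms by simp
next
 case (Suc k)
 have "mpow m (p ^ Suc k) = mpow (mpow m (p ^ k)) p" by (metis mpow_mult power_Suc2)
 thus ?case using p_power_step[OF Suc] by (simp add: algebra_simps)
qed

section \<open>Compact subgroups\<close>

abbreviation MT :: "('f^2^2) topology" where "MT \<equiv> matrix_topology v"

definition mball :: "'f^2^2 => int => ('f^2^2) set" where "mball A n = {B. intn n (B - A)}"

lemma openin_MT: "openin MT S \<longleftrightarrow> (\<forall>A\<in>S. \<exists>n. mball A n \<subseteq> S)"
proof -
 have b: "{B. \<forall>i j. B $ i $ j - A $ i $ j \<in> Fi n} = mball A n" for A n
  by (auto simp: mball_def intn_def forall_2)
 have MT: "MT = topology_generated_by {mball A n | A n. True}"
  unfolding matrix_topology_def b ..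
 show ?thesis
 proof
  assume "openin MT S"
  hence "generate_topology_on {mball A n | A n. True} S"
   unfolding MT openin_topology_generated_by_iff .
  thus "\<forall>A\<in>S. \<exists>n. mball A n \<subseteq> S"
  proof induction
   case (Int S T)
   show ?case
   proof
    fix A assume "A \<in> S \<inter> T"
    then obtain m n where "mball A m \<subseteq> S" "mball A n \<subseteq> T" using Int by blast
    moreover have "mball A (max m n) \<subseteq> mball A m \<inter> mball A n"
     unfolding mball_def using intn_mono by fastforce
    ultimately show "\<exists>n. mball A n \<subseteq> S \<inter> T" by blast
   qed
  next
   case (UN K)
   thus ?case by (meson Union_iff Union_upper subset_trans)
  next
   case (Basis S)
   then obtain A n where S: "S = mball A n" by blast
   have "mball B n \<subseteq> S" if "B \<in> S" for B
    using that unfolding S mball_def using intn_trans by blast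
   thus ?case by blast
  qed simp
 next
  assume S: "\<forall>A\<in>S. \<exists>n. mball A n \<subseteq> S"
  have "A \<in> mball A n" for A n by (simp add: mball_def)
  have "S = \<Union>{mball A n | A n. mball A n \<subseteq> S}"
  proof (intro equalityI subsetI)
   fix A assume "A \<in> S"
   then obtain n where "mball A n \<subseteq> S" using S by blast
   thus "A \<in> \<Union>{mball A n | A n. mball A n \<subseteq> S}" using \<open>A \<in> mball A n\<close> by blast
  qed blast
  moreover have "openin MT (\<Union>{mball A n | A n. mball A n \<subseteq> S})"
   by (rule openin_Union) (auto simp: MT intro!: topology_generated_by_Basis)
  ultimately show "openin MT S" by simp
 qed
qed

lemma topspace_MT [simp]: "topspace MT = UNIV"
 using openin_MT[of UNIV] openin_subset by auto

text \<open>Digit expansion: each step refines the representatives by one digit, scaled by an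
  element of valuation \<open>n + int k\<close>.\<close>

lemma finite_reps: "\<exists>R. finite R \<and> (\<forall>a\<in>Fi n. \<exists>r\<in>R. a - r \<in> Fi (n + int k))"
proof (induction k)
 case 0 show ?case by (intro exI[of _ "{0}"]) simp
next
 case (Suc k)
 then obtain R where R: "finite R" "!!a. a \<in> Fi n ==> \<exists>r\<in>R. a - r \<in> Fi (n + int k)" by blast
 obtain R' where R': "finite R'" "!!a. a \<in> Fi 0 ==> \<exists>r\<in>R'. a - r \<in> Fi 1" using residue_reps by blast
 define c where "c = \<pi> powi (n + int k)"
 have c: "c ~= 0" "v c = n + int k" using pi by (simp_all add: c_def v_powi)
 have cF: "c * a \<in> Fi (v c + j) \<longleftrightarrow> a \<in> Fi j" for a j
  using c(1) by (cases "a = 0") (auto simp: frac_ideal_def v_mult)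
 have "\<exists>r\<in>(\<lambda>(r, s). r + c * s) ` (R \<times> R'). a - r \<in> Fi (n + int (Suc k))" if a: "a \<in> Fi n" for a
 proof -
  obtain r where r: "r \<in> R" "a - r \<in> Fi (n + int k)" using R a by blast
  hence "(a - r) / c \<in> Fi 0" using cF[of "(a - r) / c" 0] c by simp
  then obtain s where s: "s \<in> R'" "(a - r) / c - s \<in> Fi 1" using R' by blast
  hence "c * ((a - r) / c - s) \<in> Fi (n + int (Suc k))" using cF[of "(a - r) / c - s" 1] c by (simp add: algebra_simps)
  moreover have "c * ((a - r) / c - s) = a - (r + c * s)" using c by (simp add: field_simps)
  ultimately show ?thesis using r s by (intro bexI[of _ "r + c * s"]) auto
 qed
 thus ?case using R(1) R'(1) by (intro exI[of _ "(\<lambda>(r, s). r + c * s) ` (R \<times> R')"]) auto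
qed

lemma finite_reps_matrix: "\<exists>R. finite R \<and> (\<forall>A. intn n A --> (\<exists>B\<in>R. intn (n + int k) (A - B)))"
proof -
 obtain R where R: "finite R" "!!a. a \<in> Fi n ==> \<exists>r\<in>R. a - r \<in> Fi (n + int k)" using finite_reps[of n k] by (elim exE conjE) simp
 let ?R = "(\<lambda>(a, b, c, d). mk2 a b c d) ` (R \<times> R \<times> R \<times> R)"
 have "\<exists>B\<in>?R. intn (n + int k) (A - B)" if "intn n A" for A
 proof -
  obtain a b c d where "a \<in> R" "b \<in> R" "c \<in> R" "d \<in> R" "A$1$1 - a \<in> Fi (n + int k)" "A$1$2 - b \<in> Fi (n + int k)"
   "A$2$1 - c \<in> Fi (n + int k)" "A$2$2 - d \<in> Fi (n + int k)"
   using \<open>intn n A\<close> R(2) unfolding intn_def by meson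
  thus ?thesis by (intro bexI[of _ "mk2 a b c d"]) (auto simp: intn_def image_iff)
 qed
 thus ?thesis using R(1) by (intro exI[of _ ?R]) auto
qed

lemma matrix_complete: assumes "!!n i. n <= i ==> intn (int n) (B i - B n)"
 shows "\<exists>L. \<forall>n. intn (int n) (B n - L)"
proof -
 have "\<exists>l. \<forall>n. f n - l \<in> Fi (int n)" if f: "!!n i. n <= i ==> f i - f n \<in> Fi (int n)" for f :: "nat => 'f"
 proof -
  have "\<forall>n. \<exists>N. \<forall>i\<ge>N. \<forall>j\<ge>N. f i - f j \<in> Fi n"
  proof
   fix n
   have "f i - f j \<in> Fi n" if "i >= nat n" "j >= nat n" for i j
    using Fi_diff[OF f[OF that(1)] f[OF that(2)]] Fi_mono[of _ "int (nat n)" n] by simp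
   thus "\<exists>N. \<forall>i\<ge>N. \<forall>j\<ge>N. f i - f j \<in> Fi n" by blast
  qed
  then obtain l where l: "\<forall>n. \<exists>N. \<forall>i\<ge>N. f i - l \<in> Fi n"
   using nonarch unfolding nonarch_local_field_def by blast
  have "f n - l \<in> Fi (int n)" for n
  proof -
   obtain N where "\<forall>i\<ge>N. f i - l \<in> Fi (int n)" using l by blast
   hence "f (max n N) - l \<in> Fi (int n)" by simp
   thus ?thesis using Fi_diff[OF _ f[of n "max n N"], of "f (max n N) - l"] by simp
  qed
  thus ?thesis by blast
 qed
 from this[of "\<lambda>n. B n $ i $ j" for i j] assms
 have "\<exists>l. \<forall>n. B n $ 1 $ 1 - l \<in> Fi (int n)" "\<exists>l. \<forall>n. B n $ 1 $ 2 - l \<in> Fi (int n)"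
  "\<exists>l. \<forall>n. B n $ 2 $ 1 - l \<in> Fi (int n)" "\<exists>l. \<forall>n. B n $ 2 $ 2 - l \<in> Fi (int n)"
  by (auto simp: intn_def)
 then obtain a b c d where "\<forall>n. B n $ 1 $ 1 - a \<in> Fi (int n)" "\<forall>n. B n $ 1 $ 2 - b \<in> Fi (int n)"
  "\<forall>n. B n $ 2 $ 1 - c \<in> Fi (int n)" "\<forall>n. B n $ 2 $ 2 - d \<in> Fi (int n)" by blast
 thus ?thesis by (intro exI[of _ "mk2 a b c d"]) (auto simp: intn_def)
qed

text \<open>Heine-Borel. Call a set bad if no finite subfamily of the cover suffices. A bad piece of
  \<open>S\<close> contains a bad piece one level smaller, centred in \<open>S\<close>; the centres
  converge because the field is complete, and the limit has a neighbourhood inside one member of the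
  cover, which then covers a bad piece.\<close>

lemma compactin_MT:
 assumes bd: "!!A. A \<in> S ==> intn (- int N) A"
  and cl: "!!L. (!!n. \<exists>B\<in>S. intn (int n) (B - L)) ==> L \<in> S"
 shows "compactin MT S"
 unfolding compactin_def
proof (intro conjI allI impI)
 fix \<U> assume U: "Ball \<U> (openin MT) \<and> S \<subseteq> \<Union> \<U>"
 define bad where "bad T \<longleftrightarrow> \<not> (\<exists>\<F>. finite \<F> \<and> \<F> \<subseteq> \<U> \<and> T \<subseteq> \<Union>\<F>)" for T
 have bad_Un: "\<exists>T\<in>\<T>. bad T" if "finite \<T>" "bad (\<Union>\<T>)" for \<T>
 proof (rule ccontr)
  assume "\<not> ?thesis"
  hence "\<forall>T\<in>\<T>. \<exists>\<F>. finite \<F> \<and> \<F> \<subseteq> \<U> \<and> T \<subseteq> \<Union>\<F>" unfolding bad_def by blast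
  then obtain f where f: "!!T. T \<in> \<T> ==> finite (f T) \<and> f T \<subseteq> \<U> \<and> T \<subseteq> \<Union>(f T)" by metis
  have "finite (\<Union>(f ` \<T>))" using f that(1) by auto
  moreover have "\<Union>(f ` \<T>) \<subseteq> \<U>" using f by (simp add: UN_subset_iff)
  moreover have "\<Union>\<T> \<subseteq> \<Union>(\<Union>(f ` \<T>))" 
  proof
   fix x assume "x \<in> \<Union>\<T>"
   then obtain T where T: "T \<in> \<T>" "x \<in> T" by blast
   hence "x \<in> \<Union>(f T)" using f[OF T(1)] by (elim conjE) (erule subsetD)
   thus "x \<in> \<Union>(\<Union>(f ` \<T>))" using T(1) by blast
  qed
  ultimately show False using that(2) unfolding bad_def by (elim notE) (intro exI conjI)
 qed
 have bad_mono: "bad T'" if "bad T" "T \<subseteq> T'" for T T'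
  using that unfolding bad_def by blast
 have step: "\<exists>C. C \<in> S \<and> intn j (C - B) \<and> bad (S \<inter> mball C (j + 1))"
  if b: "bad (S \<inter> mball B j)" for B and j :: int
 proof -
  obtain R where R: "finite R" "!!A. intn (- int N) A ==> \<exists>B\<in>R. intn (- int N + int (nat (j + 1 + int N))) (A - B)"
   using finite_reps_matrix by blast
  let ?T = "(\<lambda>r. S \<inter> mball B j \<inter> mball r (j + 1)) ` R"
  have "S \<inter> mball B j \<subseteq> \<Union>?T"
  proof
   fix A assume A: "A \<in> S \<inter> mball B j"
   then obtain r where "r \<in> R" "intn (- int N + int (nat (j + 1 + int N))) (A - r)" using R bd by blast
   hence "intn (j + 1) (A - r)" by (rule_tac intn_mono) auto
   with A \<open>r \<in> R\<close> show "A \<in> \<Union>?T" by (auto simp: mball_def)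
  qed
  hence "bad (\<Union>?T)" by (rule bad_mono[OF b])
  then obtain r where r: "r \<in> R" "bad (S \<inter> mball B j \<inter> mball r (j + 1))" using bad_Un[of ?T] R(1) by auto
  have "S \<inter> mball B j \<inter> mball r (j + 1) ~= {}"
  proof
   assume "S \<inter> mball B j \<inter> mball r (j + 1) = {}"
   thus False using r(2) unfolding bad_def by (metis empty_subsetI finite.emptyI)
  qed
  then obtain C where C: "C \<in> S" "intn j (C - B)" "intn (j + 1) (C - r)" by (auto simp: mball_def)
  have "mball r (j + 1) \<subseteq> mball C (j + 1)" using C(3) intn_trans intn_diff_swap unfolding mball_def by blast
  thus ?thesis using C r(2) bad_mono by blast
 qed
 show "\<exists>\<F>. finite \<F> \<and> \<F> \<subseteq> \<U> \<and> S \<subseteq> \<Union> \<F>"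
 proof (rule ccontr)
  assume "\<not> ?thesis"
  hence bS: "bad S" by (simp add: bad_def)
  have "S ~= {}"
  proof
   assume "S = {}"
   thus False using bS unfolding bad_def by (metis empty_subsetI finite.emptyI)
  qed
  then obtain C0 where C0: "C0 \<in> S" by blast
  hence "S \<subseteq> S \<inter> mball C0 (- int N)" using bd by (auto simp: mball_def intn_diff)
  hence C0b: "bad (S \<inter> mball C0 (- int N + int 0))" using bad_mono[OF bS] by simp
  have "\<exists>f. \<forall>n. (f n \<in> S \<and> bad (S \<inter> mball (f n) (- int N + int n))) \<and> intn (- int N + int n) (f (Suc n) - f n)"
  proof (rule dependent_nat_choice)
   show "\<exists>x. x \<in> S \<and> bad (S \<inter> mball x (- int N + int 0))" using C0 C0b by blast
   show "\<exists>y. (y \<in> S \<and> bad (S \<inter> mball y (- int N + int (Suc n)))) \<and> intn (- int N + int n) (y - x)"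
    if "x \<in> S \<and> bad (S \<inter> mball x (- int N + int n))" for x n
    using step[of x "- int N + int n"] that by (auto simp: algebra_simps)
  qed
  then obtain f' where f': "!!n. f' n \<in> S \<and> bad (S \<inter> mball (f' n) (- int N + int n))"
   "!!n. intn (- int N + int n) (f' (Suc n) - f' n)" by blast
  \<comment> \<open>Dropping the first \<open>N\<close> terms makes the level of the n-th ball equal
    to \<open>n\<close>, as \<open>matrix_complete\<close> requires.\<close>
  define f where "f n = f' (n + N)" for n
  have f: "!!n. f n \<in> S" "!!n. bad (S \<inter> mball (f n) (int n))" "!!n. intn (int n) (f (Suc n) - f n)"
   using f'(1)[of "n + N" for n] f'(2)[of "n + N" for n] by (simp_all add: f_def)
  have "intn (int n) (f i - f n)" if "n <= i" for n i
   using that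
  proof (induction i rule: dec_induct)
   case (step m)
   have "intn (int n) (f (Suc m) - f m)" using f(3)[of m] step by (auto intro: intn_mono)
   thus ?case using step intn_trans by blast
  qed simp
  then obtain L where L: "!!n. intn (int n) (f n - L)" using matrix_complete[of f] by blast
  hence "L \<in> S" using cl f(1) by blast
  then obtain W where W: "W \<in> \<U>" "L \<in> W" using U by blast
  then obtain n where n: "mball L n \<subseteq> W" using U openin_MT by blast
  have "mball (f (nat n)) (int (nat n)) \<subseteq> mball L n"
  proof
   fix B assume "B \<in> mball (f (nat n)) (int (nat n))"
   hence "intn (int (nat n)) (B - L)" using intn_trans[OF _ L[of "nat n"], of B] by (simp add: mball_def)
   thus "B \<in> mball L n" by (auto simp: mball_def intro: intn_mono)
  qed
  hence "S \<inter> mball (f (nat n)) (int (nat n)) \<subseteq> \<Union>{W}" using n by blast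
  thus False using f(2)[of "nat n"] W(1) unfolding bad_def by (metis finite.simps empty_subsetI insert_subset)
 qed
qed simp

end

section \<open>Stabilisers and congruence subgroups\<close>

context local_field
begin

text \<open>The matrix of \<open>g\<close> in the basis given by the columns of \<open>A\<close>.
  Conditions attached to the vertex \<open>vx A\<close> become conditions on the entries of
  \<open>co A g\<close>.\<close>

definition co :: "'f^2^2 => 'f^2^2 => 'f^2^2" where "co A g = minv A ** g ** A"

lemma co_mult: assumes "det A ~= 0" shows "co A (g ** h) = co A g ** co A h"
proof -
 have "co A g ** co A h = minv A ** g ** (A ** (minv A ** (h ** A)))"
  by (simp add: co_def matrix_mul_assoc)
 thus ?thesis by (simp add: minv_cancel[OF assms] co_def matrix_mul_assoc)
qed

lemma co_1: "det A ~= 0 ==> co A (mat 1) = mat 1"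
 by (simp add: co_def minv)

lemma co_inverse: assumes "det A ~= 0" shows "co A (A ** m ** minv A) = m" "A ** co A g ** minv A = g"
proof -
 have "co A (A ** m ** minv A) = (minv A ** (A ** m)) ** minv A ** A"
  by (simp only: co_def matrix_mul_assoc)
 thus "co A (A ** m ** minv A) = m" by (simp only: minv_cancel[OF assms])
 have "A ** co A g ** minv A = A ** (minv A ** (g ** A ** minv A))"
  by (simp only: co_def matrix_mul_assoc)
 thus "A ** co A g ** minv A = g" by (simp only: minv_cancel[OF assms])
qed

lemma det_co: "det A ~= 0 ==> det (co A g) = det g"
 by (simp add: co_def det_mult2 det_minv)

lemma co_minv: assumes "det A ~= 0" "det g ~= 0" shows "co A (minv g) = minv (co A g)"
 by (rule minv_unique) (simp add: minv co_1 assms flip: co_mult[OF assms(1)])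

lemma co_mpow: "det A ~= 0 ==> co A (mpow g n) = mpow (co A g) n"
 by (induction n) (simp_all add: co_1 co_mult)

lemma co_co: assumes "det A ~= 0" "det B ~= 0" shows "co (A ** B) g = co B (co A g)"
 by (simp add: co_def minv_mult[OF assms] matrix_mul_assoc)

lemma co_sc: "det A ~= 0 ==> co A (sc c ** g) = sc c ** co A g"
 by (simp only: co_def sc_pull(2)[of "minv A"] matrix_mul_assoc[symmetric])

lemma co_vx: assumes "det A ~= 0" "det g ~= 0"
 shows "actv g (vx A) = vx A \<longleftrightarrow> (\<exists>c k. c ~= 0 \<and> GLO k \<and> co A g = sc c ** k)"
proof -
 have "actv g (vx A) = vx A \<longleftrightarrow> (\<exists>c k. c ~= 0 \<and> GLO k \<and> g ** A = sc c ** A ** k)"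
  unfolding act_vx using vx_eq[of A "g ** A"] assms by (auto simp: det_mult2)
 moreover have "g ** A = sc c ** A ** k \<longleftrightarrow> co A g = sc c ** k" for c k
 proof
  assume "g ** A = sc c ** A ** k"
  hence "co A g = minv A ** (sc c ** (A ** k))" by (simp only: co_def matrix_mul_assoc[symmetric])
  thus "co A g = sc c ** k" by (simp only: sc_pull(2)[of "minv A"] minv_cancel[OF assms(1)])
 next
  assume c: "co A g = sc c ** k"
  have "g ** A = A ** co A g" by (simp add: co_def minv_cancel[OF assms(1)] flip: matrix_mul_assoc)
  thus "g ** A = sc c ** A ** k" unfolding c by (simp only: sc_pull(2)[of A] matrix_mul_assoc[symmetric])
 qed
 ultimately show ?thesis by simp
qed

text \<open>Conjugation by a fixed matrix loses only a bounded amount of precision, which carries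
  closedness and openness over from matrices in the frame.\<close>

lemma co_near: assumes "det A ~= 0"
 shows "\<exists>N. \<forall>n g h. intn n (g - h) --> intn (n - int N) (co A g - co A h)"
proof -
 obtain a b where ab: "intn (- int a) (minv A)" "intn (- int b) A" using intn_exists by meson
 have "intn (n - int (a + b)) (co A g - co A h)" if "intn n (g - h)" for n g h
 proof -
  have "co A g - co A h = minv A ** (g - h) ** A" by (simp add: co_def minus_mult)
  moreover have "intn (- int a + n) (minv A ** (g - h))" using ab that by (intro intn_mult) auto
  ultimately show ?thesis using intn_mult[OF _ ab(2)] by simp
 qed
 thus ?thesis by blast
qed

definition cj :: "'f^2^2 => ('f^2^2 => bool) => ('f^2^2) set" where "cj A P = {g. P (co A g)}"

text \<open>Subgroups of GL_2(O) are given by predicates on matrices, so that \<open>cj\<close>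
  transports one description at the standard vertex to all vertices.\<close>

definition mgroup :: "('f^2^2 => bool) => bool" where
 "mgroup P \<longleftrightarrow> P (mat 1) \<and> (\<forall>m. P m --> GLO m \<and> P (minv m)) \<and> (\<forall>m n. P m --> P n --> P (m ** n))"

lemma subgroup_GL2I: assumes "!!g. g \<in> H ==> det g ~= 0 \<and> minv g \<in> H" "mat 1 \<in> H"
 "!!g h. g \<in> H ==> h \<in> H ==> g ** h \<in> H" shows "subgroup H GL2"
proof (rule subgroup.intro)
 fix x assume x: "x \<in> H"
 thus "inv\<^bsub>GL2\<^esub> x \<in> H" using assms(1)[OF x] by (simp add: GL2_inv GL2_carrier)
qed (use assms in "auto simp: GL2_carrier")

lemma subgroup_GL2D: assumes "subgroup H GL2"
 shows "g \<in> H ==> det g ~= 0" "g \<in> H ==> minv g \<in> H" "mat 1 \<in> H" "g \<in> H ==> h \<in> H ==> g ** h \<in> H"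
  "g \<in> H ==> mpow g n \<in> H"
proof -
 show d: "g \<in> H ==> det g ~= 0" for g using subgroup.subset[OF assms] by (auto simp: GL2_carrier)
 show "g \<in> H ==> minv g \<in> H"
  using subgroup.m_inv_closed[OF assms, of g] d[of g] GL2_inv[of g] by (simp add: GL2_carrier)
 show 1: "mat 1 \<in> H" using subgroup.one_closed[OF assms] by simp
 show m: "g \<in> H ==> h \<in> H ==> g ** h \<in> H" for g h using subgroup.m_closed[OF assms, of g h] by simp
 show "g \<in> H ==> mpow g n \<in> H" by (induction n) (simp_all add: 1 m)
qed

lemma cj_subgroup: assumes "mgroup P" "det A ~= 0" shows "subgroup (cj A P) GL2"
proof (rule subgroup_GL2I)
 fix g assume g: "g \<in> cj A P"
 hence "GLO (co A g)" using assms by (auto simp: cj_def mgroup_def)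
 hence d: "det g ~= 0" using assms(2) GLO_det det_co by metis
 thus "det g ~= 0 \<and> minv g \<in> cj A P" using assms g by (auto simp: cj_def mgroup_def co_minv)
qed (use assms in "auto simp: cj_def mgroup_def co_mult co_1")

lemma cj_compact:
 assumes "!!m. P m ==> int2 m" "det A ~= 0" "!!m. (!!n. \<exists>m'. P m' \<and> intn (int n) (m' - m)) ==> P m"
 shows "compactin MT (cj A P)"
proof -
 obtain a b where ab: "intn (- int a) A" "intn (- int b) (minv A)" using intn_exists by meson
 show ?thesis
 proof (rule compactin_MT[of _ "a + b"])
  fix g assume "g \<in> cj A P"
  hence "int2 (co A g)" using assms(1) by (simp add: cj_def)
  hence "intn (- int a) (A ** co A g)"
   using ab(1) intn_mult[of "- int a" A 0 "co A g" "- int a"] by (simp add: intn_0)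
  hence "intn (- int (a + b)) (A ** co A g ** minv A)"
   using ab(2) intn_mult[of "- int a" "A ** co A g" "- int b" "minv A" "- int (a + b)"] by simp
  thus "intn (- int (a + b)) g" by (simp add: co_inverse assms)
 next
  fix L assume L: "!!n. \<exists>B\<in>cj A P. intn (int n) (B - L)"
  obtain N where N: "!!n g h. intn n (g - h) ==> intn (n - int N) (co A g - co A h)"
   using co_near[OF assms(2)] by blast
  have "\<exists>m'. P m' \<and> intn (int n) (m' - co A L)" for n
  proof -
   obtain B where B: "B \<in> cj A P" "intn (int (n + N)) (B - L)" using L by blast
   thus ?thesis using N[OF B(2)] by (intro exI[of _ "co A B"]) (auto simp: cj_def)
  qed
  thus "L \<in> cj A P" using assms(3) by (simp add: cj_def)
 qed
qed

lemma cj_open: assumes "!!m m'. P m ==> intn n (m' - m) ==> P m'" "det A ~= 0"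
 shows "openin MT (cj A P)"
proof -
 obtain N where N: "!!n g h. intn n (g - h) ==> intn (n - int N) (co A g - co A h)"
  using co_near[OF assms(2)] by blast
 show ?thesis unfolding openin_MT
 proof
  fix g assume g: "g \<in> cj A P"
  have "mball g (n + int N) \<subseteq> cj A P"
  proof
   fix h assume "h \<in> mball g (n + int N)"
   hence "intn n (co A h - co A g)" using N[of "n + int N" h g] by (simp add: mball_def)
   thus "h \<in> cj A P" using assms(1) g by (simp add: cj_def)
  qed
  thus "\<exists>n. mball g n \<subseteq> cj A P" by blast
 qed
qed

section \<open>The maximal compact subgroup fixing a vertex\<close>

lemma mgroup_GLO: "mgroup GLO"
 by (simp add: mgroup_def GLO_1 GLO_minv GLO_mult)

lemma GLO_near: assumes "intn 1 (m' - m)" "GLO m'" shows "GLO m"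
proof -
 have "int2 m" using assms intn_mono[of 1 "m' - m" 0] by (intro int2_cong[of m m']) (auto simp: GLO_def intn_diff_swap)
 moreover from this have "det m' - det m \<in> Fi 1" using assms by (intro det_cong) (auto simp: GLO_def)
 ultimately show ?thesis using assms vu_cong[of "det m'" "det m"] by (simp add: GLO_def)
qed

text \<open>The sets \<open>W n\<close> of matrices with bounded entries are open and exhaust the
  space.\<close>

lemma compact_bounded: assumes "compactin MT S" shows "\<exists>N. \<forall>g\<in>S. intn (- int N) g"
proof -
 define W where "W n = {B. intn (- int n) B}" for n
 have "openin MT (W n)" for n unfolding openin_MT
 proof
  fix A assume A: "A \<in> W n"
  have "mball A 0 \<subseteq> W n"
  proof
   fix B assume "B \<in> mball A 0"
   hence "intn (- int n) (B - A)" by (auto simp: mball_def intro: intn_mono)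
   thus "B \<in> W n" using intn_add[of _ "B - A" A] A by (auto simp: W_def)
  qed
  thus "\<exists>n'. mball A n' \<subseteq> W n" by blast
 qed
 moreover have "S \<subseteq> \<Union>(range W)" using intn_exists by (auto simp: W_def)
 ultimately obtain \<F> where F: "finite \<F>" "\<F> \<subseteq> range W" "S \<subseteq> \<Union>\<F>"
  using assms unfolding compactin_def by (metis rangeE)
 then obtain I where I: "finite I" "\<F> = W ` I" by (metis finite_subset_image)
 have "intn (- int (Max I)) g" if "g \<in> S" for g
 proof -
  have "g \<in> \<Union>(W ` I)" using that F(3) I(2) by blast
  then obtain n where "n \<in> I" "intn (- int n) g" by (auto simp: W_def)
  thus ?thesis using I by (auto intro: intn_mono)
 qed
 thus ?thesis by blast
qed

lemma det_Fi: "intn n m ==> det m \<in> Fi (n + n)"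
 unfolding det_2 intn_def by (intro Fi_diff) (auto intro: Fi_mult)

text \<open>In a frame, the stabiliser of a vertex consists of scalars times GL_2(O). In a compact
  group the powers of an element stay bounded, so determinants have valuation 0, and this forces the
  scalar to be a unit.\<close>

lemma compact_fixing: assumes "det A ~= 0" "subgroup K GL2" "compactin MT K" "!!g. g \<in> K ==> actv g (vx A) = vx A"
 shows "K \<subseteq> cj A GLO"
proof
 fix g assume g: "g \<in> K"
 obtain N where N: "!!g. g \<in> K ==> intn (- int N) g" using compact_bounded[OF assms(3)] by blast
 note K = subgroup_GL2D[OF assms(2)]
 have ge: "v (det h) >= 0" if "h \<in> K" for h
 proof (rule ccontr)
  assume neg: "\<not> v (det h) >= 0"
  \<comment> \<open>Entries of valuation at least \<open>- int N\<close> give a determinant of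
    valuation at least \<open>- int (2 * N)\<close>; with exponent \<open>Suc (2 * N)\<close> a
    negative \<open>v (det h)\<close> would fall below that bound.\<close>
  have "mpow h (Suc (2 * N)) \<in> K" using K that by blast
  hence "det (mpow h (Suc (2 * N))) \<in> Fi (- int N + - int N)" using N det_Fi by blast
  hence "int (Suc (2 * N)) * v (det h) >= - int (2 * N)"
   using K(1)[OF that] v_power[of "det h" "Suc (2 * N)"] unfolding det_mpow by (simp add: frac_ideal_def)
  moreover have "int (Suc (2 * N)) * v (det h) <= int (Suc (2 * N)) * (-1)"
   using neg by (intro mult_left_mono) auto
  ultimately show False by simp
 qed
 have "v (det (minv g)) >= 0" using ge K g by blast
 hence v0: "v (det g) = 0" using ge[OF g] K(1)[OF g] by (simp add: det_minv v_inverse)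
 obtain c k where ck: "c ~= 0" "GLO k" "co A g = sc c ** k" using co_vx[OF assms(1) K(1)[OF g]] assms(4)[OF g] by blast
 hence "det g = c * c * det k" using det_co[OF assms(1), of g] by (simp add: det_mult2 det_sc)
 hence "v c = 0" using v0 ck by (simp add: v_mult GLO_def vu_def)
 hence "GLO (sc c)" using ck by (simp add: GLO_def int2_def det_sc vu_def v_mult Fi_iff)
 thus "g \<in> cj A GLO" using ck by (simp add: cj_def GLO_mult)
qed

text \<open>Maximality is \<open>compact_fixing\<close>; the candidate itself is bounded and closed
  in the frame, hence compact.\<close>

lemma K_group_eq: assumes "det A ~= 0" shows "K_group v (vx A) = cj A GLO"
 unfolding K_group_def
proof (rule Greatest_equality)
 have "\<exists>c k. c ~= 0 \<and> GLO k \<and> co A g = sc c ** k" if "GLO (co A g)" for g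
  using that by (intro exI[of _ 1] exI[of _ "co A g"]) simp
 hence "\<forall>g\<in>cj A GLO. actv g (vx A) = vx A"
  using co_vx[OF assms] subgroup_GL2D(1)[OF cj_subgroup[OF mgroup_GLO assms]] by (auto simp: cj_def)
 moreover have "compactin MT (cj A GLO)"
 proof (rule cj_compact[OF _ assms])
  show "GLO m" if "!!n. \<exists>m'. GLO m' \<and> intn (int n) (m' - m)" for m
  proof -
   obtain m' where "GLO m'" "intn (int 1) (m' - m)" using \<open>!!n. \<exists>m'. GLO m' \<and> intn (int n) (m' - m)\<close> by blast
   thus ?thesis using GLO_near by simp
  qed
 qed (simp add: GLO_def)
 ultimately show "subgroup (cj A GLO) GL2 \<and> compactin MT (cj A GLO) \<and> (\<forall>g\<in>cj A GLO. actv g (vx A) = vx A)"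
  using cj_subgroup[OF mgroup_GLO assms] by blast
 show "K <= cj A GLO" if "subgroup K GL2 \<and> compactin MT K \<and> (\<forall>g\<in>K. actv g (vx A) = vx A)" for K
  using compact_fixing[OF assms] that by blast
qed

text \<open>The form that U_x^(e) takes in a frame of \<open>x\<close>: the principal congruence
  subgroup of level \<open>e\<close>, enlarged by the scalars congruent to 1 modulo
  \<open>\<pi>\<close>. The scalars have to be there because they lie in every U_y^(1).\<close>

definition Mp :: "nat => 'f^2^2 => bool" where
 "Mp e m \<longleftrightarrow> m$1$2 \<in> Fi (int e) \<and> m$2$1 \<in> Fi (int e) \<and> m$1$1 - m$2$2 \<in> Fi (int e) \<and> m$1$1 - 1 \<in> Fi 1"

lemma Mp_mono: "Mp e m ==> e' <= e ==> Mp e' m"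
 by (auto simp: Mp_def intro: Fi_mono)

lemma Mp_22: assumes "Mp e m" "e >= 1" shows "m$2$2 - 1 \<in> Fi 1"
proof -
 have "m$1$1 - m$2$2 \<in> Fi 1" using assms by (auto simp: Mp_def intro: Fi_mono)
 thus ?thesis using assms Fi_diff[of "m$1$1 - 1" 1 "m$1$1 - m$2$2"] by (simp add: Mp_def)
qed

lemma Mp_1_iff: "Mp 1 m \<longleftrightarrow> intn 1 (m - mat 1)"
proof
 assume m: "Mp 1 m" thus "intn 1 (m - mat 1)" using Mp_22[OF m] by (simp add: Mp_def intn_def)
next
 assume "intn 1 (m - mat 1)"
 thus "Mp 1 m" using Fi_diff[of "m$1$1 - 1" 1 "m$2$2 - 1"] by (simp add: Mp_def intn_def)
qed

lemma Mp_GLO: assumes "Mp e m" "e >= 1" shows "GLO m"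
proof -
 have "intn 1 (m - mat 1)" using Mp_mono[OF assms] Mp_1_iff by simp
 thus ?thesis using GLO_near[of "mat 1" m] by (simp add: intn_diff_swap GLO_1)
qed

text \<open>\<open>Mp e\<close> consists of the matrices \<open>s + \<pi>\<^sup>e N\<close> with \<open>s \<in> 1 + \<pi>O\<close> and \<open>N\<close> integral.\<close>

lemma Mp_alt: assumes "e >= 1" shows "Mp e m \<longleftrightarrow> (\<exists>s. s - 1 \<in> Fi 1 \<and> intn (int e) (m - sc s))"
proof
 assume "Mp e m" thus "\<exists>s. s - 1 \<in> Fi 1 \<and> intn (int e) (m - sc s)"
  by (intro exI[of _ "m$1$1"]) (auto simp: Mp_def intn_def Fi_diff_swap)
next
 assume "\<exists>s. s - 1 \<in> Fi 1 \<and> intn (int e) (m - sc s)"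
 then obtain s where s: "s - 1 \<in> Fi 1" "intn (int e) (m - sc s)" by blast
 hence "m$1$1 - s \<in> Fi 1" using assms by (auto simp: intn_def intro: Fi_mono)
 hence "m$1$1 - 1 \<in> Fi 1" using Fi_add[OF _ s(1), of "m$1$1 - s"] by simp
 moreover have "m$1$1 - m$2$2 \<in> Fi (int e)" using s Fi_diff[of "m$1$1 - s" "int e" "m$2$2 - s"] by (simp add: intn_def)
 ultimately show "Mp e m" using s by (simp add: Mp_def intn_def)
qed

lemma mgroup_Mp: assumes "e >= 1" shows "mgroup (Mp e)"
 unfolding mgroup_def
proof (intro conjI allI impI)
 show "Mp e (mat 1)" by (simp add: Mp_def)
 show "GLO m" if "Mp e m" for m using Mp_GLO assms that by blast
 show "Mp e (m ** n)" if mn: "Mp e m" "Mp e n" for m n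
 proof -
  obtain s t where s: "s - 1 \<in> Fi 1" "intn (int e) (m - sc s)" "t - 1 \<in> Fi 1" "intn (int e) (n - sc t)"
   using mn Mp_alt[OF assms] by meson
  have "vu s" using s one_plus_Fi_vu by blast
  hence "intn (int e) (m ** n - sc s ** sc t)"
   using s Mp_GLO[OF mn(2) assms] by (intro intn_cong_mult) (auto simp: GLO_def int2_def vu_Fi)
  moreover have "s * t - 1 \<in> Fi 1"
   using Fi_add[OF Fi_mult0(1)[OF vu_Fi[OF \<open>vu s\<close>] s(3)] s(1)] by (simp add: algebra_simps)
  moreover have "sc s ** sc t = sc (s * t)" by (simp add: eq2)
  ultimately show ?thesis unfolding Mp_alt[OF assms] by auto
 qed
 show "Mp e (minv m)" if m: "Mp e m" for m
 proof -
  have d: "vu (det m)" using Mp_GLO[OF m assms] by (simp add: GLO_def)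
  have i: "intn 1 (m - mat 1)" using Mp_mono[OF m assms] Mp_1_iff by simp
  have "det m - 1 \<in> Fi 1" using det_cong[OF i] Mp_GLO[OF m assms] by (simp add: GLO_def)
  hence "m$2$2 - det m \<in> Fi 1" using Fi_diff[OF Mp_22[OF m assms], of "det m - 1"] by simp
  moreover have "minv m $ 1 $ 1 - 1 = (m$2$2 - det m) / det m" using d by (simp add: minv_def field_simps vu_nz)
  moreover have "minv m $ 1 $ 1 - minv m $ 2 $ 2 = (m$2$2 - m$1$1) / det m" using d by (simp add: minv_def field_simps vu_nz)
  ultimately show ?thesis using m d unfolding Mp_def by (simp add: divide_vu_Fi Fi_diff_swap) (simp add: minv_def divide_vu_Fi)
 qed
qed

text \<open>Scalars are central and congruences are preserved by integral conjugation. Hence the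
  group at a vertex does not depend on the frame (\<open>cj_Mp_indep\<close>).\<close>

lemma Mp_conj: assumes "Mp e m" "e >= 1" "GLO k" shows "Mp e (minv k ** m ** k)"
proof -
 obtain s where s: "s - 1 \<in> Fi 1" "intn (int e) (m - sc s)" using assms Mp_alt by blast
 have ik: "int2 k" "int2 (minv k)" using assms(3) GLO_minv by (auto simp: GLO_def)
 have "minv k ** m ** k - sc s = minv k ** (m - sc s) ** k"
 proof -
  have "minv k ** sc s ** k = sc s" by (simp only: sc_pull(1)[of "minv k"] minv_cancel[OF GLO_det[OF assms(3)]])
  thus ?thesis by (simp add: minus_mult)
 qed
 moreover have "intn (int e) (minv k ** (m - sc s))" using s ik by (intro intn_mult[of 0]) (auto simp: intn_0)
 hence "intn (int e) (minv k ** (m - sc s) ** k)" using ik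
  intn_mult[of "int e" "minv k ** (m - sc s)" 0 k "int e"] by (simp add: intn_0)
 ultimately show ?thesis using s assms(2) Mp_alt by auto
qed

lemma cj_Mp_indep: assumes "det A ~= 0" "det B ~= 0" "vx A = vx B" "e >= 1" shows "cj A (Mp e) = cj B (Mp e)"
proof -
 have *: "cj A (Mp e) \<subseteq> cj B (Mp e)" if AB: "det A ~= 0" "det B ~= 0" "vx A = vx B" for A B
 proof
  fix g assume g: "g \<in> cj A (Mp e)"
  obtain c k where ck: "c ~= 0" "GLO k" "B = sc c ** A ** k" using vx_eq AB by blast
  have sA: "det (sc c ** A) ~= 0" using ck AB by (simp add: det_mult2 det_sc)
  have "co (sc c ** A) g = co A g"
  proof -
   have "co (sc c) g = g" using ck(1) by (simp add: co_def minv_sc eq2)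
   thus ?thesis using co_co[of "sc c" A g] ck AB by (simp add: det_sc)
  qed
  hence "co B g = minv k ** co A g ** k"
   unfolding ck(3) using co_co[OF sA GLO_det[OF ck(2)], of g] by (simp add: co_def)
  thus "g \<in> cj B (Mp e)" using g Mp_conj assms(4) ck(2) by (simp add: cj_def)
 qed
 show ?thesis using *[of A B] *[of B A] assms by auto
qed

lemma Mp_near: assumes "e >= 1" "Mp e m" "intn (int e) (m' - m)" shows "Mp e m'"
proof -
 obtain s where "s - 1 \<in> Fi 1" "intn (int e) (m - sc s)" using assms Mp_alt by blast
 thus ?thesis using assms Mp_alt intn_trans by blast
qed

lemma inv_subgroup_GL2: assumes "subgroup N GL2" "x \<in> N" shows "inv\<^bsub>GL2\<lparr>carrier := N\<rparr>\<^esub> x = minv x"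
 using group.m_inv_consistent[OF GL2_group assms] GL2_inv[of x] subgroup.mem_carrier[OF assms] by simp

lemma pow_subgroup_GL2: "x [^]\<^bsub>GL2\<lparr>carrier := N\<rparr>\<^esub> n = mpow x n" for n :: nat
 by (induction n) (simp_all add: nat_pow_def)

lemma normal_GL2I: assumes "subgroup N GL2" "subgroup H GL2" "H \<subseteq> N"
 "!!x h. x \<in> N ==> h \<in> H ==> x ** h ** minv x \<in> H" shows "H \<lhd> GL2\<lparr>carrier := N\<rparr>"
proof -
 interpret N: group "GL2\<lparr>carrier := N\<rparr>" using group.subgroup_imp_group[OF GL2_group assms(1)] .
 have "subgroup H (GL2\<lparr>carrier := N\<rparr>)"
  using group.subgroup_incl[OF GL2_group assms(2,1,3)] .
 thus ?thesis unfolding N.normal_inv_iff using assms(4) inv_subgroup_GL2[OF assms(1)] by simp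
qed

lemma normal_GL2D: assumes "subgroup N GL2" "H \<lhd> GL2\<lparr>carrier := N\<rparr>" "x \<in> N" "h \<in> H" shows "x ** h ** minv x \<in> H"
proof -
 interpret N: group "GL2\<lparr>carrier := N\<rparr>" using group.subgroup_imp_group[OF GL2_group assms(1)] .
 show ?thesis using assms(2,3,4) unfolding N.normal_inv_iff using inv_subgroup_GL2[OF assms(1)] by auto
qed

text \<open>An open subgroup \<open>H\<close> contains all elements close enough to 1. So the
  quotient is finite, a coset being determined by a residue, and by
  \<open>p_power_tends_to_1\<close> each of its elements is killed by a power of \<open>p\<close>;
  \<open>prime_power_order\<close> concludes.\<close>

lemma Mp1_pro_p: assumes A: "det A ~= 0" shows "pro_p_subgroup v p (cj A (Mp 1))"
 unfolding pro_p_subgroup_def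
proof (intro conjI allI impI)
 let ?N = "cj A (Mp 1)"
 show sN: "subgroup ?N GL2" by (rule cj_subgroup[OF mgroup_Mp A]) simp
 show "compactin MT ?N"
 proof (rule cj_compact)
  show "int2 m" if "Mp 1 m" for m using Mp_GLO[OF that] by (simp add: GLO_def)
  show "Mp 1 m" if "!!n. \<exists>m'. Mp 1 m' \<and> intn (int n) (m' - m)" for m
  proof -
   obtain m' where "Mp 1 m'" "intn (int 1) (m' - m)" using \<open>!!n. \<exists>m'. Mp 1 m' \<and> intn (int n) (m' - m)\<close> by blast
   thus ?thesis using Mp_near[of 1 m' m] by (simp add: intn_diff_swap)
  qed
 qed (rule A)
 fix H assume H: "H \<lhd> GL2\<lparr>carrier := ?N\<rparr> \<and> openin (subtopology MT ?N) H"
 interpret N: group "GL2\<lparr>carrier := ?N\<rparr>" using group.subgroup_imp_group[OF GL2_group sN] .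
 interpret H: normal H "GL2\<lparr>carrier := ?N\<rparr>" using H by blast
 interpret Q: group "GL2\<lparr>carrier := ?N\<rparr> Mod H" by (rule H.factorgroup_is_group)
 obtain T where T: "openin MT T" "H = T \<inter> ?N" using H unfolding openin_subtopology by blast
 have "mat 1 \<in> H" using H.one_closed by simp
 then obtain n0 where n0: "mball (mat 1) n0 \<subseteq> T" using T openin_MT by blast
 obtain N where N: "!!n g h. intn n (g - h) ==> intn (n - int N) (co (minv A) g - co (minv A) h)"
  using co_near[OF det_minv_nz[OF A]] by blast
 \<comment> \<open>\<open>N\<close> makes up for the precision lost when conjugating back from the
   frame.\<close>
 define n1 where "n1 = nat (n0 + int N) + 1"
 have near: "g \<in> H" if g: "g \<in> ?N" "intn (int n1) (co A g - mat 1)" for g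
 proof -
  have "co (minv A) (co A g) = g" "co (minv A) (mat 1) = mat 1"
   using co_co[OF A det_minv_nz[OF A], of g] A by (simp_all add: minv co_1 det_minv_nz) (simp add: co_def minv_unique[of "mat 1" "mat 1", symmetric])
  hence "intn (int n1 - int N) (g - mat 1)" using N[OF g(2)] by simp
  hence "g \<in> mball (mat 1) n0" unfolding mball_def by (auto simp: n1_def intro: intn_mono)
  thus ?thesis using n0 T g by blast
 qed
 obtain R where R: "finite R" "!!B. intn 0 B ==> \<exists>C\<in>R. intn (int n1) (B - C)"
  using finite_reps_matrix[of 0 n1] by auto
 let ?Q = "rcosets\<^bsub>GL2\<lparr>carrier := ?N\<rparr>\<^esub> H"
 have "\<forall>C\<in>?Q. \<exists>r\<in>R. \<exists>g\<in>?N. C = H #>\<^bsub>GL2\<lparr>carrier := ?N\<rparr>\<^esub> g \<and> intn (int n1) (co A g - r)"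
 proof
  fix C assume "C \<in> ?Q"
  then obtain g where g: "g \<in> ?N" "C = H #>\<^bsub>GL2\<lparr>carrier := ?N\<rparr>\<^esub> g" by (auto simp: RCOSETS_def)
  hence "intn 0 (co A g)" using Mp_GLO[of 1 "co A g"] by (simp add: cj_def GLO_def intn_0)
  thus "\<exists>r\<in>R. \<exists>g\<in>?N. C = H #>\<^bsub>GL2\<lparr>carrier := ?N\<rparr>\<^esub> g \<and> intn (int n1) (co A g - r)"
   using R(2) g by blast
 qed
 then obtain r where r: "\<forall>C\<in>?Q. r C \<in> R \<and> (\<exists>g\<in>?N. C = H #>\<^bsub>GL2\<lparr>carrier := ?N\<rparr>\<^esub> g \<and> intn (int n1) (co A g - r C))"
  by metis
 \<comment> \<open>Two elements with the same residue at level \<open>n1\<close> have a quotient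
   close to 1, which therefore lies in \<open>H\<close>.\<close>
 have "inj_on r ?Q"
 proof (rule inj_onI)
  fix C C' assume C: "C \<in> ?Q" "C' \<in> ?Q" "r C = r C'"
  obtain g where g: "g \<in> ?N" "C = H #>\<^bsub>GL2\<lparr>carrier := ?N\<rparr>\<^esub> g" "intn (int n1) (co A g - r C)" using r C by blast
  obtain h where h: "h \<in> ?N" "C' = H #>\<^bsub>GL2\<lparr>carrier := ?N\<rparr>\<^esub> h" "intn (int n1) (co A h - r C)" using r C by metis
  have gh: "intn (int n1) (co A g - co A h)" using g h intn_trans intn_diff_swap by blast
  have dh: "det h ~= 0" "minv h \<in> ?N" using subgroup_GL2D[OF sN] h by blast+
  have "g ** minv h \<in> H"
  proof (rule near)
   show "g ** minv h \<in> ?N" using subgroup_GL2D(4)[OF sN] g(1) dh(2) by blast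
   have "int2 (co A (minv h))" using dh(2) Mp_GLO[of 1] by (simp add: cj_def GLO_def)
   moreover have "co A (g ** minv h) - mat 1 = (co A g - co A h) ** co A (minv h)"
    using dh A by (simp add: minus_mult co_1 minv flip: co_mult)
   ultimately show "intn (int n1) (co A (g ** minv h) - mat 1)"
    using gh intn_mult[of "int n1" _ 0] by (simp add: intn_0)
  qed
  moreover have "g = (g ** minv h) ** h" using dh(1) by (simp add: minv_cancel)
  ultimately have "g \<in> H #>\<^bsub>GL2\<lparr>carrier := ?N\<rparr>\<^esub> h" by (auto simp: r_coset_def)
  thus "C = C'" using N.repr_independence[of g H h] H.is_subgroup h g by simp
 qed
 hence finQ: "finite ?Q" using r R(1) by (meson finite_imageD finite_subset image_subsetI)
 have "\<exists>k. C [^]\<^bsub>GL2\<lparr>carrier := ?N\<rparr> Mod H\<^esub> (p ^ k) = \<one>\<^bsub>GL2\<lparr>carrier := ?N\<rparr> Mod H\<^esub>"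
  if C: "C \<in> carrier (GL2\<lparr>carrier := ?N\<rparr> Mod H)" for C
 proof -
  obtain g where g: "g \<in> ?N" "C = H #>\<^bsub>GL2\<lparr>carrier := ?N\<rparr>\<^esub> g" using C by (auto simp: FactGroup_def RCOSETS_def)
  interpret h: group_hom "GL2\<lparr>carrier := ?N\<rparr>" "GL2\<lparr>carrier := ?N\<rparr> Mod H" "\<lambda>a. H #>\<^bsub>GL2\<lparr>carrier := ?N\<rparr>\<^esub> a"
   by (unfold_locales) (rule H.r_coset_hom_Mod)
  have "intn 1 (co A g - mat 1)" using g Mp_1_iff by (simp add: cj_def)
  hence "intn (int n1) (co A (mpow g (p ^ n1)) - mat 1)"
   using p_power_tends_to_1[of "co A g" n1] A by (auto simp: co_mpow intro: intn_mono)
  hence "mpow g (p ^ n1) \<in> H" using near subgroup_GL2D(5)[OF sN g(1)] by blast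
  hence "H #>\<^bsub>GL2\<lparr>carrier := ?N\<rparr>\<^esub> (mpow g (p ^ n1)) = H"
   using N.coset_join2[of "mpow g (p ^ n1)" H] H.is_subgroup subgroup_GL2D(5)[OF sN g(1)] by simp
  hence "C [^]\<^bsub>GL2\<lparr>carrier := ?N\<rparr> Mod H\<^esub> (p ^ n1) = H"
   using h.hom_nat_pow[of g "p ^ n1"] g by (simp add: pow_subgroup_GL2)
  thus ?thesis by (intro exI[of _ n1]) (simp add: FactGroup_def)
 qed
 hence "\<exists>k. order (GL2\<lparr>carrier := ?N\<rparr> Mod H) = p ^ k"
  using finQ by (intro Q.prime_power_order p_prime) (auto simp: FactGroup_def)
 thus "\<exists>k. card ?Q = p ^ k" by (simp add: order_def FactGroup_def)
qed

text \<open>Elements of a normal pro-\<open>p\<close> subgroup of \<open>GL\<^sub>2(O)\<close> have trace congruent to \<open>2\<close>; applying this to the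
 product of \<open>m\<close> and a conjugate of \<open>m\<close> kills the entries of \<open>m - 1\<close> one by one.\<close>

lemma normal_trace_2: assumes tr: "!!m. m \<in> N ==> m$1$1 + m$2$2 - 2 \<in> Fi 1 \<and> det (m - mat 1) \<in> Fi 1 \<and> GLO m"
 and mult: "!!m n. m \<in> N ==> n \<in> N ==> m ** n \<in> N"
 and conj: "!!k m. GLO k ==> m \<in> N ==> k ** m ** minv k \<in> N" and m: "m \<in> N"
 shows "Mp 1 m"
proof -
 define a b c e where abcd: "a = m$1$1 - 1" "b = m$1$2" "c = m$2$1" "e = m$2$2 - 1"
 have i: "a \<in> Fi 0" "b \<in> Fi 0" "c \<in> Fi 0" "e \<in> Fi 0" using tr[OF m] by (auto simp: abcd GLO_def int2_def Fi_diff)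
 have t: "a + e \<in> Fi 1" using tr[OF m] by (simp add: abcd algebra_simps)
 have d: "a * e - b * c \<in> Fi 1" using tr[OF m] by (simp add: abcd det_2 algebra_simps)
 \<comment> \<open>The expression is the trace of the product of \<open>m - mat 1\<close> and
   \<open>n - mat 1\<close>, which is tr(mn) - tr(m) - tr(n) + 2; each of the three traces is
   congruent to 2.\<close>
 have key: "(m - mat 1)$1$1 * (n - mat 1)$1$1 + (m - mat 1)$1$2 * (n - mat 1)$2$1
   + (m - mat 1)$2$1 * (n - mat 1)$1$2 + (m - mat 1)$2$2 * (n - mat 1)$2$2 \<in> Fi 1" if n: "n \<in> N" for n
 proof -
  have t: "m$1$1 + m$2$2 - 2 \<in> Fi 1" "n$1$1 + n$2$2 - 2 \<in> Fi 1" "(m ** n)$1$1 + (m ** n)$2$2 - 2 \<in> Fi 1"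
   using tr[OF m] tr[OF n] tr[OF mult[OF m n]] by blast+
  show ?thesis using Fi_diff[OF Fi_diff[OF t(3,1)] t(2)] by (simp add: algebra_simps)
 qed
 have sq: "x \<in> Fi 1" if "x * x \<in> Fi 1" for x using Fi1_prime[of x 1] that by simp
 have tsq: "a * a + 2 * (b * c) + e * e \<in> Fi 1" using key[OF m] by (simp add: abcd algebra_simps)
 \<comment> \<open>Replacing the second factor by its conjugate under the upper unipotent matrix
   changes the pairing by exactly \<open>c * c\<close>; below, the lower unipotent matrix gives
   \<open>b * b\<close>.\<close>
 have c: "c \<in> Fi 1"
 proof -
  let ?k = "mk2 1 1 0 (1::'f)"
  have k: "GLO ?k" by (simp add: GLO_def int2_def det_2)
  have mk: "minv ?k = mk2 1 (-1) 0 1" by (rule minv_unique[symmetric]) (simp add: eq2)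
  have "a * (a + c) + b * c + c * (b + e - a - c) + e * (e - c) \<in> Fi 1"
   using key[OF conj[OF k m]] unfolding mk by (simp add: abcd algebra_simps)
  from Fi_diff[OF tsq this] have "c * c \<in> Fi 1" by (simp add: algebra_simps)
  thus ?thesis by (rule sq)
 qed
 have b: "b \<in> Fi 1"
 proof -
  let ?k = "mk2 1 0 1 (1::'f)"
  have k: "GLO ?k" by (simp add: GLO_def int2_def det_2)
  have mk: "minv ?k = mk2 1 0 (-1) 1" by (rule minv_unique[symmetric]) (simp add: eq2)
  have "a * (a - b) + b * (a + c - b - e) + c * b + e * (b + e) \<in> Fi 1"
   using key[OF conj[OF k m]] unfolding mk by (simp add: abcd algebra_simps)
  from Fi_diff[OF tsq this] have "b * b \<in> Fi 1" by (simp add: algebra_simps)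
  thus ?thesis by (rule sq)
 qed
 have e1: "a * (a + e) \<in> Fi 1" "b * c \<in> Fi 1" using i t c by (auto intro: Fi_mult0)
 have "a * a = a * (a + e) - (a * e - b * c) - b * c" by (simp add: algebra_simps)
 hence a: "a \<in> Fi 1" using Fi_diff[OF Fi_diff[OF e1(1) d] e1(2)] by (rule_tac sq) (simp only:)
 hence "e \<in> Fi 1" using Fi_diff[OF t a] by simp
 thus ?thesis unfolding Mp_1_iff intn_def using a b c by (simp add: abcd)
qed

text \<open>For maximality let \<open>N\<close> be normal and pro-p. Its intersection with the
  candidate is open and normal in \<open>N\<close>, so the index is a power of \<open>p\<close>, and
  raising an element of \<open>N\<close> to that power gives something congruent to 1. The elements
  of \<open>N\<close> are thus unipotent modulo \<open>\<pi>\<close>, and normality allows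
  \<open>normal_trace_2\<close> to conclude.\<close>

lemma U1_group_eq: assumes A: "det A ~= 0" shows "U1_group v p (vx A) = cj A (Mp 1)"
 unfolding U1_group_def K_group_eq[OF A]
proof (rule Greatest_equality)
 have sK: "subgroup (cj A GLO) GL2" by (rule cj_subgroup[OF mgroup_GLO A])
 have sN: "subgroup (cj A (Mp 1)) GL2" by (rule cj_subgroup[OF mgroup_Mp A]) simp
 have "cj A (Mp 1) \<lhd> GL2\<lparr>carrier := cj A GLO\<rparr>"
 proof (rule normal_GL2I[OF sK sN])
  show "cj A (Mp 1) \<subseteq> cj A GLO" using Mp_GLO by (auto simp: cj_def)
  fix x h assume x: "x \<in> cj A GLO" and h: "h \<in> cj A (Mp 1)"
  have dx: "det x ~= 0" using subgroup_GL2D(1)[OF sK x] .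
  have "Mp 1 (minv (minv (co A x)) ** co A h ** minv (co A x))"
   using x h by (intro Mp_conj GLO_minv) (auto simp: cj_def)
  thus "x ** h ** minv x \<in> cj A (Mp 1)"
   using A dx by (simp add: cj_def co_mult co_minv minv_minv det_co)
 qed
 thus "cj A (Mp 1) \<lhd> GL2\<lparr>carrier := cj A GLO\<rparr> \<and> pro_p_subgroup v p (cj A (Mp 1))"
  using Mp1_pro_p[OF A] by blast
 fix N assume N: "N \<lhd> GL2\<lparr>carrier := cj A GLO\<rparr> \<and> pro_p_subgroup v p N"
 hence sN': "subgroup N GL2" and idx: "!!H. H \<lhd> (GL2\<lparr>carrier := N\<rparr>) ==> openin (subtopology MT N) H ==>
     (\<exists>k. card (rcosets\<^bsub>GL2\<lparr>carrier := N\<rparr>\<^esub> H) = p ^ k)"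
  unfolding pro_p_subgroup_def by blast+
 interpret K: group "GL2\<lparr>carrier := cj A GLO\<rparr>" using group.subgroup_imp_group[OF GL2_group sK] .
 have NK: "N \<subseteq> cj A GLO" using N normal_imp_subgroup subgroup.subset by fastforce
 define H where "H = N \<inter> cj A (Mp 1)"
 have sH: "subgroup H GL2"
  unfolding H_def using subgroup_GL2D[OF sN] subgroup_GL2D[OF sN'] by (intro subgroup_GL2I) auto
 have nH: "H \<lhd> GL2\<lparr>carrier := N\<rparr>"
 proof (rule normal_GL2I[OF sN' sH])
  show "H \<subseteq> N" by (simp add: H_def)
  fix x h assume x: "x \<in> N" and h: "h \<in> H"
  have "x ** h ** minv x \<in> N" using subgroup_GL2D(2,4)[OF sN'] x h by (auto simp: H_def)
  moreover have "x ** h ** minv x \<in> cj A (Mp 1)"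
   using normal_GL2D[OF sK \<open>cj A (Mp 1) \<lhd> GL2\<lparr>carrier := cj A GLO\<rparr>\<close>] x h NK by (auto simp: H_def)
  ultimately show "x ** h ** minv x \<in> H" by (simp add: H_def)
 qed
 have "openin MT (cj A (Mp 1))" 
 proof (rule cj_open[OF _ A])
  show "Mp 1 m'" if "Mp 1 m" "intn 1 (m' - m)" for m m' using Mp_near[of 1 m m'] that by simp
 qed
 hence "openin (subtopology MT N) H" unfolding H_def openin_subtopology by blast
 then obtain j where j: "card (rcosets\<^bsub>GL2\<lparr>carrier := N\<rparr>\<^esub> H) = p ^ j" using idx nH by blast
 have tr: "m$1$1 + m$2$2 - 2 \<in> Fi 1 \<and> det (m - mat 1) \<in> Fi 1 \<and> GLO m" if m: "m \<in> co A ` N" for m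
 proof -
  obtain g where g: "g \<in> N" "m = co A g" using m by blast
  have "g [^]\<^bsub>GL2\<lparr>carrier := N\<rparr>\<^esub> (p ^ j) \<in> H"
   by (rule normal.pow_index_mem[OF nH j]) (use g p_prime prime_gt_0_nat in auto)
  hence "Mp 1 (mpow m (p ^ j))" using g A
   by (simp add: pow_subgroup_GL2 H_def cj_def co_mpow)
  hence "intn 1 (mpow m (p ^ j) - mat 1)" by (simp only: Mp_1_iff)
  moreover have "GLO m" using g NK by (auto simp: cj_def)
  ultimately show ?thesis using p_power_mod_pi[of m j] by (simp add: GLO_def)
 qed
 have conj: "k ** m ** minv k \<in> co A ` N" if k: "GLO k" and m: "m \<in> co A ` N" for k m
 proof -
  obtain g where g: "g \<in> N" "m = co A g" using m by blast
  define x where "x = A ** k ** minv A"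
  have x: "co A x = k" "x \<in> cj A GLO" using co_inverse(1)[OF A] k by (simp_all add: x_def cj_def)
  have dx: "det x ~= 0" using subgroup_GL2D(1)[OF sK x(2)] .
  have "x ** g ** minv x \<in> N" using normal_GL2D[OF sK] N x(2) g(1) by blast
  moreover have "co A (x ** g ** minv x) = k ** m ** minv k" using A dx by (simp add: co_mult co_minv x g)
  ultimately show ?thesis by (metis imageI)
 qed
 have mult: "m ** n \<in> co A ` N" if m: "m \<in> co A ` N" and n: "n \<in> co A ` N" for m n
 proof -
  obtain g h where "g \<in> N" "h \<in> N" "m = co A g" "n = co A h" using m n by blast
  thus ?thesis using subgroup_GL2D(4)[OF sN', of g h] co_mult[OF A, of g h] by (auto intro: rev_image_eqI)
 qed
 show "N <= cj A (Mp 1)"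
 proof
  fix g assume "g \<in> N"
  hence "Mp 1 (co A g)" using normal_trace_2[of "co A ` N", OF tr mult conj] by blast
  thus "g \<in> cj A (Mp 1)" by (simp add: cj_def)
 qed
qed

end

section \<open>The groups \<open>U\<^sub>x\<^sup>(\<^sup>e\<^sup>)\<close>\<close>

locale tree_level = local_field v p for v :: "'f::field => int" and p :: nat +
 fixes e :: nat
 assumes e1: "e >= 1"
begin

lemma det_A_D: "det A ~= 0 ==> det (A ** D n) ~= 0"
 by (simp add: det_mult2 det_D)

lemma co_D: "co (D n) m = mk2 (m$1$1) (\<pi> ^ n * m$1$2) (m$2$1 / \<pi> ^ n) (m$2$2)"
proof -
 have "D n ** mk2 (m$1$1) (\<pi> ^ n * m$1$2) (m$2$1 / \<pi> ^ n) (m$2$2) = m ** D n"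
  by (simp add: eq2 D_def mult.commute)
 thus ?thesis unfolding co_def
  by (simp only: matrix_mul_assoc[symmetric]) (metis minv_cancel(1) det_D(2))
qed

lemma co_A_D: "det A ~= 0 ==> co (A ** D n) g =
  mk2 (co A g $1$1) (\<pi> ^ n * co A g $1$2) (co A g $2$1 / \<pi> ^ n) (co A g $2$2)"
 using co_co[of A "D n" g] co_D by (simp add: det_D)

text \<open>Going \<open>n\<close> steps along the ray relaxes the condition on the upper right
  entry by \<open>n\<close> and sharpens that on the lower left entry by \<open>n\<close>; the
  diagonal is unaffected.\<close>

lemma Mp_D: "Mp k (mk2 a (\<pi> ^ n * b) (c / \<pi> ^ n) f) \<longleftrightarrow>
  b \<in> Fi (int k - int n) \<and> c \<in> Fi (int k + int n) \<and> a - f \<in> Fi (int k) \<and> a - 1 \<in> Fi 1"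
 by (simp add: Mp_def pi_power_mult_Fi' divide_pi_power_Fi)

definition Ux :: "'f vertex => ('f^2^2) set" where "Ux x = U_group v p e {x}"

text \<open>The ball of radius \<open>e - 1\<close> consists of points on rays in the frames
  \<open>A ** k\<close>. For the harder inclusion three end points suffice: divisibility of the
  lower left entry by \<open>\<pi> ^ e\<close> in the frames with \<open>k\<close> equal to
  \<open>mat 1\<close>, \<open>Sw\<close> and \<open>Lo 1\<close> controls \<open>m$2$1\<close>,
  then \<open>m$1$2\<close>, then the difference of the diagonal entries.\<close>

lemma U1_Inter: assumes A: "det A ~= 0"
 shows "(\<Inter>y\<in>{y \<in> VV. d (vx A) y <= e - 1}. U1_group v p y) = cj A (Mp e)"
proof (intro equalityI subsetI)
 fix g assume g: "g \<in> cj A (Mp e)"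
 show "g \<in> (\<Inter>y\<in>{y \<in> VV. d (vx A) y <= e - 1}. U1_group v p y)"
 proof
  fix y assume y: "y \<in> {y \<in> VV. d (vx A) y <= e - 1}"
  then obtain A' where A': "det A' ~= 0" "vx A = vx A'" "y = vx (A' ** D (d (vx A) y))"
   using rp_iff[of "d (vx A) y" "vx A" y] vx_vertex[OF A] unfolding rp_def by auto
  have n: "d (vx A) y <= e - 1" using y by simp
  have "Mp e (co A' g)" using g cj_Mp_indep[OF A A'(1,2) e1] by (auto simp: cj_def)
  hence "Mp 1 (co (A' ** D (d (vx A) y)) g)" unfolding co_A_D[OF A'(1)] Mp_D
   using n e1 by (auto simp: Mp_def intro: Fi_mono)
  thus "g \<in> U1_group v p y" using U1_group_eq[OF det_A_D[OF A'(1)]] by (subst A'(3)) (simp add: cj_def)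
 qed
next
 fix g assume g: "g \<in> (\<Inter>y\<in>{y \<in> VV. d (vx A) y <= e - 1}. U1_group v p y)"
 have *: "Mp 1 (co (A ** k ** D (e - 1)) g)" if k: "GLO k" for k
 proof -
  have Ak: "det (A ** k) ~= 0" using A k by (simp add: det_mult2 GLO_det)
  have "d (vx A) (vx (A ** k ** D (e - 1))) = e - 1"
   using d_rp[OF rpI[OF Ak]] vx_right[OF k A] by simp
  hence "g \<in> U1_group v p (vx (A ** k ** D (e - 1)))" using g vx_vertex[OF det_A_D[OF Ak]] by auto
  thus ?thesis using U1_group_eq[OF det_A_D[OF Ak]] by (simp add: cj_def)
 qed
 define m where "m = co A g"
 have **: "co (A ** k) g $2$1 \<in> Fi (int e) \<and> co (A ** k) g $ 1 $ 1 - 1 \<in> Fi 1" if k: "GLO k" for k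
  using *[OF k] e1 unfolding co_A_D[of "A ** k", unfolded det_mult2, OF no_zero_divisors[OF A GLO_det[OF k]]] Mp_D
  by (simp add: of_nat_diff)
 have 1: "m$2$1 \<in> Fi (int e)" "m$1$1 - 1 \<in> Fi 1" using **[OF GLO_1] by (simp_all add: m_def)
 have c: "co (A ** k) g = minv k ** m ** k" if "GLO k" for k
  using co_co[OF A GLO_det[OF that], of g] by (simp add: co_def[of k] m_def)
 have "minv Sw = Sw" by (rule minv_unique[symmetric]) (simp add: Sw_def eq2)
 hence 2: "m$1$2 \<in> Fi (int e)" using **[OF GLO_Sw] c[OF GLO_Sw] by (simp add: Sw_def)
 have "minv (Lo 1) = Lo (-1)" by (rule minv_unique[symmetric]) (simp add: Lo_def eq2)
 hence "(m$2$1 - m$1$2) - (m$1$1 - m$2$2) \<in> Fi (int e)"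
  using **[OF GLO_Lo[OF Fi_1]] c[OF GLO_Lo[OF Fi_1]] by (simp add: Lo_def algebra_simps)
 hence "m$1$1 - m$2$2 \<in> Fi (int e)"
  using Fi_diff[OF Fi_diff[OF 1(1) 2]] by fastforce
 thus "g \<in> cj A (Mp e)" using 1 2 by (simp add: cj_def Mp_def m_def)
qed

lemma generate_subgroup_GL2: "subgroup H GL2 ==> generate GL2 H = H"
 using group.generate_subgroup_incl[OF GL2_group, of H H] generate.incl[of _ H GL2] by blast

lemma Ux_vx: "det A ~= 0 ==> Ux (vx A) = cj A (Mp e)"
 by (simp add: Ux_def U_group_def U1_Inter generate_subgroup_GL2 cj_subgroup mgroup_Mp e1 del: One_nat_def)

lemma U_group_generate: assumes "\<tau> \<subseteq> VV" shows "U_group v p e \<tau> = generate GL2 (\<Union>x\<in>\<tau>. Ux x)"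
proof -
 have "(\<Inter>y\<in>{y \<in> VV. d x y <= e - 1}. U1_group v p y) = Ux x" if x: "x \<in> \<tau>" for x
 proof -
  obtain A where "det A ~= 0" "x = vx A" using x assms by (auto simp: vertices_eq)
  thus ?thesis using U1_Inter Ux_vx by simp
 qed
 thus ?thesis by (simp add: U_group_def)
qed

lemma Ux_subgroup: "x \<in> VV ==> subgroup (Ux x) GL2"
 by (auto simp: vertices_eq Ux_vx intro!: cj_subgroup mgroup_Mp e1)

lemma Ux_carrier: "x \<in> VV ==> Ux x \<subseteq> carrier GL2"
 using subgroup.subset[OF Ux_subgroup] .

lemma US_subgroup: assumes "\<tau> \<in> SS" shows "subgroup (U_group v p e \<tau>) GL2"
proof -
 have t: "\<tau> \<subseteq> VV" using simplex_subset[OF assms] by blast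
 have "(\<Union>x\<in>\<tau>. Ux x) \<subseteq> carrier GL2" using Ux_carrier t by blast
 thus ?thesis unfolding U_group_generate[OF t] by (rule group.generate_is_subgroup[OF GL2_group])
qed

lemma Ux_US: "\<tau> \<in> SS ==> x \<in> \<tau> ==> u \<in> Ux x ==> u \<in> U_group v p e \<tau>"
 using U_group_generate[of \<tau>] simplex_subset by (auto intro: generate.incl)

lemma US_induct: assumes \<tau>: "\<tau> \<in> SS" and S: "subgroup S GL2" "!!x. x \<in> \<tau> ==> Ux x \<subseteq> S"
 shows "U_group v p e \<tau> \<subseteq> S"
proof -
 have "\<tau> \<subseteq> VV" using simplex_subset[OF \<tau>] by blast
 thus ?thesis unfolding U_group_generate[OF \<open>\<tau> \<subseteq> VV\<close>]
  using group.generate_subgroup_incl[OF GL2_group _ S(1)] S(2) by blast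
qed

text \<open>The radius is \<open>e\<close>, although the group is cut out by conditions on the ball
  of radius \<open>e - 1\<close>: passing to the frame of a vertex at distance at most
  \<open>e\<close> divides the lower left entry by at most \<open>\<pi> ^ e\<close>, which keeps it
  integral.\<close>

lemma Ux_fix: assumes "x \<in> VV" "u \<in> Ux x" "y \<in> VV" "d x y <= e" shows "actv u y = y"
proof -
 obtain A where A: "det A ~= 0" "x = vx A" "y = vx (A ** D (d x y))"
  using rp_iff[of "d x y" x y] assms unfolding rp_def by auto
 have m: "Mp e (co A u)" using assms A Ux_vx by (simp add: cj_def)
 have g: "GLO (co A u)" by (rule Mp_GLO[OF m e1])
 have du: "det u ~= 0" using subgroup_GL2D(1)[OF Ux_subgroup[OF assms(1)] assms(2)] .
 have "int2 (co (A ** D (d x y)) u)" using m g assms(4) unfolding co_A_D[OF A(1)]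
  by (auto simp: int2_def GLO_def Mp_def pi_power_mult_Fi' divide_pi_power_Fi intro: Fi_mono)
 moreover have "det (co (A ** D (d x y)) u) = det (co A u)" using A det_A_D by (simp add: det_co)
 ultimately have "GLO (co (A ** D (d x y)) u)" using g by (simp add: GLO_def)
 hence "actv u (vx (A ** D (d x y))) = vx (A ** D (d x y))"
  using co_vx[OF det_A_D[OF A(1)] du] by (metis matrix_mul_lid zero_neq_one)
 thus ?thesis using A(3) by simp
qed

text \<open>Converse of \<open>Ux_fix\<close> up to the centre, which acts trivially on the tree.
  The three test frames are those of \<open>U1_Inter\<close>, with end points now at distance
  \<open>e\<close>.\<close>

lemma fix_ball: assumes "x \<in> VV" "det g ~= 0" "!!y. y \<in> VV ==> d x y <= e ==> actv g y = y"
 shows "\<exists>c u. c ~= 0 \<and> u \<in> Ux x \<and> g = sc c ** u"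
proof -
 obtain A where A: "det A ~= 0" "x = vx A" using assms(1) by (auto simp: vertices_eq)
 obtain c m where cm: "c ~= 0" "GLO m" "co A g = sc c ** m"
  using co_vx[OF A(1) assms(2)] assms(3)[of x] assms(1) A(2) by auto
 have co_k: "co (A ** k) g = sc c ** (minv k ** m ** k)" if "GLO k" for k
  using co_co[OF A(1) GLO_det[OF that], of g] co_sc[OF GLO_det[OF that], of c m] cm(3) by (simp add: co_def[of k])
 have *: "(minv k ** m ** k) $2$1 \<in> Fi (int e)" if k: "GLO k" for k
 proof -
  define l where "l = minv k ** m ** k"
  have l: "GLO l" using k cm by (simp add: l_def GLO_mult GLO_minv)
  have Ak: "det (A ** k) ~= 0" using A k by (simp add: det_mult2 GLO_det)
  have "d x (vx (A ** k ** D e)) = e" using d_rp[OF rpI[OF Ak]] vx_right[OF k A(1)] A(2) by simp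
  hence "actv g (vx (A ** k ** D e)) = vx (A ** k ** D e)" using assms(3) vx_vertex[OF det_A_D[OF Ak]] by simp
  then obtain b h where bh: "b ~= 0" "GLO h" "co (A ** k ** D e) g = sc b ** h"
   using co_vx[OF det_A_D[OF Ak] assms(2)] by blast
  have eq: "sc b ** h = mk2 (c * l$1$1) (\<pi> ^ e * (c * l$1$2)) (c * l$2$1 / \<pi> ^ e) (c * l$2$2)"
   using bh(3) co_k[OF k] unfolding co_A_D[OF Ak] l_def[symmetric] by simp
  \<comment> \<open>Comparing determinants shows that the two scalars differ by a unit.\<close>
  have "b * b * det h = c * c * det l"
   using arg_cong[OF eq, of det] by (simp add: det_mult2 det_sc) (simp add: det_2 algebra_simps)
  from arg_cong[OF this, of v] have "v b = v c"
   using bh cm l by (simp add: v_mult GLO_def vu_def)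
  hence bc: "vu (b / c)" using bh cm by (simp add: vu_def v_divide)
  have "l$2$1 / \<pi> ^ e = (b / c) * h$2$1"
   using arg_cong[OF eq, of "\<lambda>m. m$2$1"] cm(1) by (simp add: field_simps)
  moreover have "h$2$1 \<in> Fi 0" using bh by (simp add: GLO_def int2_def)
  ultimately have "l$2$1 / \<pi> ^ e \<in> Fi 0" using vu_mult_Fi[OF bc] by simp
  thus ?thesis by (simp add: divide_pi_power_Fi l_def)
 qed
 have 1: "m$2$1 \<in> Fi (int e)" using *[OF GLO_1] by (simp add: minv_unique[of "mat 1" "mat 1", symmetric])
 have "minv Sw = Sw" by (rule minv_unique[symmetric]) (simp add: Sw_def eq2)
 hence 2: "m$1$2 \<in> Fi (int e)" using *[OF GLO_Sw] by (simp add: Sw_def)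
 have "minv (Lo 1) = Lo (-1)" by (rule minv_unique[symmetric]) (simp add: Lo_def eq2)
 hence "(m$2$1 - m$1$2) - (m$1$1 - m$2$2) \<in> Fi (int e)"
  using *[OF GLO_Lo[OF Fi_1]] by (simp add: Lo_def algebra_simps)
 hence 3: "m$1$1 - m$2$2 \<in> Fi (int e)"
  using Fi_diff[OF Fi_diff[OF 1(1) 2]] by fastforce
 have im: "m$1$1 \<in> Fi 0" "m$2$2 \<in> Fi 0" "m$1$2 \<in> Fi 0" using cm by (auto simp: GLO_def int2_def)
 have "m$1$2 * m$2$1 \<in> Fi 1" using Fi_mult0(1)[OF im(3) 1] e1 by (auto intro: Fi_mono)
 hence "vu (m$1$1 * m$2$2)"
  using cm vu_cong[of "m$1$1 * m$2$2" "det m"] by (simp add: det_2 GLO_def)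
 hence a: "vu (m$1$1)" using vu_mult_iff im by blast
 \<comment> \<open>Division by the unit \<open>m$1$1\<close> moves the scalar part into the centre
   and leaves 1 in the corner.\<close>
 define n where "n = sc (inverse (m$1$1)) ** m"
 have "n$1$2 = m$1$2 / m$1$1" "n$2$1 = m$2$1 / m$1$1" "n$1$1 - n$2$2 = (m$1$1 - m$2$2) / m$1$1" "n$1$1 = 1"
  using vu_nz[OF a] by (simp_all add: n_def field_simps)
 hence "Mp e n" using 1 2 3 a by (simp add: Mp_def divide_vu_Fi)
 define u where "u = A ** n ** minv A"
 have u: "u \<in> Ux x" using A \<open>Mp e n\<close> by (simp add: u_def Ux_vx cj_def co_inverse)
 have "co A (sc (c * m$1$1) ** u) = co A g"
  using A vu_nz[OF a] by (simp add: co_sc cm u_def co_inverse n_def sc_sc mult.assoc)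
 hence "g = sc (c * m$1$1) ** u" using co_inverse(2)[OF A(1)] by metis
 thus ?thesis using u cm(1) vu_nz[OF a] by (intro exI[of _ "c * m$1$1"] exI[of _ u]) simp
qed

text \<open>An Iwahori factorisation in a frame adapted to the path from \<open>x\<close> to
  \<open>c\<close>: the lower unipotent factor of \<open>u\<close> satisfies the conditions at
  \<open>b\<close> and at \<open>x\<close>, and the remaining upper triangular factor those at
  \<open>c\<close>, where the upper right entry is less constrained.\<close>

lemma Ux_decompose: assumes "x \<in> VV" "{b, c} \<in> EE" "d x c = d x b + 1" "u \<in> Ux b"
 shows "\<exists>u1 u2. u1 \<in> Ux b \<and> u1 \<in> Ux x \<and> u2 \<in> Ux c \<and> u = u1 ** u2"
proof -
 define n where "n = d x b"
 obtain A where A: "det A ~= 0" "x = vx A" "b = vx (A ** D n)" "c = vx (A ** D (Suc n))"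
  using geodesic_pair[OF assms(1-3)] by (auto simp: n_def)
 define m where "m = co A u"
 have m: "m$1$2 \<in> Fi (int e - int n)" "m$2$1 \<in> Fi (int e + int n)" "m$1$1 - m$2$2 \<in> Fi (int e)" "m$1$1 - 1 \<in> Fi 1"
  using assms(4) unfolding A(3) Ux_vx[OF det_A_D[OF A(1)]] cj_def co_A_D[OF A(1)] Mp_D by (auto simp: m_def)
 have a: "vu (m$1$1)" using m one_plus_Fi_vu by blast
 define q where "q = m$2$1 / m$1$1"
 have q: "q \<in> Fi (int e + int n)" using m a by (simp add: q_def divide_vu_Fi)
 have mq: "minv (Lo q) = Lo (- q)" by (rule minv_unique[symmetric]) (simp add: Lo_def eq2)
 have dq: "det (Lo q) ~= 0" by (simp add: Lo_def det_2)
 define m' where "m' = Lo (- q) ** m"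
 have m': "m'$1$1 = m$1$1" "m'$1$2 = m$1$2" "m'$2$1 = 0" "m'$2$2 = m$2$2 - q * m$1$2"
  using vu_nz[OF a] by (simp_all add: m'_def Lo_def q_def)
 have qm: "q * m$1$2 \<in> Fi (int e)" using q m e1 by (auto intro: Fi_mult)
 define u1 u2 where "u1 = A ** Lo q ** minv A" and "u2 = A ** m' ** minv A"
 have c1: "co A u1 = Lo q" "co A u2 = m'" by (simp_all add: u1_def u2_def co_inverse A)
 have "u1 \<in> Ux b" "u1 \<in> Ux x" unfolding A(2,3) Ux_vx[OF det_A_D[OF A(1)]] Ux_vx[OF A(1)] cj_def co_A_D[OF A(1)] mem_Collect_eq Mp_D c1
  using q by (auto simp: Lo_def Mp_def intro: Fi_mono)
 moreover have "u2 \<in> Ux c" unfolding A(4) Ux_vx[OF det_A_D[OF A(1)]] cj_def co_A_D[OF A(1)] mem_Collect_eq Mp_D c1 m'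
  using m Fi_add[OF m(3) qm] by (auto simp: algebra_simps intro: Fi_mono)
 moreover have "u = u1 ** u2"
 proof -
  have "co A (u1 ** u2) = m" unfolding co_mult[OF A(1)] c1 m'_def mq[symmetric] by (rule minv_cancel(2)[OF dq])
  thus ?thesis unfolding m_def using co_inverse(2)[OF A(1)] by metis
 qed
 ultimately show ?thesis by blast
qed

text \<open>After division by a scalar, \<open>u\<close> is congruent to 1 at level
  \<open>e\<close>, so its p-th power is so at level \<open>e + 1\<close> by
  \<open>p_power_step\<close>; level \<open>e + 1\<close> at \<open>a\<close> implies level
  \<open>e\<close> at the neighbour \<open>b\<close>.\<close>

lemma Ux_p_power: assumes "{a, b} \<in> EE" "u \<in> Ux a" shows "mpow u p \<in> Ux b"
proof -
 obtain A where A: "det A ~= 0" "a = vx A" "b = vx (A ** D 1)"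
  using assms(1) by (auto simp: edge_iff rp_def)
 define m where "m = co A u"
 have m: "Mp e m" using assms(2) A by (simp add: Ux_vx cj_def m_def)
 have s: "vu (m$1$1)" "m$1$1 - 1 \<in> Fi 1" using m one_plus_Fi_vu by (auto simp: Mp_def)
 define n where "n = sc (inverse (m$1$1)) ** m"
 have mn: "m = sc (m$1$1) ** n" using vu_nz[OF s(1)] by (simp add: n_def sc_sc)
 have "n$1$2 = m$1$2 / m$1$1" "n$2$1 = m$2$1 / m$1$1" "1 - n$2$2 = (m$1$1 - m$2$2) / m$1$1" "n$1$1 = 1"
  using vu_nz[OF s(1)] by (simp_all add: n_def field_simps)
 hence "intn (int e) (n - mat 1)" using m s(1) Fi_diff_swap[of "n$2$2" 1]
  by (simp add: intn_def Mp_def divide_vu_Fi)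
 hence i: "intn (int e + 1) (mpow n p - mat 1)" by (rule p_power_step) (use e1 in simp)
 have pw: "mpow (sc c ** n) k = sc (c ^ k) ** mpow n k" for c :: 'f and k
 proof (induction k)
  case (Suc k)
  have "mpow (sc c ** n) (Suc k) = sc (c ^ k) ** (mpow n k ** (sc c ** n))"
   using Suc by (simp add: matrix_mul_assoc)
  also have "\<dots> = sc (c ^ k) ** (sc c ** (mpow n k ** n))" by (simp only: sc_pull(2)[of "mpow n k"])
  finally show ?case by (simp add: sc_sc mult.commute)
 qed simp
 define t where "t = (m$1$1) ^ p"
 have t1: "t - 1 \<in> Fi 1"
 proof -
  have "s ^ k - 1 \<in> Fi 1" if "s - 1 \<in> Fi 1" for s :: 'f and k
  proof (induction k)
   case (Suc k)
   have "s * (s ^ k - 1) \<in> Fi 1" by (rule Fi_mult0(1)[OF vu_Fi[OF one_plus_Fi_vu[OF that]] Suc])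
   thus ?case using Fi_add[OF _ that] by (fastforce simp: algebra_simps)
  qed simp
  thus ?thesis using s by (simp add: t_def)
 qed
 have "mpow m p - sc t = sc t ** (mpow n p - mat 1)"
  by (subst mn) (simp add: pw t_def minus_mult)
 moreover have "intn (int e + 1) (sc t ** (mpow n p - mat 1))"
  using i vu_Fi[OF one_plus_Fi_vu[OF t1]] intn_mult[of 0 "sc t" "int e + 1" "mpow n p - mat 1"]
  by (simp add: intn_0 int2_def)
 ultimately have "Mp (Suc e) (mpow m p)" using t1 Mp_alt[of "Suc e"] by (auto simp: add.commute)
 hence "mpow u p \<in> cj (A ** D 1) (Mp e)" unfolding cj_def mem_Collect_eq co_A_D[OF A(1)] Mp_D
  unfolding co_mpow[OF A(1)] m_def[symmetric] by (auto simp: Mp_def add.commute intro: Fi_mono)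
 thus ?thesis using A by (simp add: Ux_vx det_A_D)
qed

text \<open>A group containing that of the edge from \<open>vx A\<close> to
  \<open>vx (A ** D 1)\<close>: in each entry it imposes the weaker of the conditions at the two
  ends. For \<open>e = 1\<close> it is the pro-p Iwahori subgroup.\<close>

definition Iw :: "'f^2^2 => bool" where
 "Iw m \<longleftrightarrow> m$1$2 \<in> Fi (int e - 1) \<and> m$2$1 \<in> Fi (int e) \<and> m$1$1 - m$2$2 \<in> Fi (int e) \<and> m$1$1 - 1 \<in> Fi 1"

lemma IwD: assumes "Iw m" shows "m$1$1 - 1 \<in> Fi 1" "m$2$2 - 1 \<in> Fi 1" "m$1$1 \<in> Fi 0" "m$2$2 \<in> Fi 0"
 "m$1$2 \<in> Fi (int e - 1)" "m$2$1 \<in> Fi (int e)" "m$1$1 - m$2$2 \<in> Fi (int e)"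
 "m$1$2 \<in> Fi 0" "m$2$1 \<in> Fi 0"
proof -
 show "m$1$1 - 1 \<in> Fi 1" using assms by (simp add: Iw_def)
 have "m$1$1 - m$2$2 \<in> Fi 1" using assms e1 by (auto simp: Iw_def intro: Fi_mono)
 from Fi_diff[OF \<open>m$1$1 - 1 \<in> Fi 1\<close> this] show "m$2$2 - 1 \<in> Fi 1" by simp
 thus "m$1$1 \<in> Fi 0" "m$2$2 \<in> Fi 0" using \<open>m$1$1 - 1 \<in> Fi 1\<close> one_plus_Fi_vu vu_Fi by blast+
qed (use assms e1 in "auto simp: Iw_def intro: Fi_mono")

lemma Iw_cross: "Iw m ==> Iw n ==> m$1$2 * n$2$1 \<in> Fi (int e)"
 using IwD(6,8) Fi_mult0(1) by blast

lemma mgroup_Iw: "mgroup Iw"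
 unfolding mgroup_def
proof (intro conjI allI impI)
 show "Iw (mat 1)" by (simp add: Iw_def)
 show "Iw (m ** n)" if mn: "Iw m" "Iw n" for m n
 proof -
  note M = IwD[OF mn(1)] and N = IwD[OF mn(2)]
  have c: "m$1$2 * n$2$1 \<in> Fi (int e)" "m$2$1 * n$1$2 \<in> Fi (int e)"
   using Iw_cross[OF mn] Iw_cross[OF mn(2,1)] by (simp_all add: mult.commute)
  have c1: "m$1$2 * n$2$1 \<in> Fi 1" using c e1 by (auto intro: Fi_mono)
  have "(m$1$1 * (n$1$1 - n$2$2) + (m$1$1 - m$2$2) * n$2$2) + (m$1$2 * n$2$1 - m$2$1 * n$1$2) \<in> Fi (int e)"
   by (rule Fi_add[OF Fi_add[OF Fi_mult0(1)[OF M(3) N(7)] Fi_mult0(2)[OF M(7) N(4)]] Fi_diff[OF c]])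
  moreover have "((m$1$1 - 1) * n$1$1 + (n$1$1 - 1)) + m$1$2 * n$2$1 \<in> Fi 1"
   by (rule Fi_add[OF Fi_add[OF Fi_mult0(2)[OF M(1) N(3)] N(1)] c1])
  moreover have "m$1$1 * n$1$2 + m$1$2 * n$2$2 \<in> Fi (int e - 1)"
   by (rule Fi_add[OF Fi_mult0(1)[OF M(3) N(5)] Fi_mult0(2)[OF M(5) N(4)]])
  moreover have "m$2$1 * n$1$1 + m$2$2 * n$2$1 \<in> Fi (int e)"
   by (rule Fi_add[OF Fi_mult0(2)[OF M(6) N(3)] Fi_mult0(1)[OF M(4) N(6)]])
  ultimately show ?thesis by (simp add: Iw_def algebra_simps)
 qed
 fix m assume m: "Iw m"
 note M = IwD[OF m]
 have c1: "m$1$2 * m$2$1 \<in> Fi 1" using Iw_cross[OF m m] e1 by (auto intro: Fi_mono)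
 have "m$2$2 * (m$1$1 - 1) - m$1$2 * m$2$1 \<in> Fi 1" by (rule Fi_diff[OF Fi_mult0(1)[OF M(4,1)] c1])
 hence d: "det m - m$2$2 \<in> Fi 1" by (simp add: det_2 algebra_simps)
 hence "det m - 1 \<in> Fi 1" using Fi_add[OF d M(2)] by simp
 hence u: "vu (det m)" by (rule one_plus_Fi_vu)
 show "GLO m" using M u by (simp add: GLO_def int2_def)
 have "minv m $ 1 $ 1 - 1 = (m$2$2 - det m) / det m" using u by (simp add: minv_def field_simps vu_nz)
 moreover have "minv m $ 1 $ 1 - minv m $ 2 $ 2 = (m$2$2 - m$1$1) / det m" using u by (simp add: minv_def field_simps vu_nz)
 ultimately show "Iw (minv m)" using M u d unfolding Iw_def
  by (simp add: divide_vu_Fi Fi_diff_swap) (simp add: minv_def divide_vu_Fi)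
qed

lemma US_Iw: assumes "det A ~= 0" shows "U_group v p e {vx A, vx (A ** D 1)} \<subseteq> cj A Iw"
proof (rule US_induct)
 show "{vx A, vx (A ** D 1)} \<in> SS" using rpI[OF assms, of 1] by (simp add: edge_simplex edge_iff)
 show "subgroup (cj A Iw) GL2" by (rule cj_subgroup[OF mgroup_Iw assms])
 have "cj A (Mp e) \<subseteq> cj A Iw" by (auto simp: cj_def Mp_def Iw_def intro: Fi_mono)
 moreover have "cj (A ** D 1) (Mp e) \<subseteq> cj A Iw"
  unfolding cj_def co_A_D[OF assms] Mp_D by (auto simp: Iw_def intro: Fi_mono)
 ultimately show "Ux x \<subseteq> cj A Iw" if "x \<in> {vx A, vx (A ** D 1)}" for x
  using that assms by (auto simp: Ux_vx det_A_D)
qed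

text \<open>Compared with U_a^(e) only the upper right entry is one level short. Modulo
  \<open>\<pi> ^ e\<close> that entry is additive along powers, so at exponent \<open>p\<close> it
  is multiplied by \<open>p\<close>.\<close>

lemma US_p_power: assumes "{a, b} \<in> EE" "u \<in> U_group v p e {a, b}" shows "mpow u p \<in> Ux a"
proof -
 obtain A where A: "det A ~= 0" "a = vx A" "b = vx (A ** D 1)"
  using assms(1) by (auto simp: edge_iff rp_def)
 define m where "m = co A u"
 have m: "Iw m" using US_Iw[OF A(1)] assms(2) A by (auto simp: cj_def m_def)
 have I: "Iw (mpow m k)" for k
  using mgroup_Iw m by (induction k) (auto simp: mgroup_def)
 \<comment> \<open>Multiplying an entry of level \<open>e - 1\<close> by a unit congruent to 1 does
   not change it modulo \<open>\<pi> ^ e\<close>.\<close>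
 have P: "x * y - z \<in> Fi (int e)" if "x - 1 \<in> Fi 1" "y - z \<in> Fi (int e)" "y \<in> Fi (int e - 1)" for x y z :: 'f
 proof -
  have "(x - 1) * y \<in> Fi (int e)" using that(1,3) by (rule Fi_mult) simp
  from Fi_add[OF this that(2)] show ?thesis by (simp add: algebra_simps)
 qed
 have k12: "mpow m k $ 1 $ 2 - of_nat k * m$1$2 \<in> Fi (int e)" for k
 proof (induction k)
  case (Suc k)
  have "(mpow m k $1$1 * m$1$2 - m$1$2) + (m$2$2 * mpow m k $1$2 - of_nat k * m$1$2) \<in> Fi (int e)"
   using IwD[OF I[of k]] IwD[OF m] Suc by (intro Fi_add P) auto
  thus ?case by (simp add: algebra_simps)
 qed simp
 have "of_nat p * m$1$2 \<in> Fi (int e)" using p_Fi IwD[OF m] by (auto intro: Fi_mult)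
 hence "mpow m p $ 1 $ 2 \<in> Fi (int e)" using Fi_add[OF k12[of p]] by fastforce
 hence "Mp e (mpow m p)" using I[of p] by (simp add: Mp_def Iw_def)
 thus ?thesis using A by (simp add: Ux_vx cj_def co_mpow m_def)
qed

text \<open>Ensures that edge groups preserve the two orbits of vertices, so that no sign enters
  their action on \<open>F_hat\<close>.\<close>

lemma US_det: assumes "\<tau> \<in> SS" "u \<in> U_group v p e \<tau>" shows "v (det u) = 0"
proof -
 let ?S = "{g. vu (det g)}"
 have "subgroup ?S GL2"
  by (rule subgroup_GL2I) (auto simp: det_mult2 vu_mult vu_nz det_minv vu_inverse)
 moreover have "Ux x \<subseteq> ?S" if x: "x \<in> \<tau>" for x
 proof -
  obtain A where A: "det A ~= 0" "x = vx A" using simplex_subset[OF assms(1) x] by (auto simp: vertices_eq)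
  have "vu (det g)" if "g \<in> Ux x" for g
   using Mp_GLO[OF _ e1, of "co A g"] that A det_co[OF A(1), of g] by (simp add: Ux_vx cj_def GLO_def)
  thus ?thesis by blast
 qed
 ultimately show ?thesis using US_induct[OF assms(1)] assms(2) by (auto simp: vu_def)
qed

lemma Ux_conj: assumes "x \<in> VV" "u \<in> Ux x" "det g ~= 0" shows "g ** u ** minv g \<in> Ux (actv g x)"
proof -
 obtain A where A: "det A ~= 0" "x = vx A" using assms(1) by (auto simp: vertices_eq)
 have gA: "det (g ** A) ~= 0" using A assms by (simp add: det_mult2)
 have "co (g ** A) (g ** u ** minv g) = co A u"
  unfolding co_co[OF assms(3) A(1)] by (simp add: co_def matrix_mul_assoc minv[OF assms(3)] minv_cancel[OF assms(3)])
 thus ?thesis using assms(2) by (simp add: A act_vx Ux_vx gA cj_def)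
qed

lemma US_conj: assumes "\<tau> \<in> SS" "u \<in> U_group v p e \<tau>" "det g ~= 0"
 shows "g ** u ** minv g \<in> U_group v p e (act_simplex g \<tau>)"
proof -
 let ?S = "{u. det u ~= 0 \<and> g ** u ** minv g \<in> U_group v p e (act_simplex g \<tau>)}"
 have s: "act_simplex g \<tau> \<in> SS" by (rule simplex_act[OF assms(3,1)])
 note G = subgroup_GL2D[OF US_subgroup[OF s]]
 have "subgroup ?S GL2"
 proof (rule subgroup_GL2I)
  fix u assume u: "u \<in> ?S"
  have "minv (g ** u ** minv g) = g ** minv u ** minv g"
   using u assms(3) by (simp add: minv_mult det_mult2 det_minv_nz minv_minv matrix_mul_assoc)
  thus "det u ~= 0 \<and> minv u \<in> ?S" using u G(2)[of "g ** u ** minv g"] by (simp add: det_minv_nz)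
 next
  show "mat 1 \<in> ?S" using G(3) by (simp add: minv[OF assms(3)])
 next
  fix u w assume uw: "u \<in> ?S" "w \<in> ?S"
  have "(g ** u ** minv g) ** (g ** w ** minv g) = g ** u ** (minv g ** (g ** (w ** minv g)))"
   by (simp only: matrix_mul_assoc)
  hence "(g ** u ** minv g) ** (g ** w ** minv g) = g ** (u ** w) ** minv g"
   by (simp add: minv_cancel[OF assms(3)] matrix_mul_assoc)
  thus "u ** w \<in> ?S" using uw G(4)[of "g ** u ** minv g" "g ** w ** minv g"] by (simp add: det_mult2)
 qed
 moreover have "Ux x \<subseteq> ?S" if x: "x \<in> \<tau>" for x
 proof -
  have xV: "x \<in> VV" using simplex_subset[OF assms(1) x] .
  show ?thesis
   using Ux_US[OF s _ Ux_conj[OF xV _ assms(3)]] x subgroup_GL2D(1)[OF Ux_subgroup[OF xV]]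
   by (auto simp: act_simplex_def)
 qed
 ultimately show ?thesis using US_induct[OF assms(1)] assms(2) by blast
qed

text \<open>Transitivity on the neighbours of \<open>z\<close> is what allows the vectors of one
  edge to generate the whole module at \<open>z\<close>.\<close>

lemma K_group_props: assumes "z \<in> VV"
 shows "k \<in> K_group v z ==> det k ~= 0 \<and> actv k z = z"
  "{z, y} \<in> EE ==> {z, y'} \<in> EE ==> \<exists>k\<in>K_group v z. actv k y = y'"
proof -
 obtain A where A: "det A ~= 0" "z = vx A" using assms by (auto simp: vertices_eq)
 note K = K_group_eq[OF A(1)]
 show "det k ~= 0 \<and> actv k z = z" if k: "k \<in> K_group v z"
 proof -
  have "GLO (co A k)" using k A K by (simp add: cj_def)
  moreover from this have "det k ~= 0" using det_co[OF A(1)] GLO_det by metis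
  moreover have "\<exists>c l. c ~= 0 \<and> GLO l \<and> co A k = sc c ** l"
   using \<open>GLO (co A k)\<close> by (intro exI[of _ 1] exI[of _ "co A k"]) simp
  ultimately show ?thesis using co_vx[OF A(1)] A(2) by blast
 qed
 assume "{z, y} \<in> EE" "{z, y'} \<in> EE"
 then obtain B B' where B: "det B ~= 0" "z = vx B" "y = vx (B ** D 1)" "det B' ~= 0" "z = vx B'" "y' = vx (B' ** D 1)"
  by (auto simp: edge_iff rp_def)
 then obtain c k where ck: "c ~= 0" "GLO k" "B' = sc c ** B ** k" using vx_eq by metis
 define g where "g = B ** k ** minv B"
 have "g \<in> K_group v z" using ck(2) B(1) unfolding B(2) K_group_eq[OF B(1)] by (simp add: cj_def g_def co_inverse)
 moreover have "actv g y = y'"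
 proof -
  have "actv g y = vx (B ** k ** D 1)" using B(1) by (simp add: B(3) act_vx g_def matrix_mul_assoc minv_cancel)
  also have "\<dots> = vx (sc c ** (B ** k ** D 1))" using ck B(1) by (intro vx_sc[symmetric]) (auto simp: det_mult2 GLO_det det_D)
  finally show ?thesis using ck(3) B(6) by (simp add: matrix_mul_assoc)
 qed
 ultimately show "\<exists>k\<in>K_group v z. actv k y = y'" by blast
qed

end

section \<open>The completed group\<close>

context tree_level
begin

abbreviation LC :: "('f^2^2) set => ('f vertex => 'f vertex) set" where "LC \<equiv> local_closure v e"
abbreviation GG :: "('f vertex => 'f vertex) set" where "GG \<equiv> LC (carrier GL2)"
abbreviation hG :: "('f vertex => 'f vertex) monoid" where "hG \<equiv> hat_G v e"
abbreviation hU :: "'f tree_simplex => ('f vertex => 'f vertex) set" where "hU \<equiv> hat_U v p e"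
abbreviation ball :: "'f tree_simplex => 'f vertex set" where "ball \<equiv> tree_ball v e"
abbreviation th :: "'f^2^2 => 'f vertex => 'f vertex" where "th \<equiv> to_hat_G v"

lemma ball_mem: "z \<in> ball \<tau> \<longleftrightarrow> z \<in> VV \<and> (\<exists>x\<in>\<tau>. d x z <= e)"
 by (simp add: tree_ball_def)

lemma ball_self: "x \<in> VV ==> x \<in> \<tau> ==> x \<in> ball \<tau>"
 by (auto simp: ball_mem intro!: bexI[of _ x])

lemma LC_D: assumes "g \<in> LC S"
 shows "bij_betw g VV VV" "g \<in> extensional VV" "x \<in> VV ==> g x \<in> VV"
  "x \<in> VV ==> y \<in> VV ==> d (g x) (g y) = d x y" "g \<in> Bij VV"
  "\<mu> \<in> EE ==> \<exists>g'\<in>S. \<forall>x\<in>ball \<mu>. g x = actv g' x"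
 using assms by (auto simp: local_closure_def tree_aut_def Bij_def bij_betw_def)

lemma LC_I: assumes "bij_betw g VV VV" "g \<in> extensional VV"
 "!!x y. x \<in> VV ==> y \<in> VV ==> d (g x) (g y) = d x y"
 "!!\<mu>. \<mu> \<in> EE ==> \<exists>g'\<in>S. \<forall>x\<in>ball \<mu>. g x = actv g' x"
 shows "g \<in> LC S"
 using assms by (auto simp: local_closure_def tree_aut_def Bij_def)

lemma LC_mono: "g \<in> LC S ==> S \<subseteq> T ==> g \<in> LC T"
 unfolding local_closure_def by blast

lemma LC_GG: "g \<in> LC S ==> subgroup S GL2 ==> g \<in> GG"
 using LC_mono subgroup.subset by blast

lemma ball_act: assumes "det g ~= 0" "\<mu> \<subseteq> VV" "z \<in> ball \<mu>" shows "actv g z \<in> ball (act_simplex g \<mu>)"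
proof -
 obtain x where x: "x \<in> \<mu>" "d x z <= e" and z: "z \<in> VV" using assms(3) by (auto simp: ball_mem)
 hence "d (actv g x) (actv g z) <= e" using d_act[OF assms(1)] assms(2) by (simp add: subset_iff)
 thus ?thesis using x z act_vertex_VV[OF assms(1)] by (auto simp: ball_mem act_simplex_def)
qed

lemma edge_sub: "\<mu> \<in> EE ==> \<mu> \<subseteq> VV"
 using edge_subset by blast

lemma LC_compose: assumes S: "subgroup S GL2" and "g \<in> LC S" "h \<in> LC S" shows "compose VV g h \<in> LC S"
proof (rule LC_I)
 show "bij_betw (compose VV g h) VV VV" using bij_betw_compose LC_D(1) assms by blast
 show "compose VV g h \<in> extensional VV" by (rule compose_extensional)
 show "d (compose VV g h x) (compose VV g h y) = d x y" if "x \<in> VV" "y \<in> VV" for x y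
  using that assms by (simp add: compose_eq LC_D)
 fix \<mu> assume \<mu>: "\<mu> \<in> EE"
 obtain h' where h': "h' \<in> S" "!!x. x \<in> ball \<mu> ==> h x = actv h' x" using LC_D(6)[OF assms(3) \<mu>] by blast
 have dh: "det h' ~= 0" using subgroup_GL2D(1)[OF S h'(1)] .
 \<comment> \<open>The local model of \<open>g\<close> has to be taken at the image of the edge
   under \<open>h\<close>.\<close>
 obtain g' where g': "g' \<in> S" "!!x. x \<in> ball (act_simplex h' \<mu>) ==> g x = actv g' x"
  using LC_D(6)[OF assms(2) edge_act[OF dh \<mu>]] by blast
 have "compose VV g h x = actv (g' ** h') x" if x: "x \<in> ball \<mu>" for x
  using x h'(2) g'(2) ball_act[OF dh edge_sub[OF \<mu>] x] by (simp add: compose_eq ball_mem act_vertex_mult)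
 thus "\<exists>g'\<in>S. \<forall>x\<in>ball \<mu>. compose VV g h x = actv g' x"
  using subgroup_GL2D(4)[OF S g'(1) h'(1)] by blast
qed

lemma LC_inv: assumes S: "subgroup S GL2" and g: "g \<in> LC S" shows "(\<lambda>x\<in>VV. inv_into VV g x) \<in> LC S"
proof (rule LC_I)
 let ?i = "\<lambda>x\<in>VV. inv_into VV g x"
 note b = LC_D(1)[OF g]
 have i: "x \<in> VV ==> ?i x \<in> VV \<and> g (?i x) = x" for x
  using bij_betw_inv_into_right[OF b] bij_betw_inv_into[OF b] by (auto simp: bij_betw_def)
 have ig: "x \<in> VV ==> ?i (g x) = x" for x using bij_betw_inv_into_left[OF b] LC_D(3)[OF g] by simp
 show "bij_betw ?i VV VV" using bij_betw_inv_into[OF b] by (simp cong: bij_betw_cong)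
 show "?i \<in> extensional VV" by simp
 show "d (?i x) (?i y) = d x y" if "x \<in> VV" "y \<in> VV" for x y
  using LC_D(4)[OF g, of "?i x" "?i y"] i that by metis
 fix \<mu> assume \<mu>: "\<mu> \<in> EE"
 obtain x y where xy: "\<mu> = {x, y}" "{x, y} \<in> EE" using edge_cases[OF \<mu>] by metis
 have xyV: "x \<in> VV" "y \<in> VV" "d x y = 1" using xy edge_d by auto
 hence "d (?i x) (?i y) = 1" using LC_D(4)[OF g, of "?i x" "?i y"] i by metis
 hence \<nu>: "{?i x, ?i y} \<in> EE" using i xyV by (simp only: edge_d)
 \<comment> \<open>\<open>g\<close> is modelled at the edge that it carries to
   \<open>\<mu>\<close>.\<close>
 obtain g' where g': "g' \<in> S" "!!z. z \<in> ball {?i x, ?i y} ==> g z = actv g' z" using LC_D(6)[OF g \<nu>] by blast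
 have dg: "det g' ~= 0" using subgroup_GL2D(1)[OF S g'(1)] .
 have "?i x \<in> ball {?i x, ?i y}" "?i y \<in> ball {?i x, ?i y}" using i xyV by (auto intro!: ball_self)
 hence "act_simplex g' {?i x, ?i y} = \<mu>" using g'(2) i xyV xy(1) by (auto simp: act_simplex_def)
 hence \<nu>': "act_simplex (minv g') \<mu> = {?i x, ?i y}"
  using act_simplex_minv(1)[OF dg edge_simplex[OF \<nu>]] by simp
 have "?i z = actv (minv g') z" if z: "z \<in> ball \<mu>" for z
 proof -
  have "actv (minv g') z \<in> ball {?i x, ?i y}"
   using ball_act[OF det_minv_nz[OF dg] edge_sub[OF \<mu>] z] \<nu>' by simp
  hence "g (actv (minv g') z) = z" using g'(2) act_minv(2)[OF dg] z by (simp add: ball_mem)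
  moreover have "actv (minv g') z \<in> VV" using act_vertex_VV[OF det_minv_nz[OF dg]] z by (simp add: ball_mem)
  ultimately show ?thesis using ig by metis
 qed
 thus "\<exists>g'\<in>S. \<forall>x\<in>ball \<mu>. ?i x = actv g' x" using subgroup_GL2D(2)[OF S g'(1)] by blast
qed

lemma th_apply: "x \<in> VV ==> th g x = actv g x"
 by (simp add: to_hat_G_def)

lemma th_LC: assumes S: "subgroup S GL2" and g: "g \<in> S" shows "th g \<in> LC S"
proof (rule LC_I)
 have dg: "det g ~= 0" using subgroup_GL2D(1)[OF S g] .
 show "bij_betw (th g) VV VV"
  by (rule bij_betw_byWitness[where f' = "th (minv g)"])
   (use dg det_minv_nz[OF dg] in "auto simp: th_apply act_vertex_VV act_minv")
 show "th g \<in> extensional VV" by (simp add: to_hat_G_def)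
 show "d (th g x) (th g y) = d x y" if "x \<in> VV" "y \<in> VV" for x y using that dg by (simp add: th_apply d_act)
 show "\<exists>g'\<in>S. \<forall>x\<in>ball \<mu>. th g x = actv g' x" for \<mu> using g by (auto simp: th_apply ball_mem)
qed

lemma GL2_subgroup: "subgroup (carrier GL2) (GL2 :: ('f^2^2) monoid)"
 by (rule group.subgroup_self[OF GL2_group])

lemma th_GG: "det g ~= 0 ==> th g \<in> GG"
 using th_LC[OF GL2_subgroup] by (simp add: GL2_carrier)

lemma LC_eqI: "g \<in> LC S ==> h \<in> LC T ==> (!!x. x \<in> VV ==> g x = h x) ==> g = h"
 using LC_D(2) extensionalityI by metis

lemma th_1: "th (mat 1) = (\<lambda>x\<in>VV. x)"
 by (rule ext) (simp add: to_hat_G_def act_vertex_1 restrict_def)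

lemma LC_subgroup: assumes S: "subgroup S GL2" shows "subgroup (LC S) (BijGroup VV)"
proof
 show "LC S \<subseteq> carrier (BijGroup VV)" using LC_D(5) by (auto simp: BijGroup_def)
 show "g \<otimes>\<^bsub>BijGroup VV\<^esub> h \<in> LC S" if "g \<in> LC S" "h \<in> LC S" for g h
  using that LC_compose[OF S] LC_D(5) by (simp add: BijGroup_def)
 show "\<one>\<^bsub>BijGroup VV\<^esub> \<in> LC S" using th_LC[OF S subgroup_GL2D(3)[OF S]] by (simp add: BijGroup_def th_1)
 show "inv\<^bsub>BijGroup VV\<^esub> g \<in> LC S" if "g \<in> LC S" for g
  using that LC_inv[OF S] LC_D(5) by (simp add: inv_BijGroup)
qed

lemma hG_carrier [simp]: "carrier hG = GG"
 by (simp add: hat_G_def)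

lemma hG_group: "group hG"
 unfolding hat_G_def by (rule group.subgroup_imp_group[OF group_BijGroup LC_subgroup[OF GL2_subgroup]])

lemma hG_mult: "g \<in> GG ==> h \<in> GG ==> g \<otimes>\<^bsub>hG\<^esub> h = compose VV g h"
 using LC_D(5) by (simp add: hat_G_def BijGroup_def)

lemma hG_mult_apply: "g \<in> GG ==> h \<in> GG ==> x \<in> VV ==> (g \<otimes>\<^bsub>hG\<^esub> h) x = g (h x)"
 by (simp add: hG_mult compose_eq)

lemma hG_mult_GG: "g \<in> GG ==> h \<in> GG ==> g \<otimes>\<^bsub>hG\<^esub> h \<in> GG"
 using group.is_monoid[OF hG_group] monoid.m_closed by fastforce

lemma hG_one: "\<one>\<^bsub>hG\<^esub> = (\<lambda>x\<in>VV. x)" "\<one>\<^bsub>hG\<^esub> = th (mat 1)"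
 by (simp_all add: hat_G_def BijGroup_def th_1)

lemma LC_subgroup_hG: assumes "subgroup S GL2" shows "subgroup (LC S) hG"
 unfolding hat_G_def
 by (rule group.subgroup_incl[OF group_BijGroup LC_subgroup[OF assms] LC_subgroup[OF GL2_subgroup]])
  (use LC_GG[OF _ assms] in blast)

lemma hU_subgroup: "\<tau> \<in> SS ==> subgroup (hU \<tau>) hG"
 unfolding hat_U_def by (rule LC_subgroup_hG[OF US_subgroup])

lemma hU_GG: "\<tau> \<in> SS ==> g \<in> hU \<tau> ==> g \<in> GG"
 using subgroup.subset[OF hU_subgroup] by auto

lemma hUx_hU: assumes "\<tau> \<in> SS" "x \<in> \<tau>" "g \<in> LC (Ux x)" shows "g \<in> hU \<tau>"
 unfolding hat_U_def by (rule LC_mono[OF assms(3)]) (use Ux_US[OF assms(1,2)] in blast)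

lemma th_mult: assumes "det g ~= 0" "det h ~= 0" shows "th g \<otimes>\<^bsub>hG\<^esub> th h = th (g ** h)"
 by (rule LC_eqI[OF hG_mult_GG th_GG])
  (use assms in "auto simp: th_GG det_mult2 hG_mult_apply th_apply act_vertex_mult act_vertex_VV")

lemma th_sc: assumes "c ~= 0" "det g ~= 0" shows "th (sc c ** g) = th g"
 by (rule LC_eqI[OF th_GG th_GG])
  (use assms in "auto simp: det_mult2 det_sc th_apply act_vertex_mult act_vertex_sc act_vertex_VV")

lemma GG_edge: assumes "g \<in> GG" "\<mu> \<in> EE" shows "\<exists>g'. det g' ~= 0 \<and> (\<forall>x\<in>ball \<mu>. g x = actv g' x)"
 using LC_D(6)[OF assms] by (auto simp: GL2_carrier)

lemma GG_vertex: assumes "g \<in> GG" "x \<in> VV" shows "\<exists>g'. det g' ~= 0 \<and> (\<forall>z\<in>ball {x}. g z = actv g' z)"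
proof -
 obtain y where "{x, y} \<in> EE" using vertex_on_edge[OF assms(2)] by blast
 moreover have "ball {x} \<subseteq> ball {x, y}" by (auto simp: ball_mem)
 ultimately show ?thesis using GG_edge[OF assms(1)] by (meson subsetD)
qed

subsection \<open>Elements fixing a ball\<close>

lemma edge_orient: assumes "x \<in> VV" "\<mu> \<in> EE" obtains b c where "\<mu> = {b, c}" "{b, c} \<in> EE" "d x c = d x b + 1"
proof -
 obtain b c where bc: "\<mu> = {b, c}" "{b, c} \<in> EE" using edge_cases[OF assms(2)] by metis
 thus thesis using nbr_dist[OF assms(1) bc(2)] that[of b c] that[of c b] by (auto simp: insert_commute)
qed

text \<open>The hypothesis concerns the ball of \<open>x\<close>, the conclusion all edges; the
  proof goes outwards. A local model \<open>u\<close> in U_x^(e) at one edge has to be corrected at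
  the next edge by some \<open>w\<close> in the group of their common vertex \<open>b\<close>. Of
  the two factors of \<open>w\<close> in \<open>Ux_decompose\<close>, one lies in U_x^(e) and the
  other is invisible on the ball of the new edge.\<close>

lemma hat_fix_ball: assumes x: "x \<in> VV" and h: "h \<in> GG" "!!y. y \<in> VV ==> d x y <= e ==> h y = y"
 shows "h \<in> LC (Ux x)"
proof (rule LC_I)
 have "\<exists>u\<in>Ux x. \<forall>y\<in>ball {b, c}. h y = actv u y" if "{b, c} \<in> EE" "d x c = d x b + 1" for b c
  using that
 proof (induction "d x b" arbitrary: b c)
  case 0
  have bV: "b \<in> VV" "c \<in> VV" using edge_vertices 0 by auto
  hence "b = x" using 0 x d_0[of x b] by simp
  obtain g where g: "det g ~= 0" "!!y. y \<in> ball {b, c} ==> h y = actv g y" using GG_edge[OF h(1) 0(2)] by blast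
  have "actv g y = y" if "y \<in> VV" "d x y <= e" for y
   using g(2)[of y] h(2)[OF that] that \<open>b = x\<close> by (auto simp: ball_mem)
  then obtain c' u where u: "c' ~= 0" "u \<in> Ux x" "g = sc c' ** u" using fix_ball[OF x g(1)] by blast
  have "det u ~= 0" using subgroup_GL2D(1)[OF Ux_subgroup[OF x] u(2)] .
  hence "actv g y = actv u y" if "y \<in> VV" for y
   using that u by (simp add: act_vertex_mult act_vertex_sc act_vertex_VV)
  thus ?case using g(2) u(2) by (auto simp: ball_mem intro!: bexI[of _ u])
 next
  case (Suc n)
  have bV: "b \<in> VV" "c \<in> VV" using edge_vertices Suc by auto
  have "x ~= b" using Suc(2) x by auto
  then obtain a where a: "{a, b} \<in> EE" "d x b = d x a + 1" using prev_exists[OF x bV(1)] by blast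
  then obtain u where u: "u \<in> Ux x" "!!y. y \<in> ball {a, b} ==> h y = actv u y"
   using Suc(1)[of a b] Suc(2) by auto
  have du: "det u ~= 0" using subgroup_GL2D(1)[OF Ux_subgroup[OF x] u(1)] .
  obtain g where g: "det g ~= 0" "!!y. y \<in> ball {b, c} ==> h y = actv g y" using GG_edge[OF h(1) Suc(3)] by blast
  have dug: "det (minv u ** g) ~= 0" using g du by (simp add: det_mult2 det_minv_nz)
  \<comment> \<open>Both edges contain \<open>b\<close>, so \<open>u\<close> and \<open>g\<close>
    agree with \<open>h\<close>, hence with each other, on the ball of \<open>b\<close>.\<close>
  have "actv (minv u ** g) y = y" if y: "y \<in> VV" "d b y <= e" for y
  proof -
   have "actv g y = actv u y" using g(2)[of y] u(2)[of y] y by (auto simp: ball_mem)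
   thus ?thesis using y act_minv(1)[OF du] by (simp add: act_vertex_mult)
  qed
  then obtain c' w where w: "c' ~= 0" "w \<in> Ux b" "minv u ** g = sc c' ** w" using fix_ball[OF bV(1) dug] by blast
  obtain w1 w2 where w12: "w1 \<in> Ux b" "w1 \<in> Ux x" "w2 \<in> Ux c" "w = w1 ** w2"
   using Ux_decompose[OF x Suc(3,4) w(2)] by blast
  note sb = subgroup_GL2D[OF Ux_subgroup[OF bV(1)]]
  have "minv w1 ** w = w2" using sb(1)[OF w12(1)] by (simp add: w12(4) minv_cancel)
  hence w2b: "w2 \<in> Ux b" using sb(4)[OF sb(2)[OF w12(1)] w(2)] by simp
  have w2fix: "actv w2 y = y" if "y \<in> ball {b, c}" for y
   using that Ux_fix[OF bV(1) w2b] Ux_fix[OF bV(2) w12(3)] by (auto simp: ball_mem)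
  have ge: "g = u ** (sc c' ** (w1 ** w2))" using w(3) w12(4) minv_cancel(2)[OF du] by metis
  have "h y = actv (u ** w1) y" if y: "y \<in> ball {b, c}" for y
  proof -
   have yV: "y \<in> VV" using y by (simp add: ball_mem)
   have "actv w1 y \<in> VV" using act_vertex_VV[OF sb(1)[OF w12(1)] yV] .
   hence "actv g y = actv u (actv w1 y)"
    unfolding ge using yV w2fix[OF y] w(1) act_vertex_VV[OF sb(1)[OF w2b] yV]
    by (simp add: act_vertex_mult act_vertex_sc)
   thus ?thesis using g(2)[OF y] yV by (simp add: act_vertex_mult)
  qed
  thus ?case using subgroup_GL2D(4)[OF Ux_subgroup[OF x] u(1) w12(2)] by blast
 qed
 thus "\<exists>g'\<in>Ux x. \<forall>y\<in>ball \<mu>. h y = actv g' y" if "\<mu> \<in> EE" for \<mu>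
  using edge_orient[OF x that] by metis
qed (use LC_D[OF h(1)] in auto)

text \<open>Lets a matrix stand in for an element of the completed group on vectors attached to
  \<open>x\<close>: the quotient of the two fixes the ball around \<open>x\<close>, so
  \<open>hat_fix_ball\<close> applies to it.\<close>

lemma hat_agree: assumes "x \<in> VV" "g \<in> GG" "det g' ~= 0" "!!z. z \<in> ball {x} ==> g z = actv g' z"
 shows "\<exists>h\<in>LC (Ux x). g = th g' \<otimes>\<^bsub>hG\<^esub> h"
proof
 let ?h = "th (minv g') \<otimes>\<^bsub>hG\<^esub> g"
 have tm: "th (minv g') \<in> GG" using assms(3) by (simp add: th_GG det_minv_nz)
 show "?h \<in> LC (Ux x)"
 proof (rule hat_fix_ball[OF assms(1) hG_mult_GG[OF tm assms(2)]])
  fix y assume y: "y \<in> VV" "d x y <= e"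
  have "actv g' y \<in> VV" using y assms(3) act_vertex_VV by blast
  thus "?h y = y" using assms(4)[of y] y act_minv(1)[OF assms(3) y(1)]
   by (simp add: hG_mult_apply[OF tm assms(2)] th_apply ball_mem)
 qed
 show "g = th g' \<otimes>\<^bsub>hG\<^esub> ?h"
  by (rule LC_eqI[OF assms(2) hG_mult_GG[OF th_GG[OF assms(3)] hG_mult_GG[OF tm assms(2)]]])
   (use assms tm LC_D(3)[OF assms(2)] hG_mult_GG[OF tm assms(2)] in
    \<open>simp add: hG_mult_apply th_GG th_apply act_vertex_VV det_minv_nz act_minv\<close>)
qed

lemma hU_conj: assumes "\<tau> \<in> SS" "det g ~= 0" "h' \<in> hU (act_simplex g \<tau>)"
 shows "\<exists>h\<in>hU \<tau>. h' \<otimes>\<^bsub>hG\<^esub> th g = th g \<otimes>\<^bsub>hG\<^esub> h"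
proof
 let ?h = "th (minv g) \<otimes>\<^bsub>hG\<^esub> (h' \<otimes>\<^bsub>hG\<^esub> th g)"
 have s: "act_simplex g \<tau> \<in> SS" by (rule simplex_act[OF assms(2,1)])
 have G: "th (minv g) \<in> GG" "th g \<in> GG" "h' \<in> GG"
  using assms s by (auto simp: th_GG det_minv_nz hU_GG)
 have G2: "h' \<otimes>\<^bsub>hG\<^esub> th g \<in> GG" "?h \<in> GG" using G by (auto simp: hG_mult_GG)
 have hx: "?h x = actv (minv g) (h' (actv g x))" if "x \<in> VV" for x
  using that G G2 assms(2) LC_D(3)[OF G(3)] by (simp add: hG_mult_apply th_apply act_vertex_VV)
 show "?h \<in> hU \<tau>" unfolding hat_U_def
 proof (rule LC_I)
  fix \<mu> assume \<mu>: "\<mu> \<in> EE"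
  obtain u where u: "u \<in> U_group v p e (act_simplex g \<tau>)" "!!x. x \<in> ball (act_simplex g \<mu>) ==> h' x = actv u x"
   using LC_D(6)[OF assms(3)[unfolded hat_U_def] edge_act[OF assms(2) \<mu>]] by blast
  have "minv g ** u ** minv (minv g) \<in> U_group v p e (act_simplex (minv g) (act_simplex g \<tau>))"
   by (rule US_conj[OF s u(1) det_minv_nz[OF assms(2)]])
  hence "minv g ** u ** g \<in> U_group v p e \<tau>"
   using assms by (simp add: minv_minv act_simplex_minv)
  moreover have "?h x = actv (minv g ** u ** g) x" if x: "x \<in> ball \<mu>" for x
   using x u(2)[OF ball_act[OF assms(2) edge_sub[OF \<mu>] x]] hx assms(2)
   by (simp add: ball_mem act_vertex_mult act_vertex_VV)
  ultimately show "\<exists>g'\<in>U_group v p e \<tau>. \<forall>x\<in>ball \<mu>. ?h x = actv g' x" by blast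
 qed (use LC_D[OF G2(2)] in auto)
 show "h' \<otimes>\<^bsub>hG\<^esub> th g = th g \<otimes>\<^bsub>hG\<^esub> ?h"
 proof (rule LC_eqI[OF G2(1) hG_mult_GG[OF G(2) G2(2)]])
  fix x assume x: "x \<in> VV"
  have "h' (actv g x) \<in> VV" using LC_D(3)[OF G(3)] act_vertex_VV[OF assms(2) x] by blast
  thus "(h' \<otimes>\<^bsub>hG\<^esub> th g) x = (th g \<otimes>\<^bsub>hG\<^esub> ?h) x"
   using x G G2 LC_D(3)[OF G2(2) x] hx[OF x] act_minv(2)[OF assms(2)]
   by (simp add: hG_mult_apply th_apply)
 qed
qed

subsection \<open>Elements acting on one branch only\<close>

definition branch_map :: "'f vertex => 'f vertex => 'f^2^2 => 'f vertex => 'f vertex" where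
 "branch_map a b u = (\<lambda>z\<in>VV. if z \<in> behind a b then actv u z else z)"

text \<open>The ball of an edge meets both half-trees only near the cut, and there \<open>u\<close>
  is trivial on the side that must not move, because it fixes the ball of radius \<open>e\<close>
  around \<open>a\<close> or \<open>b\<close>. So on the ball of each edge the map agrees with
  \<open>u\<close> or with the identity.\<close>

lemma branch_map_GG: assumes ab: "{a, b} \<in> EE" and u: "u \<in> Ux a \<or> u \<in> Ux b" shows "branch_map a b u \<in> GG"
proof (rule LC_I)
 have V: "a \<in> VV" "b \<in> VV" "d a b = 1" "d b a = 1" using ab d_sym by (auto simp: edge_d)
 have ba: "{b, a} \<in> EE" using ab by (simp add: insert_commute)
 have du: "det u ~= 0" using u subgroup_GL2D(1)[OF Ux_subgroup] V by blast
 \<comment> \<open>On either side, being within \<open>e\<close> of the farther end of the edge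
   implies being within \<open>e\<close> of both ends, so it does not matter which of the two groups
   contains \<open>u\<close>.\<close>
 have fx: "actv u z = z" if "z \<in> behind b a" "d b z <= e" for z
  using that u V Ux_fix[of a u z] Ux_fix[of b u z] by (auto simp: behind_def)
 have fx': "actv u z = z" if "z \<in> behind a b" "d a z <= e" for z
  using that u V Ux_fix[of a u z] Ux_fix[of b u z] by (auto simp: behind_def)
 have ua: "actv u a = a" "actv u b = b"
  using fx[of a] fx'[of b] V e1 by (auto simp: behind_def)
 have beh: "actv w z \<in> behind a b" if "z \<in> behind a b" "det w ~= 0" "actv w a = a" "actv w b = b" for w z
  using that d_act[of w a z] d_act[of w b z] V by (auto simp: behind_def act_vertex_VV)
 have mu: "actv (minv u) a = a" "actv (minv u) b = b"
  using act_minv(1)[OF du V(1)] act_minv(1)[OF du V(2)] ua by auto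
 have bV: "z \<in> VV" if "z \<in> behind a b" for z using that by (simp add: behind_def)
 let ?h = "branch_map a b u"
 have h: "?h z = (if z \<in> behind a b then actv u z else z)" if "z \<in> VV" for z
  using that by (simp add: branch_map_def)
 show "bij_betw ?h VV VV"
  by (rule bij_betw_byWitness[where f' = "branch_map a b (minv u)"])
   (use du det_minv_nz[OF du] beh[OF _ du ua] beh[OF _ det_minv_nz[OF du] mu] in
    \<open>auto simp: branch_map_def act_vertex_VV act_minv bV\<close>)
 show "?h \<in> extensional VV" by (simp add: branch_map_def)
 \<comment> \<open>A path between the half-trees passes through the edge, and \<open>u\<close>
   preserves the distance to \<open>b\<close>.\<close>
 have cross: "d (actv u x) y = d x y" if "x \<in> behind a b" "y \<in> behind b a" for x y
 proof -
  have "d y (actv u x) = d y a + 1 + d b (actv u x)"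
   by (rule d_across[OF ab that(2) beh[OF that(1) du ua]])
  also have "d b (actv u x) = d b x" using d_act[OF du V(2) bV[OF that(1)]] ua by simp
  also have "d y a + 1 + d b x = d y x" using d_across[OF ab that(2,1)] by simp
  finally show ?thesis using d_sym[of y x] d_sym[of y "actv u x"] that bV[OF that(1)] act_vertex_VV[OF du]
   by (simp add: behind_def)
 qed
 show "d (?h x) (?h y) = d x y" if xy: "x \<in> VV" "y \<in> VV" for x y
 proof -
  have "x \<in> behind a b \<or> x \<in> behind b a" "y \<in> behind a b \<or> y \<in> behind b a" using behind_or[OF ab] xy by auto
  thus ?thesis
   using xy cross[of x y] cross[of y x] d_act[OF du xy] d_sym[OF xy] d_sym[of x "actv u y"] act_vertex_VV[OF du]
    behind_disjoint[of x a b] behind_disjoint[of y a b] by (auto simp: h)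
 qed
 fix \<mu> assume \<mu>: "\<mu> \<in> EE"
 obtain y1 y2 where y: "\<mu> = {y1, y2}" "{y1, y2} \<in> EE" using edge_cases[OF \<mu>] by metis
 have yV: "y1 \<in> VV" "y2 \<in> VV" using y edge_vertices by auto
 have L: "?h z = actv u z" if L0: "\<mu> \<subseteq> behind a b" "z \<in> ball \<mu>" for z
 proof (cases "z \<in> behind a b")
  case False
  have zV: "z \<in> VV" using L0 by (simp add: ball_mem)
  hence zb: "z \<in> behind b a" using False behind_or[OF ab] by blast
  obtain y where "y \<in> \<mu>" "d y z <= e" using L0 by (auto simp: ball_mem)
  hence "y \<in> behind a b" "d z y <= e" using L0 edge_subset[OF \<mu>] d_sym zV by (auto simp: behind_def)
  hence "d b z <= e" using d_across[OF ab zb, of y] zb d_sym[OF zV V(1)] by (simp add: behind_def)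
  thus ?thesis using fx[OF zb] False zV by (simp add: h)
 qed (use L0 in "simp add: h ball_mem")
 have R: "?h z = actv (mat 1) z" if R0: "\<mu> \<subseteq> behind b a" "z \<in> ball \<mu>" for z
 proof -
  have zV: "z \<in> VV" using R0 by (simp add: ball_mem)
  have "actv u z = z" if zb: "z \<in> behind a b"
  proof -
   obtain y where y: "y \<in> \<mu>" "d y z <= e" using R0(2) unfolding ball_mem by blast
   hence "y \<in> behind b a" using R0(1) by blast
   from d_across[OF ab this zb] have "d a z <= e" using y(2) zb by (simp add: behind_def)
   thus ?thesis by (rule fx'[OF zb])
  qed
  thus ?thesis using zV by (simp add: h act_vertex_1)
 qed
 \<comment> \<open>On the cut edge itself the model depends on the hypothesis: \<open>u\<close> if
   it lies in \<open>Ux a\<close>, since it is then trivial on the \<open>a\<close> side of the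
   ball, and the identity if it lies in \<open>Ux b\<close>.\<close>
 have M: "\<exists>g'\<in>carrier GL2. \<forall>z\<in>ball \<mu>. ?h z = actv g' z" if "\<mu> = {a, b}"
  using u
 proof
  assume ua': "u \<in> Ux a"
  have "?h z = actv u z" if z: "z \<in> ball \<mu>" for z
  proof (cases "z \<in> behind a b")
   case False
   have zV: "z \<in> VV" using z by (simp add: ball_mem)
   hence zb: "z \<in> behind b a" using False behind_or[OF ab] by blast
   hence "d a z <= e" using z \<open>\<mu> = {a, b}\<close> by (auto simp: ball_mem behind_def)
   thus ?thesis using Ux_fix[OF V(1) ua' zV] False zV by (simp add: h)
  qed (use z in "simp add: h ball_mem")
  thus ?thesis using du by (auto simp: GL2_carrier)
 next
  assume ub': "u \<in> Ux b"
  have "?h z = actv (mat 1) z" if z: "z \<in> ball \<mu>" for z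
  proof -
   have zV: "z \<in> VV" using z by (simp add: ball_mem)
   have "actv u z = z" if "z \<in> behind a b"
    using that z \<open>\<mu> = {a, b}\<close> Ux_fix[OF V(2) ub' zV] by (auto simp: ball_mem behind_def)
   thus ?thesis using zV by (simp add: h act_vertex_1)
  qed
  thus ?thesis by (intro bexI[of _ "mat 1"]) (auto simp: GL2_carrier)
 qed
 \<comment> \<open>The cut edge is the only one that joins the two half-trees.\<close>
 have mixed: "\<mu> = {a, b}" if "w1 \<in> behind b a" "w2 \<in> behind a b" "\<mu> = {w1, w2}" for w1 w2
 proof -
  have "{w1, w2} \<in> EE" using that \<mu> by simp
  hence "d w1 w2 = 1" "w1 \<in> VV" "w2 \<in> VV" by (auto simp: edge_d)
  hence "d w1 a = 0" "d b w2 = 0" using d_across[OF ab that(1,2)] by auto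
  hence "w1 = a" "w2 = b" using d_0 V \<open>w1 \<in> VV\<close> \<open>w2 \<in> VV\<close> by auto
  thus ?thesis using that by simp
 qed
 have "y1 \<in> behind a b \<or> y1 \<in> behind b a" "y2 \<in> behind a b \<or> y2 \<in> behind b a" using behind_or[OF ab] yV by auto
 then consider "\<mu> \<subseteq> behind a b" | "\<mu> \<subseteq> behind b a" | "\<mu> = {a, b}"
  using mixed[of y1 y2] mixed[of y2 y1] y(1) by (auto simp: insert_commute)
 thus "\<exists>g'\<in>carrier GL2. \<forall>z\<in>ball \<mu>. ?h z = actv g' z"
 proof cases
  case 1 thus ?thesis using L du by (intro bexI[of _ u]) (auto simp: GL2_carrier)
 next
  case 2 thus ?thesis using R by (intro bexI[of _ "mat 1"]) (auto simp: GL2_carrier)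
 next
  case 3 thus ?thesis by (rule M)
 qed
qed

lemma branch_map_LC: assumes "{a, b} \<in> EE" "u \<in> Ux a" "x \<in> VV" "u \<in> Ux x" shows "branch_map a b u \<in> LC (Ux x)"
 by (rule hat_fix_ball[OF assms(3) branch_map_GG]) (use assms Ux_fix[OF assms(3,4)] in "auto simp: branch_map_def")

subsection \<open>Pro-p behaviour\<close>

lemma hG_pow_GG: "g \<in> GG ==> g [^]\<^bsub>hG\<^esub> (n::nat) \<in> GG"
 using group.is_monoid[OF hG_group] monoid.nat_pow_closed by fastforce

text \<open>The set \<open>T\<close> is stable, so the local description by \<open>u\<close> can be
  iterated.\<close>

lemma hG_pow_act: assumes "G \<in> GG" "T \<subseteq> VV" "!!z. z \<in> T ==> G z = actv u z \<and> G z \<in> T"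
 shows "z \<in> T ==> (G [^]\<^bsub>hG\<^esub> (n::nat)) z = actv (mpow u n) z"
proof (induction n arbitrary: z)
 case 0 thus ?case using assms(2) by (auto simp: hG_one(1) act_vertex_1)
next
 case (Suc n)
 have zV: "z \<in> VV" using Suc assms(2) by blast
 have "(G [^]\<^bsub>hG\<^esub> Suc n) z = (G [^]\<^bsub>hG\<^esub> n) (G z)"
  using hG_mult_apply[OF hG_pow_GG[OF assms(1)] assms(1) zV, of n] by simp
 also have "\<dots> = actv (mpow u n) (G z)"
  using Suc(1)[of "G z"] assms(3)[OF Suc(2)] by blast
 also have "\<dots> = actv (mpow u n) (actv u z)" using assms(3)[OF Suc(2)] by simp
 finally show ?case using zV by (simp add: act_vertex_mult)
qed

lemma GL2_fix_subgroup: assumes "x \<in> VV" shows "subgroup {g. det g ~= 0 \<and> actv g x = x} GL2"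
proof (rule subgroup_GL2I)
 fix g assume g: "g \<in> {g. det g ~= 0 \<and> actv g x = x}"
 hence "actv (minv g) x = x" using act_minv(1)[of g x] assms by simp
 thus "det g ~= 0 \<and> minv g \<in> {g. det g ~= 0 \<and> actv g x = x}" using g by (simp add: det_minv_nz)
qed (use assms in "simp_all add: det_mult2 act_vertex_mult act_vertex_1")

lemma US_fix: assumes "{a, b} \<in> EE" "u \<in> U_group v p e {a, b}" shows "actv u a = a"
proof -
 have V: "a \<in> VV" "b \<in> VV" "d b a = 1" using assms d_sym by (auto simp: edge_d)
 have "U_group v p e {a, b} \<subseteq> {g. det g ~= 0 \<and> actv g a = a}"
  by (rule US_induct[OF edge_simplex[OF assms(1)] GL2_fix_subgroup[OF V(1)]])
   (use V e1 Ux_fix[of a] Ux_fix[of b] subgroup_GL2D(1)[OF Ux_subgroup] in "auto simp del: One_nat_def")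
 thus ?thesis using assms(2) by blast
qed

text \<open>Each further p-th power brings the element into the vertex groups one step farther out.
  \<open>US_p_power\<close> starts at \<open>a\<close>; near a new vertex \<open>y\<close> the
  element already acts through the group of the preceding vertex \<open>x\<close>, and p-th powers
  of that group lie in the group of \<open>y\<close> by \<open>Ux_p_power\<close>. In particular
  some p-power of the element fixes any given ball around \<open>a\<close> pointwise.\<close>

lemma hU_p_power: assumes "{a, b} \<in> EE" "g \<in> hU {a, b}"
 shows "\<exists>k. \<forall>y\<in>VV. d a y <= m --> (\<exists>u\<in>Ux y. \<forall>z\<in>VV. d y z <= e --> (g [^]\<^bsub>hG\<^esub> (p ^ k)) z = actv u z)"
proof -
 have V: "a \<in> VV" "b \<in> VV" using assms edge_vertices by auto
 have gG: "g \<in> GG" using hU_GG[OF edge_simplex assms(2)] assms(1) by blast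
 interpret hG: group hG by (rule hG_group)
 have ball_stable: "G z \<in> VV \<and> d y (G z) <= e" if "G \<in> GG" "y \<in> VV" "G y = y" "z \<in> VV" "d y z <= e" for G y z
  using LC_D(3,4)[OF that(1)] that by metis
 show ?thesis
 proof (induction m)
  case 0
  obtain u where u: "u \<in> U_group v p e {a, b}" "!!x. x \<in> ball {a, b} ==> g x = actv u x"
   using LC_D(6)[OF assms(2)[unfolded hat_U_def] assms(1)] by blast
  have ga: "g a = a" using u(2)[OF ball_self[OF V(1)]] US_fix[OF assms(1) u(1)] by simp
  have "(g [^]\<^bsub>hG\<^esub> p) z = actv (mpow u p) z" if "z \<in> VV" "d a z <= e" for z
   using hG_pow_act[OF gG, of "{z\<in>VV. d a z <= e}" u z p] u(2) that ball_stable[OF gG V(1) ga] by (auto simp: ball_mem)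
  hence "\<forall>y\<in>VV. d a y <= 0 --> (\<exists>u\<in>Ux y. \<forall>z\<in>VV. d y z <= e --> (g [^]\<^bsub>hG\<^esub> (p ^ 1)) z = actv u z)"
   using US_p_power[OF assms(1) u(1)] d_0[OF V(1)] by auto
  thus ?case by blast
 next
  case (Suc m)
  then obtain k where k: "!!y. y \<in> VV ==> d a y <= m ==> \<exists>u\<in>Ux y. \<forall>z\<in>VV. d y z <= e --> (g [^]\<^bsub>hG\<^esub> (p ^ k)) z = actv u z"
   by blast
  define G where "G = g [^]\<^bsub>hG\<^esub> (p ^ k)"
  have G: "G \<in> GG" unfolding G_def by (rule hG_pow_GG[OF gG])
  have Gp: "g [^]\<^bsub>hG\<^esub> (p ^ Suc k) = G [^]\<^bsub>hG\<^esub> p" using hG.nat_pow_pow[of g "p ^ k" p] gG by (simp add: G_def mult.commute)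
  have fixG: "G z = z" if "y \<in> VV" "d a y <= m" "z \<in> VV" "d y z <= e" for y z
   using k[OF that(1,2)] that Ux_fix unfolding G_def by auto
  have "\<exists>u\<in>Ux y. \<forall>z\<in>VV. d y z <= e --> (G [^]\<^bsub>hG\<^esub> p) z = actv u z" if y: "y \<in> VV" "d a y <= Suc m" for y
  proof -
   have "\<exists>u. mpow u p \<in> Ux y \<and> G y = y \<and> (\<forall>z\<in>VV. d y z <= e --> G z = actv u z)"
   proof (cases "d a y <= m")
    case True
    then obtain u where "u \<in> Ux y" "\<forall>z\<in>VV. d y z <= e --> G z = actv u z" using k[OF y(1)] unfolding G_def by blast
    thus ?thesis using subgroup_GL2D(5)[OF Ux_subgroup[OF y(1)]] fixG[OF y(1) True y(1)] y(1)
     by (intro exI[of _ u]) simp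
   next
    case False
    hence "a ~= y" using V by auto
    then obtain x where x: "{x, y} \<in> EE" "d a y = d a x + 1" using prev_exists[OF V(1) y(1)] by blast
    have xV: "x \<in> VV" "d x y = 1" "d a x <= m" using x y edge_d by auto
    obtain w where w: "det w ~= 0" "!!z. z \<in> ball {x, y} ==> G z = actv w z" using GG_edge[OF G x(1)] by blast
    have "actv w z = z" if "z \<in> VV" "d x z <= e" for z
     using w(2)[of z] fixG[OF xV(1,3) that] that by (auto simp: ball_mem)
    then obtain c u where u: "c ~= 0" "u \<in> Ux x" "w = sc c ** u" using fix_ball[OF xV(1) w(1)] by blast
    have "det u ~= 0" using subgroup_GL2D(1)[OF Ux_subgroup[OF xV(1)] u(2)] .
    hence "G z = actv u z" if "z \<in> VV" "d y z <= e" for z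
     using w(2)[of z] that u by (simp add: ball_mem act_vertex_mult act_vertex_sc act_vertex_VV)
    moreover have "G y = y" using fixG[OF xV(1,3) y(1)] xV(2) e1 by simp
    ultimately show ?thesis using Ux_p_power[OF x(1) u(2)] by blast
   qed
   then obtain u where u: "mpow u p \<in> Ux y" "G y = y" "!!z. z \<in> VV ==> d y z <= e ==> G z = actv u z" by blast
   have "(G [^]\<^bsub>hG\<^esub> p) z = actv (mpow u p) z" if "z \<in> VV" "d y z <= e" for z
    using hG_pow_act[OF G, of "{z\<in>VV. d y z <= e}" u z p] u(3) that ball_stable[OF G y(1) u(2)] by auto
   thus ?thesis using u(1) by blast
  qed
  thus ?case unfolding Gp[symmetric] by blast
 qed
qed

end

section \<open>Linear maps, quotients and direct sums of modules\<close>

lemma (in abelian_group) neg_zero: "\<ominus> \<zero> = \<zero>"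
 using r_neg[OF zero_closed] by simp

lemma (in abelian_group) diff_zero_iff: assumes "x \<in> carrier G" "y \<in> carrier G" shows "x \<ominus> y = \<zero> \<longleftrightarrow> x = y"
proof -
 have "x = (x \<ominus> y) \<oplus> y" using assms by (simp add: a_minus_def a_assoc l_neg)
 thus ?thesis using assms by (auto simp: a_minus_def r_neg)
qed

text \<open>\<open>lin_maps\<close> without extensionality, so that composites and restrictions can
  be formed without adjusting values outside the carrier.\<close>

definition linmap ::
 "('l, 'c) ring_scheme => ('l, 'a) module => ('l, 'b) module => ('a => 'b) => bool" where
 "linmap R M N f \<longleftrightarrow> f \<in> carrier M \<rightarrow> carrier N \<and>
   (\<forall>x\<in>carrier M. \<forall>y\<in>carrier M. f (x \<oplus>\<^bsub>M\<^esub> y) = f x \<oplus>\<^bsub>N\<^esub> f y) \<and>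
   (\<forall>a\<in>carrier R. \<forall>x\<in>carrier M. f (a \<odot>\<^bsub>M\<^esub> x) = a \<odot>\<^bsub>N\<^esub> f x)"

lemma linmapD: assumes "linmap R M N f"
 shows "x \<in> carrier M ==> f x \<in> carrier N"
  "x \<in> carrier M ==> y \<in> carrier M ==> f (x \<oplus>\<^bsub>M\<^esub> y) = f x \<oplus>\<^bsub>N\<^esub> f y"
  "a \<in> carrier R ==> x \<in> carrier M ==> f (a \<odot>\<^bsub>M\<^esub> x) = a \<odot>\<^bsub>N\<^esub> f x"
 using assms by (auto simp: linmap_def)

lemma linmapI: assumes "!!x. x \<in> carrier M ==> f x \<in> carrier N"
 "!!x y. x \<in> carrier M ==> y \<in> carrier M ==> f (x \<oplus>\<^bsub>M\<^esub> y) = f x \<oplus>\<^bsub>N\<^esub> f y"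
 "!!a x. a \<in> carrier R ==> x \<in> carrier M ==> f (a \<odot>\<^bsub>M\<^esub> x) = a \<odot>\<^bsub>N\<^esub> f x"
 shows "linmap R M N f"
 using assms by (auto simp: linmap_def)

lemma linmap_cong: assumes "linmap R M N f" "Module.module R M" "!!x. x \<in> carrier M ==> g x = f x" shows "linmap R M N g"
proof -
 interpret M: Module.module R M by fact
 show ?thesis by (rule linmapI) (use assms(3) linmapD[OF assms(1)] in simp_all)
qed

lemma linear_on_iff: assumes "Module.module R M" shows "linear_on R M N f \<longleftrightarrow> linmap R M N f"
proof -
 interpret M: Module.module R M by fact
 show ?thesis by (auto simp: lin_maps_def linmap_def)
qed

lemma lin_maps_iff: "f \<in> lin_maps R M N \<longleftrightarrow> linmap R M N f \<and> f \<in> extensional (carrier M)"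
 by (auto simp: lin_maps_def linmap_def PiE_def)

lemma linmap_0: assumes "linmap R M N f" "Module.module R M" "Module.module R N" shows "f \<zero>\<^bsub>M\<^esub> = \<zero>\<^bsub>N\<^esub>"
proof -
 interpret M: Module.module R M by fact
 interpret N: Module.module R N by fact
 have "f \<zero>\<^bsub>M\<^esub> \<oplus>\<^bsub>N\<^esub> f \<zero>\<^bsub>M\<^esub> = f \<zero>\<^bsub>M\<^esub>"
  using linmapD(2)[OF assms(1), of "\<zero>\<^bsub>M\<^esub>" "\<zero>\<^bsub>M\<^esub>"] by simp
 thus ?thesis using linmapD(1)[OF assms(1), of "\<zero>\<^bsub>M\<^esub>"] by (metis M.M.zero_closed N.M.add.r_cancel_one')
qed

lemma linmap_neg: assumes "linmap R M N f" "Module.module R M" "Module.module R N" "x \<in> carrier M"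
 shows "f (\<ominus>\<^bsub>M\<^esub> x) = \<ominus>\<^bsub>N\<^esub> f x"
proof -
 interpret M: Module.module R M by fact
 interpret N: Module.module R N by fact
 have fx: "f x \<in> carrier N" "f (\<ominus>\<^bsub>M\<^esub> x) \<in> carrier N" using linmapD(1)[OF assms(1)] assms(4) by auto
 have "f (\<ominus>\<^bsub>M\<^esub> x) \<oplus>\<^bsub>N\<^esub> f x = \<zero>\<^bsub>N\<^esub>"
  using linmapD(2)[OF assms(1), of "\<ominus>\<^bsub>M\<^esub> x" x] assms(4) linmap_0[OF assms(1-3)] by (simp add: M.M.l_neg)
 thus ?thesis using N.M.minus_equality fx by metis
qed

lemma linmap_minus: assumes "linmap R M N f" "Module.module R M" "Module.module R N" "x \<in> carrier M" "y \<in> carrier M"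
 shows "f (x \<ominus>\<^bsub>M\<^esub> y) = f x \<ominus>\<^bsub>N\<^esub> f y"
proof -
 interpret M: Module.module R M by fact
 show ?thesis using linmapD(2)[OF assms(1)] linmap_neg[OF assms(1-3,5)] assms(4,5) by (simp add: a_minus_def)
qed

lemma linmap_comp: "linmap R M N f ==> linmap R N K g ==> linmap R M K (\<lambda>x. g (f x))"
 by (auto simp: linmap_def Pi_iff)

lemma linmap_inj: assumes "linmap R M N f" "Module.module R M" "Module.module R N"
 "!!x. x \<in> carrier M ==> f x = \<zero>\<^bsub>N\<^esub> ==> x = \<zero>\<^bsub>M\<^esub>" shows "inj_on f (carrier M)"
proof (rule inj_onI)
 interpret M: Module.module R M by fact
 interpret N: Module.module R N by fact
 fix x y assume xy: "x \<in> carrier M" "y \<in> carrier M" "f x = f y"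
 hence "f (x \<ominus>\<^bsub>M\<^esub> y) = \<zero>\<^bsub>N\<^esub>" using linmap_minus[OF assms(1-3)] linmapD(1)[OF assms(1)]
  by (simp add: a_minus_def N.M.r_neg)
 hence "x \<ominus>\<^bsub>M\<^esub> y = \<zero>\<^bsub>M\<^esub>" using assms(4) xy by simp
 thus "x = y" using xy by (simp add: M.M.diff_zero_iff)
qed

lemma submod_iff: assumes "Module.module R M"
 shows "submodule N R M \<longleftrightarrow> N \<subseteq> carrier M \<and> \<zero>\<^bsub>M\<^esub> \<in> N \<and> (\<forall>x\<in>N. \<forall>y\<in>N. x \<oplus>\<^bsub>M\<^esub> y \<in> N) \<and>
  (\<forall>a\<in>carrier R. \<forall>x\<in>N. a \<odot>\<^bsub>M\<^esub> x \<in> N)"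
proof -
 interpret M: Module.module R M by fact
 show ?thesis
 proof
  assume s: "submodule N R M"
  hence "\<zero>\<^bsub>M\<^esub> \<in> N" using subgroup.one_closed[of N "add_monoid M"] submodule.axioms(1) by fastforce
  thus "N \<subseteq> carrier M \<and> \<zero>\<^bsub>M\<^esub> \<in> N \<and> (\<forall>x\<in>N. \<forall>y\<in>N. x \<oplus>\<^bsub>M\<^esub> y \<in> N) \<and> (\<forall>a\<in>carrier R. \<forall>x\<in>N. a \<odot>\<^bsub>M\<^esub> x \<in> N)"
   using M.submoduleE[OF s] by blast
 next
  assume N: "N \<subseteq> carrier M \<and> \<zero>\<^bsub>M\<^esub> \<in> N \<and> (\<forall>x\<in>N. \<forall>y\<in>N. x \<oplus>\<^bsub>M\<^esub> y \<in> N) \<and> (\<forall>a\<in>carrier R. \<forall>x\<in>N. a \<odot>\<^bsub>M\<^esub> x \<in> N)"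
  show "submodule N R M"
  proof (rule M.submoduleI)
   fix x assume x: "x \<in> N"
   hence "x \<in> carrier M" using N by blast
   hence "\<ominus>\<^bsub>M\<^esub> x = (\<ominus>\<^bsub>R\<^esub> \<one>\<^bsub>R\<^esub>) \<odot>\<^bsub>M\<^esub> x" by (simp add: M.smult_l_minus)
   thus "\<ominus>\<^bsub>M\<^esub> x \<in> N" using N x M.R.one_closed M.R.a_inv_closed by metis
  qed (use N in blast)+
 qed
qed

lemma submod_neg: assumes "Module.module R M" "submodule N R M" "x \<in> N" shows "\<ominus>\<^bsub>M\<^esub> x \<in> N"
proof -
 interpret M: Module.module R M by fact
 show ?thesis using M.submoduleE(3)[OF assms(2)] assms(3) by blast
qed

lemma submod_finsum: assumes "Module.module R M" "submodule N R M" "!!i. i \<in> A ==> f i \<in> N"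
 shows "finsum M f A \<in> N"
proof -
 interpret M: Module.module R M by fact
 have N: "N \<subseteq> carrier M" "\<zero>\<^bsub>M\<^esub> \<in> N" "!!x y. x \<in> N ==> y \<in> N ==> x \<oplus>\<^bsub>M\<^esub> y \<in> N"
  using assms(2) submod_iff[OF assms(1)] by auto
 show ?thesis
 proof (cases "finite A")
  case True
  thus ?thesis using assms(3)
  proof (induction A)
   case (insert i A)
   hence "f \<in> A \<rightarrow> carrier M" "f i \<in> carrier M" using N(1) by auto
   thus ?case using insert N(3) by simp
  qed (use N in simp)
 qed (use N in simp)
qed

lemma submod_module: "Module.module R M ==> submodule N R M ==> Module.module R (M\<lparr>carrier := N\<rparr>)"
 by (rule submodule.submodule_is_module)

lemma linmap_image_submod: assumes "linmap R M N f" "Module.module R M" "Module.module R N"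
 shows "submodule (f ` carrier M) R N"
proof -
 interpret M: Module.module R M by fact
 have "\<zero>\<^bsub>N\<^esub> \<in> f ` carrier M" using linmap_0[OF assms] by (metis M.M.zero_closed imageI)
 moreover have "f x \<oplus>\<^bsub>N\<^esub> f y \<in> f ` carrier M" if "x \<in> carrier M" "y \<in> carrier M" for x y
  using linmapD(2)[OF assms(1) that] that by (metis M.M.add.m_closed imageI)
 moreover have "a \<odot>\<^bsub>N\<^esub> f x \<in> f ` carrier M" if "x \<in> carrier M" "a \<in> carrier R" for x a
  using linmapD(3)[OF assms(1) that(2,1)] that by (metis M.smult_closed imageI)
 ultimately show ?thesis unfolding submod_iff[OF assms(3)] using linmapD(1)[OF assms(1)] by blast
qed

lemma linmap_preimage_submod: assumes "linmap R M N f" "Module.module R M" "Module.module R N" "submodule K R N"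
 shows "submodule {x \<in> carrier M. f x \<in> K} R M"
proof -
 interpret M: Module.module R M by fact
 show ?thesis unfolding submod_iff[OF assms(2)]
  using assms(4)[unfolded submod_iff[OF assms(3)]] linmapD[OF assms(1)] linmap_0[OF assms(1-3)] by auto
qed

lemma linmap_equalizer_submod: assumes "linmap R M N f" "linmap R M N g" "Module.module R M" "Module.module R N"
 shows "submodule {x \<in> carrier M. f x = g x} R M"
proof -
 interpret M: Module.module R M by fact
 show ?thesis unfolding submod_iff[OF assms(3)]
  using linmapD[OF assms(1)] linmapD[OF assms(2)] linmap_0[OF assms(1,3,4)] linmap_0[OF assms(2,3,4)] by auto
qed

lemma zero_submod: assumes "Module.module R M" shows "submodule {\<zero>\<^bsub>M\<^esub>} R M"
proof -
 interpret M: Module.module R M by fact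
 show ?thesis by (simp add: submod_iff[OF assms])
qed

subsection \<open>Quotients\<close>

locale module_quotient =
 fixes R :: "('l, 'c) ring_scheme" and M :: "('l, 'm) module" and N :: "'m set"
 assumes M: "Module.module R M" and N: "submodule N R M"
begin

sublocale M: Module.module R M by (rule M)

lemma Nsub: "N \<subseteq> carrier M" "\<zero>\<^bsub>M\<^esub> \<in> N" "x \<in> N ==> y \<in> N ==> x \<oplus>\<^bsub>M\<^esub> y \<in> N"
 "a \<in> carrier R ==> x \<in> N ==> a \<odot>\<^bsub>M\<^esub> x \<in> N"
 using N unfolding submod_iff[OF M] by auto

sublocale N: abelian_subgroup N M
 by (rule abelian_subgroupI3[OF additive_subgroup.intro[OF submodule.axioms(1)[OF N]] M.M.abelian_group_axioms])

definition q :: "'m => 'm set" where "q x = N +>\<^bsub>M\<^esub> x"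

lemma q_self: "x \<in> carrier M ==> x \<in> q x"
 unfolding q_def by (rule N.a_rcos_self)

lemma q_mem: "q x = {n \<oplus>\<^bsub>M\<^esub> x | n. n \<in> N}"
 by (auto simp: q_def a_r_coset_def')

lemma q_add_N: "x \<in> carrier M ==> n \<in> N ==> q (n \<oplus>\<^bsub>M\<^esub> x) = q x"
 unfolding q_def by (rule N.a_repr_independence'[symmetric, rotated]) (auto simp: a_r_coset_def')

lemma q_eq_iff: assumes "x \<in> carrier M" "y \<in> carrier M" shows "q x = q y \<longleftrightarrow> x \<ominus>\<^bsub>M\<^esub> y \<in> N"
proof
 assume "q x = q y"
 then obtain n where n: "n \<in> N" "x = n \<oplus>\<^bsub>M\<^esub> y" using q_self[OF assms(1)] by (auto simp: q_mem)
 hence nM: "n \<in> carrier M" using Nsub(1) by blast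
 have "x \<ominus>\<^bsub>M\<^esub> y = n" unfolding n(2) a_minus_def using nM assms(2) by (simp add: M.M.a_assoc M.M.r_neg)
 thus "x \<ominus>\<^bsub>M\<^esub> y \<in> N" using n by simp
next
 assume n: "x \<ominus>\<^bsub>M\<^esub> y \<in> N"
 have "x = (x \<ominus>\<^bsub>M\<^esub> y) \<oplus>\<^bsub>M\<^esub> y" unfolding a_minus_def using assms by (simp add: M.M.a_assoc M.M.l_neg)
 thus "q x = q y" using q_add_N[OF assms(2) n] by simp
qed

lemma q_zero_iff: assumes "x \<in> carrier M" shows "q x = N \<longleftrightarrow> x \<in> N"
proof -
 have "q \<zero>\<^bsub>M\<^esub> = N" using Nsub(1) by (force simp: q_mem)
 thus ?thesis using q_eq_iff[OF assms M.M.zero_closed] assms by (simp add: a_minus_def M.M.neg_zero)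
qed

abbreviation Q where "Q \<equiv> quot_module M N"

lemma Q_carrier: "carrier Q = q ` carrier M"
 by (auto simp: quot_module_def A_RCOSETS_def' q_def)

lemma Q_zero: "\<zero>\<^bsub>Q\<^esub> = N" "\<zero>\<^bsub>Q\<^esub> = q \<zero>\<^bsub>M\<^esub>"
 using q_zero_iff[of "\<zero>\<^bsub>M\<^esub>"] Nsub(2) by (simp_all add: quot_module_def)

lemma Q_add: "x \<in> carrier M ==> y \<in> carrier M ==> q x \<oplus>\<^bsub>Q\<^esub> q y = q (x \<oplus>\<^bsub>M\<^esub> y)"
 using N.a_rcos_sum by (simp add: quot_module_def q_def)

lemma Q_smult: assumes "a \<in> carrier R" "x \<in> carrier M" shows "a \<odot>\<^bsub>Q\<^esub> q x = q (a \<odot>\<^bsub>M\<^esub> x)"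
proof -
 have "q (a \<odot>\<^bsub>M\<^esub> c) = q (a \<odot>\<^bsub>M\<^esub> x)" if "c \<in> q x" for c
 proof -
  obtain n where n: "n \<in> N" "c = n \<oplus>\<^bsub>M\<^esub> x" using \<open>c \<in> q x\<close> by (auto simp: q_mem)
  hence "a \<odot>\<^bsub>M\<^esub> c = a \<odot>\<^bsub>M\<^esub> n \<oplus>\<^bsub>M\<^esub> a \<odot>\<^bsub>M\<^esub> x" using assms Nsub(1) M.smult_r_distr by auto
  thus ?thesis using q_add_N[of "a \<odot>\<^bsub>M\<^esub> x" "a \<odot>\<^bsub>M\<^esub> n"] assms n Nsub by simp
 qed
 hence "(\<Union>c\<in>q x. q (a \<odot>\<^bsub>M\<^esub> c)) = q (a \<odot>\<^bsub>M\<^esub> x)" using q_self[OF assms(2)] by blast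
 thus ?thesis by (simp add: quot_module_def coset_map_def q_def)
qed

lemma Q_module: "Module.module R Q"
proof (rule moduleI)
 show "cring R" by (rule M.R.cring_axioms)
 show "abelian_group Q"
 proof (rule abelian_groupI)
  fix C assume "C \<in> carrier Q"
  then obtain x where "x \<in> carrier M" "C = q x" by (auto simp: Q_carrier)
  thus "\<exists>Y\<in>carrier Q. Y \<oplus>\<^bsub>Q\<^esub> C = \<zero>\<^bsub>Q\<^esub>"
   by (intro bexI[of _ "q (\<ominus>\<^bsub>M\<^esub> x)"]) (auto simp: Q_carrier Q_add M.M.l_neg Q_zero(2))
 qed (auto simp: Q_carrier Q_add Q_zero(2) M.M.a_ac)
qed (auto simp: Q_carrier Q_add Q_smult M.smult_l_distr M.smult_r_distr M.smult_assoc1)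

lemma q_linmap: "linmap R M Q q"
 by (rule linmapI) (auto simp: Q_carrier Q_add Q_smult)

lemma coset_map_quot: assumes "module_quotient R M' N'" "linmap R M M' f" "!!n. n \<in> N ==> f n \<in> N'" "x \<in> carrier M"
 shows "coset_map M' N' f (q x) = N' +>\<^bsub>M'\<^esub> f x"
proof -
 interpret Q': module_quotient R M' N' by fact
 have "Q'.q (f c) = Q'.q (f x)" if "c \<in> q x" for c
 proof -
  obtain n where n: "n \<in> N" "c = n \<oplus>\<^bsub>M\<^esub> x" using \<open>c \<in> q x\<close> by (auto simp: q_mem)
  thus ?thesis using linmapD(2)[OF assms(2)] Nsub(1) assms Q'.q_add_N linmapD(1)[OF assms(2)] by auto
 qed
 hence "(\<Union>c\<in>q x. Q'.q (f c)) = Q'.q (f x)" using q_self[OF assms(4)] by blast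
 thus ?thesis by (simp add: coset_map_def Q'.q_def)
qed

lemma coset_map_linmap: assumes "module_quotient R M' N'" "linmap R M M' f" "!!n. n \<in> N ==> f n \<in> N'"
 shows "linmap R Q (quot_module M' N') (coset_map M' N' f)"
proof -
 interpret Q': module_quotient R M' N' by fact
 have e: "x \<in> carrier M ==> coset_map M' N' f (q x) = Q'.q (f x)" for x
  using coset_map_quot[OF assms] by (simp add: Q'.q_def)
 show ?thesis
  by (rule linmapI) (auto simp: Q_carrier Q'.Q_carrier Q_add Q_smult e linmapD[OF assms(2)] Q'.Q_add Q'.Q_smult)
qed

end

subsection \<open>Direct sums\<close>

text \<open>Collected for pointwise arithmetic in direct sums, where the module varies with the
  index.\<close>

lemma (in Module.module) module_arith:
 shows "\<zero>\<^bsub>M\<^esub> \<in> carrier M"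
  "x \<in> carrier M ==> y \<in> carrier M ==> x \<oplus>\<^bsub>M\<^esub> y \<in> carrier M"
  "a \<in> carrier R ==> x \<in> carrier M ==> a \<odot>\<^bsub>M\<^esub> x \<in> carrier M"
  "x \<in> carrier M ==> \<ominus>\<^bsub>M\<^esub> x \<in> carrier M"
  "x \<in> carrier M ==> \<ominus>\<^bsub>M\<^esub> x \<oplus>\<^bsub>M\<^esub> x = \<zero>\<^bsub>M\<^esub>"
  "x \<in> carrier M ==> x \<oplus>\<^bsub>M\<^esub> \<ominus>\<^bsub>M\<^esub> x = \<zero>\<^bsub>M\<^esub>"
  "x \<in> carrier M ==> \<zero>\<^bsub>M\<^esub> \<oplus>\<^bsub>M\<^esub> x = x"
  "x \<in> carrier M ==> x \<oplus>\<^bsub>M\<^esub> \<zero>\<^bsub>M\<^esub> = x"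
  "a \<in> carrier R ==> a \<odot>\<^bsub>M\<^esub> \<zero>\<^bsub>M\<^esub> = \<zero>\<^bsub>M\<^esub>"
  "x \<in> carrier M ==> y \<in> carrier M ==> x \<oplus>\<^bsub>M\<^esub> y = y \<oplus>\<^bsub>M\<^esub> x"
  "x \<in> carrier M ==> y \<in> carrier M ==> z \<in> carrier M ==> x \<oplus>\<^bsub>M\<^esub> y \<oplus>\<^bsub>M\<^esub> z = x \<oplus>\<^bsub>M\<^esub> (y \<oplus>\<^bsub>M\<^esub> z)"
  "x \<in> carrier M ==> y \<in> carrier M ==> z \<in> carrier M ==> x \<oplus>\<^bsub>M\<^esub> (y \<oplus>\<^bsub>M\<^esub> z) = y \<oplus>\<^bsub>M\<^esub> (x \<oplus>\<^bsub>M\<^esub> z)"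
  "\<ominus>\<^bsub>M\<^esub> \<zero>\<^bsub>M\<^esub> = \<zero>\<^bsub>M\<^esub>"
 by (simp_all add: M.l_neg M.r_neg M.a_ac M.neg_zero)

locale direct_sum_modules =
 fixes R :: "('l, 'c) ring_scheme" and I :: "'i set" and M :: "'i => ('l, 'm) module"
 assumes R: "cring R" and M: "!!i. i \<in> I ==> Module.module R (M i)"
begin

abbreviation DS where "DS \<equiv> direct_sum I M"

lemmas mod_facts = module.module_arith[OF M]

lemma DS_mem: "c \<in> carrier DS \<longleftrightarrow> c \<in> extensional I \<and> (\<forall>i\<in>I. c i \<in> carrier (M i)) \<and> finite {i\<in>I. c i ~= \<zero>\<^bsub>M i\<^esub>}"
 by (auto simp: direct_sum_def PiE_def)

lemma DS_apply: "i \<in> I ==> (c \<oplus>\<^bsub>DS\<^esub> c') i = c i \<oplus>\<^bsub>M i\<^esub> c' i"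
 "i \<in> I ==> (a \<odot>\<^bsub>DS\<^esub> c) i = a \<odot>\<^bsub>M i\<^esub> c i" "i \<in> I ==> \<zero>\<^bsub>DS\<^esub> i = \<zero>\<^bsub>M i\<^esub>"
 by (simp_all add: direct_sum_def)

lemma DS_ext: "c \<oplus>\<^bsub>DS\<^esub> c' \<in> extensional I" "a \<odot>\<^bsub>DS\<^esub> c \<in> extensional I" "\<zero>\<^bsub>DS\<^esub> \<in> extensional I"
 by (simp_all add: direct_sum_def)

lemma DS_closed: "c \<in> carrier DS ==> c' \<in> carrier DS ==> c \<oplus>\<^bsub>DS\<^esub> c' \<in> carrier DS"
 "a \<in> carrier R ==> c \<in> carrier DS ==> a \<odot>\<^bsub>DS\<^esub> c \<in> carrier DS" "\<zero>\<^bsub>DS\<^esub> \<in> carrier DS"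
proof -
 show "c \<oplus>\<^bsub>DS\<^esub> c' \<in> carrier DS" if c: "c \<in> carrier DS" "c' \<in> carrier DS"
 proof -
  let ?S = "{i\<in>I. (c \<oplus>\<^bsub>DS\<^esub> c') i ~= \<zero>\<^bsub>M i\<^esub>}"
  have "?S \<subseteq> {i\<in>I. c i ~= \<zero>\<^bsub>M i\<^esub>} \<union> {i\<in>I. c' i ~= \<zero>\<^bsub>M i\<^esub>}"
   by (auto simp: DS_apply mod_facts)
  hence "finite ?S" by (rule finite_subset) (use c in "simp add: DS_mem")
  thus ?thesis unfolding DS_mem using c DS_ext by (intro conjI ballI) (auto simp: DS_mem DS_apply mod_facts)
 qed
 show "a \<odot>\<^bsub>DS\<^esub> c \<in> carrier DS" if c: "a \<in> carrier R" "c \<in> carrier DS"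
 proof -
  let ?S = "{i\<in>I. (a \<odot>\<^bsub>DS\<^esub> c) i ~= \<zero>\<^bsub>M i\<^esub>}"
  have "?S \<subseteq> {i\<in>I. c i ~= \<zero>\<^bsub>M i\<^esub>}"
   using c by (auto simp: DS_apply mod_facts)
  hence "finite ?S" by (rule finite_subset) (use c in "simp add: DS_mem")
  thus ?thesis unfolding DS_mem using c DS_ext by (intro conjI ballI) (auto simp: DS_mem DS_apply mod_facts)
 qed
 have "{i\<in>I. \<zero>\<^bsub>DS\<^esub> i ~= \<zero>\<^bsub>M i\<^esub>} = {}" by (auto simp: DS_apply)
 hence "finite {i\<in>I. \<zero>\<^bsub>DS\<^esub> i ~= \<zero>\<^bsub>M i\<^esub>}" by (simp only: finite.emptyI)
 thus "\<zero>\<^bsub>DS\<^esub> \<in> carrier DS" unfolding DS_mem using DS_ext by (intro conjI ballI) (auto simp: DS_apply mod_facts)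
qed

lemma DS_eqI: assumes "c \<in> carrier DS" "c' \<in> carrier DS" "!!i. i \<in> I ==> c i = c' i" shows "c = c'"
 by (rule extensionalityI[of _ I]) (use assms in "auto simp: DS_mem")

lemma DS_module: "Module.module R DS"
proof (rule moduleI)
 show "abelian_group DS"
 proof (rule abelian_groupI)
  fix c assume c: "c \<in> carrier DS"
  let ?n = "\<lambda>i\<in>I. \<ominus>\<^bsub>M i\<^esub> c i"
  have "{i\<in>I. ?n i ~= \<zero>\<^bsub>M i\<^esub>} \<subseteq> {i\<in>I. c i ~= \<zero>\<^bsub>M i\<^esub>}" by (auto simp: mod_facts)
  hence "finite {i\<in>I. ?n i ~= \<zero>\<^bsub>M i\<^esub>}" by (rule finite_subset) (use c in "simp add: DS_mem")
  hence "?n \<in> carrier DS" unfolding DS_mem using c by (intro conjI ballI) (auto simp: DS_mem mod_facts)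
  moreover have "?n \<oplus>\<^bsub>DS\<^esub> c = \<zero>\<^bsub>DS\<^esub>"
   by (rule DS_eqI) (use c calculation DS_closed in "auto simp: DS_apply DS_mem mod_facts")
  ultimately show "\<exists>y\<in>carrier DS. y \<oplus>\<^bsub>DS\<^esub> c = \<zero>\<^bsub>DS\<^esub>" by blast
 next
  fix x y z assume "x \<in> carrier DS" "y \<in> carrier DS" "z \<in> carrier DS"
  thus "x \<oplus>\<^bsub>DS\<^esub> y \<oplus>\<^bsub>DS\<^esub> z = x \<oplus>\<^bsub>DS\<^esub> (y \<oplus>\<^bsub>DS\<^esub> z)"
   by (intro DS_eqI DS_closed) (auto simp: DS_apply DS_mem mod_facts)
 next
  fix x y assume "x \<in> carrier DS" "y \<in> carrier DS"
  thus "x \<oplus>\<^bsub>DS\<^esub> y = y \<oplus>\<^bsub>DS\<^esub> x"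
   by (intro DS_eqI DS_closed) (auto simp: DS_apply DS_mem mod_facts)
 next
  fix x assume "x \<in> carrier DS"
  thus "\<zero>\<^bsub>DS\<^esub> \<oplus>\<^bsub>DS\<^esub> x = x"
   by (intro DS_eqI DS_closed) (auto simp: DS_apply DS_mem mod_facts)
 qed (auto intro: DS_closed)
 interpret cring R by (rule R)
 fix a b x y assume a: "a \<in> carrier R" "b \<in> carrier R" and x: "x \<in> carrier DS"
 show "(a \<oplus>\<^bsub>R\<^esub> b) \<odot>\<^bsub>DS\<^esub> x = a \<odot>\<^bsub>DS\<^esub> x \<oplus>\<^bsub>DS\<^esub> b \<odot>\<^bsub>DS\<^esub> x"
  using a x by (intro DS_eqI DS_closed) (auto simp: DS_apply DS_mem module.smult_l_distr[OF M])
 show "(a \<otimes>\<^bsub>R\<^esub> b) \<odot>\<^bsub>DS\<^esub> x = a \<odot>\<^bsub>DS\<^esub> (b \<odot>\<^bsub>DS\<^esub> x)"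
  using a x by (intro DS_eqI DS_closed) (auto simp: DS_apply DS_mem module.smult_assoc1[OF M])
next
 fix a x y assume "a \<in> carrier R" "x \<in> carrier DS" "y \<in> carrier DS"
 thus "a \<odot>\<^bsub>DS\<^esub> (x \<oplus>\<^bsub>DS\<^esub> y) = a \<odot>\<^bsub>DS\<^esub> x \<oplus>\<^bsub>DS\<^esub> a \<odot>\<^bsub>DS\<^esub> y"
  by (intro DS_eqI DS_closed) (auto simp: DS_apply DS_mem module.smult_r_distr[OF M])
next
 interpret cring R by (rule R)
 fix x assume "x \<in> carrier DS"
 thus "\<one>\<^bsub>R\<^esub> \<odot>\<^bsub>DS\<^esub> x = x"
  by (intro DS_eqI DS_closed) (auto simp: DS_apply DS_mem module.smult_one[OF M])
qed (use R DS_closed in auto)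

definition single :: "'i => 'm => 'i => 'm" where
 "single i f = (\<lambda>j\<in>I. if j = i then f else \<zero>\<^bsub>M j\<^esub>)"

lemma single_apply: "j \<in> I ==> single i f j = (if j = i then f else \<zero>\<^bsub>M j\<^esub>)"
 by (simp add: single_def)

lemma single_mem: assumes "i \<in> I" "f \<in> carrier (M i)" shows "single i f \<in> carrier DS"
proof -
 have "{j\<in>I. single i f j ~= \<zero>\<^bsub>M j\<^esub>} \<subseteq> {i}" by (auto simp: single_def)
 hence "finite {j\<in>I. single i f j ~= \<zero>\<^bsub>M j\<^esub>}" by (rule finite_subset) simp
 thus ?thesis unfolding DS_mem using assms by (intro conjI ballI) (auto simp: single_def mod_facts)
qed

lemma single_linmap: assumes "i \<in> I" shows "linmap R (M i) DS (single i)"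
proof (rule linmapI)
 fix x y assume "x \<in> carrier (M i)" "y \<in> carrier (M i)"
 thus "single i (x \<oplus>\<^bsub>M i\<^esub> y) = single i x \<oplus>\<^bsub>DS\<^esub> single i y"
  using assms by (intro DS_eqI DS_closed single_mem) (auto simp: DS_apply single_apply mod_facts)
next
 fix a x assume "a \<in> carrier R" "x \<in> carrier (M i)"
 thus "single i (a \<odot>\<^bsub>M i\<^esub> x) = a \<odot>\<^bsub>DS\<^esub> single i x"
  using assms by (intro DS_eqI DS_closed single_mem) (auto simp: DS_apply single_apply mod_facts)
qed (use single_mem assms in auto)

lemma DS_split: assumes "c \<in> carrier DS" "i \<in> I"
 shows "c(i := \<zero>\<^bsub>M i\<^esub>) \<in> carrier DS" "c = c(i := \<zero>\<^bsub>M i\<^esub>) \<oplus>\<^bsub>DS\<^esub> single i (c i)"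
proof -
 have "{j\<in>I. (c(i := \<zero>\<^bsub>M i\<^esub>)) j ~= \<zero>\<^bsub>M j\<^esub>} \<subseteq> {j\<in>I. c j ~= \<zero>\<^bsub>M j\<^esub>}" by auto
 hence "finite {j\<in>I. (c(i := \<zero>\<^bsub>M i\<^esub>)) j ~= \<zero>\<^bsub>M j\<^esub>}"
  by (rule finite_subset) (use assms in "simp add: DS_mem")
 thus 1: "c(i := \<zero>\<^bsub>M i\<^esub>) \<in> carrier DS"
  unfolding DS_mem using assms by (intro conjI ballI) (auto simp: DS_mem mod_facts extensional_def)
 show "c = c(i := \<zero>\<^bsub>M i\<^esub>) \<oplus>\<^bsub>DS\<^esub> single i (c i)"
  by (rule DS_eqI[OF assms(1) DS_closed(1)[OF 1 single_mem]])
   (use assms in "auto simp: DS_apply single_apply mod_facts DS_mem")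
qed

text \<open>Induction on the number of nonzero coordinates, which are split off one at a
  time.\<close>

lemma DS_induct [consumes 1]: assumes "c \<in> carrier DS" "P \<zero>\<^bsub>DS\<^esub>"
 "!!c c'. c \<in> carrier DS ==> c' \<in> carrier DS ==> P c ==> P c' ==> P (c \<oplus>\<^bsub>DS\<^esub> c')"
 "!!i f. i \<in> I ==> f \<in> carrier (M i) ==> P (single i f)" shows "P c"
 using assms(1)
proof (induction "card {i\<in>I. c i ~= \<zero>\<^bsub>M i\<^esub>}" arbitrary: c rule: less_induct)
 case less
 have fin: "finite {i\<in>I. c i ~= \<zero>\<^bsub>M i\<^esub>}" using less(2) by (simp add: DS_mem)
 show ?case
 proof (cases "{i\<in>I. c i ~= \<zero>\<^bsub>M i\<^esub>} = {}")
  case True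
  hence "c = \<zero>\<^bsub>DS\<^esub>" by (intro DS_eqI less(2) DS_closed) (auto simp: DS_apply)
  thus ?thesis using assms(2) by simp
 next
  case False
  then obtain i where i: "i \<in> I" "c i ~= \<zero>\<^bsub>M i\<^esub>" by blast
  note s = DS_split[OF less(2) i(1)]
  have "{j\<in>I. (c(i := \<zero>\<^bsub>M i\<^esub>)) j ~= \<zero>\<^bsub>M j\<^esub>} \<subset> {j\<in>I. c j ~= \<zero>\<^bsub>M j\<^esub>}" using i by auto
  hence "card {j\<in>I. (c(i := \<zero>\<^bsub>M i\<^esub>)) j ~= \<zero>\<^bsub>M j\<^esub>} < card {j\<in>I. c j ~= \<zero>\<^bsub>M j\<^esub>}"
   using fin by (rule psubset_card_mono[rotated])
  hence "P (c(i := \<zero>\<^bsub>M i\<^esub>))" using less(1) s(1) by blast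
  moreover have ci: "c i \<in> carrier (M i)" using less(2) i by (simp add: DS_mem)
  ultimately show ?thesis using assms(3,4) s single_mem[OF i(1) ci] i(1) by metis
 qed
qed

end

lemma subrep_generated_eqI: assumes "Module.module R M" "S \<subseteq> carrier M"
 "!!h x. h \<in> H ==> x \<in> carrier M ==> \<rho> h x \<in> carrier M"
 "!!N. submodule N R M ==> (!!h x. h \<in> H ==> x \<in> N ==> \<rho> h x \<in> N) ==> S \<subseteq> N ==> carrier M \<subseteq> N"
 shows "subrep_generated R M H \<rho> S = carrier M"
proof -
 interpret M: Module.module R M by fact
 have "carrier M \<in> {N. submodule N R M \<and> (\<forall>h\<in>H. \<forall>x\<in>N. \<rho> h x \<in> N) \<and> S \<subseteq> N}"
  using M.carrier_is_submodule assms(2,3) by blast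
 thus ?thesis unfolding subrep_generated_def using assms(4) by (intro equalityI Inter_lower Inter_greatest) auto
qed

lemma subrep_generated_le: assumes "submodule N R M" "!!h x. h \<in> H ==> x \<in> N ==> \<rho> h x \<in> N" "S \<subseteq> N"
 shows "subrep_generated R M H \<rho> S \<subseteq> N"
 unfolding subrep_generated_def using assms by blast

section \<open>Coefficient systems and their homology\<close>

abbreviation Ob :: "('f, 'l, 'm) coeff_system => 'f tree_simplex => 'm set" where
 "Ob F \<tau> \<equiv> carrier (obj F \<tau>)"

lemma (in abelian_monoid) finsum_only: assumes "finite A" "!!j. j \<in> A ==> j ~= i ==> f j = \<zero>" "i \<in> A ==> f i \<in> carrier G"
 shows "finsum G f A = (if i \<in> A then f i else \<zero>)"
proof -
 have z: "finsum G f (A - {i}) = \<zero>"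
 proof -
  have "finsum G f (A - {i}) = finsum G (\<lambda>_. \<zero>) (A - {i})" by (rule finsum_cong') (use assms(2) in auto)
  thus ?thesis by simp
 qed
 show ?thesis
 proof (cases "i \<in> A")
  case True
  hence "finsum G f A = finsum G f (insert i (A - {i}))" by (simp add: insert_absorb)
  also have "\<dots> = f i \<oplus> finsum G f (A - {i})"
   by (rule finsum_insert) (use assms True in auto)
  finally show ?thesis using z True assms(3) by simp
 qed (use z in simp)
qed

locale coeff = tree_level v p e for v :: "'f::field => int" and p e :: nat +
 fixes \<Lambda> :: "('l, 'c) ring_scheme" and F :: "('f, 'l, 'm) coeff_system"
 assumes F: "F \<in> cat_C0 v p e \<Lambda>"
begin

lemma F_equivariant: "equivariant_coeff_system v \<Lambda> F"
 using F by (simp add: cat_C0_def cat_C_def)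

lemma F_mod: "\<tau> \<in> SS ==> Module.module \<Lambda> (obj F \<tau>)"
 using F_equivariant by (simp add: equivariant_coeff_system_def)

lemma F_modV: "x \<in> VV ==> Module.module \<Lambda> (obj F {x})" and F_modE: "\<tau> \<in> EE ==> Module.module \<Lambda> (obj F \<tau>)"
 by (auto intro: F_mod vertex_simplex edge_simplex)

lemma F_tr: assumes "\<tau> \<in> EE" "x \<in> \<tau>" shows "linmap \<Lambda> (obj F \<tau>) (obj F {x}) (trans_map F \<tau> x)"
proof -
 have "\<forall>\<tau>\<in>EE. \<forall>x\<in>\<tau>. linear_on \<Lambda> (obj F \<tau>) (obj F {x}) (trans_map F \<tau> x)"
  using F_equivariant unfolding equivariant_coeff_system_def by (elim conjE) assumption
 thus ?thesis using linear_on_iff[OF F_modE[OF assms(1)]] assms by blast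
qed

lemma F_act: assumes "det g ~= 0" "\<tau> \<in> SS"
 shows "linmap \<Lambda> (obj F \<tau>) (obj F (act_simplex g \<tau>)) (act_map F g \<tau>)"
proof -
 have "\<forall>g\<in>carrier GL2. \<forall>\<tau>\<in>SS. linear_on \<Lambda> (obj F \<tau>) (obj F (act_simplex g \<tau>)) (act_map F g \<tau>)"
  using F_equivariant unfolding equivariant_coeff_system_def by (elim conjE) assumption
 moreover have "g \<in> carrier GL2" using assms(1) by (simp add: GL2_carrier)
 ultimately have "linear_on \<Lambda> (obj F \<tau>) (obj F (act_simplex g \<tau>)) (act_map F g \<tau>)" using assms(2) by blast
 thus ?thesis by (rule iffD1[OF linear_on_iff[OF F_mod[OF assms(2)]]])
qed

lemma F_act_mult: assumes "det g ~= 0" "det h ~= 0" "\<tau> \<in> SS" "f \<in> Ob F \<tau>"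
 shows "act_map F (g ** h) \<tau> f = act_map F g (act_simplex h \<tau>) (act_map F h \<tau> f)"
proof -
 have "\<forall>g\<in>carrier GL2. \<forall>h\<in>carrier GL2. \<forall>\<tau>\<in>SS. \<forall>f\<in>Ob F \<tau>.
    act_map F g (act_simplex h \<tau>) (act_map F h \<tau> f) = act_map F (g ** h) \<tau> f"
  using F_equivariant unfolding equivariant_coeff_system_def by (elim conjE) assumption
 thus ?thesis using assms by (simp add: GL2_carrier)
qed

lemma F_act_1: assumes "\<tau> \<in> SS" "f \<in> Ob F \<tau>" shows "act_map F (mat 1) \<tau> f = f"
proof -
 have "\<forall>\<tau>\<in>SS. \<forall>f\<in>Ob F \<tau>. act_map F (mat 1) \<tau> f = f"
  using F_equivariant unfolding equivariant_coeff_system_def by (elim conjE) assumption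
 thus ?thesis using assms by simp
qed

lemma F_act_tr: assumes "det g ~= 0" "\<tau> \<in> EE" "x \<in> \<tau>" "f \<in> Ob F \<tau>"
 shows "trans_map F (act_simplex g \<tau>) (actv g x) (act_map F g \<tau> f) = act_map F g {x} (trans_map F \<tau> x f)"
proof -
 have "\<forall>g\<in>carrier GL2. \<forall>\<tau>\<in>EE. \<forall>x\<in>\<tau>. \<forall>f\<in>Ob F \<tau>.
    trans_map F (act_simplex g \<tau>) (actv g x) (act_map F g \<tau> f) = act_map F g {x} (trans_map F \<tau> x f)"
  using F_equivariant unfolding equivariant_coeff_system_def by (elim conjE) assumption
 thus ?thesis using assms by (simp add: GL2_carrier)
qed

lemma F_U: assumes "\<tau> \<in> SS" "g \<in> U_group v p e \<tau>" "f \<in> Ob F \<tau>" shows "act_map F g \<tau> f = f"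
 using F assms by (simp add: cat_C0_def cat_C_def)

lemma F_sc: assumes "c ~= 0" "\<tau> \<in> SS" "f \<in> Ob F \<tau>" shows "act_map F (sc c) \<tau> f = f"
proof -
 have "sc c \<in> GL2_centre" using assms(1) unfolding GL2_centre_eq by blast
 thus ?thesis using F assms(2,3) by (simp add: cat_C0_def)
qed

lemma F_edge: assumes "\<tau> \<in> EE" "z \<in> \<tau>"
 shows F_inj: "inj_on (trans_map F \<tau> z) (Ob F \<tau>)"
 and F_image: "trans_map F \<tau> z ` Ob F \<tau> =
   {f \<in> Ob F {z}. \<forall>g\<in>U_group v p e \<tau>. act_map F g {z} f = f}"
 and F_gen: "subrep_generated \<Lambda> (obj F {z}) (K_group v z) (\<lambda>g. act_map F g {z})
   (trans_map F \<tau> z ` Ob F \<tau>) = Ob F {z}"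
proof -
 have "\<forall>\<eta>\<in>EE. \<forall>z\<in>\<eta>. inj_on (trans_map F \<eta> z) (Ob F \<eta>) \<and>
    trans_map F \<eta> z ` Ob F \<eta> =
     {f \<in> Ob F {z}. \<forall>g\<in>U_group v p e \<eta>. act_map F g {z} f = f} \<and>
    subrep_generated \<Lambda> (obj F {z}) (K_group v z) (\<lambda>g. act_map F g {z})
     (trans_map F \<eta> z ` Ob F \<eta>) = Ob F {z}"
  using F unfolding cat_C0_def cat_C_def by (elim CollectE conjE) assumption
 note E = bspec[OF bspec[OF this assms(1)] assms(2)]
 show "inj_on (trans_map F \<tau> z) (Ob F \<tau>)" using E by (elim conjE)
 show "trans_map F \<tau> z ` Ob F \<tau> =
   {f \<in> Ob F {z}. \<forall>g\<in>U_group v p e \<tau>. act_map F g {z} f = f}" using E by (elim conjE)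
 show "subrep_generated \<Lambda> (obj F {z}) (K_group v z) (\<lambda>g. act_map F g {z})
   (trans_map F \<tau> z ` Ob F \<tau>) = Ob F {z}" using E by (elim conjE)
qed

lemma F_tr_zero: "\<tau> \<in> EE ==> z \<in> \<tau> ==> f \<in> Ob F \<tau> ==> trans_map F \<tau> z f = \<zero>\<^bsub>obj F {z}\<^esub> \<longleftrightarrow> f = \<zero>\<^bsub>obj F \<tau>\<^esub>"
proof -
 assume a: "\<tau> \<in> EE" "z \<in> \<tau>" "f \<in> Ob F \<tau>"
 interpret T: Module.module \<Lambda> "obj F \<tau>" by (rule F_modE[OF a(1)])
 show "trans_map F \<tau> z f = \<zero>\<^bsub>obj F {z}\<^esub> \<longleftrightarrow> f = \<zero>\<^bsub>obj F \<tau>\<^esub>"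
  using linmap_0[OF F_tr[OF a(1,2)] F_modE[OF a(1)] F_modV[OF edge_subset[OF a(1,2)]]]
   inj_onD[OF F_inj[OF a(1,2)], of f "\<zero>\<^bsub>obj F \<tau>\<^esub>"] a(3) by auto
qed

lemma \<Lambda>_cring: "cring \<Lambda>"
proof -
 obtain x where "x \<in> VV" using vx_vertex[of "mat 1"] by auto
 thus ?thesis using F_modV[of x] unfolding Module.module_def by blast
qed

text \<open>Two matrices with the same effect on the ball differ by a scalar times an element of
  U_x^(e) for a vertex \<open>x\<close> of the simplex (\<open>fix_ball\<close>). The scalar acts
  trivially because the centre does, the other factor by condition (a).\<close>

lemma hat_act_eq: assumes "\<tau> \<in> SS" "\<tau> ~= {}" "det g' ~= 0" "!!x. x \<in> ball \<tau> ==> g x = actv g' x" "f \<in> Ob F \<tau>"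
 shows "hat_act v e F g \<tau> f = act_map F g' \<tau> f"
proof -
 define s where "s = (SOME g'. g' \<in> carrier GL2 \<and> (\<forall>x\<in>ball \<tau>. g x = actv g' x))"
 have "s \<in> carrier GL2 \<and> (\<forall>x\<in>ball \<tau>. g x = actv s x)"
  unfolding s_def by (rule someI[of _ g']) (use assms in "auto simp: GL2_carrier")
 hence s: "det s ~= 0" "!!x. x \<in> ball \<tau> ==> actv s x = actv g' x"
  using assms(4) by (auto simp: GL2_carrier)
 define t where "t = minv g' ** s"
 have t: "det t ~= 0" "s = g' ** t" using s assms by (simp_all add: t_def det_mult2 det_minv_nz minv_cancel)
 have tf: "actv t x = x" if "x \<in> ball \<tau>" for x
 proof -
  have "x \<in> VV" using that by (simp add: ball_mem)
  thus ?thesis using s(2)[OF that] act_minv(1)[OF assms(3)] by (simp add: t_def act_vertex_mult)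
 qed
 have tV: "x \<in> \<tau> ==> x \<in> VV \<and> actv t x = x" for x
  using simplex_subset[OF assms(1)] tf ball_self by blast
 obtain x where x: "x \<in> \<tau>" using assms(2) by blast
 hence "x \<in> VV" using tV by blast
 have "actv t y = y" if "y \<in> VV" "d x y <= e" for y using tf that x by (auto simp: ball_mem)
 then obtain c u where u: "c ~= 0" "u \<in> Ux x" "t = sc c ** u" using fix_ball[OF \<open>x \<in> VV\<close> t(1)] by blast
 have du: "det u ~= 0" using subgroup_GL2D(1)[OF Ux_subgroup[OF \<open>x \<in> VV\<close>] u(2)] .
 have ut: "actv u y = actv t y" if "y \<in> VV" for y
  using that u(1,3) du by (simp add: act_vertex_mult act_vertex_sc act_vertex_VV)
 have "act_simplex t \<tau> = \<tau>" "act_simplex u \<tau> = \<tau>"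
  using tV ut unfolding act_simplex_def by (force simp: image_iff)+
 moreover have "u \<in> U_group v p e \<tau>" by (rule Ux_US[OF assms(1) x u(2)])
 ultimately have "act_map F t \<tau> f = f" unfolding u(3)
  using F_act_mult[of "sc c" u \<tau> f] du u(1) assms(1,5) F_U F_sc by (simp add: det_sc)
 hence "act_map F s \<tau> f = act_map F g' \<tau> f"
  unfolding t(2) using F_act_mult[OF assms(3) t(1) assms(1,5)] \<open>act_simplex t \<tau> = \<tau>\<close> by simp
 thus ?thesis unfolding hat_act_def s_def[symmetric] .
qed

lemma hat_act_vertex: assumes "g \<in> GG" "x \<in> VV"
 obtains g' where "det g' ~= 0" "g x = actv g' x" "!!z. z \<in> ball {x} ==> g z = actv g' z"
  "!!f. f \<in> Ob F {x} ==> hat_act v e F g {x} f = act_map F g' {x} f"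
proof -
 obtain g' where g': "det g' ~= 0" "!!z. z \<in> ball {x} ==> g z = actv g' z" using GG_vertex[OF assms] by blast
 moreover have "g x = actv g' x" using g'(2)[OF ball_self[OF assms(2)]] by simp
 ultimately show thesis using that hat_act_eq[OF vertex_simplex[OF assms(2)]] by blast
qed

lemma hat_act_linmap: assumes "g \<in> GG" "x \<in> VV"
 shows "linmap \<Lambda> (obj F {x}) (obj F {g x}) (hat_act v e F g {x})"
proof -
 obtain g' where g': "det g' ~= 0" "g x = actv g' x"
  "!!f. f \<in> Ob F {x} ==> hat_act v e F g {x} f = act_map F g' {x} f"
  using hat_act_vertex[OF assms] by metis
 have "linmap \<Lambda> (obj F {x}) (obj F {g x}) (act_map F g' {x})"
  using F_act[OF g'(1) vertex_simplex[OF assms(2)]] g'(2) by (simp add: act_simplex_vertex)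
 thus ?thesis using linmap_cong F_modV[OF assms(2)] g'(3) by blast
qed

lemma hat_act_mult: assumes "g \<in> GG" "h \<in> GG" "x \<in> VV" "f \<in> Ob F {x}"
 shows "hat_act v e F (g \<otimes>\<^bsub>hG\<^esub> h) {x} f = hat_act v e F g {h x} (hat_act v e F h {x} f)"
proof -
 obtain h' where h': "det h' ~= 0" "h x = actv h' x" "!!z. z \<in> ball {x} ==> h z = actv h' z"
  "!!f. f \<in> Ob F {x} ==> hat_act v e F h {x} f = act_map F h' {x} f"
  using hat_act_vertex[OF assms(2,3)] by metis
 have hx: "h x \<in> VV" using LC_D(3)[OF assms(2,3)] .
 obtain g' where g': "det g' ~= 0" "!!z. z \<in> ball {h x} ==> g z = actv g' z"
  "!!f. f \<in> Ob F {h x} ==> hat_act v e F g {h x} f = act_map F g' {h x} f"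
  using hat_act_vertex[OF assms(1) hx] by metis
 have "(g \<otimes>\<^bsub>hG\<^esub> h) z = actv (g' ** h') z" if z: "z \<in> ball {x}" for z
 proof -
  have "actv h' z \<in> ball {h x}" using ball_act[OF h'(1) _ z] assms(3) h'(2) by (simp add: act_simplex_vertex)
  thus ?thesis using z h'(3)[OF z] g'(2) assms by (simp add: hG_mult_apply act_vertex_mult ball_mem)
 qed
 hence "hat_act v e F (g \<otimes>\<^bsub>hG\<^esub> h) {x} f = act_map F (g' ** h') {x} f"
  using g'(1) h'(1) assms by (intro hat_act_eq vertex_simplex) (auto simp: det_mult2)
 also have "\<dots> = act_map F g' {h x} (act_map F h' {x} f)"
  using F_act_mult[OF g'(1) h'(1) vertex_simplex[OF assms(3)] assms(4)] h'(2) by (simp add: act_simplex_vertex)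
 also have "act_map F h' {x} f \<in> Ob F {h x}"
  using linmapD(1)[OF F_act[OF h'(1) vertex_simplex[OF assms(3)]] assms(4)] h'(2) by (simp add: act_simplex_vertex)
 hence "act_map F g' {h x} (act_map F h' {x} f) = hat_act v e F g {h x} (hat_act v e F h {x} f)"
  using g'(3) h'(4)[OF assms(4)] by simp
 finally show ?thesis .
qed

section \<open>Chains and the boundary map\<close>

sublocale DS0: direct_sum_modules \<Lambda> VV "\<lambda>x. obj F {x}"
 by (rule direct_sum_modules.intro[OF \<Lambda>_cring F_modV])

sublocale DS1: direct_sum_modules \<Lambda> EE "obj F"
 by (rule direct_sum_modules.intro[OF \<Lambda>_cring F_modE])

abbreviation "C0 \<equiv> chains0 v F"
abbreviation "C1 \<equiv> chains1 v F"
abbreviation "bd \<equiv> boundary v F"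

lemma C0: "C0 = DS0.DS" and C1: "C1 = DS1.DS"
 by (simp_all add: chains0_def chains1_def)

lemma C0_module: "Module.module \<Lambda> C0" and C1_module: "Module.module \<Lambda> C1"
 using DS0.DS_module DS1.DS_module by (simp_all add: C0 C1)

lemma edge_at: assumes "\<tau> \<in> EE" "y \<in> \<tau>" obtains z where "\<tau> = {y, z}" "{y, z} \<in> EE"
proof -
 obtain a b where ab: "\<tau> = {a, b}" "{a, b} \<in> EE" using edge_cases[OF assms(1)] by metis
 then consider "y = a" | "y = b" using assms(2) by blast
 thus thesis by cases (use ab that[of b] that[of a] in "simp_all add: insert_commute")
qed

lemma finite_edges_at': "finite {\<tau> \<in> EE. y \<in> \<tau>}"
proof (rule finite_subset)
 show "{\<tau> \<in> EE. y \<in> \<tau>} \<subseteq> (\<lambda>z. {y, z}) ` {z. {y, z} \<in> EE}"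
 proof
  fix \<tau> assume "\<tau> \<in> {\<tau> \<in> EE. y \<in> \<tau>}"
  then obtain z where "\<tau> = {y, z}" "{y, z} \<in> EE" using edge_at[of \<tau> y] by auto
  thus "\<tau> \<in> (\<lambda>z. {y, z}) ` {z. {y, z} \<in> EE}" by (intro image_eqI[of _ _ z]) simp_all
 qed
 show "finite ((\<lambda>z. {y, z}) ` {z. {y, z} \<in> EE})" by (rule finite_imageI[OF finite_edges_at])
qed

lemma bd_terms: assumes "c \<in> carrier C1" "\<tau> \<in> EE" "y \<in> \<tau>" shows "trans_map F \<tau> y (c \<tau>) \<in> Ob F {y}"
 using linmapD(1)[OF F_tr[OF assms(2,3)]] assms by (simp add: C1 DS1.DS_mem)

lemma bd_apply: "y \<in> VV ==> bd c y = finsum (obj F {y}) (\<lambda>\<tau>. trans_map F \<tau> y (c \<tau>)) {\<tau> \<in> EE. y \<in> \<tau>}"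
 by (simp add: boundary_def)

text \<open>Finite support survives because each edge has only two ends.\<close>

lemma bd_mem: assumes "c \<in> carrier C1" shows "bd c \<in> carrier C0"
proof -
 have "{y\<in>VV. bd c y ~= \<zero>\<^bsub>obj F {y}\<^esub>} \<subseteq> \<Union>{\<tau>\<in>EE. c \<tau> ~= \<zero>\<^bsub>obj F \<tau>\<^esub>}"
 proof
  fix y assume y: "y \<in> {y\<in>VV. bd c y ~= \<zero>\<^bsub>obj F {y}\<^esub>}"
  interpret Y: Module.module \<Lambda> "obj F {y}" using y by (intro F_modV) simp
  show "y \<in> \<Union>{\<tau>\<in>EE. c \<tau> ~= \<zero>\<^bsub>obj F \<tau>\<^esub>}"
  proof (rule ccontr)
   assume n: "\<not> ?thesis"
   have "trans_map F \<tau> y (c \<tau>) = \<zero>\<^bsub>obj F {y}\<^esub>" if "\<tau> \<in> {\<tau> \<in> EE. y \<in> \<tau>}" for \<tau>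
    using that n F_tr_zero[of \<tau> y "c \<tau>"] assms by (auto simp: C1 DS1.DS_mem)
   hence "finsum (obj F {y}) (\<lambda>\<tau>. trans_map F \<tau> y (c \<tau>)) {\<tau> \<in> EE. y \<in> \<tau>} = finsum (obj F {y}) (\<lambda>\<tau>. \<zero>\<^bsub>obj F {y}\<^esub>) {\<tau> \<in> EE. y \<in> \<tau>}"
    by (intro Y.M.finsum_cong') auto
   moreover have "bd c y ~= \<zero>\<^bsub>obj F {y}\<^esub>" "y \<in> VV" using y by simp_all
   ultimately show False using bd_apply[of y c] by simp
  qed
 qed
 moreover have "finite (\<Union>{\<tau>\<in>EE. c \<tau> ~= \<zero>\<^bsub>obj F \<tau>\<^esub>})"
 proof (rule finite_Union)
  show "finite {\<tau>\<in>EE. c \<tau> ~= \<zero>\<^bsub>obj F \<tau>\<^esub>}" using assms by (simp add: C1 DS1.DS_mem)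
  show "finite \<tau>" if "\<tau> \<in> {\<tau>\<in>EE. c \<tau> ~= \<zero>\<^bsub>obj F \<tau>\<^esub>}" for \<tau>
   using edge_cases[of \<tau>] that by (metis (no_types, lifting) finite.emptyI finite_insert mem_Collect_eq)
 qed
 ultimately have "finite {y\<in>VV. bd c y ~= \<zero>\<^bsub>obj F {y}\<^esub>}" by (rule finite_subset)
 moreover have "bd c y \<in> Ob F {y}" if y: "y \<in> VV" for y
 proof -
  interpret Y: Module.module \<Lambda> "obj F {y}" using y by (intro F_modV) simp
  show ?thesis unfolding bd_apply[OF y] using bd_terms[OF assms] by (intro Y.M.finsum_closed) auto
 qed
 ultimately show ?thesis unfolding C0 DS0.DS_mem by (simp add: boundary_def)
qed

lemma bd_linmap: "linmap \<Lambda> C1 C0 bd"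
proof (rule linmapI)
 show "bd c \<in> carrier C0" if "c \<in> carrier C1" for c using bd_mem[OF that] .
 fix c c' assume c: "c \<in> carrier C1" "c' \<in> carrier C1"
 interpret C1: Module.module \<Lambda> C1 by (rule C1_module)
 have cc: "c \<oplus>\<^bsub>C1\<^esub> c' \<in> carrier C1" using c by simp
 show "bd (c \<oplus>\<^bsub>C1\<^esub> c') = bd c \<oplus>\<^bsub>C0\<^esub> bd c'"
  unfolding C0
 proof (rule DS0.DS_eqI)
  fix y assume y: "y \<in> VV"
  interpret Y: Module.module \<Lambda> "obj F {y}" using y by (intro F_modV) simp
  have "bd (c \<oplus>\<^bsub>C1\<^esub> c') y = finsum (obj F {y}) (\<lambda>\<tau>. trans_map F \<tau> y (c \<tau>) \<oplus>\<^bsub>obj F {y}\<^esub> trans_map F \<tau> y (c' \<tau>)) {\<tau> \<in> EE. y \<in> \<tau>}"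
   unfolding bd_apply[OF y] using c linmapD(2)[OF F_tr]
   by (intro Y.M.finsum_cong') (auto simp: bd_terms C1 DS1.DS_apply DS1.DS_mem intro!: Y.M.add.m_closed bd_terms[unfolded C1 DS1.DS_mem])
  also have "\<dots> = bd c y \<oplus>\<^bsub>obj F {y}\<^esub> bd c' y"
   unfolding bd_apply[OF y] using c by (intro Y.M.finsum_addf) (auto simp: bd_terms)
  finally show "bd (c \<oplus>\<^bsub>C1\<^esub> c') y = (bd c \<oplus>\<^bsub>DS0.DS\<^esub> bd c') y" using y by (simp add: DS0.DS_apply)
 qed (use bd_mem c cc in "auto simp: C0[symmetric] C0_module intro!: DS0.DS_closed[folded C0]")
next
 fix a c assume a: "a \<in> carrier \<Lambda>" and c: "c \<in> carrier C1"
 interpret C1: Module.module \<Lambda> C1 by (rule C1_module)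
 have cc: "a \<odot>\<^bsub>C1\<^esub> c \<in> carrier C1" using c a by simp
 show "bd (a \<odot>\<^bsub>C1\<^esub> c) = a \<odot>\<^bsub>C0\<^esub> bd c"
  unfolding C0
 proof (rule DS0.DS_eqI)
  fix y assume y: "y \<in> VV"
  interpret Y: Module.module \<Lambda> "obj F {y}" using y by (intro F_modV) simp
  have "bd (a \<odot>\<^bsub>C1\<^esub> c) y = finsum (obj F {y}) (\<lambda>\<tau>. a \<odot>\<^bsub>obj F {y}\<^esub> trans_map F \<tau> y (c \<tau>)) {\<tau> \<in> EE. y \<in> \<tau>}"
   unfolding bd_apply[OF y] using c a linmapD(3)[OF F_tr]
   by (intro Y.M.finsum_cong') (auto simp: bd_terms C1 DS1.DS_apply DS1.DS_mem intro!: Y.smult_closed bd_terms[unfolded C1 DS1.DS_mem])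
  also have "\<dots> = a \<odot>\<^bsub>obj F {y}\<^esub> bd c y"
   unfolding bd_apply[OF y] using c a by (intro Y.finsum_smult_ldistr[symmetric]) (auto simp: bd_terms finite_edges_at')
  finally show "bd (a \<odot>\<^bsub>C1\<^esub> c) y = (a \<odot>\<^bsub>DS0.DS\<^esub> bd c) y" using y by (simp add: DS0.DS_apply)
 qed (use bd_mem c cc a in "auto simp: C0[symmetric] C0_module intro!: DS0.DS_closed[folded C0]")
qed

lemma bd_single: assumes "{x, y} \<in> EE" "f \<in> Ob F {x, y}"
 shows "bd (DS1.single {x, y} f) = DS0.single x (trans_map F {x, y} x f) \<oplus>\<^bsub>C0\<^esub> DS0.single y (trans_map F {x, y} y f)"
proof -
 have xy: "x \<in> VV" "y \<in> VV" "x ~= y" using assms(1) edge_d[of x y] by auto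
 have r: "trans_map F {x, y} z f \<in> Ob F {z}" if "z \<in> {x, y}" for z
  using linmapD(1)[OF F_tr[OF assms(1) that] assms(2)] .
 have s: "DS1.single {x, y} f \<in> carrier C1" using DS1.single_mem[OF assms] by (simp add: C1)
 show ?thesis unfolding C0
 proof (rule DS0.DS_eqI)
  fix z assume z: "z \<in> VV"
  interpret Z: Module.module \<Lambda> "obj F {z}" using z by (intro F_modV) simp
  have "bd (DS1.single {x, y} f) z = (if {x, y} \<in> {\<tau> \<in> EE. z \<in> \<tau>} then trans_map F {x, y} z (DS1.single {x, y} f {x, y}) else \<zero>\<^bsub>obj F {z}\<^esub>)"
   unfolding bd_apply[OF z]
  proof (rule Z.M.finsum_only[OF finite_edges_at'])
   fix \<tau> assume t: "\<tau> \<in> {\<tau> \<in> EE. z \<in> \<tau>}" "\<tau> ~= {x, y}"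
   interpret T: Module.module \<Lambda> "obj F \<tau>" using t by (intro F_modE) simp
   show "trans_map F \<tau> z (DS1.single {x, y} f \<tau>) = \<zero>\<^bsub>obj F {z}\<^esub>"
    using t F_tr_zero[of \<tau> z "\<zero>\<^bsub>obj F \<tau>\<^esub>"] by (simp add: DS1.single_apply)
  qed (use r assms in "auto simp: DS1.single_apply")
  also have "\<dots> = (if z \<in> {x, y} then trans_map F {x, y} z f else \<zero>\<^bsub>obj F {z}\<^esub>)"
   using assms(1) by (simp add: DS1.single_apply)
  also have "\<dots> = (DS0.single x (trans_map F {x, y} x f) \<oplus>\<^bsub>DS0.DS\<^esub> DS0.single y (trans_map F {x, y} y f)) z"
  proof -
   consider "z = x" | "z = y" | "z ~= x" "z ~= y" by blast
   thus ?thesis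
    by cases (use z xy r[of x] r[of y] in "simp_all add: DS0.DS_apply(1) DS0.single_apply DS0.mod_facts")
  qed
  finally show "bd (DS1.single {x, y} f) z = (DS0.single x (trans_map F {x, y} x f) \<oplus>\<^bsub>DS0.DS\<^esub> DS0.single y (trans_map F {x, y} y f)) z" .
 next
  show "bd (DS1.single {x, y} f) \<in> carrier DS0.DS" using bd_mem[OF s] by (simp add: C0)
 qed (intro DS0.DS_closed DS0.single_mem xy r, simp_all)
qed

lemma boundaries_submod: "submodule (boundaries v F) \<Lambda> C0"
 unfolding boundaries_def by (rule linmap_image_submod[OF bd_linmap C1_module C0_module])

section \<open>The homology module and its generating classes\<close>

sublocale Qt: module_quotient \<Lambda> C0 "boundaries v F"
 by (rule module_quotient.intro[OF C0_module boundaries_submod])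

abbreviation "HM \<equiv> quot_module C0 (boundaries v F)"
abbreviation "cls \<equiv> H0_class v F"

lemma H0_mod: "rep_mod (H0 v e F) = HM"
 by (simp add: H0_def)

lemma cls_q: "cls x f = Qt.q (DS0.single x f)"
 by (simp add: H0_class_def Qt.q_def DS0.single_def)

lemma single_C0: "x \<in> VV ==> f \<in> Ob F {x} ==> DS0.single x f \<in> carrier C0"
 using DS0.single_mem by (simp add: C0)

lemma cls_linmap: "x \<in> VV ==> linmap \<Lambda> (obj F {x}) HM (cls x)"
proof -
 assume x: "x \<in> VV"
 have "cls x = (\<lambda>f. Qt.q (DS0.single x f))" by (rule ext) (rule cls_q)
 thus ?thesis using linmap_comp[OF DS0.single_linmap[OF x, folded C0] Qt.q_linmap] by simp
qed

lemma cls_mem: "x \<in> VV ==> f \<in> Ob F {x} ==> cls x f \<in> carrier HM"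
 using linmapD(1)[OF cls_linmap] .

lemma cls_edge: assumes "{x, y} \<in> EE" "f \<in> Ob F {x, y}"
 shows "cls x (trans_map F {x, y} x f) \<oplus>\<^bsub>HM\<^esub> cls y (trans_map F {x, y} y f) = \<zero>\<^bsub>HM\<^esub>"
proof -
 have xy: "x \<in> VV" "y \<in> VV" using assms(1) edge_vertices by auto
 have r: "trans_map F {x, y} z f \<in> Ob F {z}" if "z \<in> {x, y}" for z
  using linmapD(1)[OF F_tr[OF assms(1) that] assms(2)] .
 have s: "DS1.single {x, y} f \<in> carrier C1" using DS1.single_mem[OF assms] by (simp add: C1)
 have "bd (DS1.single {x, y} f) \<in> boundaries v F" using s by (simp add: boundaries_def)
 hence "Qt.q (bd (DS1.single {x, y} f)) = boundaries v F" using Qt.q_zero_iff bd_mem[OF s] by blast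
 thus ?thesis
  using single_C0 xy r by (simp add: bd_single[OF assms] cls_q Qt.Q_add Qt.Q_zero(1))
qed

text \<open>The boundary map carries no orientation signs, so a vector of an edge has opposite
  classes at the two ends. The signs in \<open>F_hat\<close> and in the unit go back to
  this.\<close>

lemma cls_edge_neg: assumes "{x, y} \<in> EE" "f \<in> Ob F {x, y}"
 shows "cls y (trans_map F {x, y} y f) = \<ominus>\<^bsub>HM\<^esub> cls x (trans_map F {x, y} x f)"
proof -
 interpret H: Module.module \<Lambda> HM by (rule Qt.Q_module)
 have xy: "x \<in> VV" "y \<in> VV" using assms(1) edge_vertices by auto
 have r: "cls z (trans_map F {x, y} z f) \<in> carrier HM" if "z \<in> {x, y}" for z
  using linmapD(1)[OF F_tr[OF assms(1) that] assms(2)] cls_mem that xy by auto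
 show ?thesis using cls_edge[OF assms] r H.M.minus_equality[of "cls y (trans_map F {x, y} y f)" "cls x (trans_map F {x, y} x f)"]
  by (simp add: H.M.a_comm)
qed

lemma H_induct: assumes "w \<in> carrier HM" "P \<zero>\<^bsub>HM\<^esub>"
 "!!w w'. w \<in> carrier HM ==> w' \<in> carrier HM ==> P w ==> P w' ==> P (w \<oplus>\<^bsub>HM\<^esub> w')"
 "!!x f. x \<in> VV ==> f \<in> Ob F {x} ==> P (cls x f)" shows "P w"
proof -
 obtain c where c: "c \<in> carrier C0" "w = Qt.q c" using assms(1) by (auto simp: Qt.Q_carrier)
 have "P (Qt.q c)" using c(1)[unfolded C0]
 proof (induction rule: DS0.DS_induct)
  case 1 thus ?case using assms(2)[unfolded Qt.Q_zero(2)] by (simp only: C0)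
 next
  case (2 c c')
  hence cc: "c \<in> carrier C0" "c' \<in> carrier C0" by (simp_all add: C0)
  thus ?case using assms(3)[of "Qt.q c" "Qt.q c'"] Qt.Q_add[OF cc] 2 by (simp add: Qt.Q_carrier flip: C0)
 next
  case (3 x f) thus ?case using assms(4) by (simp add: cls_q)
 qed
 thus ?thesis using c by simp
qed

lemma H_submod_eq: assumes "submodule N \<Lambda> HM" "!!x f. x \<in> VV ==> f \<in> Ob F {x} ==> cls x f \<in> N" "w \<in> carrier HM"
 shows "w \<in> N"
 using assms(3) by (rule H_induct) (use assms(1,2) in "auto simp: submod_iff[OF Qt.Q_module]")

lemma H_linmap_eq: assumes "linmap \<Lambda> HM W f" "linmap \<Lambda> HM W g" "Module.module \<Lambda> W"
 "!!x a. x \<in> VV ==> a \<in> Ob F {x} ==> f (cls x a) = g (cls x a)" "w \<in> carrier HM"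
 shows "f w = g w"
proof -
 have "w \<in> {w \<in> carrier HM. f w = g w}"
  by (rule H_submod_eq[OF linmap_equalizer_submod[OF assms(1,2) Qt.Q_module assms(3)]]) (use assms(4,5) cls_mem in auto)
 thus ?thesis by simp
qed

text \<open>Boundaries need only be tested on single edges. This serves the group action, the counit
  and the maps induced on homology.\<close>

lemma boundaries_into: assumes "linmap \<Lambda> C0 W h" "Module.module \<Lambda> W" "submodule K \<Lambda> W"
 "!!x y f. {x, y} \<in> EE ==> f \<in> Ob F {x, y} ==>
   h (DS0.single x (trans_map F {x, y} x f)) \<oplus>\<^bsub>W\<^esub> h (DS0.single y (trans_map F {x, y} y f)) \<in> K"
 "b \<in> boundaries v F" shows "h b \<in> K"
proof -
 obtain c where c: "c \<in> carrier C1" "b = bd c" using assms(5) by (auto simp: boundaries_def)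
 note K = assms(3)[unfolded submod_iff[OF assms(2)]]
 have "h (bd c) \<in> K" using c(1)[unfolded C1]
 proof (induction rule: DS1.DS_induct)
  case 1
  have "bd \<zero>\<^bsub>C1\<^esub> = \<zero>\<^bsub>C0\<^esub>" by (rule linmap_0[OF bd_linmap C1_module C0_module])
  thus ?case using linmap_0[OF assms(1) C0_module assms(2)] K by (simp add: C1)
 next
  case (2 c c')
  thus ?case using linmapD(2)[OF bd_linmap, of c c'] linmapD(2)[OF assms(1), of "bd c" "bd c'"] bd_mem K by (simp add: C1)
 next
  case (3 \<tau> f)
  then obtain x y where xy: "\<tau> = {x, y}" "{x, y} \<in> EE" using edge_cases by metis
  have r: "DS0.single z (trans_map F {x, y} z f) \<in> carrier C0" if "z \<in> {x, y}" for z
   using linmapD(1)[OF F_tr[OF xy(2) that]] single_C0 that edge_vertices[OF xy(2)] 3 xy by auto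
  show ?case using 3 bd_single[OF xy(2)] linmapD(2)[OF assms(1) r r] assms(4)[OF xy(2)] xy(1) by simp
 qed
 thus ?thesis using c by simp
qed

subsection \<open>The vertex modules embed into the homology\<close>

text \<open>Among the edges in the support of \<open>c\<close> take one reaching farthest from
  \<open>x\<close>. The other edges at its outer end \<open>y\<close> lead farther out and so miss
  the support; hence the boundary at \<open>y\<close> is one transition map applied to one
  coefficient, and that map is injective.\<close>

lemma bd_concentrated: assumes c: "c \<in> carrier C1" and x: "x \<in> VV" and z: "!!y. y \<in> VV ==> y ~= x ==> bd c y = \<zero>\<^bsub>obj F {y}\<^esub>"
 shows "c = \<zero>\<^bsub>C1\<^esub>"
proof -
 define S where "S = {\<tau>\<in>EE. c \<tau> ~= \<zero>\<^bsub>obj F \<tau>\<^esub>}"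
 have fin: "finite S" using c by (simp add: S_def C1 DS1.DS_mem)
 define far where "far \<tau> = Max (d x ` \<tau>)" for \<tau>
 have "S = {}"
 proof (rule ccontr)
  assume ne: "S ~= {}"
  have "Max (far ` S) \<in> far ` S" using fin ne by (intro Max_in) auto
  then obtain \<tau> where t: "\<tau> \<in> S" "far \<tau> = Max (far ` S)" by (elim imageE) metis
  hence mx: "far \<tau>' <= far \<tau>" if "\<tau>' \<in> S" for \<tau>' using that fin by simp
  have tE: "\<tau> \<in> EE" using t by (simp add: S_def)
  obtain b y where bb: "\<tau> = {b, y}" "{b, y} \<in> EE" "d x y = d x b + 1" using edge_orient[OF x tE] by metis
  have V: "b \<in> VV" "y \<in> VV" using bb edge_vertices by auto
  have ft: "far \<tau> = d x y" using bb by (simp add: far_def)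
  have "y ~= x" using bb x by auto
  interpret Y: Module.module \<Lambda> "obj F {y}" by (rule F_modV[OF V(2)])
  have "bd c y = (if \<tau> \<in> {\<tau> \<in> EE. y \<in> \<tau>} then trans_map F \<tau> y (c \<tau>) else \<zero>\<^bsub>obj F {y}\<^esub>)"
   unfolding bd_apply[OF V(2)]
  proof (rule Y.M.finsum_only[OF finite_edges_at'])
   fix \<tau>' assume t': "\<tau>' \<in> {\<tau> \<in> EE. y \<in> \<tau>}" "\<tau>' ~= \<tau>"
   then obtain z where z: "\<tau>' = {y, z}" "{y, z} \<in> EE" using edge_at[of \<tau>' y] by auto
   have "d x z = d x y + 1"
   proof (rule ccontr)
    assume "d x z ~= d x y + 1"
    hence dz: "d x y = d x z + 1" using nbr_dist[OF x z(2)] by simp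
    have "{z, y} \<in> EE" using z(2) by (subst insert_commute)
    hence "z = b" using prev_unique[OF x _ dz bb(2,3)] by blast
    hence "\<tau>' = \<tau>" unfolding z(1) bb(1) by (simp only: insert_commute)
    thus False using t'(2) by blast
   qed
   hence "far \<tau>' > far \<tau>" using ft z by (simp add: far_def)
   hence "\<tau>' \<notin> S" using mx by fastforce
   hence "c \<tau>' = \<zero>\<^bsub>obj F \<tau>'\<^esub>" using t' by (simp add: S_def)
   thus "trans_map F \<tau>' y (c \<tau>') = \<zero>\<^bsub>obj F {y}\<^esub>" using F_tr_zero[of \<tau>' y "c \<tau>'"] t' c by (auto simp: C1 DS1.DS_mem)
  qed (use bd_terms[OF c] in auto)
  hence "trans_map F \<tau> y (c \<tau>) = \<zero>\<^bsub>obj F {y}\<^esub>" using z[OF V(2) \<open>y ~= x\<close>] tE bb by simp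
  hence "c \<tau> = \<zero>\<^bsub>obj F \<tau>\<^esub>" using F_tr_zero[OF tE, of y "c \<tau>"] bb c tE by (simp add: C1 DS1.DS_mem)
  thus False using t by (simp add: S_def)
 qed
 thus ?thesis using c unfolding C1
  by (intro DS1.DS_eqI DS1.DS_closed) (auto simp: S_def DS1.DS_apply)
qed

lemma cls_inj: assumes x: "x \<in> VV" shows "inj_on (cls x) (Ob F {x})"
proof (rule linmap_inj[OF cls_linmap[OF x] F_modV[OF x] Qt.Q_module])
 fix f assume f: "f \<in> Ob F {x}" "cls x f = \<zero>\<^bsub>HM\<^esub>"
 hence "DS0.single x f \<in> boundaries v F"
  using Qt.q_zero_iff[OF single_C0[OF x f(1)]] by (simp add: cls_q Qt.Q_zero(1))
 then obtain c where c: "c \<in> carrier C1" "DS0.single x f = bd c" by (auto simp: boundaries_def)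
 hence "c = \<zero>\<^bsub>C1\<^esub>" by (intro bd_concentrated[OF c(1) x]) (simp add: DS0.single_apply flip: c(2))
 hence "DS0.single x f = \<zero>\<^bsub>C0\<^esub>" using linmap_0[OF bd_linmap C1_module C0_module] c(2) by simp
 thus "f = \<zero>\<^bsub>obj F {x}\<^esub>" using DS0.DS_apply(3)[OF x] DS0.single_apply[OF x, of x f] by (simp add: C0)
qed

end

section \<open>The homology representation\<close>

context tree_level
begin

lemma GG_inv: assumes "g \<in> GG"
 shows "y \<in> VV ==> inv_into VV g y \<in> VV" "y \<in> VV ==> g (inv_into VV g y) = y" "x \<in> VV ==> inv_into VV g (g x) = x"
 using bij_betw_inv_into_right[OF LC_D(1)[OF assms]] bij_betw_inv_into_left[OF LC_D(1)[OF assms]]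
  bij_betw_inv_into[OF LC_D(1)[OF assms]] by (auto simp: bij_betw_def)

end

context coeff
begin

abbreviation "actc \<equiv> chains0_act v e F"
abbreviation "ract \<equiv> rep_act (H0 v e F)"

lemma actc_apply: "y \<in> VV ==> actc g c y = hat_act v e F g {inv_into VV g y} (c (inv_into VV g y))"
 by (simp add: chains0_act_def Let_def)

lemma hat_act_0: assumes "g \<in> GG" "x \<in> VV" shows "hat_act v e F g {x} \<zero>\<^bsub>obj F {x}\<^esub> = \<zero>\<^bsub>obj F {g x}\<^esub>"
 by (rule linmap_0[OF hat_act_linmap[OF assms] F_modV[OF assms(2)] F_modV[OF LC_D(3)[OF assms]]])

lemma actc_mem: assumes "g \<in> GG" "c \<in> carrier C0" shows "actc g c \<in> carrier C0"
proof -
 have "{y\<in>VV. actc g c y ~= \<zero>\<^bsub>obj F {y}\<^esub>} \<subseteq> g ` {x\<in>VV. c x ~= \<zero>\<^bsub>obj F {x}\<^esub>}"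
 proof
  fix y assume y: "y \<in> {y\<in>VV. actc g c y ~= \<zero>\<^bsub>obj F {y}\<^esub>}"
  define x where "x = inv_into VV g y"
  have x: "x \<in> VV" "g x = y" using GG_inv[OF assms(1)] y by (simp_all add: x_def)
  have "c x ~= \<zero>\<^bsub>obj F {x}\<^esub>" using y hat_act_0[OF assms(1) x(1)] x by (auto simp: actc_apply x_def)
  thus "y \<in> g ` {x\<in>VV. c x ~= \<zero>\<^bsub>obj F {x}\<^esub>}" using x by blast
 qed
 hence "finite {y\<in>VV. actc g c y ~= \<zero>\<^bsub>obj F {y}\<^esub>}"
  by (rule finite_subset) (use assms(2) in "simp add: C0 DS0.DS_mem")
 moreover have "actc g c y \<in> Ob F {y}" if y: "y \<in> VV" for y
  using linmapD(1)[OF hat_act_linmap[OF assms(1) GG_inv(1)[OF assms(1) y]]] GG_inv[OF assms(1)] y assms(2)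
  by (simp add: actc_apply C0 DS0.DS_mem)
 ultimately show ?thesis unfolding C0 DS0.DS_mem by (simp add: chains0_act_def)
qed

lemma actc_linmap: assumes g: "g \<in> GG" shows "linmap \<Lambda> C0 C0 (actc g)"
proof (rule linmapI)
 interpret C0m: Module.module \<Lambda> C0 by (rule C0_module)
 show "actc g c \<in> carrier C0" if "c \<in> carrier C0" for c by (rule actc_mem[OF g that])
 show "actc g (c \<oplus>\<^bsub>C0\<^esub> c') = actc g c \<oplus>\<^bsub>C0\<^esub> actc g c'" if c: "c \<in> carrier C0" "c' \<in> carrier C0" for c c'
 proof (rule DS0.DS_eqI)
  fix y assume y: "y \<in> VV"
  define x where "x = inv_into VV g y"
  have x: "x \<in> VV" "g x = y" using GG_inv[OF g] y by (simp_all add: x_def)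
  have cx: "c x \<in> Ob F {x}" "c' x \<in> Ob F {x}" using c x by (simp_all add: C0 DS0.DS_mem)
  show "actc g (c \<oplus>\<^bsub>C0\<^esub> c') y = (actc g c \<oplus>\<^bsub>C0\<^esub> actc g c') y"
   using linmapD(2)[OF hat_act_linmap[OF g x(1)] cx] x y by (simp add: C0 DS0.DS_apply actc_apply x_def[symmetric])
 qed (use actc_mem[OF g] c in "simp_all flip: C0")
 show "actc g (a \<odot>\<^bsub>C0\<^esub> c) = a \<odot>\<^bsub>C0\<^esub> actc g c" if a: "a \<in> carrier \<Lambda>" and c: "c \<in> carrier C0" for a c
 proof (rule DS0.DS_eqI)
  fix y assume y: "y \<in> VV"
  define x where "x = inv_into VV g y"
  have x: "x \<in> VV" "g x = y" using GG_inv[OF g] y by (simp_all add: x_def)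
  have cx: "c x \<in> Ob F {x}" using c x by (simp add: C0 DS0.DS_mem)
  show "actc g (a \<odot>\<^bsub>C0\<^esub> c) y = (a \<odot>\<^bsub>C0\<^esub> actc g c) y"
   using linmapD(3)[OF hat_act_linmap[OF g x(1)] a cx] x y by (simp add: C0 DS0.DS_apply actc_apply x_def[symmetric])
 qed (use actc_mem[OF g] c a in "simp_all flip: C0")
qed

lemma actc_single: assumes g: "g \<in> GG" and x: "x \<in> VV" and f: "f \<in> Ob F {x}"
 shows "actc g (DS0.single x f) = DS0.single (g x) (hat_act v e F g {x} f)"
proof (rule DS0.DS_eqI)
 have gx: "g x \<in> VV" "hat_act v e F g {x} f \<in> Ob F {g x}"
  using LC_D(3)[OF g x] linmapD(1)[OF hat_act_linmap[OF g x] f] by auto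
 show "actc g (DS0.single x f) \<in> carrier DS0.DS" using actc_mem[OF g single_C0[OF x f]] by (simp add: C0)
 show "DS0.single (g x) (hat_act v e F g {x} f) \<in> carrier DS0.DS" by (rule DS0.single_mem[OF gx])
 fix y assume y: "y \<in> VV"
 define z where "z = inv_into VV g y"
 have z: "z \<in> VV" "g z = y" using GG_inv[OF g] y by (simp_all add: z_def)
 have "z = x \<longleftrightarrow> y = g x" using GG_inv(3)[OF g x] z by (auto simp: z_def)
 thus "actc g (DS0.single x f) y = DS0.single (g x) (hat_act v e F g {x} f) y"
  using hat_act_0[OF g z(1)] z y by (auto simp: actc_apply z_def[symmetric] DS0.single_apply)
qed

lemma actc_boundaries: assumes g: "g \<in> GG" and b: "b \<in> boundaries v F" shows "actc g b \<in> boundaries v F"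
proof (rule boundaries_into[OF actc_linmap[OF g] C0_module boundaries_submod _ b])
 fix x y f assume xy: "{x, y} \<in> EE" and f: "f \<in> Ob F {x, y}"
 have V: "x \<in> VV" "y \<in> VV" using edge_vertices[OF xy] by auto
 \<comment> \<open>The ball of the edge contains the balls of both ends, so one matrix computes the
   action at both.\<close>
 obtain g' where g': "det g' ~= 0" "!!z. z \<in> ball {x, y} ==> g z = actv g' z" using GG_edge[OF g xy] by blast
 define f' where "f' = act_map F g' {x, y} f"
 have gxy: "g x = actv g' x" "g y = actv g' y" using g'(2) V ball_self by auto
 have s: "act_simplex g' {x, y} = {g x, g y}" using gxy by (simp add: act_simplex_def)
 have E: "{g x, g y} \<in> EE" using edge_act[OF g'(1) xy] s by simp
 have f'm: "f' \<in> Ob F {g x, g y}"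
  using linmapD(1)[OF F_act[OF g'(1) edge_simplex[OF xy]] f] s by (simp add: f'_def)
 have r: "trans_map F {x, y} z f \<in> Ob F {z}" if "z \<in> {x, y}" for z
  using linmapD(1)[OF F_tr[OF xy that] f] .
 have h: "hat_act v e F g {z} (trans_map F {x, y} z f) = trans_map F {g x, g y} (g z) f'" if z: "z \<in> {x, y}" for z
 proof -
  have zV: "z \<in> VV" using z V by auto
  have "hat_act v e F g {z} (trans_map F {x, y} z f) = act_map F g' {z} (trans_map F {x, y} z f)"
   using z zV g' r[OF z] by (intro hat_act_eq vertex_simplex) (auto simp: ball_mem)
  thus ?thesis using F_act_tr[OF g'(1) xy z f] s gxy z by (auto simp: f'_def)
 qed
 have "DS1.single {g x, g y} f' \<in> carrier C1" using DS1.single_mem[OF E f'm] by (simp add: C1)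
 hence "bd (DS1.single {g x, g y} f') \<in> boundaries v F" by (simp add: boundaries_def)
 thus "actc g (DS0.single x (trans_map F {x, y} x f)) \<oplus>\<^bsub>C0\<^esub> actc g (DS0.single y (trans_map F {x, y} y f)) \<in> boundaries v F"
  using actc_single[OF g V(1) r[of x]] actc_single[OF g V(2) r[of y]] h[of x] h[of y] bd_single[OF E f'm] by simp
qed

lemma ract_linmap: "g \<in> GG ==> linmap \<Lambda> HM HM (ract g)"
 unfolding H0_def rep.simps by (rule Qt.coset_map_linmap[OF Qt.module_quotient_axioms actc_linmap actc_boundaries])

lemma ract_q: "g \<in> GG ==> c \<in> carrier C0 ==> ract g (Qt.q c) = Qt.q (actc g c)"
 using Qt.coset_map_quot[OF Qt.module_quotient_axioms actc_linmap actc_boundaries] by (simp add: H0_def Qt.q_def)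

lemma ract_cls: "g \<in> GG ==> x \<in> VV ==> f \<in> Ob F {x} ==> ract g (cls x f) = cls (g x) (hat_act v e F g {x} f)"
 using ract_q[OF _ single_C0] actc_single by (simp add: cls_q)

lemma ract_cls': assumes "g \<in> GG" "x \<in> VV" "f \<in> Ob F {x}" "det g' ~= 0" "!!z. z \<in> ball {x} ==> g z = actv g' z"
 shows "ract g (cls x f) = cls (actv g' x) (act_map F g' {x} f)"
 using ract_cls[OF assms(1-3)] hat_act_eq[OF vertex_simplex[OF assms(2)] _ assms(4,5,3)] assms(5)[OF ball_self[OF assms(2)]] by simp

lemma H0_rep: "hat_rep v e \<Lambda> (H0 v e F)"
 unfolding hat_rep_def H0_mod hG_carrier
proof (intro conjI ballI)
 show "Module.module \<Lambda> HM" by (rule Qt.Q_module)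
 show "linear_on \<Lambda> HM HM (ract g)" if "g \<in> GG" for g
  by (rule iffD2[OF linear_on_iff[OF Qt.Q_module] ract_linmap[OF that]])
 show "ract (g \<otimes>\<^bsub>hG\<^esub> h) w = ract g (ract h w)" if gh: "g \<in> GG" "h \<in> GG" and w: "w \<in> carrier HM" for g h w
 proof (rule H_linmap_eq[OF ract_linmap[OF hG_mult_GG[OF gh]] linmap_comp[OF ract_linmap[OF gh(2)] ract_linmap[OF gh(1)]] Qt.Q_module _ w])
  fix x f assume x: "x \<in> VV" and f: "f \<in> Ob F {x}"
  have "hat_act v e F h {x} f \<in> Ob F {h x}" using linmapD(1)[OF hat_act_linmap[OF gh(2) x] f] .
  thus "ract (g \<otimes>\<^bsub>hG\<^esub> h) (cls x f) = ract g (ract h (cls x f))"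
   using x f gh LC_D(3)[OF gh(2) x] by (simp add: ract_cls hG_mult_GG hG_mult_apply hat_act_mult)
 qed
 show "ract \<one>\<^bsub>hG\<^esub> w = w" if w: "w \<in> carrier HM" for w
 proof (rule H_linmap_eq[OF _ _ Qt.Q_module _ w])
  have o: "\<one>\<^bsub>hG\<^esub> \<in> GG" unfolding hG_one(2) by (rule th_GG) simp
  show "linmap \<Lambda> HM HM (ract \<one>\<^bsub>hG\<^esub>)" by (rule ract_linmap[OF o])
  show "linmap \<Lambda> HM HM (\<lambda>w. w)" by (simp add: linmap_def)
  show "ract \<one>\<^bsub>hG\<^esub> (cls x f) = cls x f" if "x \<in> VV" "f \<in> Ob F {x}" for x f
   using ract_cls'[OF o that, of "mat 1"] that
   by (simp add: hG_one(1) ball_mem act_vertex_1 F_act_1 vertex_simplex)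
 qed
qed

lemma cls_fixed_edge: assumes "{x, y} \<in> EE" "f \<in> Ob F {x, y}" "h \<in> hU {x, y}"
 shows "ract h (cls x (trans_map F {x, y} x f)) = cls x (trans_map F {x, y} x f)"
proof -
 have xV: "x \<in> VV" using edge_vertices[OF assms(1)] by blast
 let ?r = "trans_map F {x, y} x f"
 have r: "?r \<in> Ob F {x}" using linmapD(1)[OF F_tr[OF assms(1)] assms(2)] by simp
 obtain u where u: "u \<in> U_group v p e {x, y}" "\<forall>z\<in>ball {x, y}. h z = actv u z"
  using LC_D(6)[OF assms(3)[unfolded hat_U_def] assms(1)] by blast
 have du: "det u ~= 0" using subgroup_GL2D(1)[OF US_subgroup[OF edge_simplex[OF assms(1)]] u(1)] .
 have "act_map F u {x} ?r = ?r" using F_image[OF assms(1), of x] assms(2) u(1) by blast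
 moreover have "actv u x = x" by (rule US_fix[OF assms(1) u(1)])
 moreover have "!!z. z \<in> ball {x} ==> h z = actv u z" using u(2) by (auto simp: ball_mem)
 ultimately show ?thesis using ract_cls'[OF hU_GG[OF edge_simplex[OF assms(1)] assms(3)] xV r du] by simp
qed

text \<open>A vector of \<open>H\<^sub>0\<close> fixed by the completed group of \<open>x\<close> comes from \<open>F(x)\<close>.
 A chain representing it is pushed towards \<open>x\<close>, edge by edge.  If \<open>y\<close> is a vertex of its support
 farthest from \<open>x\<close>, and \<open>b\<close> the neighbour of \<open>y\<close> towards \<open>x\<close>, then an automorphism acting as \<open>u\<close> behind \<open>y\<close>
 and trivially elsewhere changes the chain at \<open>y\<close> only; hence \<open>u\<close> fixes its value at \<open>y\<close>.\<close>

lemma pushing_key: assumes x: "x \<in> VV" and c: "c \<in> carrier C0" and T: "T \<subseteq> VV" "!!z. z \<in> VV ==> z \<notin> T ==> c z = \<zero>\<^bsub>obj F {z}\<^esub>"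
 and fx: "!!h. h \<in> LC (Ux x) ==> ract h (Qt.q c) = Qt.q c"
 and b: "{b, y} \<in> EE" "d x y = d x b + 1" and far: "!!z. z \<in> T ==> z ~= x ==> d x z <= d x y"
 and u: "u \<in> Ux b" "u \<in> Ux x"
 shows "act_map F u {y} (c y) = c y"
proof -
 have V: "b \<in> VV" "y \<in> VV" using edge_vertices[OF b(1)] by auto
 have by1: "d b y = 1" using b(1) edge_d by blast
 define h where "h = branch_map b y u"
 have hL: "h \<in> LC (Ux x)" unfolding h_def by (rule branch_map_LC[OF b(1) u(1) x u(2)])
 have h: "h \<in> GG" by (rule LC_GG[OF hL Ux_subgroup[OF x]])
 have du: "det u ~= 0" using subgroup_GL2D(1)[OF Ux_subgroup[OF x] u(2)] .
 have happ: "h z = (if z \<in> behind b y then actv u z else z)" if "z \<in> VV" for z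
  using that by (simp add: h_def branch_map_def)
 have xb: "x \<in> behind y b" using x V b(2) d_sym[of x y] d_sym[of x b] by (simp add: behind_def)
 \<comment> \<open>A point of the support on the far side of the cut, other than \<open>y\<close>,
   would be farther from \<open>x\<close> than \<open>y\<close> is.\<close>
 have Tb: "z \<in> behind y b" if z: "z \<in> T" "z ~= y" for z
 proof (rule ccontr)
  assume n: "z \<notin> behind y b"
  have zV: "z \<in> VV" using z T by blast
  hence zb: "z \<in> behind b y" using behind_or[OF b(1) zV] n by blast
  hence "z ~= x" using n xb by blast
  hence "d x z <= d x y" using far z by blast
  moreover have "d x z = d x b + 1 + d y z" by (rule d_across[OF b(1) xb zb])
  ultimately have "d y z = 0" using b(2) by simp
  thus False using d_0[OF V(2) zV] z by simp
 qed
 \<comment> \<open>A point across the cut that is within \<open>e\<close> of \<open>z\<close> is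
   within \<open>e\<close> of \<open>b\<close>, where \<open>u\<close> is trivial.\<close>
 have hfix: "h z' = z'" if z: "z \<in> behind y b" "z' \<in> ball {z}" for z z'
 proof -
  have z'V: "z' \<in> VV" using z by (simp add: ball_mem)
  have "actv u z' = z'" if z'b: "z' \<in> behind b y"
  proof -
   have "d z z' = d z b + 1 + d y z'" by (rule d_across[OF b(1) z(1) z'b])
   moreover have "d z z' <= e" using z(2) by (simp add: ball_mem)
   ultimately have "d b z' <= e" using z'b by (simp add: behind_def)
   thus ?thesis by (rule Ux_fix[OF V(1) u(1) z'V])
  qed
  thus ?thesis by (simp add: happ[OF z'V])
 qed
 define c0 where "c0 = c(y := \<zero>\<^bsub>obj F {y}\<^esub>)"
 have c0: "c0 \<in> carrier C0" "c = c0 \<oplus>\<^bsub>C0\<^esub> DS0.single y (c y)"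
  using DS0.DS_split[OF c[unfolded C0] V(2)] by (simp_all add: c0_def C0)
 have c0T: "z \<in> behind y b" if "z \<in> VV" "c0 z ~= \<zero>\<^bsub>obj F {z}\<^esub>" for z
  using that T(2)[of z] Tb[of z] by (cases "z = y") (auto simp: c0_def)
 have fixself: "h z = z" if "z \<in> behind y b" for z
  using hfix[OF that, of z] that ball_self[of z "{z}"] by (simp add: behind_def)
 have "actc h c0 = c0"
 proof (rule DS0.DS_eqI)
  fix z assume z: "z \<in> VV"
  define x' where "x' = inv_into VV h z"
  have x': "x' \<in> VV" "h x' = z" using GG_inv[OF h] z by (simp_all add: x'_def)
  show "actc h c0 z = c0 z"
  proof (cases "c0 x' = \<zero>\<^bsub>obj F {x'}\<^esub>")
   case True
   have "c0 z = \<zero>\<^bsub>obj F {z}\<^esub>"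
   proof (rule ccontr)
    assume n: "c0 z ~= \<zero>\<^bsub>obj F {z}\<^esub>"
    hence "h z = z" using fixself c0T z by blast
    hence "x' = z" using GG_inv(3)[OF h z] by (simp add: x'_def)
    thus False using True n by simp
   qed
   thus ?thesis using True hat_act_0[OF h x'(1)] x'(2) z by (simp add: actc_apply x'_def[symmetric])
  next
   case False
   hence xb': "x' \<in> behind y b" using c0T x' by blast
   hence "x' = z" using fixself x'(2) by simp
   moreover have "hat_act v e F h {x'} (c0 x') = act_map F (mat 1) {x'} (c0 x')"
    using hfix[OF xb'] x'(1) c0(1)
    by (intro hat_act_eq vertex_simplex) (auto simp: ball_mem act_vertex_1 C0 DS0.DS_mem)
   moreover have "c0 x' \<in> Ob F {x'}" using c0(1) x' by (simp add: C0 DS0.DS_mem)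
   ultimately show ?thesis using z F_act_1[OF vertex_simplex] by (simp add: actc_apply x'_def[symmetric])
  qed
 qed (use actc_mem[OF h c0(1)] c0(1) in "simp_all add: C0")
 hence q0: "ract h (Qt.q c0) = Qt.q c0" using ract_q[OF h c0(1)] by simp
 have cy: "c y \<in> Ob F {y}" using c V by (simp add: C0 DS0.DS_mem)
 have "ract h (cls y (c y)) = cls (actv u y) (act_map F u {y} (c y))"
 proof (rule ract_cls'[OF h V(2) cy du])
  fix z assume z: "z \<in> ball {y}"
  hence zV: "z \<in> VV" and yz: "d y z <= e" by (simp_all add: ball_mem)
  have "actv u z = z" if "z \<notin> behind b y"
  proof -
   have "z \<in> behind y b" using behind_or[OF b(1) zV] that by blast
   hence "d b z <= e" using yz by (simp add: behind_def)
   thus ?thesis by (rule Ux_fix[OF V(1) u(1) zV])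
  qed
  thus "h z = actv u z" by (simp add: happ[OF zV])
 qed
 moreover have uy: "actv u y = y" using Ux_fix[OF V(1) u(1) V(2)] by1 e1 by simp
 ultimately have r: "ract h (cls y (c y)) = cls y (act_map F u {y} (c y))" by simp
 have am: "act_map F u {y} (c y) \<in> Ob F {y}"
  using linmapD(1)[OF F_act[OF du vertex_simplex[OF V(2)]] cy] uy by (simp add: act_simplex_vertex)
 interpret H: Module.module \<Lambda> HM by (rule Qt.Q_module)
 have qm: "Qt.q c0 \<in> carrier HM" using c0(1) by (simp add: Qt.Q_carrier)
 have qc: "Qt.q c = Qt.q c0 \<oplus>\<^bsub>HM\<^esub> cls y (c y)"
  using Qt.Q_add[OF c0(1) single_C0[OF V(2) cy]] c0(2) by (simp add: cls_q)
 have "Qt.q c0 \<oplus>\<^bsub>HM\<^esub> cls y (act_map F u {y} (c y)) = Qt.q c0 \<oplus>\<^bsub>HM\<^esub> cls y (c y)"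
  using fx[OF hL] linmapD(2)[OF ract_linmap[OF h] qm cls_mem[OF V(2) cy]] q0 r qc by simp
 hence "cls y (act_map F u {y} (c y)) = cls y (c y)"
  using qm cls_mem[OF V(2) cy] cls_mem[OF V(2) am] by simp
 thus ?thesis using inj_onD[OF cls_inj[OF V(2)]] am cy by blast
qed

lemma act_stabiliser: assumes "y \<in> VV" "f \<in> Ob F {y}"
 shows "subgroup {g. det g ~= 0 \<and> actv g y = y \<and> act_map F g {y} f = f} GL2"
proof (rule subgroup_GL2I)
 fix g assume g: "g \<in> {g. det g ~= 0 \<and> actv g y = y \<and> act_map F g {y} f = f}"
 hence dg: "det g ~= 0" "act_simplex g {y} = {y}" by (simp_all add: act_simplex_vertex)
 have "act_map F (minv g) {y} (act_map F g {y} f) = f"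
  using F_act_mult[OF det_minv_nz[OF dg(1)] dg(1) vertex_simplex[OF assms(1)] assms(2)] F_act_1[OF vertex_simplex[OF assms(1)] assms(2)]
   minv(1)[OF dg(1)] dg(2) by simp
 thus "det g ~= 0 \<and> minv g \<in> {g. det g ~= 0 \<and> actv g y = y \<and> act_map F g {y} f = f}"
  using g act_minv(1)[OF dg(1) assms(1)] by (simp add: det_minv_nz)
next
 fix g h assume "g \<in> {g. det g ~= 0 \<and> actv g y = y \<and> act_map F g {y} f = f}" "h \<in> {g. det g ~= 0 \<and> actv g y = y \<and> act_map F g {y} f = f}"
 thus "g ** h \<in> {g. det g ~= 0 \<and> actv g y = y \<and> act_map F g {y} f = f}"
  using F_act_mult[OF _ _ vertex_simplex[OF assms(1)] assms(2), of g h] assms(1)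
  by (simp add: det_mult2 act_vertex_mult act_simplex_vertex)
qed (use F_act_1[OF vertex_simplex[OF assms(1)] assms(2)] act_vertex_1[OF assms(1)] in simp)

text \<open>U_y^(e) acts trivially on F(y), so invariance under the edge group reduces to invariance
  under U_b^(e).\<close>

lemma edge_invariants: assumes "{b, y} \<in> EE" "f \<in> Ob F {y}" "!!u. u \<in> Ux b ==> act_map F u {y} f = f"
 shows "\<exists>f'\<in>Ob F {b, y}. f = trans_map F {b, y} y f'"
proof -
 have V: "b \<in> VV" "y \<in> VV" "d b y = 1" using assms(1) edge_d by auto
 let ?S = "{g. det g ~= 0 \<and> actv g y = y \<and> act_map F g {y} f = f}"
 have "U_group v p e {b, y} \<subseteq> ?S"
 proof (rule US_induct[OF edge_simplex[OF assms(1)] act_stabiliser[OF V(2) assms(2)]])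
  fix z assume "z \<in> {b, y}"
  then consider "z = b" | "z = y" by blast
  thus "Ux z \<subseteq> ?S"
  proof cases
   case 1
   have "actv u y = y \<and> det u ~= 0" if "u \<in> Ux b" for u
    using Ux_fix[OF V(1) that V(2)] V(3) e1 subgroup_GL2D(1)[OF Ux_subgroup[OF V(1)] that] by simp
   thus ?thesis using assms(3) 1 by blast
  next
   case 2
   have "actv u y = y \<and> det u ~= 0 \<and> act_map F u {y} f = f" if "u \<in> Ux y" for u
    using Ux_fix[OF V(2) that V(2)] V(2) subgroup_GL2D(1)[OF Ux_subgroup[OF V(2)] that]
     F_U[OF vertex_simplex[OF V(2)] _ assms(2), of u] that by (simp add: Ux_def)
   thus ?thesis using 2 by blast
  qed
 qed
 hence "f \<in> trans_map F {b, y} y ` Ob F {b, y}"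
  using F_image[OF assms(1), of y] assms(2) by auto
 thus ?thesis by blast
qed

text \<open>The induction measure is the sum of the distances to \<open>x\<close> over a finite set
  containing the support; moving the value at \<open>y\<close> to its neighbour \<open>b\<close>
  lowers it.\<close>

lemma fixed_vertex: assumes x: "x \<in> VV" and w: "w \<in> carrier HM" and fx: "!!h. h \<in> LC (Ux x) ==> ract h w = w"
 shows "\<exists>f\<in>Ob F {x}. w = cls x f"
proof -
 have "\<exists>f\<in>Ob F {x}. w = cls x f"
  if "finite T" "T \<subseteq> VV" "c \<in> carrier C0" "!!z. z \<in> VV ==> z \<notin> T ==> c z = \<zero>\<^bsub>obj F {z}\<^esub>" "w = Qt.q c" for T c
  using that
 proof (induction "sum (d x) T" arbitrary: T c rule: less_induct)
  case less
  note c = less(4)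
  show ?case
  proof (cases "T \<subseteq> {x}")
   case True
   have cx: "c x \<in> Ob F {x}" using c x by (simp add: C0 DS0.DS_mem)
   have "c = DS0.single x (c x)"
    by (rule DS0.DS_eqI[OF c[unfolded C0] DS0.single_mem[OF x cx]]) (use less(5) True in "auto simp: DS0.single_apply")
   thus ?thesis using less(6) cx by (metis cls_q)
  next
   case False
   hence ne: "T - {x} ~= {}" "finite (T - {x})" using less(2) by auto
   have "Max (d x ` (T - {x})) \<in> d x ` (T - {x})" using ne by (intro Max_in) auto
   then obtain y where y: "y \<in> T - {x}" "d x y = Max (d x ` (T - {x}))" by (elim imageE) metis
   hence far: "d x z <= d x y" if "z \<in> T" "z ~= x" for z using that ne by simp
   have yV: "y \<in> VV" "y ~= x" "y \<in> T" using y less(3) by auto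
   then obtain b where b: "{b, y} \<in> EE" "d x y = d x b + 1" using prev_exists[OF x, of y] by auto
   have bV: "b \<in> VV" using edge_vertices[OF b(1)] by blast
   have cy: "c y \<in> Ob F {y}" using c yV by (simp add: C0 DS0.DS_mem)
   have key: "act_map F u {y} (c y) = c y" if u: "u \<in> Ux b" "u \<in> Ux x" for u
    by (rule pushing_key[OF x c less(3,5) _ b far u]) (use fx less(6) in auto)
   \<comment> \<open>\<open>pushing_key\<close> only covers elements of U_b^(e) that also lie in
     U_x^(e). The other factor given by \<open>Ux_decompose\<close> belongs to U_y^(e) and is
     trivial on F(y).\<close>
   have "act_map F u {y} (c y) = c y" if u: "u \<in> Ux b" for u
   proof -
    obtain u1 u2 where u12: "u1 \<in> Ux b" "u1 \<in> Ux x" "u2 \<in> Ux y" "u = u1 ** u2"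
     using Ux_decompose[OF x b u] by blast
    have dd: "det u1 ~= 0" "det u2 ~= 0"
     using subgroup_GL2D(1)[OF Ux_subgroup[OF bV] u12(1)] subgroup_GL2D(1)[OF Ux_subgroup[OF yV(1)] u12(3)] by auto
    have "act_map F u2 {y} (c y) = c y" using F_U[OF vertex_simplex[OF yV(1)] _ cy] u12(3) by (simp add: Ux_def)
    moreover have "actv u2 y = y" using Ux_fix[OF yV(1) u12(3) yV(1)] yV by simp
    ultimately show ?thesis
     unfolding u12(4) using F_act_mult[OF dd vertex_simplex[OF yV(1)] cy] key[OF u12(1,2)] by (simp add: act_simplex_vertex)
   qed
   then obtain f' where f': "f' \<in> Ob F {b, y}" "c y = trans_map F {b, y} y f'"
    using edge_invariants[OF b(1) cy] by blast
   interpret B: Module.module \<Lambda> "obj F {b}" by (rule F_modV[OF bV])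
   interpret H: Module.module \<Lambda> HM by (rule Qt.Q_module)
   define r where "r = trans_map F {b, y} b f'"
   have r: "r \<in> Ob F {b}" "\<ominus>\<^bsub>obj F {b}\<^esub> r \<in> Ob F {b}"
    using linmapD(1)[OF F_tr[OF b(1), of b] f'(1)] by (simp_all add: r_def)
   define c0 where "c0 = c(y := \<zero>\<^bsub>obj F {y}\<^esub>)"
   have c0: "c0 \<in> carrier C0" "c = c0 \<oplus>\<^bsub>C0\<^esub> DS0.single y (c y)"
    using DS0.DS_split[OF c[unfolded C0] yV(1)] by (simp_all add: c0_def C0)
   define c' where "c' = c0 \<oplus>\<^bsub>C0\<^esub> DS0.single b (\<ominus>\<^bsub>obj F {b}\<^esub> r)"
   have c': "c' \<in> carrier C0" unfolding c'_def using c0(1) single_C0[OF bV r(2)] by (simp add: Qt.M.M.add.m_closed)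
   define T' where "T' = insert b (T - {y})"
   have T': "finite T'" "T' \<subseteq> VV" using less(2,3) bV by (auto simp: T'_def)
   have z: "c' z = \<zero>\<^bsub>obj F {z}\<^esub>" if zz: "z \<in> VV" "z \<notin> T'" for z
   proof -
    have "c0 z = \<zero>\<^bsub>obj F {z}\<^esub>" "z ~= b" using zz less(5)[of z] by (auto simp: T'_def c0_def)
    thus ?thesis using zz(1) by (simp add: c'_def C0 DS0.DS_apply DS0.single_apply DS0.mod_facts)
   qed
   have "cls y (c y) = \<ominus>\<^bsub>HM\<^esub> cls b r" unfolding f'(2) r_def by (rule cls_edge_neg[OF b(1) f'(1)])
   also have "\<dots> = cls b (\<ominus>\<^bsub>obj F {b}\<^esub> r)"
    by (rule linmap_neg[OF cls_linmap[OF bV] F_modV[OF bV] Qt.Q_module r(1), symmetric])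
   finally have "Qt.q c = Qt.q c'"
    using Qt.Q_add[OF c0(1) single_C0[OF yV(1) cy]] Qt.Q_add[OF c0(1) single_C0[OF bV r(2)]] c0(2)
    by (simp add: cls_q c'_def)
   hence wc': "w = Qt.q c'" using less(6) by simp
   \<comment> \<open>An inequality only, since \<open>b\<close> may already belong to
     \<open>T\<close>.\<close>
   have "sum (d x) T' <= d x b + sum (d x) (T - {y})"
    using less(2) by (cases "b \<in> T - {y}") (auto simp: T'_def insert_absorb)
   also have "\<dots> < d x y + sum (d x) (T - {y})" using b(2) by simp
   also have "\<dots> = sum (d x) T" using yV(3) less(2) by (simp add: sum.remove)
   finally show ?thesis using less(1)[OF _ T' c' z wc'] by blast
  qed
 qed
 moreover obtain c where c: "c \<in> carrier C0" "w = Qt.q c" using w by (auto simp: Qt.Q_carrier)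
 moreover have "finite {z\<in>VV. c z ~= \<zero>\<^bsub>obj F {z}\<^esub>}" using c by (simp add: C0 DS0.DS_mem)
 ultimately show ?thesis by blast
qed

text \<open>The edge group contains the group of \<open>x\<close>, so the vector comes from some
  \<open>f\<close> in F(x). As F(x) embeds into homology, the remaining invariance under U_y^(e)
  passes to \<open>f\<close> itself.\<close>

lemma fixed_edge: assumes xy: "{x, y} \<in> EE" and w: "w \<in> carrier HM" and fx: "!!h. h \<in> hU {x, y} ==> ract h w = w"
 shows "\<exists>f\<in>Ob F {x, y}. w = cls x (trans_map F {x, y} x f)"
proof -
 have V: "x \<in> VV" "y \<in> VV" "d y x = 1" using xy edge_d d_sym by auto
 have yx: "{y, x} \<in> EE" using xy by (simp add: insert_commute)
 have "ract h w = w" if "h \<in> LC (Ux x)" for h using fx hUx_hU[OF edge_simplex[OF xy] _ that] by blast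
 then obtain f where f: "f \<in> Ob F {x}" "w = cls x f" using fixed_vertex[OF V(1) w] by blast
 have "act_map F u {x} f = f" if u: "u \<in> Ux y" for u
 proof -
  have du: "det u ~= 0" using subgroup_GL2D(1)[OF Ux_subgroup[OF V(2)] u] .
  have ux: "actv u x = x" using Ux_fix[OF V(2) u V(1)] V(3) e1 by simp
  have "th u \<in> hU {x, y}" unfolding hat_U_def
   by (rule th_LC[OF US_subgroup[OF edge_simplex[OF xy]] Ux_US[OF edge_simplex[OF xy] _ u]]) simp
  hence "cls x f = ract (th u) (cls x f)" using fx f(2) by simp
  also have "\<dots> = cls (actv u x) (act_map F u {x} f)"
   by (rule ract_cls'[OF th_GG[OF du] V(1) f(1) du]) (simp add: th_apply ball_mem)
  finally have "cls x f = cls x (act_map F u {x} f)" using ux by simp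
  moreover have "act_map F u {x} f \<in> Ob F {x}"
   using linmapD(1)[OF F_act[OF du vertex_simplex[OF V(1)]] f(1)] ux by (simp add: act_simplex_vertex)
  ultimately show ?thesis using inj_onD[OF cls_inj[OF V(1)]] f(1) by metis
 qed
 then obtain f' where "f' \<in> Ob F {y, x}" "f = trans_map F {y, x} x f'" using edge_invariants[OF yx f(1)] by blast
 thus ?thesis using f(2) by (auto simp: insert_commute)
qed

subsection \<open>Membership in the category of representations\<close>

text \<open>Carries over to homology the condition that the image of one edge generates the module
  of a vertex under \<open>K_group v x\<close>.\<close>

lemma vertex_generated: assumes N: "submodule N \<Lambda> HM" and xy: "{x, y} \<in> EE"
 and K: "!!k w. k \<in> K_group v x ==> w \<in> N ==> ract (th k) w \<in> N"
 and r: "!!f. f \<in> Ob F {x, y} ==> cls x (trans_map F {x, y} x f) \<in> N" and f: "f \<in> Ob F {x}"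
 shows "cls x f \<in> N"
proof -
 have x: "x \<in> VV" using edge_vertices[OF xy] by blast
 let ?P = "{f \<in> Ob F {x}. cls x f \<in> N}"
 have "subrep_generated \<Lambda> (obj F {x}) (K_group v x) (\<lambda>g. act_map F g {x}) (trans_map F {x, y} x ` Ob F {x, y}) \<subseteq> ?P"
 proof (rule subrep_generated_le[OF linmap_preimage_submod[OF cls_linmap[OF x] F_modV[OF x] Qt.Q_module N]])
  fix k f assume k: "k \<in> K_group v x" and f: "f \<in> ?P"
  have kk: "det k ~= 0" "actv k x = x" using K_group_props(1)[OF x k] by auto
  have "ract (th k) (cls x f) = cls (actv k x) (act_map F k {x} f)"
   by (rule ract_cls'[OF th_GG[OF kk(1)] x _ kk(1)]) (use f in "simp_all add: th_apply ball_mem")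
  moreover have "act_map F k {x} f \<in> Ob F {x}"
   using linmapD(1)[OF F_act[OF kk(1) vertex_simplex[OF x]]] f kk(2) by (simp add: act_simplex_vertex)
  moreover have "ract (th k) (cls x f) \<in> N" using K[OF k, of "cls x f"] f by blast
  ultimately show "act_map F k {x} f \<in> ?P" using kk(2) by simp
 next
  show "trans_map F {x, y} x ` Ob F {x, y} \<subseteq> ?P"
   using r linmapD(1)[OF F_tr[OF xy, of x]] by auto
 qed
 thus ?thesis using F_gen[OF xy, of x] f by auto
qed

text \<open>The matrices act transitively on edges, so the vectors fixed by one edge group produce
  the classes of all edges, and these generate at every vertex.\<close>

lemma H0_generated: assumes \<sigma>: "{a, b} \<in> EE"
 shows "subrep_generated \<Lambda> HM (carrier hG) ract (rep_fixed (H0 v e F) (hU {a, b})) = carrier HM"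
proof (rule subrep_generated_eqI[OF Qt.Q_module])
 show "rep_fixed (H0 v e F) (hU {a, b}) \<subseteq> carrier HM" by (auto simp: rep_fixed_def H0_mod)
 show "ract h w \<in> carrier HM" if "h \<in> carrier hG" "w \<in> carrier HM" for h w
  using linmapD(1)[OF ract_linmap] that by simp
 fix N assume N: "submodule N \<Lambda> HM" "!!h w. h \<in> carrier hG ==> w \<in> N ==> ract h w \<in> N" "rep_fixed (H0 v e F) (hU {a, b}) \<subseteq> N"
 have e: "cls x (trans_map F {x, y} x f) \<in> N" if xy: "{x, y} \<in> EE" and f: "f \<in> Ob F {x, y}" for x y f
 proof -
  obtain g where g: "det g ~= 0" "actv g a = x" "actv g b = y" using edge_transitive[OF \<sigma> xy] by blast
  have V: "a \<in> VV" "b \<in> VV" "x \<in> VV" "y \<in> VV" using edge_vertices[OF \<sigma>] edge_vertices[OF xy] by auto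
  have dm: "det (minv g) ~= 0" by (rule det_minv_nz[OF g(1)])
  have s: "act_simplex (minv g) {x, y} = {a, b}" using act_minv(1)[OF g(1)] V g(2,3) by (auto simp: act_simplex_def)
  have sa: "act_simplex g {a, b} = {x, y}" using g by (simp add: act_simplex_def)
  define f' where "f' = act_map F (minv g) {x, y} f"
  have f': "f' \<in> Ob F {a, b}" using linmapD(1)[OF F_act[OF dm edge_simplex[OF xy]] f] s by (simp add: f'_def)
  have "act_map F g {a, b} f' = f"
   using F_act_mult[OF g(1) dm edge_simplex[OF xy] f] s minv(2)[OF g(1)] F_act_1[OF edge_simplex[OF xy] f] by (simp add: f'_def)
  hence tr: "act_map F g {a} (trans_map F {a, b} a f') = trans_map F {x, y} x f"
   using F_act_tr[OF g(1) \<sigma> _ f', of a] sa g(2) by simp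
  have r: "trans_map F {a, b} a f' \<in> Ob F {a}" using linmapD(1)[OF F_tr[OF \<sigma>, of a] f'] by simp
  have "cls a (trans_map F {a, b} a f') \<in> N"
   using N(3) cls_fixed_edge[OF \<sigma> f'] cls_mem[OF V(1) r] by (auto simp: rep_fixed_def H0_mod)
  hence "ract (th g) (cls a (trans_map F {a, b} a f')) \<in> N" using N(2) th_GG[OF g(1)] by simp
  moreover have "ract (th g) (cls a (trans_map F {a, b} a f')) = cls (actv g a) (act_map F g {a} (trans_map F {a, b} a f'))"
   by (rule ract_cls'[OF th_GG[OF g(1)] V(1) r g(1)]) (simp add: th_apply ball_mem)
  ultimately show ?thesis using tr g(2) by simp
 qed
 have "cls x f \<in> N" if x: "x \<in> VV" "f \<in> Ob F {x}" for x f
 proof -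
  obtain y where xy: "{x, y} \<in> EE" using vertex_on_edge[OF x(1)] by blast
  show ?thesis by (rule vertex_generated[OF N(1) xy _ _ x(2)])
   (use N(2) th_GG K_group_props(1)[OF x(1)] e[OF xy] in auto)
 qed
 thus "carrier HM \<subseteq> N" using H_submod_eq[OF N(1)] by blast
qed

lemma H0_smooth: assumes \<sigma>: "{a, b} \<in> EE" and w: "w \<in> carrier HM"
 shows "\<exists>m. \<forall>h\<in>hU {a, b}. (\<forall>x\<in>tree_ball v m {a, b}. h x = x) --> ract h w = w"
 using w
proof (rule H_induct)
 have z: "ract h \<zero>\<^bsub>HM\<^esub> = \<zero>\<^bsub>HM\<^esub>" if "h \<in> hU {a, b}" for h
  using linmap_0[OF ract_linmap Qt.Q_module Qt.Q_module] hU_GG[OF edge_simplex[OF \<sigma>] that] by blast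
 thus "\<exists>m. \<forall>h\<in>hU {a, b}. (\<forall>x\<in>tree_ball v m {a, b}. h x = x) --> ract h \<zero>\<^bsub>HM\<^esub> = \<zero>\<^bsub>HM\<^esub>" by blast
next
 fix w w' assume ww: "w \<in> carrier HM" "w' \<in> carrier HM"
  "\<exists>m. \<forall>h\<in>hU {a, b}. (\<forall>x\<in>tree_ball v m {a, b}. h x = x) --> ract h w = w"
  "\<exists>m. \<forall>h\<in>hU {a, b}. (\<forall>x\<in>tree_ball v m {a, b}. h x = x) --> ract h w' = w'"
 from ww(3) obtain m where m: "\<forall>h\<in>hU {a, b}. (\<forall>x\<in>tree_ball v m {a, b}. h x = x) --> ract h w = w" by (rule exE)
 from ww(4) obtain m' where m': "\<forall>h\<in>hU {a, b}. (\<forall>x\<in>tree_ball v m' {a, b}. h x = x) --> ract h w' = w'" by (rule exE)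
 have "ract h (w \<oplus>\<^bsub>HM\<^esub> w') = w \<oplus>\<^bsub>HM\<^esub> w'" if h: "h \<in> hU {a, b}" "\<forall>x\<in>tree_ball v (max m m') {a, b}. h x = x" for h
 proof -
  have "tree_ball v m {a, b} \<subseteq> tree_ball v (max m m') {a, b}" "tree_ball v m' {a, b} \<subseteq> tree_ball v (max m m') {a, b}"
   by (auto simp: tree_ball_def)
  hence "\<forall>x\<in>tree_ball v m {a, b}. h x = x" "\<forall>x\<in>tree_ball v m' {a, b}. h x = x" using h(2) by blast+
  hence "ract h w = w" "ract h w' = w'" using m m' h(1) by simp_all
  thus ?thesis using linmapD(2)[OF ract_linmap[OF hU_GG[OF edge_simplex[OF \<sigma>] h(1)]] ww(1,2)] by simp
 qed
 thus "\<exists>m. \<forall>h\<in>hU {a, b}. (\<forall>x\<in>tree_ball v m {a, b}. h x = x) --> ract h (w \<oplus>\<^bsub>HM\<^esub> w') = w \<oplus>\<^bsub>HM\<^esub> w'"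
  by (intro exI[of _ "max m m'"]) simp
next
 fix x f assume x: "x \<in> VV" "f \<in> Ob F {x}"
 have V: "a \<in> VV" using edge_vertices[OF \<sigma>] by blast
 \<comment> \<open>With this radius the set fixed by \<open>h\<close> contains the ball of
   \<open>x\<close>, which decides how \<open>h\<close> acts on F(x).\<close>
 have "ract h (cls x f) = cls x f" if h: "h \<in> hU {a, b}" "\<forall>z\<in>tree_ball v (d a x + e) {a, b}. h z = z" for h
 proof -
  have hz: "h z = actv (mat 1) z" if z: "z \<in> ball {x}" for z
  proof -
   have zV: "z \<in> VV" "d x z <= e" using z by (simp_all add: ball_mem)
   hence "d a z <= d a x + e" using d_triangle[OF V x(1) zV(1)] by simp
   hence "z \<in> tree_ball v (d a x + e) {a, b}" using zV by (simp add: tree_ball_def)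
   thus ?thesis using h(2) zV(1) by (simp add: act_vertex_1)
  qed
  show ?thesis using ract_cls'[OF hU_GG[OF edge_simplex[OF \<sigma>] h(1)] x, of "mat 1"] hz x
   by (simp add: act_vertex_1 F_act_1 vertex_simplex)
 qed
 thus "\<exists>m. \<forall>h\<in>hU {a, b}. (\<forall>z\<in>tree_ball v m {a, b}. h z = z) --> ract h (cls x f) = cls x f"
  by (intro exI[of _ "d a x + e"]) simp
qed

lemma H0_R0: assumes \<sigma>: "{a, b} \<in> EE" shows "H0 v e F \<in> cat_R0 v p e {a, b} \<Lambda>"
 unfolding cat_R0_def
proof (intro CollectI conjI ballI)
 show "hat_rep v e \<Lambda> (H0 v e F)" by (rule H0_rep)
 show "subrep_generated \<Lambda> (rep_mod (H0 v e F)) (carrier hG) ract (rep_fixed (H0 v e F) (hU {a, b})) = carrier (rep_mod (H0 v e F))"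
  unfolding H0_mod by (rule H0_generated[OF \<sigma>])
 fix w assume "w \<in> carrier (rep_mod (H0 v e F))"
 hence w: "w \<in> carrier HM" by (simp only: H0_mod)
 from H0_smooth[OF \<sigma> w] obtain m
  where m: "\<forall>h\<in>hU {a, b}. (\<forall>x\<in>tree_ball v m {a, b}. h x = x) --> ract h w = w" by (rule exE)
 \<comment> \<open>The pointwise stabiliser of a finite ball is the fibre through the identity of a
   restriction map, hence a basic open set.\<close>
 let ?H = "{g \<in> hU {a, b}. \<forall>x\<in>tree_ball v m {a, b}. g x = \<one>\<^bsub>hG\<^esub> x}"
 have sU: "subgroup (hU {a, b}) hG" by (rule hU_subgroup[OF edge_simplex[OF \<sigma>]])
 have one: "\<one>\<^bsub>hG\<^esub> \<in> hU {a, b}" by (rule subgroup.one_closed[OF sU])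
 have GGU: "g \<in> GG" if "g \<in> hU {a, b}" for g by (rule hU_GG[OF edge_simplex[OF \<sigma>] that])
 interpret hG: group hG by (rule hG_group)
 have tb: "x \<in> VV" if "x \<in> tree_ball v m {a, b}" for x using that by (simp add: tree_ball_def)
 have "subgroup ?H hG"
 proof (rule hG.subgroupI)
  show "?H \<subseteq> carrier hG" using GGU by auto
  show "?H ~= {}" using one by blast
 next
  fix g assume g: "g \<in> ?H"
  hence gG: "g \<in> GG" "inv\<^bsub>hG\<^esub> g \<in> GG" using GGU hG.inv_closed[of g] by auto
  have "(inv\<^bsub>hG\<^esub> g) x = x" if x: "x \<in> tree_ball v m {a, b}" for x
  proof -
   have "g x = x" using g x tb by (simp add: hG_one(1))
   hence "(inv\<^bsub>hG\<^esub> g) x = (inv\<^bsub>hG\<^esub> g \<otimes>\<^bsub>hG\<^esub> g) x" using hG_mult_apply[OF gG(2,1) tb[OF x]] by simp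
   moreover have "inv\<^bsub>hG\<^esub> g \<otimes>\<^bsub>hG\<^esub> g = \<one>\<^bsub>hG\<^esub>" using hG.l_inv[of g] gG(1) by simp
   ultimately show ?thesis using tb[OF x] by (simp add: hG_one(1))
  qed
  thus "inv\<^bsub>hG\<^esub> g \<in> ?H" using g subgroup.m_inv_closed[OF sU] tb by (simp add: hG_one(1))
 next
  fix g h assume g: "g \<in> ?H" and h: "h \<in> ?H"
  thus "g \<otimes>\<^bsub>hG\<^esub> h \<in> ?H" using subgroup.m_closed[OF sU, of g h] GGU tb by (simp add: hG_mult_apply hG_one(1))
 qed
 moreover have "openin (hat_U_topology v p e {a, b}) ?H"
 proof -
  have "?H \<in> {{g \<in> hU {a, b}. \<forall>x\<in>tree_ball v m {a, b}. g x = h x} | h m. h \<in> hU {a, b}}" using one by blast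
  thus ?thesis unfolding hat_U_topology_def by (rule topology_generated_by_Basis)
 qed
 moreover have "\<forall>h\<in>?H. ract h w = w"
 proof
  fix h assume "h \<in> ?H"
  hence "h \<in> hU {a, b}" "\<forall>x\<in>tree_ball v m {a, b}. h x = x" using tb by (simp_all add: hG_one(1))
  thus "ract h w = w" using m by simp
 qed
 ultimately show "\<exists>H. subgroup H hG \<and> openin (hat_U_topology v p e {a, b}) H \<and> (\<forall>h\<in>H. ract h w = w)"
  by (intro exI[of _ ?H] conjI)
qed

end

section \<open>The coefficient system of a representation\<close>

lemma linmap_uminus: assumes "Module.module R M" shows "linmap R M M (\<lambda>w. \<ominus>\<^bsub>M\<^esub> w)"
proof -
 interpret M: Module.module R M by fact
 show ?thesis by (rule linmapI) (simp_all add: M.M.minus_add M.smult_r_minus)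
qed

lemma linmap_restrict: assumes "linmap R M M' f" "submodule N R M" "Module.module R M" "!!x. x \<in> N ==> f x \<in> N'"
 shows "linmap R (M\<lparr>carrier := N\<rparr>) (M'\<lparr>carrier := N'\<rparr>) f"
proof -
 have "N \<subseteq> carrier M" using assms(2) unfolding submod_iff[OF assms(3)] by blast
 thus ?thesis using assms(1,4) by (auto simp: linmap_def subset_iff)
qed

lemma submod_carrier_iff: assumes "Module.module R M" "submodule N R M"
 shows "submodule K R (M\<lparr>carrier := N\<rparr>) \<longleftrightarrow> submodule K R M \<and> K \<subseteq> N"
proof -
 have "N \<subseteq> carrier M" using assms(2) unfolding submod_iff[OF assms(1)] by blast
 thus ?thesis unfolding submod_iff[OF submod_module[OF assms]] submod_iff[OF assms(1)] by auto
qed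

locale smooth_rep = tree_level v p e for v :: "'f::field => int" and p e :: nat +
 fixes \<Lambda> :: "('l, 'c) ring_scheme" and xp xm :: "'f vertex" and V :: "('f, 'l, 'w) rep"
 assumes xpm: "{xp, xm} \<in> edges v" and V: "V \<in> cat_R0 v p e {xp, xm} \<Lambda>"
begin

abbreviation "W \<equiv> rep_mod V"
abbreviation "\<rho> \<equiv> rep_act V"
abbreviation "Fh \<equiv> F_hat v p e xp V"
abbreviation "FV \<equiv> F_hat_vertex v p e V"
abbreviation "fixd \<tau> \<equiv> rep_fixed V (hU \<tau>)"

lemma V_rep: "hat_rep v e \<Lambda> V"
 using V by (simp add: cat_R0_def)

lemma W_module: "Module.module \<Lambda> W"
 using V_rep by (simp add: hat_rep_def)

sublocale W: Module.module \<Lambda> W by (rule W_module)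

lemma \<rho>_linmap: assumes "g \<in> GG" shows "linmap \<Lambda> W W (\<rho> g)"
proof -
 have "\<forall>g\<in>carrier hG. linear_on \<Lambda> W W (\<rho> g)"
  using V_rep unfolding hat_rep_def by (elim conjE) assumption
 hence "linear_on \<Lambda> W W (\<rho> g)" using assms by simp
 thus ?thesis by (rule iffD1[OF linear_on_iff[OF W_module]])
qed

lemma \<rho>_mult: assumes "g \<in> GG" "h \<in> GG" "w \<in> carrier W" shows "\<rho> (g \<otimes>\<^bsub>hG\<^esub> h) w = \<rho> g (\<rho> h w)"
proof -
 have "\<forall>g\<in>carrier hG. \<forall>h\<in>carrier hG. \<forall>w\<in>carrier W. \<rho> (g \<otimes>\<^bsub>hG\<^esub> h) w = \<rho> g (\<rho> h w)"
  using V_rep unfolding hat_rep_def by (elim conjE) assumption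
 thus ?thesis using assms by simp
qed

lemma \<rho>_one: "w \<in> carrier W ==> \<rho> \<one>\<^bsub>hG\<^esub> w = w"
 using V_rep by (simp add: hat_rep_def)

lemma \<rho>_th_1: "w \<in> carrier W ==> \<rho> (th (mat 1)) w = w"
 using \<rho>_one hG_one(2) by simp

lemma \<rho>_mem: "g \<in> GG ==> w \<in> carrier W ==> \<rho> g w \<in> carrier W"
 using linmapD(1)[OF \<rho>_linmap] .

lemma \<rho>_th_mult: assumes "det g ~= 0" "det h ~= 0" "w \<in> carrier W" shows "\<rho> (th (g ** h)) w = \<rho> (th g) (\<rho> (th h) w)"
 using \<rho>_mult[OF th_GG[OF assms(1)] th_GG[OF assms(2)] assms(3)] th_mult[OF assms(1,2)] by simp

lemma \<rho>_th_minv: assumes "det g ~= 0" "w \<in> carrier W" shows "\<rho> (th g) (\<rho> (th (minv g)) w) = w"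
 using \<rho>_th_mult[OF assms(1) det_minv_nz[OF assms(1)] assms(2)] minv(2)[OF assms(1)] \<rho>_th_1[OF assms(2)] by simp

lemma fixd_carrier: "w \<in> fixd \<tau> ==> w \<in> carrier W"
 by (simp add: rep_fixed_def)

lemma fixd_submod: assumes "\<tau> \<in> SS" shows "submodule (fixd \<tau>) \<Lambda> W"
proof -
 have "linmap \<Lambda> W W (\<rho> h)" if "h \<in> hU \<tau>" for h by (rule \<rho>_linmap[OF hU_GG[OF assms that]])
 note L = linmapD[OF this] linmap_0[OF this W_module W_module]
 show ?thesis unfolding submod_iff[OF W_module] using L by (auto simp: rep_fixed_def)
qed

lemma FV_submod: assumes "x \<in> VV" shows "submodule (FV x) \<Lambda> W"
 unfolding submod_iff[OF W_module]
proof (intro conjI ballI)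
 let ?n = "{y. {x, y} \<in> EE}"
 let ?P = "\<lambda>w. \<forall>y. {x, y} \<in> EE --> w y \<in> fixd {x, y}"
 have s: "submodule (fixd {x, y}) \<Lambda> W" if "{x, y} \<in> EE" for y using fixd_submod edge_simplex that by blast
 note S = s[unfolded submod_iff[OF W_module]]
 have PW: "w \<in> ?n \<rightarrow> carrier W" if "?P w" for w using that fixd_carrier by blast
 show "FV x \<subseteq> carrier W" using PW by (auto simp: F_hat_vertex_def intro!: W.M.finsum_closed)
 have "?P (\<lambda>_. \<zero>\<^bsub>W\<^esub>)" using S by blast
 moreover have "finsum W (\<lambda>_. \<zero>\<^bsub>W\<^esub>) ?n = \<zero>\<^bsub>W\<^esub>" by simp
 ultimately show "\<zero>\<^bsub>W\<^esub> \<in> FV x" unfolding F_hat_vertex_def by (intro CollectI exI[of _ "\<lambda>_. \<zero>\<^bsub>W\<^esub>"]) simp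
 fix a assume "a \<in> FV x"
 then obtain w where w: "a = finsum W w ?n" "?P w" unfolding F_hat_vertex_def by blast
 show "a \<oplus>\<^bsub>W\<^esub> b \<in> FV x" if b: "b \<in> FV x" for b
 proof -
  obtain w' where w': "b = finsum W w' ?n" "?P w'" using b unfolding F_hat_vertex_def by blast
  have "?P (\<lambda>y. w y \<oplus>\<^bsub>W\<^esub> w' y)" using S w w' by blast
  moreover have "finsum W (\<lambda>y. w y \<oplus>\<^bsub>W\<^esub> w' y) ?n = a \<oplus>\<^bsub>W\<^esub> b"
   using W.M.finsum_addf[OF PW[OF w(2)] PW[OF w'(2)]] w w' by simp
  ultimately show ?thesis unfolding F_hat_vertex_def by (intro CollectI exI[of _ "\<lambda>y. w y \<oplus>\<^bsub>W\<^esub> w' y"]) simp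
 qed
next
 let ?n = "{y. {x, y} \<in> EE}"
 let ?P = "\<lambda>w. \<forall>y. {x, y} \<in> EE --> w y \<in> fixd {x, y}"
 fix r a assume r: "r \<in> carrier \<Lambda>" and "a \<in> FV x"
 then obtain w where w: "a = finsum W w ?n" "?P w" unfolding F_hat_vertex_def by blast
 have "submodule (fixd {x, y}) \<Lambda> W" if "{x, y} \<in> EE" for y using fixd_submod edge_simplex that by blast
 hence "?P (\<lambda>y. r \<odot>\<^bsub>W\<^esub> w y)" using r w unfolding submod_iff[OF W_module] by blast
 moreover have "finsum W (\<lambda>y. r \<odot>\<^bsub>W\<^esub> w y) ?n = r \<odot>\<^bsub>W\<^esub> a"
  unfolding w(1) by (rule W.finsum_smult_ldistr[OF finite_edges_at r, symmetric]) (use w fixd_carrier in blast)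
 ultimately show "r \<odot>\<^bsub>W\<^esub> a \<in> FV x" unfolding F_hat_vertex_def by (intro CollectI exI[of _ "\<lambda>y. r \<odot>\<^bsub>W\<^esub> w y"]) simp
qed

lemma FV_carrier: "x \<in> VV ==> w \<in> FV x ==> w \<in> carrier W"
 using FV_submod[unfolded submod_iff[OF W_module]] by blast

lemma fixd_FV: assumes "{x, y} \<in> EE" "w \<in> fixd {x, y}" shows "w \<in> FV x"
proof -
 let ?w = "\<lambda>z. if z = y then w else \<zero>\<^bsub>W\<^esub>"
 have "finsum W ?w {y. {x, y} \<in> EE} = (if y \<in> {y. {x, y} \<in> EE} then ?w y else \<zero>\<^bsub>W\<^esub>)"
  by (rule W.M.finsum_only[OF finite_edges_at]) (use fixd_carrier[OF assms(2)] in auto)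
 hence "finsum W ?w {y. {x, y} \<in> EE} = w" using assms by simp
 moreover have "?w z \<in> fixd {x, z}" if "{x, z} \<in> EE" for z
  using assms(2) fixd_submod[OF edge_simplex[OF that], unfolded submod_iff[OF W_module]] by auto
 ultimately show ?thesis unfolding F_hat_vertex_def by (intro CollectI exI[of _ ?w]) simp
qed

text \<open>The universal property of the sum: containments need only be checked on the fixed
  vectors of the edges at \<open>x\<close>.\<close>

lemma FV_le: assumes "submodule N \<Lambda> W" "!!y. {x, y} \<in> EE ==> fixd {x, y} \<subseteq> N" shows "FV x \<subseteq> N"
proof
 fix a assume "a \<in> FV x"
 then obtain w where w: "a = finsum W w {y. {x, y} \<in> EE}" "\<forall>y. {x, y} \<in> EE --> w y \<in> fixd {x, y}"
  unfolding F_hat_vertex_def by blast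
 show "a \<in> N" unfolding w(1) by (rule submod_finsum[OF W_module assms(1)]) (use w(2) assms(2) in blast)
qed

text \<open>The closure of U_x^(e) is contained in the completed group of every edge at
  \<open>x\<close>, so it fixes each summand.\<close>

lemma FV_LC_fixed: assumes "x \<in> VV" "w \<in> FV x" "k \<in> LC (Ux x)" shows "\<rho> k w = w"
proof -
 have k: "k \<in> GG" by (rule LC_GG[OF assms(3) Ux_subgroup[OF assms(1)]])
 have "FV x \<subseteq> {w \<in> carrier W. \<rho> k w = (\<lambda>w. w) w}"
 proof (rule FV_le[OF linmap_equalizer_submod[OF \<rho>_linmap[OF k] _ W_module W_module]])
  show "linmap \<Lambda> W W (\<lambda>w. w)" by (simp add: linmap_def)
  show "fixd {x, y} \<subseteq> {w \<in> carrier W. \<rho> k w = w}" if "{x, y} \<in> EE" for y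
   using hUx_hU[OF edge_simplex[OF that] _ assms(3)] by (auto simp: rep_fixed_def)
 qed
 thus ?thesis using assms(2) by blast
qed

lemma FV_act_eq: assumes "x \<in> VV" "w \<in> FV x" "g \<in> GG" "det g' ~= 0" "!!z. z \<in> ball {x} ==> g z = actv g' z"
 shows "\<rho> g w = \<rho> (th g') w"
proof -
 obtain k where k: "k \<in> LC (Ux x)" "g = th g' \<otimes>\<^bsub>hG\<^esub> k" using hat_agree[OF assms(1,3,4,5)] by blast
 thus ?thesis
  using \<rho>_mult[OF th_GG[OF assms(4)] LC_GG[OF k(1) Ux_subgroup[OF assms(1)]] FV_carrier[OF assms(1,2)]]
   FV_LC_fixed[OF assms(1,2) k(1)] by simp
qed

text \<open>On the sum at \<open>z\<close>, an element of the completed edge group acts like the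
  matrix that models it at that edge. This reconciles condition (b), which speaks of matrices, with
  the fixed vectors of the completed group.\<close>

lemma FV_fixed: assumes "{z, y} \<in> EE" "w \<in> FV z" "!!u. u \<in> U_group v p e {z, y} ==> \<rho> (th u) w = w"
 shows "w \<in> fixd {z, y}"
proof -
 have zV: "z \<in> VV" using edge_vertices[OF assms(1)] by blast
 have "\<rho> h w = w" if h: "h \<in> hU {z, y}" for h
 proof -
  obtain u where u: "u \<in> U_group v p e {z, y}" "\<forall>x\<in>ball {z, y}. h x = actv u x"
   using LC_D(6)[OF h[unfolded hat_U_def] assms(1)] by blast
  have "\<rho> h w = \<rho> (th u) w"
   by (rule FV_act_eq[OF zV assms(2) hU_GG[OF edge_simplex[OF assms(1)] h] subgroup_GL2D(1)[OF US_subgroup[OF edge_simplex[OF assms(1)]] u(1)]])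
    (use u(2) in "auto simp: ball_mem")
  thus ?thesis using assms(3)[OF u(1)] by simp
 qed
 thus ?thesis using FV_carrier[OF zV assms(2)] by (simp add: rep_fixed_def)
qed

lemma \<rho>_fixd: assumes "\<tau> \<in> SS" "det g ~= 0" "w \<in> fixd \<tau>" shows "\<rho> (th g) w \<in> fixd (act_simplex g \<tau>)"
proof -
 have wW: "w \<in> carrier W" by (rule fixd_carrier[OF assms(3)])
 have "\<rho> h' (\<rho> (th g) w) = \<rho> (th g) w" if h': "h' \<in> hU (act_simplex g \<tau>)" for h'
 proof -
  obtain h where h: "h \<in> hU \<tau>" "h' \<otimes>\<^bsub>hG\<^esub> th g = th g \<otimes>\<^bsub>hG\<^esub> h" using hU_conj[OF assms(1,2) h'] by blast
  have G: "h' \<in> GG" "h \<in> GG" "th g \<in> GG"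
   using hU_GG[OF simplex_act[OF assms(2,1)] h'] hU_GG[OF assms(1) h(1)] th_GG[OF assms(2)] by auto
  have "\<rho> h' (\<rho> (th g) w) = \<rho> (th g) (\<rho> h w)" using \<rho>_mult[OF G(1,3) wW] \<rho>_mult[OF G(3,2) wW] h(2) by simp
  thus ?thesis using assms(3) h(1) by (simp add: rep_fixed_def)
 qed
 thus ?thesis using \<rho>_mem[OF th_GG[OF assms(2)] wW] by (simp add: rep_fixed_def)
qed

lemma \<rho>_FV: assumes "x \<in> VV" "det g ~= 0" "w \<in> FV x" shows "\<rho> (th g) w \<in> FV (actv g x)"
proof -
 have gx: "actv g x \<in> VV" by (rule act_vertex_VV[OF assms(2,1)])
 have "FV x \<subseteq> {w \<in> carrier W. \<rho> (th g) w \<in> FV (actv g x)}"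
 proof (rule FV_le[OF linmap_preimage_submod[OF \<rho>_linmap[OF th_GG[OF assms(2)]] W_module W_module FV_submod[OF gx]]])
  fix y assume xy: "{x, y} \<in> EE"
  have E: "{actv g x, actv g y} \<in> EE" using edge_act[OF assms(2) xy] by (simp add: act_simplex_def)
  have "\<rho> (th g) w \<in> FV (actv g x)" if "w \<in> fixd {x, y}" for w
   by (rule fixd_FV[OF E]) (use \<rho>_fixd[OF edge_simplex[OF xy] assms(2) that] in "simp add: act_simplex_def")
  thus "fixd {x, y} \<subseteq> {w \<in> carrier W. \<rho> (th g) w \<in> FV (actv g x)}" using fixd_carrier by blast
 qed
 thus ?thesis using assms(3) by blast
qed

subsection \<open>Signs\<close>

abbreviation "pl x \<equiv> x \<in> SL2_orbit xp"

lemma xpV: "xp \<in> VV" "xm \<in> VV"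
 using edge_vertices[OF xpm] by auto

text \<open>Source of the sign in the action on edges; it is multiplicative because valuations of
  determinants add.\<close>

lemma pl_act: assumes "x \<in> VV" "det g ~= 0" shows "pl (actv g x) \<longleftrightarrow> (pl x \<longleftrightarrow> even (v (det g)))"
proof -
 obtain A B where AB: "det A ~= 0" "xp = vx A" "det B ~= 0" "x = vx B" using xpV(1) assms(1) by (auto simp: vertices_eq)
 have gB: "det (g ** B) ~= 0" using AB assms by (simp add: det_mult2)
 have "v (det (g ** B)) = v (det g) + v (det B)" using AB assms by (simp add: det_mult2 v_mult)
 thus ?thesis using SL2_orbit_vx[OF AB(1,3)] SL2_orbit_vx[OF AB(1) gB] AB by (auto simp: act_vx)
qed

lemma pl_xp: "pl xp"
 unfolding SL2_orbit_def by (intro CollectI exI[of _ "mat 1"]) (simp add: act_vertex_1[OF xpV(1)])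

lemma pl_edge: assumes "{x, y} \<in> EE" shows "pl y \<longleftrightarrow> \<not> pl x"
proof -
 obtain A B where AB: "det A ~= 0" "xp = vx A" "det B ~= 0" "x = vx B" "y = vx (B ** D 1)"
  using xpV(1) assms by (auto simp: vertices_eq edge_iff rp_def)
 have "v (det (B ** D 1)) = v (det B) + 1" using AB pi by (simp add: det_mult2 v_mult det_D)
 thus ?thesis using SL2_orbit_vx[OF AB(1,3)] SL2_orbit_vx[OF AB(1) det_A_D[OF AB(3)]] AB by auto
qed

lemma plus_vertex_eq: assumes "{x, y} \<in> EE" "pl x" shows "plus_vertex xp {x, y} = x"
 unfolding plus_vertex_def by (rule the_equality) (use assms pl_edge[OF assms(1)] in auto)

lemma swap_iff: "det g ~= 0 ==> actv g xp \<notin> SL2_orbit xp \<longleftrightarrow> odd (v (det g))"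
 using pl_act[OF xpV(1)] pl_xp by simp

section \<open>The axioms for \<open>F_hat\<close>\<close>

lemma Fh_edge: "\<tau> \<in> EE ==> obj Fh \<tau> = W\<lparr>carrier := fixd \<tau>\<rparr>"
 by (simp add: F_hat_def)

lemma Fh_vertex: "obj Fh {x} = W\<lparr>carrier := FV x\<rparr>"
 using edge_ne_vertex[of x] by (simp add: F_hat_def)

lemma Fh_trans: "trans_map Fh \<eta> x w = (if pl x then w else \<ominus>\<^bsub>W\<^esub> w)"
 by (simp add: F_hat_def)

lemma Fh_act_edge: "\<tau> \<in> EE ==> det g ~= 0 ==> act_map Fh g \<tau> w = (if odd (v (det g)) then \<ominus>\<^bsub>W\<^esub> (\<rho> (th g) w) else \<rho> (th g) w)"
 using swap_iff by (simp add: F_hat_def)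

lemma Fh_act_vertex: "act_map Fh g {x} w = \<rho> (th g) w"
 using edge_ne_vertex[of x] by (simp add: F_hat_def)

lemma Fh_simplex_cases: assumes "\<tau> \<in> SS"
 obtains "\<tau> \<in> EE" | x where "x \<in> VV" "\<tau> = {x}"
 using assms by (auto simp: simplices_def)

lemma Fh_module: assumes "\<tau> \<in> SS" shows "Module.module \<Lambda> (obj Fh \<tau>)"
 using assms by (rule Fh_simplex_cases)
  (auto simp: Fh_edge Fh_vertex intro!: submod_module[OF W_module] fixd_submod FV_submod edge_simplex)

lemma Fh_carrier: assumes "\<tau> \<in> SS" "w \<in> Ob Fh \<tau>" shows "w \<in> carrier W"
 using assms(1) by (rule Fh_simplex_cases) (use assms(2) fixd_carrier FV_carrier in "auto simp: Fh_edge Fh_vertex")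

lemma Fh_trans_mem: assumes "\<tau> \<in> EE" "x \<in> \<tau>" "w \<in> fixd \<tau>" shows "w \<in> FV x" "\<ominus>\<^bsub>W\<^esub> w \<in> FV x"
proof -
 obtain y where y: "\<tau> = {x, y}" "{x, y} \<in> EE"
 proof -
  obtain a b where ab: "\<tau> = {a, b}" "{a, b} \<in> EE" using edge_cases[OF assms(1)] by metis
  then consider "x = a" | "x = b" using assms(2) by blast
  thus thesis by cases (use ab that[of b] that[of a] in "simp_all add: insert_commute")
 qed
 show "w \<in> FV x" using fixd_FV[OF y(2)] assms(3) y(1) by simp
 thus "\<ominus>\<^bsub>W\<^esub> w \<in> FV x" by (rule submod_neg[OF W_module FV_submod[OF edge_subset[OF assms(1,2)]]])
qed

lemma Fh_trans_linmap: assumes "\<tau> \<in> EE" "x \<in> \<tau>" shows "linmap \<Lambda> (obj Fh \<tau>) (obj Fh {x}) (trans_map Fh \<tau> x)"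
proof -
 have "linmap \<Lambda> W W (trans_map Fh \<tau> x)"
  by (rule linmap_cong[of _ _ _ "if pl x then (\<lambda>w. w) else (\<lambda>w. \<ominus>\<^bsub>W\<^esub> w)", OF _ W_module])
   (use linmap_uminus[OF W_module] in "auto simp: Fh_trans linmap_def")
 thus ?thesis unfolding Fh_edge[OF assms(1)] Fh_vertex
  by (rule linmap_restrict[OF _ fixd_submod[OF edge_simplex[OF assms(1)]] W_module])
   (use Fh_trans_mem[OF assms] in "simp add: Fh_trans")
qed

lemma Fh_act_linmap: assumes "det g ~= 0" "\<tau> \<in> SS"
 shows "linmap \<Lambda> (obj Fh \<tau>) (obj Fh (act_simplex g \<tau>)) (act_map Fh g \<tau>)"
 using assms(2)
proof (rule Fh_simplex_cases)
 assume t: "\<tau> \<in> EE"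
 have L: "linmap \<Lambda> W W (\<rho> (th g))" by (rule \<rho>_linmap[OF th_GG[OF assms(1)]])
 have "linmap \<Lambda> W W (act_map Fh g \<tau>)"
  by (rule linmap_cong[of _ _ _ "if odd (v (det g)) then (\<lambda>w. \<ominus>\<^bsub>W\<^esub> (\<rho> (th g) w)) else \<rho> (th g)", OF _ W_module])
   (use linmap_comp[OF L linmap_uminus[OF W_module]] L in "auto simp: Fh_act_edge[OF t assms(1)]")
 moreover have "act_map Fh g \<tau> w \<in> fixd (act_simplex g \<tau>)" if "w \<in> fixd \<tau>" for w
  using \<rho>_fixd[OF assms(2,1) that] submod_neg[OF W_module fixd_submod[OF simplex_act[OF assms]]]
  by (simp add: Fh_act_edge[OF t assms(1)])
 ultimately show ?thesis unfolding Fh_edge[OF t] Fh_edge[OF edge_act[OF assms(1) t]]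
  by (rule linmap_restrict[OF _ fixd_submod[OF assms(2)] W_module])
next
 fix x assume x: "x \<in> VV" "\<tau> = {x}"
 have "linmap \<Lambda> W W (act_map Fh g {x})" using \<rho>_linmap[OF th_GG[OF assms(1)]] by (simp add: Fh_act_vertex[abs_def])
 thus ?thesis unfolding x(2) act_simplex_vertex Fh_vertex
  by (rule linmap_restrict[OF _ FV_submod[OF x(1)] W_module]) (simp add: Fh_act_vertex \<rho>_FV[OF x(1) assms(1)])
qed

lemma \<rho>_neg: "g \<in> GG ==> w \<in> carrier W ==> \<rho> g (\<ominus>\<^bsub>W\<^esub> w) = \<ominus>\<^bsub>W\<^esub> \<rho> g w"
 by (rule linmap_neg[OF \<rho>_linmap W_module W_module])

lemma Fh_act_mult: assumes "det g ~= 0" "det h ~= 0" "\<tau> \<in> SS" "f \<in> Ob Fh \<tau>"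
 shows "act_map Fh g (act_simplex h \<tau>) (act_map Fh h \<tau> f) = act_map Fh (g ** h) \<tau> f"
 using assms(3)
proof (rule Fh_simplex_cases)
 note fW = Fh_carrier[OF assms(3,4)]
 have gh: "det (g ** h) ~= 0" "v (det (g ** h)) = v (det g) + v (det h)" using assms by (simp_all add: det_mult2 v_mult)
 have m: "\<rho> (th h) f \<in> carrier W" "\<rho> (th g) (\<rho> (th h) f) \<in> carrier W" using \<rho>_mem th_GG assms fW by simp_all
 { assume t: "\<tau> \<in> EE"
  show ?thesis unfolding Fh_act_edge[OF edge_act[OF assms(2) t] assms(1)] Fh_act_edge[OF t assms(2)] Fh_act_edge[OF t gh(1)]
   using m \<rho>_neg[OF th_GG[OF assms(1)] m(1)] \<rho>_th_mult[OF assms(1,2) fW] gh(2) by auto }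
 { fix x assume "x \<in> VV" "\<tau> = {x}"
  thus ?thesis using \<rho>_th_mult[OF assms(1,2) fW] by (simp add: act_simplex_vertex Fh_act_vertex) }
qed

lemma Fh_act_fixed: assumes "\<tau> \<in> SS" "g \<in> U_group v p e \<tau>" "f \<in> Ob Fh \<tau>" shows "act_map Fh g \<tau> f = f"
 using assms(1)
proof (rule Fh_simplex_cases)
 have dg: "det g ~= 0" using subgroup_GL2D(1)[OF US_subgroup[OF assms(1)] assms(2)] .
 { assume t: "\<tau> \<in> EE"
  have "th g \<in> hU \<tau>" unfolding hat_U_def by (rule th_LC[OF US_subgroup[OF assms(1)] assms(2)])
  hence "\<rho> (th g) f = f" using assms(3) by (simp add: Fh_edge[OF t] rep_fixed_def)
  thus ?thesis using US_det[OF assms(1,2)] by (simp add: Fh_act_edge[OF t dg]) }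
 { fix x assume x: "x \<in> VV" "\<tau> = {x}"
  have "th g \<in> LC (Ux x)" by (rule th_LC[OF Ux_subgroup[OF x(1)]]) (use assms(2) x in "simp add: Ux_def")
  thus ?thesis using FV_LC_fixed[OF x(1)] assms(3) x by (simp add: Fh_act_vertex Fh_vertex) }
qed

text \<open>The sign of the transition map does not affect its image; the substance is
  \<open>FV_fixed\<close>.\<close>

lemma Fh_image: assumes "{z, y} \<in> EE"
 shows "trans_map Fh {z, y} z ` fixd {z, y} = {f \<in> FV z. \<forall>g\<in>U_group v p e {z, y}. act_map Fh g {z} f = f}"
proof (intro equalityI subsetI)
 note s = fixd_submod[OF edge_simplex[OF assms]]
 fix f assume "f \<in> trans_map Fh {z, y} z ` fixd {z, y}"
 then obtain w where "w \<in> fixd {z, y}" "f = trans_map Fh {z, y} z w" by blast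
 hence f: "f \<in> fixd {z, y}" using submod_neg[OF W_module s] by (auto simp: Fh_trans)
 have "\<rho> (th g) f = f" if g: "g \<in> U_group v p e {z, y}" for g
  using f th_LC[OF US_subgroup[OF edge_simplex[OF assms]] g] by (simp add: rep_fixed_def hat_U_def)
 thus "f \<in> {f \<in> FV z. \<forall>g\<in>U_group v p e {z, y}. act_map Fh g {z} f = f}"
  using fixd_FV[OF assms f] by (simp add: Fh_act_vertex)
next
 note s = fixd_submod[OF edge_simplex[OF assms]]
 fix f assume "f \<in> {f \<in> FV z. \<forall>g\<in>U_group v p e {z, y}. act_map Fh g {z} f = f}"
 hence f: "f \<in> fixd {z, y}" using FV_fixed[OF assms] by (simp add: Fh_act_vertex)
 show "f \<in> trans_map Fh {z, y} z ` fixd {z, y}"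
 proof (cases "pl z")
  case True thus ?thesis using f by (intro image_eqI[of _ _ f]) (simp_all add: Fh_trans)
 next
  case False thus ?thesis using f submod_neg[OF W_module s f] fixd_carrier[OF f]
   by (intro image_eqI[of _ _ "\<ominus>\<^bsub>W\<^esub> f"]) (simp_all add: Fh_trans)
 qed
qed

text \<open>\<open>K_group v z\<close> permutes the edges at \<open>z\<close> transitively, so all
  summands of the module at \<open>z\<close> are translates of one of them.\<close>

lemma Fh_generated: assumes "{z, y} \<in> EE"
 shows "subrep_generated \<Lambda> (obj Fh {z}) (K_group v z) (\<lambda>g. act_map Fh g {z}) (trans_map Fh {z, y} z ` fixd {z, y}) = FV z"
proof -
 have zV: "z \<in> VV" using edge_vertices[OF assms] by blast
 have "subrep_generated \<Lambda> (obj Fh {z}) (K_group v z) (\<lambda>g. act_map Fh g {z}) (trans_map Fh {z, y} z ` fixd {z, y}) = Ob Fh {z}"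
 proof (rule subrep_generated_eqI[OF Fh_module[OF vertex_simplex[OF zV]]])
  show "trans_map Fh {z, y} z ` fixd {z, y} \<subseteq> Ob Fh {z}" unfolding Fh_image[OF assms] by (auto simp: Fh_vertex)
  show "act_map Fh k {z} x \<in> Ob Fh {z}" if "k \<in> K_group v z" "x \<in> Ob Fh {z}" for k x
   using K_group_props(1)[OF zV that(1)] \<rho>_FV[OF zV, of k x] that(2) by (simp add: Fh_act_vertex Fh_vertex)
  fix N assume N: "submodule N \<Lambda> (obj Fh {z})" "!!h x. h \<in> K_group v z ==> x \<in> N ==> act_map Fh h {z} x \<in> N"
   "trans_map Fh {z, y} z ` fixd {z, y} \<subseteq> N"
  have NW: "submodule N \<Lambda> W" using N(1) submod_carrier_iff[OF W_module FV_submod[OF zV]] by (simp add: Fh_vertex)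
  have "FV z \<subseteq> N"
  proof (rule FV_le[OF NW])
   fix y' assume zy': "{z, y'} \<in> EE"
   obtain k where k: "k \<in> K_group v z" "actv k y = y'" using K_group_props(2)[OF zV assms zy'] by blast
   have kk: "det k ~= 0" "actv k z = z" using K_group_props(1)[OF zV k(1)] by auto
   have "act_simplex k {z, y} = {z, y'}" using kk k by (simp add: act_simplex_def)
   hence s: "act_simplex (minv k) {z, y'} = {z, y}" using act_simplex_minv(1)[OF kk(1) edge_simplex[OF assms]] by simp
   show "fixd {z, y'} \<subseteq> N"
   proof
    fix f assume f: "f \<in> fixd {z, y'}"
    define f' where "f' = \<rho> (th (minv k)) f"
    have f': "f' \<in> fixd {z, y}" using \<rho>_fixd[OF edge_simplex[OF zy'] det_minv_nz[OF kk(1)] f] s by (simp add: f'_def)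
    have "f' \<in> N"
    proof (cases "pl z")
     case True thus ?thesis using N(3) f' by (auto simp: Fh_trans)
    next
     case False
     hence "\<ominus>\<^bsub>W\<^esub> (\<ominus>\<^bsub>W\<^esub> f') \<in> N" using N(3) submod_neg[OF W_module fixd_submod[OF edge_simplex[OF assms]] f']
      by (auto simp: Fh_trans)
     thus ?thesis using fixd_carrier[OF f'] by simp
    qed
    hence "\<rho> (th k) f' \<in> N" using N(2)[OF k(1)] by (simp add: Fh_act_vertex)
    thus "f \<in> N" using \<rho>_th_minv[OF kk(1) fixd_carrier[OF f]] by (simp add: f'_def)
   qed
  qed
  thus "Ob Fh {z} \<subseteq> N" by (simp add: Fh_vertex)
 qed
 thus ?thesis by (simp add: Fh_vertex)
qed

text \<open>The sign of the action on edges is the quotient of the signs of the two transition maps,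
  before and after applying \<open>g\<close>.\<close>

lemma Fh_act_trans: assumes "det g ~= 0" "\<tau> \<in> EE" "x \<in> \<tau>" "f \<in> fixd \<tau>"
 shows "trans_map Fh (act_simplex g \<tau>) (actv g x) (act_map Fh g \<tau> f) = act_map Fh g {x} (trans_map Fh \<tau> x f)"
proof -
 have fW: "f \<in> carrier W" by (rule fixd_carrier[OF assms(4)])
 have "\<rho> (th g) f \<in> carrier W" by (rule \<rho>_mem[OF th_GG[OF assms(1)] fW])
 thus ?thesis using pl_act[OF edge_subset[OF assms(2,3)] assms(1)] \<rho>_neg[OF th_GG[OF assms(1)] fW]
  by (auto simp: Fh_trans Fh_act_vertex Fh_act_edge[OF assms(2,1)])
qed

lemma Fh_equivariant: "equivariant_coeff_system v \<Lambda> Fh"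
 unfolding equivariant_coeff_system_def
proof (intro conjI ballI)
 show "Module.module \<Lambda> (obj Fh \<tau>)" if "\<tau> \<in> SS" for \<tau> by (rule Fh_module[OF that])
 show "linear_on \<Lambda> (obj Fh \<tau>) (obj Fh {x}) (trans_map Fh \<tau> x)" if "\<tau> \<in> EE" "x \<in> \<tau>" for \<tau> x
  by (rule iffD2[OF linear_on_iff[OF Fh_module[OF edge_simplex[OF that(1)]]] Fh_trans_linmap[OF that]])
 show "linear_on \<Lambda> (obj Fh \<tau>) (obj Fh (act_simplex g \<tau>)) (act_map Fh g \<tau>)" if "g \<in> carrier GL2" "\<tau> \<in> SS" for g \<tau>
  by (rule iffD2[OF linear_on_iff[OF Fh_module[OF that(2)]] Fh_act_linmap[OF _ that(2)]]) (use that in "simp add: GL2_carrier")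
 show "act_map Fh g (act_simplex h \<tau>) (act_map Fh h \<tau> f) = act_map Fh (g ** h) \<tau> f"
  if "g \<in> carrier GL2" "h \<in> carrier GL2" "\<tau> \<in> SS" "f \<in> Ob Fh \<tau>" for g h \<tau> f
  by (rule Fh_act_mult[OF _ _ that(3,4)]) (use that in "simp_all add: GL2_carrier")
 show "act_map Fh (mat 1) \<tau> f = f" if "\<tau> \<in> SS" "f \<in> Ob Fh \<tau>" for \<tau> f
  by (rule Fh_act_fixed[OF that(1) subgroup_GL2D(3)[OF US_subgroup[OF that(1)]] that(2)])
 show "trans_map Fh (act_simplex g \<tau>) (actv g x) (act_map Fh g \<tau> f) = act_map Fh g {x} (trans_map Fh \<tau> x f)"
  if "g \<in> carrier GL2" "\<tau> \<in> EE" "x \<in> \<tau>" "f \<in> Ob Fh \<tau>" for g \<tau> x f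
  by (rule Fh_act_trans[OF _ that(2,3)]) (use that in "simp_all add: GL2_carrier Fh_edge")
qed

lemma Fh_edge_condition: assumes "\<eta> \<in> EE" "z \<in> \<eta>"
 shows "inj_on (trans_map Fh \<eta> z) (Ob Fh \<eta>)"
  "trans_map Fh \<eta> z ` Ob Fh \<eta> = {f \<in> Ob Fh {z}. \<forall>g\<in>U_group v p e \<eta>. act_map Fh g {z} f = f}"
  "subrep_generated \<Lambda> (obj Fh {z}) (K_group v z) (\<lambda>g. act_map Fh g {z})
     (trans_map Fh \<eta> z ` Ob Fh \<eta>) = Ob Fh {z}"
proof -
 obtain y where y: "\<eta> = {z, y}" "{z, y} \<in> EE"
 proof -
  obtain a b where ab: "\<eta> = {a, b}" "{a, b} \<in> EE" using edge_cases[OF assms(1)] by metis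
  then consider "z = a" | "z = b" using assms(2) by blast
  thus thesis by cases (use ab that[of b] that[of a] in "simp_all add: insert_commute")
 qed
 have "inj_on (trans_map Fh {z, y} z) (fixd {z, y})"
 proof (rule inj_onI)
  fix a b assume ab: "a \<in> fixd {z, y}" "b \<in> fixd {z, y}" "trans_map Fh {z, y} z a = trans_map Fh {z, y} z b"
  have "a = b" if eq: "\<ominus>\<^bsub>W\<^esub> a = \<ominus>\<^bsub>W\<^esub> b"
  proof -
   have "\<ominus>\<^bsub>W\<^esub> (\<ominus>\<^bsub>W\<^esub> a) = \<ominus>\<^bsub>W\<^esub> (\<ominus>\<^bsub>W\<^esub> b)" by (simp only: eq)
   thus ?thesis
    by (simp only: W.M.minus_minus[OF fixd_carrier[OF ab(1)]] W.M.minus_minus[OF fixd_carrier[OF ab(2)]])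
  qed
  thus "a = b" using ab(3) by (cases "pl z") (simp_all add: Fh_trans)
 qed
 thus "inj_on (trans_map Fh \<eta> z) (Ob Fh \<eta>)" unfolding y(1) Fh_edge[OF y(2)] by simp
 show "trans_map Fh \<eta> z ` Ob Fh \<eta> = {f \<in> Ob Fh {z}. \<forall>g\<in>U_group v p e \<eta>. act_map Fh g {z} f = f}"
  unfolding y(1) Fh_edge[OF y(2)] Fh_vertex using Fh_image[OF y(2)] by simp
 show "subrep_generated \<Lambda> (obj Fh {z}) (K_group v z) (\<lambda>g. act_map Fh g {z})
     (trans_map Fh \<eta> z ` Ob Fh \<eta>) = Ob Fh {z}"
  using Fh_generated[OF y(2)] unfolding y(1) Fh_edge[OF y(2)] by (simp add: Fh_vertex)
qed

lemma Fh_C0: "Fh \<in> cat_C0 v p e \<Lambda>"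
proof -
 have "act_map Fh z \<tau> f = f" if z: "z \<in> GL2_centre" and t: "\<tau> \<in> SS" "f \<in> Ob Fh \<tau>" for z \<tau> f
 proof -
  obtain c where c: "z = sc c" "c ~= 0" using z by (auto simp: GL2_centre_eq)
  have dz: "det z ~= 0" "even (v (det z))" using c by (simp_all add: det_sc v_mult)
  have "th (sc c) = th (mat 1)" using th_sc[OF c(2), of "mat 1"] by simp
  hence "\<rho> (th z) f = f" using \<rho>_th_1[OF Fh_carrier[OF t]] c(1) by simp
  thus ?thesis using t(1) by (rule_tac Fh_simplex_cases[OF t(1)]) (use dz in "auto simp: Fh_act_edge Fh_act_vertex")
 qed
 thus ?thesis unfolding cat_C0_def cat_C_def
  using Fh_equivariant Fh_act_fixed Fh_edge_condition by (intro CollectI conjI ballI) simp_all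
qed

end

section \<open>Fixed vectors of \<open>p\<close>-groups\<close>

lemma (in cring) proper_ideal_in_maximal: assumes "ideal I R" "\<one> \<notin> I"
 shows "\<exists>M. maximalideal M R \<and> I \<subseteq> M"
proof -
 let ?A = "{J. ideal J R \<and> I \<subseteq> J \<and> \<one> \<notin> J}"
 have "\<exists>M\<in>?A. \<forall>J\<in>?A. M \<subseteq> J --> J = M"
 proof (rule subset_Zorn)
  fix C assume C: "subset.chain ?A C"
  show "\<exists>U\<in>?A. \<forall>J\<in>C. J \<subseteq> U"
  proof (cases "C = {}")
   case True thus ?thesis using assms by blast
  next
   case False
   have sub: "C \<subseteq> ?A" using C by (simp add: subset_chain_def)
   have "subset.chain {J. ideal J R} C" using C by (auto simp: subset_chain_def)
   hence "ideal (\<Union>C) R" using chain_Union_is_ideal[of C] False by simp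
   moreover have "\<one> \<notin> \<Union>C" using sub by auto
   moreover have "I \<subseteq> \<Union>C" using sub False by auto
   ultimately have "\<Union>C \<in> ?A" by simp
   thus ?thesis by (rule bexI[rotated]) auto
  qed
 qed
 then obtain M where M0: "M \<in> ?A" "\<forall>J\<in>?A. M \<subseteq> J --> J = M" by (rule bexE)
 hence M: "ideal M R" "I \<subseteq> M" "\<one> \<notin> M" "!!J. J \<in> ?A ==> M \<subseteq> J ==> J = M" by simp_all
 have "maximalideal M R"
 proof (rule maximalidealI[OF M(1)])
  show "carrier R ~= M" using M(3) one_closed by blast
  fix J assume J: "ideal J R" "M \<subseteq> J" "J \<subseteq> carrier R"
  show "J = M \<or> J = carrier R"
  proof (cases "\<one> \<in> J")
   case True thus ?thesis using ideal.one_imp_carrier[OF J(1)] by blast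
  next
   case False
   hence "J \<in> ?A" using J M(2) by auto
   thus ?thesis using M(4) J(2) by auto
  qed
 qed
 thus ?thesis using M(2) by blast
qed

lemma local_max_ideal: assumes "local_cring R" shows "maximalideal (max_ideal R) R" "maximalideal M R ==> M = max_ideal R"
proof -
 have ex: "\<exists>!I. maximalideal I R" using assms by (simp add: local_cring_def)
 show "maximalideal (max_ideal R) R" unfolding max_ideal_def by (rule theI'[OF ex])
 thus "maximalideal M R ==> M = max_ideal R" using ex by blast
qed

text \<open>The ideals generated by the powers of \<open>x\<close> become stationary, so x^n = r
  x^(n+1) for some \<open>r\<close>. Then 1 - r x kills x^n, and it is a unit because it lies
  outside the only maximal ideal.\<close>

lemma artinian_local_nilpotent:
 fixes R :: "('a, 'b) ring_scheme" (structure)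
 assumes art: "artinian_cring R" and loc: "local_cring R" and x: "x \<in> max_ideal R"
 shows "\<exists>n. x [^] (n::nat) = \<zero>"
proof -
 interpret cring R using art by (simp add: artinian_cring_def)
 interpret M: maximalideal "max_ideal R" R by (rule local_max_ideal(1)[OF loc])
 have xc: "x \<in> carrier R" using x M.a_subset by blast
 have xn: "x [^] (n::nat) \<in> carrier R" for n using xc by simp
 have "\<exists>n::nat. \<forall>m\<ge>n. PIdl (x [^] m) = PIdl (x [^] n)"
 proof -
  have "PIdl (x [^] Suc n) \<subseteq> PIdl (x [^] n)" for n
  proof
   fix y assume "y \<in> PIdl (x [^] Suc n)"
   then obtain r where r: "r \<in> carrier R" "y = r \<otimes> x [^] Suc n" by (auto simp: cgenideal_def)
   hence "y = (r \<otimes> x) \<otimes> x [^] n" using xc xn[of n] by (simp add: m_ac)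
   thus "y \<in> PIdl (x [^] n)" using r(1) xc by (auto simp: cgenideal_def)
  qed
  hence desc: "\<forall>n. ideal (PIdl (x [^] n)) R \<and> PIdl (x [^] Suc n) \<subseteq> PIdl (x [^] n)" using cgenideal_ideal[OF xn] by blast
  have "\<exists>n. \<forall>m\<ge>n. I m = I n" if "\<forall>n. ideal (I n) R \<and> I (Suc n) \<subseteq> I n" for I :: "nat => 'a set"
   using art that by (simp add: artinian_cring_def)
  from this[OF desc] show ?thesis .
 qed
 then obtain n :: nat where nn: "\<forall>m\<ge>n. PIdl (x [^] m) = PIdl (x [^] n)" by (rule exE)
 have n: "PIdl (x [^] Suc n) = PIdl (x [^] n)" by (rule nn[rule_format]) simp
 have "x [^] n \<in> PIdl (x [^] Suc n)" unfolding n by (rule cgenideal_self[OF xn])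
 then obtain r where r: "r \<in> carrier R" "x [^] n = r \<otimes> x [^] Suc n" by (auto simp: cgenideal_def)
 let ?a = "\<one> \<ominus> r \<otimes> x"
 have rx: "r \<otimes> x \<in> max_ideal R" by (rule M.I_l_closed[OF x r(1)])
 have ac: "?a \<in> carrier R" using r(1) xc by simp
 have "\<one> \<in> PIdl ?a"
 proof (rule ccontr)
  assume "\<one> \<notin> PIdl ?a"
  then obtain M' where M': "maximalideal M' R" "PIdl ?a \<subseteq> M'" using proper_ideal_in_maximal[OF cgenideal_ideal[OF ac]] by blast
  hence "?a \<in> max_ideal R" using local_max_ideal(2)[OF loc M'(1)] cgenideal_self[OF ac] by blast
  hence "?a \<oplus> r \<otimes> x \<in> max_ideal R" using M.a_closed rx by blast
  moreover have "?a \<oplus> r \<otimes> x = \<one>" using r(1) xc by (simp add: minus_eq a_assoc l_neg)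
  ultimately show False using M.one_imp_carrier M.I_notcarr by simp
 qed
 then obtain s where s: "s \<in> carrier R" "s \<otimes> ?a = \<one>" by (auto simp: cgenideal_def)
 have "?a \<otimes> x [^] n = x [^] n \<ominus> r \<otimes> x \<otimes> x [^] n" using r(1) xc xn[of n] by (simp add: minus_eq l_distr l_minus)
 also have "r \<otimes> x \<otimes> x [^] n = r \<otimes> x [^] Suc n" using r(1) xc xn[of n] by (simp add: m_ac)
 also have "x [^] n \<ominus> \<dots> = \<zero>" unfolding r(2)[symmetric] using xn[of n] by (simp add: minus_eq r_neg)
 finally have "s \<otimes> ?a \<otimes> x [^] n = \<zero>" using s(1) ac xn[of n] by (simp add: m_assoc)
 thus ?thesis using s(2) xn[of n] by auto
qed

lemma (in Module.module) add_pow_smult: assumes "a \<in> carrier R" "x \<in> carrier M"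
 shows "(add_pow R (n::nat) a) \<odot>\<^bsub>M\<^esub> x = add_pow M n (a \<odot>\<^bsub>M\<^esub> x)"
proof (induction n)
 case 0 thus ?case using assms by (simp add: smult_l_null)
next
 case (Suc n) thus ?case using assms by (simp add: smult_l_distr)
qed

text \<open>The structure map sends the maximal ideal into the maximal ideal, so \<open>p\<close>
  becomes an element of that of \<Lambda>, which is nilpotent by
  \<open>artinian_local_nilpotent\<close>.\<close>

lemma art_algebra_p_nilpotent:
 assumes rc: "residue_field_char \<oo> p" and art: "art_algebra \<oo> \<Lambda>" and W: "Module.module \<Lambda> W"
 shows "\<exists>n. \<forall>w\<in>carrier W. ((add_pow W p) ^^ n) w = \<zero>\<^bsub>W\<^esub>"
proof -
 interpret W: Module.module \<Lambda> W by (rule W)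
 interpret A: Module.algebra \<oo> \<Lambda> using art by (simp add: art_algebra_def)
 let ?x = "add_pow \<Lambda> p \<one>\<^bsub>\<Lambda>\<^esub>"
 have "add_pow \<oo> p \<one>\<^bsub>\<oo>\<^esub> \<in> max_ideal \<oo>" using rc by (simp add: residue_field_char_def)
 moreover have "add_pow \<oo> p \<one>\<^bsub>\<oo>\<^esub> \<in> carrier \<oo>" by simp
 ultimately have "(add_pow \<oo> p \<one>\<^bsub>\<oo>\<^esub>) \<odot>\<^bsub>\<Lambda>\<^esub> \<one>\<^bsub>\<Lambda>\<^esub> \<in> max_ideal \<Lambda>" using art unfolding art_algebra_def by blast
 hence "?x \<in> max_ideal \<Lambda>" using A.add_pow_smult[OF A.R.one_closed W.R.one_closed, of p] by simp
 then obtain n where n: "?x [^]\<^bsub>\<Lambda>\<^esub> (n::nat) = \<zero>\<^bsub>\<Lambda>\<^esub>" using artinian_local_nilpotent[of \<Lambda> ?x] art by (auto simp: art_algebra_def)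
 have "((add_pow W p) ^^ k) w = (?x [^]\<^bsub>\<Lambda>\<^esub> k) \<odot>\<^bsub>W\<^esub> w" if w: "w \<in> carrier W" for w and k :: nat
 proof (induction k)
  case 0 thus ?case using w by simp
 next
  case (Suc k)
  have c: "?x \<in> carrier \<Lambda>" "(?x [^]\<^bsub>\<Lambda>\<^esub> k) \<odot>\<^bsub>W\<^esub> w \<in> carrier W" using w by simp_all
  have "add_pow W p ((?x [^]\<^bsub>\<Lambda>\<^esub> k) \<odot>\<^bsub>W\<^esub> w) = ?x \<odot>\<^bsub>W\<^esub> ((?x [^]\<^bsub>\<Lambda>\<^esub> k) \<odot>\<^bsub>W\<^esub> w)"
   using W.add_pow_smult[OF W.R.one_closed c(2), of p] c(2) by simp
  also have "\<dots> = (?x [^]\<^bsub>\<Lambda>\<^esub> Suc k) \<odot>\<^bsub>W\<^esub> w"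
   using W.smult_assoc1[OF c(1) W.R.nat_pow_closed[OF c(1)] w, of k] W.R.m_comm[OF c(1) W.R.nat_pow_closed[OF c(1)], of k] by simp
  finally show ?case using Suc by simp
 qed
 hence "\<forall>w\<in>carrier W. ((add_pow W p) ^^ n) w = \<zero>\<^bsub>W\<^esub>" using n by (simp add: W.smult_l_null)
 thus ?thesis by blast
qed

text \<open>Class equation: without a second fixed point, all orbits other than that of
  \<open>z\<close> would have size divisible by \<open>p\<close>, so \<open>card E\<close> would be
  congruent to 1.\<close>

lemma p_group_fixed_point:
 assumes act: "group_action P E \<phi>" and fin: "finite E" and P: "order P = p ^ r" "Factorial_Ring.prime (p::nat)"
  and z: "z \<in> E" "!!g. g \<in> carrier P ==> \<phi> g z = z" and card: "p dvd card E"
 shows "\<exists>x\<in>E. x ~= z \<and> (\<forall>g\<in>carrier P. \<phi> g x = x)"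
proof (rule ccontr)
 assume no: "\<not> ?thesis"
 interpret group_action P E \<phi> by (rule act)
 have part: "partition E (orbits P E \<phi>)" by (rule orbit_partition)
 have orb_z: "orbit P \<phi> z = {z}" using z orbit_refl[OF z(1)] by (auto simp: orbit_def)
 have un: "\<Union>(orbits P E \<phi>) = E" by (rule partition.partition_coverture[OF part])
 have dis: "A = B" if "x \<in> A" "x \<in> B" "A \<in> orbits P E \<phi>" "B \<in> orbits P E \<phi>" for x A B
  by (rule partition.disjoint_union[OF part that(3,4)]) (use that(1,2) in auto)
 let ?C = "orbits P E \<phi> - {{z}}"
 have zo: "{z} \<in> orbits P E \<phi>" using z(1) orb_z by (auto simp: orbits_def)
 have Un: "\<Union>?C = E - {z}" 
 proof (rule Set.set_eqI)
  fix x
  have "A ~= {z}" if "x \<in> A" "x ~= z" for A using that by auto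
  moreover have "A = {z}" if "z \<in> A" "A \<in> orbits P E \<phi>" for A using dis[OF that(1) _ that(2) zo] by simp
  ultimately show "x \<in> \<Union>?C \<longleftrightarrow> x \<in> E - {z}" using un by (cases "x = z") auto
 qed
 have "p dvd card A" if A: "A \<in> ?C" for A
 proof -
  obtain x where x: "x \<in> E" "A = orbit P \<phi> x" using A by (auto simp: orbits_def)
  have xz: "x ~= z" using x(2) A orb_z by auto
  have dv: "card A dvd p ^ r" using orbit_stabilizer_theorem[OF x(1)] P(1) x(2) by (metis dvd_triv_left)
  have "card A ~= 1"
  proof
   assume "card A = 1"
   then obtain a where "A = {a}" by (auto simp: card_1_singleton_iff)
   hence "\<phi> g x = x" if "g \<in> carrier P" for g using orbit_refl[OF x(1)] x(2) that by (auto simp: orbit_def)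
   thus False using no x(1) xz by blast
  qed
  thus ?thesis using dv P(2) divides_primepow_nat[OF P(2), of "card A" r] by (metis dvd_power dvd_refl gr0I power_0)
 qed
 hence "p dvd card (\<Union>?C)"
  by (intro dvd_partition) (use Un fin dis in "simp, simp, blast")
 hence "p dvd card E - 1" unfolding Un using z(1) fin by simp
 moreover have "card E ~= 0" using z(1) fin by auto
 ultimately have "p dvd 1" using card by (metis One_nat_def Suc_pred dvd_diffD1 gr0I One_nat_def Suc_leI)
 thus False using P(2) by (simp add: prime_nat_iff)
qed

text \<open>The generators are adjoined one at a time, each contributing a finite cyclic
  factor.\<close>

lemma (in comm_group) finite_generate_exponent: assumes "finite S" "S \<subseteq> carrier G" "p > 0" "!!s. s \<in> S ==> s [^] (p::nat) = \<one>"
 shows "finite (generate G S)"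
proof -
 have "\<exists>E. subgroup E G \<and> finite E \<and> S \<subseteq> E" using assms
 proof (induction S rule: finite_induct)
  case empty thus ?case using triv_subgroup by blast
 next
  case (insert s S)
  then obtain E where E: "subgroup E G" "finite E" "S \<subseteq> E" by blast
  have s: "s \<in> carrier G" "s [^] p = \<one>" using insert.prems by auto
  have o: "ord s ~= 0" using pow_eq_id[OF s(1), of p] s(2) assms(3) by (metis dvd_0_left_iff less_irrefl)
  let ?T = "generate G {s}"
  have T: "subgroup ?T G" "s \<in> ?T" using s(1) generate_is_subgroup[of "{s}"] generate.incl[of s "{s}" G] by auto
  have "finite ?T" using generate_pow_card[OF s(1)] o by (metis card.infinite)
  hence "finite (?T <#> E)" using E(2) by (auto simp: set_mult_def)
  moreover have "subgroup (?T <#> E) G" by (rule mult_subgroups[OF T(1) E(1)])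
  moreover have "insert s S \<subseteq> ?T <#> E"
  proof -
   have "s = s \<otimes> \<one>" using s(1) by simp
   hence "s \<in> ?T <#> E" unfolding set_mult_def using T(2) subgroup.one_closed[OF E(1)] by blast
   moreover have "x \<in> ?T <#> E" if "x \<in> S" for x
   proof -
    have "x = \<one> \<otimes> x" using that insert.prems by auto
    thus ?thesis unfolding set_mult_def using E(3) that subgroup.one_closed[OF T(1)] by blast
   qed
   ultimately show ?thesis by blast
  qed
  ultimately show ?case by blast
 qed
 then obtain E where E: "subgroup E G" "finite E" "S \<subseteq> E" by blast
 thus ?thesis using generate_subgroup_incl[OF E(3,1)] finite_subset by blast
qed

text \<open>Stated multiplicatively, used for the additive group of homology. \<open>H\<close> may
  be infinite: what matters is that the orbit of \<open>w\<close> generates a finite group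
  \<open>E\<close> and that \<open>H\<close> acts on \<open>E\<close> through a finite group of
  p-power order.\<close>

lemma (in comm_group) p_group_fixed_vector:
 assumes H: "group H" and p: "Factorial_Ring.prime (p::nat)"
  and a: "!!g. g \<in> carrier H ==> a g \<in> hom G G"
  and am: "!!g h x. g \<in> carrier H ==> h \<in> carrier H ==> x \<in> carrier G ==> a (g \<otimes>\<^bsub>H\<^esub> h) x = a g (a h x)"
  and a1: "!!x. x \<in> carrier G ==> a \<one>\<^bsub>H\<^esub> x = x"
  and w: "w \<in> carrier G" "w [^] p = \<one>" "w ~= \<one>"
  and fin: "finite {a g w | g. g \<in> carrier H}"
  and pw: "!!g. g \<in> carrier H ==> \<exists>k. \<forall>h\<in>carrier H. a (g [^]\<^bsub>H\<^esub> (p ^ k)) (a h w) = a h w"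
 shows "\<exists>x\<in>generate G {a g w | g. g \<in> carrier H}. x ~= \<one> \<and> (\<forall>g\<in>carrier H. a g x = x)"
proof -
 interpret H: group H by (rule H)
 let ?S = "{a g w | g. g \<in> carrier H}"
 define E where "E = generate G ?S"
 have ac: "a g x \<in> carrier G" if "g \<in> carrier H" "x \<in> carrier G" for g x using a[OF that(1)] that(2) by (auto simp: hom_def)
 have S: "?S \<subseteq> carrier G" using ac w(1) by blast
 have Esub: "subgroup E G" unfolding E_def by (rule generate_is_subgroup[OF S])
 have Ec: "x \<in> carrier G" if "x \<in> E" for x using subgroup.mem_carrier[OF Esub that] .
 have SE: "?S \<subseteq> E" unfolding E_def by (rule subsetI) (rule generate.incl)
 have gh: "group_hom G G (a g)" if "g \<in> carrier H" for g using a[OF that] by (simp add: group_hom_def group_hom_axioms_def is_group)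
 have finE: "finite E" unfolding E_def
 proof (rule finite_generate_exponent[OF fin S prime_gt_0_nat[OF p]])
  fix s assume "s \<in> ?S"
  then obtain g where g: "g \<in> carrier H" "s = a g w" by blast
  thus "s [^] p = \<one>" using group_hom.hom_nat_pow[OF gh[OF g(1)] w(1), of p] w(2) group_hom.hom_one[OF gh[OF g(1)]] by simp
 qed
 have aE: "a g x \<in> E" if g: "g \<in> carrier H" and x: "x \<in> E" for g x
 proof -
  have "a g ` ?S \<subseteq> ?S"
  proof
   fix y assume "y \<in> a g ` ?S"
   then obtain h where h: "h \<in> carrier H" "y = a g (a h w)" by blast
   hence "y = a (g \<otimes>\<^bsub>H\<^esub> h) w" using am[OF g h(1) w(1)] by simp
   thus "y \<in> ?S" using g h(1) by blast
  qed
  hence "a g ` ?S \<subseteq> E" using SE by blast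
  hence "generate G (a g ` ?S) \<subseteq> E" by (rule generate_subgroup_incl[OF _ Esub])
  moreover have "generate G (a g ` ?S) = a g ` E" unfolding E_def by (rule group_hom.generate_img[OF gh[OF g] S])
  ultimately show ?thesis using x by blast
 qed
 have inv: "a (inv\<^bsub>H\<^esub> g) (a g x) = x" if "g \<in> carrier H" "x \<in> E" for g x
  using am[OF H.inv_closed[OF that(1)] that(1) Ec[OF that(2)]] a1[OF Ec[OF that(2)]] that(1) by simp
 \<comment> \<open>The image of \<open>H\<close> under this homomorphism into the permutations of
   \<open>E\<close> is the finite p-group.\<close>
 define \<phi> where "\<phi> g = restrict (a g) E" for g
 have bij: "\<phi> g \<in> Bij E" if g: "g \<in> carrier H" for g
 proof -
  have "bij_betw (\<phi> g) E E"
   by (rule bij_betw_byWitness[where f' = "\<phi> (inv\<^bsub>H\<^esub> g)"])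
    (use g aE inv inv[OF H.inv_closed[OF g]] in "auto simp: \<phi>_def")
  thus ?thesis by (simp add: Bij_def \<phi>_def)
 qed
 have hom: "\<phi> \<in> hom H (BijGroup E)"
 proof (rule homI)
  show "\<phi> g \<in> carrier (BijGroup E)" if "g \<in> carrier H" for g using bij[OF that] by (simp add: BijGroup_def)
  show "\<phi> (g \<otimes>\<^bsub>H\<^esub> h) = \<phi> g \<otimes>\<^bsub>BijGroup E\<^esub> \<phi> h" if "g \<in> carrier H" "h \<in> carrier H" for g h
   using bij[OF that(1)] bij[OF that(2)] am[OF that Ec] aE[OF that(2)] by (auto simp: BijGroup_def compose_def \<phi>_def)
 qed
 interpret hh: group_hom H "BijGroup E" \<phi> using hom by (simp add: group_hom_def group_hom_axioms_def H group_BijGroup)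
 let ?P = "(BijGroup E)\<lparr>carrier := \<phi> ` carrier H\<rparr>"
 have Psub: "subgroup (\<phi> ` carrier H) (BijGroup E)" by (rule hh.img_is_subgroup)
 interpret P: group ?P by (rule subgroup.subgroup_is_group[OF Psub group_BijGroup])
 have one: "\<phi> \<one>\<^bsub>H\<^esub> = \<one>\<^bsub>BijGroup E\<^esub>" by (rule hh.hom_one)
 have "finite (carrier ?P)"
 proof -
  have "\<phi> ` carrier H \<subseteq> E \<rightarrow>\<^sub>E E" using aE by (auto simp: \<phi>_def)
  thus ?thesis using finite_PiE[OF finE, of "\<lambda>_. E"] finE by (simp add: finite_subset)
 qed
 moreover have "\<exists>k. x [^]\<^bsub>?P\<^esub> (p ^ k) = \<one>\<^bsub>?P\<^esub>" if "x \<in> carrier ?P" for x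
 proof -
  obtain g where g: "g \<in> carrier H" "x = \<phi> g" using \<open>x \<in> carrier ?P\<close> by auto
  obtain k where k: "\<forall>h\<in>carrier H. a (g [^]\<^bsub>H\<^esub> (p ^ k)) (a h w) = a h w" using pw[OF g(1)] by blast
  let ?g = "g [^]\<^bsub>H\<^esub> (p ^ k)"
  have gk: "?g \<in> carrier H" using g(1) by simp
  have fixsub: "subgroup {x \<in> carrier G. a ?g x = x} G"
  proof -
   interpret ag: group_hom G G "a ?g" by (rule gh[OF gk])
   show ?thesis by (rule subgroupI) auto
  qed
  \<comment> \<open>The fixed points of an endomorphism form a subgroup, so triviality on the orbit
    of \<open>w\<close> gives triviality on \<open>E\<close>.\<close>
  have "E \<subseteq> {x \<in> carrier G. a ?g x = x}" unfolding E_def by (rule generate_subgroup_incl[OF _ fixsub]) (use k S in blast)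
  hence "a ?g x = x" if "x \<in> E" for x using that by blast
  hence "\<phi> ?g = \<phi> \<one>\<^bsub>H\<^esub>" using a1[OF Ec] by (auto simp: \<phi>_def)
  hence "\<phi> g [^]\<^bsub>BijGroup E\<^esub> (p ^ k) = \<one>\<^bsub>BijGroup E\<^esub>" using hh.hom_nat_pow[OF g(1), of "p ^ k"] one by simp
  moreover have "x [^]\<^bsub>?P\<^esub> (p ^ k) = x [^]\<^bsub>BijGroup E\<^esub> (p ^ k)" using hh.H.nat_pow_consistent[of x "p ^ k" "\<phi> ` carrier H"] by simp
  ultimately show ?thesis using g(2) by auto
 qed
 ultimately obtain r where r: "order ?P = p ^ r" using P.prime_power_order[OF p] by blast
 have act: "group_action ?P E id" unfolding group_action_def by (rule hh.H.canonical_inj_is_hom[OF Psub])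
 \<comment> \<open>\<open>w\<close> is an element of order \<open>p\<close> in
   \<open>E\<close>.\<close>
 have "p dvd card E"
 proof -
  interpret GE: group "G\<lparr>carrier := E\<rparr>" by (rule subgroup.subgroup_is_group[OF Esub is_group])
  have wE: "w \<in> E" using SE a1[OF w(1)] H.one_closed by (metis (mono_tags, lifting) mem_Collect_eq subsetD)
  have "w [^]\<^bsub>G\<lparr>carrier := E\<rparr>\<^esub> p = \<one>" using nat_pow_consistent[of w p E] w(2) by simp
  hence "GE.ord w dvd p" using GE.pow_eq_id[of w p] wE by simp
  moreover have "GE.ord w ~= 1" using GE.ord_eq_1[of w] wE w(3) by simp
  ultimately have "GE.ord w = p" using p by (meson prime_nat_iff)
  thus ?thesis using GE.ord_dvd_group_order[of w] wE by (simp add: order_def)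
 qed
 moreover have "id g \<one> = \<one>" if "g \<in> carrier ?P" for g
  using that group_hom.hom_one[OF gh] subgroup.one_closed[OF Esub] by (auto simp: \<phi>_def)
 ultimately have "\<exists>x\<in>E. x ~= \<one> \<and> (\<forall>g\<in>carrier ?P. id g x = x)"
  using p_group_fixed_point[OF act finE r p subgroup.one_closed[OF Esub]] by blast
 then obtain x where x: "x \<in> E" "x ~= \<one>" "\<forall>g\<in>carrier ?P. id g x = x" by blast
 have "a g x = x" if "g \<in> carrier H" for g using x(1) x(3) that by (auto simp: \<phi>_def)
 thus ?thesis using x(1,2) unfolding E_def by blast
qed

context tree_level
begin

lemma finite_ball: assumes "x \<in> VV" shows "finite {y \<in> VV. d x y <= n}"
proof (induction n)
 case 0
 have "{y \<in> VV. d x y <= 0} \<subseteq> {x}" using d_0[OF assms] by auto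
 thus ?case using finite_subset by blast
next
 case (Suc n)
 let ?B = "{y \<in> VV. d x y <= n}"
 have "{y \<in> VV. d x y <= Suc n} \<subseteq> ?B \<union> (\<Union>b\<in>?B. {y. {b, y} \<in> EE})"
 proof
  fix y assume y: "y \<in> {y \<in> VV. d x y <= Suc n}"
  show "y \<in> ?B \<union> (\<Union>b\<in>?B. {y. {b, y} \<in> EE})"
  proof (cases "y \<in> ?B")
   case False
   hence "x ~= y" using y assms by auto
   then obtain b where "{b, y} \<in> EE" "d x y = d x b + 1" using prev_exists[of x y] assms y by blast
   thus ?thesis using y edge_vertices[of b y] by auto
  qed simp
 qed
 thus ?case by (rule finite_subset) (use Suc finite_edges_at in blast)
qed

lemma hU_apply: assumes "{a, b} \<in> EE" "h \<in> hU {a, b}" shows "h a = a"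
proof -
 obtain g' where "g' \<in> U_group v p e {a, b}" "\<forall>x\<in>ball {a, b}. h x = actv g' x"
  using LC_D(6)[OF assms(2)[unfolded hat_U_def] assms(1)] by blast
 moreover have "a \<in> ball {a, b}" using edge_vertices[OF assms(1)] by (auto simp: ball_mem)
 ultimately show ?thesis using US_fix[OF assms(1)] by auto
qed

lemma hU_ball: assumes "{a, b} \<in> EE" "h \<in> hU {a, b}" "y \<in> VV" shows "h y \<in> VV" "d a (h y) = d a y"
 using LC_D(3)[OF assms(2)[unfolded hat_U_def] assms(3)]
  LC_D(4)[OF assms(2)[unfolded hat_U_def] conjunct1[OF edge_vertices[OF assms(1)]] assms(3)] hU_apply[OF assms(1,2)]
 by simp_all

end

text \<open>The value \<open>F g\<close> depends only on the map that \<open>g\<close> induces from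
  the finite set \<open>B\<close> to itself.\<close>

lemma finite_agreement_classes:
 assumes "finite B" "!!g. g \<in> H ==> g ` B \<subseteq> B"
  "!!g g'. g \<in> H ==> g' \<in> H ==> (!!y. y \<in> B ==> g y = g' y) ==> F g = F g'"
 shows "finite (F ` H)"
proof -
 have fin: "finite ((\<lambda>g. restrict g B) ` H)"
 proof (rule finite_subset)
  show "(\<lambda>g. restrict g B) ` H \<subseteq> B \<rightarrow>\<^sub>E B" using assms(2) unfolding image_subset_iff by auto
  show "finite (B \<rightarrow>\<^sub>E B)" using assms(1) by (simp add: finite_PiE)
 qed
 have "F ` H \<subseteq> (\<lambda>f. F (SOME g. g \<in> H \<and> restrict g B = f)) ` (\<lambda>g. restrict g B) ` H"
 proof
  fix y assume "y \<in> F ` H"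
  then obtain g where g: "g \<in> H" "y = F g" by blast
  let ?g = "SOME g'. g' \<in> H \<and> restrict g' B = restrict g B"
  have s: "?g \<in> H \<and> restrict ?g B = restrict g B" by (rule someI[of _ g]) (simp add: g(1))
  have "F ?g = F g"
  proof (rule assms(3)[OF conjunct1[OF s] g(1)])
   fix y assume "y \<in> B"
   thus "?g y = g y" using fun_cong[OF conjunct2[OF s], of y] by simp
  qed
  thus "y \<in> (\<lambda>f. F (SOME g. g \<in> H \<and> restrict g B = f)) ` (\<lambda>g. restrict g B) ` H"
   unfolding image_image using g by (intro image_eqI[of _ _ g]) simp_all
 qed
 thus ?thesis by (rule finite_subset) (use fin in simp)
qed

text \<open>Take the last iterate different from \<open>z\<close>.\<close>

lemma nilpotent_kills:
 assumes "!!w. w \<in> N ==> f w \<in> N" "w \<in> N" "w ~= z" "(f ^^ n) w = z"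
 shows "\<exists>w'\<in>N. w' ~= z \<and> f w' = z"
 using assms(2-4)
proof (induction n arbitrary: w)
 case 0 thus ?case by simp
next
 case (Suc n)
 show ?case
 proof (cases "f w = z")
  case True thus ?thesis using Suc.prems by blast
 next
  case False
  show ?thesis by (rule Suc.IH[OF assms(1)[OF Suc.prems(1)] False]) (use Suc.prems(3) in "simp only: funpow_Suc_right comp_apply")
 qed
qed

context coeff
begin

text \<open>Smoothness makes the action on \<open>w\<close> depend only on a finite ball
  \<open>B\<close>. Hence the orbit of \<open>w\<close> is finite, and \<open>hU_p_power\<close>
  makes some p-power of each group element trivial on it, as \<open>p_group_fixed_vector\<close>
  requires.\<close>

lemma fixed_in_stable_submodule:
 assumes \<sigma>: "{a, b} \<in> EE" and nil: "\<exists>n. \<forall>w\<in>carrier HM. ((add_pow HM p) ^^ n) w = \<zero>\<^bsub>HM\<^esub>"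
  and N: "submodule N \<Lambda> HM" and st: "!!h w. h \<in> hU {a, b} ==> w \<in> N ==> ract h w \<in> N"
  and ne: "w0 \<in> N" "w0 ~= \<zero>\<^bsub>HM\<^esub>"
 shows "\<exists>w\<in>N. w ~= \<zero>\<^bsub>HM\<^esub> \<and> (\<forall>h\<in>hU {a, b}. ract h w = w)"
proof -
 interpret H: Module.module \<Lambda> HM by (rule Qt.Q_module)
 interpret R: smooth_rep v p e \<Lambda> a b "H0 v e F" by unfold_locales (use \<sigma> H0_R0 in auto)
 have NH: "w \<in> carrier HM" if "w \<in> N" for w using N that unfolding submod_iff[OF Qt.Q_module] by blast
 have pN: "add_pow HM p w \<in> N" if w: "w \<in> N" for w
 proof -
  have "add_pow HM p w = (add_pow \<Lambda> p \<one>\<^bsub>\<Lambda>\<^esub>) \<odot>\<^bsub>HM\<^esub> w"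
   using H.add_pow_smult[OF cring.cring_simprules(6)[OF \<Lambda>_cring] NH[OF w], of p] NH[OF w] by simp
  moreover have "add_pow \<Lambda> p \<one>\<^bsub>\<Lambda>\<^esub> \<in> carrier \<Lambda>"
   by simp
  ultimately show ?thesis using N w unfolding submod_iff[OF Qt.Q_module] by simp
 qed
 obtain n where "\<forall>w\<in>carrier HM. ((add_pow HM p) ^^ n) w = \<zero>\<^bsub>HM\<^esub>" using nil by blast
 then obtain w where w: "w \<in> N" "w ~= \<zero>\<^bsub>HM\<^esub>" "add_pow HM p w = \<zero>\<^bsub>HM\<^esub>"
  using nilpotent_kills[of N "add_pow HM p" w0 "\<zero>\<^bsub>HM\<^esub>" n, OF pN ne] NH[OF ne(1)] by blast
 have wH: "w \<in> carrier HM" by (rule NH[OF w(1)])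
 obtain m where m: "\<forall>h\<in>hU {a, b}. (\<forall>x\<in>tree_ball v m {a, b}. h x = x) --> ract h w = w" using H0_smooth[OF \<sigma> wH] by blast
 \<comment> \<open>Centred at \<open>a\<close>, which the edge group fixes, so that the group maps
   \<open>B\<close> to itself; the extra 1 makes it contain the ball around both ends of the
   edge.\<close>
 define B where "B = {y \<in> VV. d a y <= m + 1}"
 have ab: "a \<in> VV" "b \<in> VV" "d a b = 1" using \<sigma> by (simp_all add: edge_d)
 have finB: "finite B" unfolding B_def by (rule finite_ball[OF ab(1)])
 have BV: "B \<subseteq> VV" by (auto simp: B_def)
 have ballB: "tree_ball v m {a, b} \<subseteq> B"
  unfolding tree_ball_def B_def using d_triangle[OF ab(1,2)] ab(3) by fastforce
 have sim: "{a, b} \<in> SS" by (rule edge_simplex[OF \<sigma>])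
 have UG: "h \<in> GG" if "h \<in> hU {a, b}" for h by (rule hU_GG[OF sim that])
 have hB: "h y \<in> B" if "h \<in> hU {a, b}" "y \<in> B" for h y
  using hU_ball[OF \<sigma> that(1), of y] that(2) by (simp add: B_def)
 interpret G: group hG by (rule hG_group)
 have Us: "subgroup (hU {a, b}) hG" by (rule hU_subgroup[OF sim])
 have rm: "ract (g \<otimes>\<^bsub>hG\<^esub> h) x = ract g (ract h x)" if "g \<in> GG" "h \<in> GG" "x \<in> carrier HM" for g h x
  using R.\<rho>_mult[of g h x] that by (simp add: H0_mod)
 \<comment> \<open>The quotient of \<open>h\<close> and \<open>h'\<close> fixes \<open>B\<close>
   pointwise and so fixes \<open>w\<close>.\<close>
 have key: "ract h w = ract h' w" if h: "h \<in> hU {a, b}" "h' \<in> hU {a, b}" and ag: "!!y. y \<in> B ==> h y = h' y" for h h'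
 proof -
  let ?k = "inv\<^bsub>hG\<^esub> h' \<otimes>\<^bsub>hG\<^esub> h"
  have k: "?k \<in> hU {a, b}" using subgroup.m_closed[OF Us subgroup.m_inv_closed[OF Us h(2)] h(1)] .
  have hk: "h' \<otimes>\<^bsub>hG\<^esub> ?k = h" 
  proof -
   have c: "h \<in> carrier hG" "h' \<in> carrier hG" using UG[OF h(1)] UG[OF h(2)] by simp_all
   show ?thesis by (simp only: G.m_assoc[OF c(2) G.inv_closed[OF c(2)] c(1), symmetric] G.r_inv[OF c(2)] G.l_one[OF c(1)])
  qed
  have "?k y = y" if y: "y \<in> B" for y
  proof -
   have yV: "y \<in> VV" using y BV by blast
   have "h' (?k y) = h y" using hG_mult_apply[OF UG[OF h(2)] UG[OF k] yV] hk by simp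
   hence "h' (?k y) = h' y" using ag[OF y] by simp
   moreover have "inj_on h' VV" using LC_D(1)[OF UG[OF h(2)]] by (rule bij_betw_imp_inj_on)
   ultimately show ?thesis using inj_onD[of h' VV "?k y" y] LC_D(3)[OF UG[OF k] yV] yV by blast
  qed
  hence "ract ?k w = w" using m k ballB by blast
  thus ?thesis using rm[OF UG[OF h(2)] UG[OF k] wH] hk by simp
 qed
 have fin: "finite ((\<lambda>h. ract h w) ` hU {a, b})"
  by (rule finite_agreement_classes[OF finB]) (use hB key in blast)+
 let ?H = "hG\<lparr>carrier := hU {a, b}\<rparr>"
 have eqS: "{ract g w | g. g \<in> carrier ?H} = (\<lambda>h. ract h w) ` hU {a, b}" by auto
 have "\<exists>x\<in>generate (add_monoid HM) {ract g w | g. g \<in> carrier ?H}. x ~= \<one>\<^bsub>add_monoid HM\<^esub> \<and> (\<forall>g\<in>carrier ?H. ract g x = x)"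
 proof (rule comm_group.p_group_fixed_vector[OF H.M.a_comm_group _ p_prime])
  show "group ?H" by (rule subgroup.subgroup_is_group[OF Us hG_group])
  show "ract g \<in> hom (add_monoid HM) (add_monoid HM)" if "g \<in> carrier ?H" for g
   using linmapD(1,2)[OF ract_linmap[OF UG]] that by (intro homI) simp_all
  show "ract (g \<otimes>\<^bsub>?H\<^esub> h) x = ract g (ract h x)" if "g \<in> carrier ?H" "h \<in> carrier ?H" "x \<in> carrier (add_monoid HM)" for g h x
   using rm[OF UG UG] that by simp
  show "ract \<one>\<^bsub>?H\<^esub> x = x" if "x \<in> carrier (add_monoid HM)" for x using R.\<rho>_one[of x] that by (simp add: H0_mod)
  show "w \<in> carrier (add_monoid HM)" "w ~= \<one>\<^bsub>add_monoid HM\<^esub>" using wH w(2) by simp_all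
  show "w [^]\<^bsub>add_monoid HM\<^esub> p = \<one>\<^bsub>add_monoid HM\<^esub>" using w(3) by (simp add: add_pow_def)
  show "finite {ract g w | g. g \<in> carrier ?H}" unfolding eqS by (rule fin)
  show "\<exists>k. \<forall>h\<in>carrier ?H. ract (g [^]\<^bsub>?H\<^esub> (p ^ k)) (ract h w) = ract h w" if g: "g \<in> carrier ?H" for g
  proof -
   have gU: "g \<in> hU {a, b}" using g by simp
   obtain k where k: "\<forall>y\<in>VV. d a y <= m + 1 --> (\<exists>u\<in>Ux y. \<forall>z\<in>VV. d y z <= e --> (g [^]\<^bsub>hG\<^esub> (p ^ k)) z = actv u z)"
    using hU_p_power[OF \<sigma> gU] by blast
   let ?g = "g [^]\<^bsub>hG\<^esub> (p ^ k)"
   have pe: "g [^]\<^bsub>?H\<^esub> (p ^ k) = ?g" using G.nat_pow_consistent[of g "p ^ k" "hU {a, b}"] by simp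
   have gk: "?g \<in> hU {a, b}"
   proof -
    interpret S: group ?H by (rule subgroup.subgroup_is_group[OF Us hG_group])
    show ?thesis using S.nat_pow_closed[OF g, of "p ^ k"] pe by simp
   qed
   have gB: "?g y = y" if y: "y \<in> B" for y
   proof -
    have yV: "y \<in> VV" "d a y <= m + 1" using y by (simp_all add: B_def)
    obtain u where u: "u \<in> Ux y" "\<forall>z\<in>VV. d y z <= e --> ?g z = actv u z" using k yV by blast
    have "?g y = actv u y" using u(2) yV(1) by simp
    also have "\<dots> = y" by (rule Ux_fix[OF yV(1) u(1) yV(1)]) (simp add: yV(1))
    finally show ?thesis .
   qed
   have "ract ?g (ract h w) = ract h w" if h: "h \<in> hU {a, b}" for h
   proof -
    \<comment> \<open>\<open>h\<close> maps \<open>B\<close> to itself, so following it by a p-power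
      trivial on \<open>B\<close> does not change what it does on \<open>B\<close>.\<close>
    have "ract (?g \<otimes>\<^bsub>hG\<^esub> h) w = ract h w"
    proof (rule key[OF subgroup.m_closed[OF Us gk h] h])
     fix y assume y: "y \<in> B"
     thus "(?g \<otimes>\<^bsub>hG\<^esub> h) y = h y" using hG_mult_apply[OF UG[OF gk] UG[OF h], of y] gB[OF hB[OF h y]] BV by auto
    qed
    thus ?thesis using rm[OF UG[OF gk] UG[OF h] wH] by simp
   qed
   thus ?thesis unfolding pe[symmetric] by (intro exI[of _ k]) simp
  qed
 qed
 then obtain x where x: "x \<in> generate (add_monoid HM) ((\<lambda>h. ract h w) ` hU {a, b})" "x ~= \<zero>\<^bsub>HM\<^esub>" "\<forall>g\<in>hU {a, b}. ract g x = x"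
  unfolding eqS by auto
 have "generate (add_monoid HM) ((\<lambda>h. ract h w) ` hU {a, b}) \<subseteq> N"
  by (rule group.generate_subgroup_incl[OF comm_group.axioms(2)[OF H.M.a_comm_group] _ submodule.axioms(1)[OF N]])
   (use st w(1) in blast)
 thus ?thesis using x by blast
qed

end

section \<open>The counit\<close>

context smooth_rep
begin

sublocale FH: coeff v p e \<Lambda> Fh by unfold_locales (rule Fh_C0)

text \<open>The counit at the level of chains.\<close>

definition total :: "('f vertex => 'w) => 'w" where
 "total c = finsum W c {x \<in> VV. c x ~= \<zero>\<^bsub>W\<^esub>}"

lemma chain_iff: "c \<in> carrier FH.C0 \<longleftrightarrow> c \<in> extensional VV \<and> (\<forall>x\<in>VV. c x \<in> FV x) \<and> finite {x \<in> VV. c x ~= \<zero>\<^bsub>W\<^esub>}"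
 unfolding FH.C0 FH.DS0.DS_mem by (simp add: Fh_vertex)

lemma total_eq: assumes "c \<in> carrier FH.C0" "finite S" "S \<subseteq> VV" "{x \<in> VV. c x ~= \<zero>\<^bsub>W\<^esub>} \<subseteq> S"
 shows "total c = finsum W c S"
 unfolding total_def
 by (rule W.M.add.finprod_mono_neutral_cong_left[OF assms(2,4)])
  (use assms(1,3) FV_carrier in "auto simp: chain_iff")

lemma total_linmap: "linmap \<Lambda> FH.C0 W total"
proof (rule linmapI)
 have cW: "c x \<in> carrier W" if "c \<in> carrier FH.C0" "x \<in> VV" for c x using that FV_carrier by (auto simp: chain_iff)
 show "total c \<in> carrier W" if "c \<in> carrier FH.C0" for c
  unfolding total_def by (rule W.M.finsum_closed) (use cW[OF that] in auto)
 show "total (c \<oplus>\<^bsub>FH.C0\<^esub> c') = total c \<oplus>\<^bsub>W\<^esub> total c'" if c: "c \<in> carrier FH.C0" "c' \<in> carrier FH.C0" for c c'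
 proof -
  let ?S = "{x \<in> VV. c x ~= \<zero>\<^bsub>W\<^esub>} \<union> {x \<in> VV. c' x ~= \<zero>\<^bsub>W\<^esub>}"
  have S: "finite ?S" "?S \<subseteq> VV" using c by (auto simp: chain_iff)
  have ap: "(c \<oplus>\<^bsub>FH.C0\<^esub> c') x = c x \<oplus>\<^bsub>W\<^esub> c' x" if "x \<in> VV" for x
   unfolding FH.C0 using FH.DS0.DS_apply(1)[OF that] by (simp add: Fh_vertex)
  have m: "c \<oplus>\<^bsub>FH.C0\<^esub> c' \<in> carrier FH.C0" using FH.DS0.DS_closed(1) c unfolding FH.C0 by blast
  have "total (c \<oplus>\<^bsub>FH.C0\<^esub> c') = finsum W (c \<oplus>\<^bsub>FH.C0\<^esub> c') ?S"
   by (rule total_eq[OF m S]) (auto simp: ap)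
  also have "\<dots> = finsum W (\<lambda>x. c x \<oplus>\<^bsub>W\<^esub> c' x) ?S"
   by (rule W.M.finsum_cong') (use ap cW[OF c(1)] cW[OF c(2)] in auto)
  also have "\<dots> = finsum W c ?S \<oplus>\<^bsub>W\<^esub> finsum W c' ?S"
   by (rule W.M.finsum_addf) (use cW[OF c(1)] cW[OF c(2)] in auto)
  also have "\<dots> = total c \<oplus>\<^bsub>W\<^esub> total c'" using total_eq[OF c(1) S] total_eq[OF c(2) S] by simp
  finally show ?thesis .
 qed
 show "total (r \<odot>\<^bsub>FH.C0\<^esub> c) = r \<odot>\<^bsub>W\<^esub> total c" if r: "r \<in> carrier \<Lambda>" and c: "c \<in> carrier FH.C0" for r c
 proof -
  let ?S = "{x \<in> VV. c x ~= \<zero>\<^bsub>W\<^esub>}"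
  have S: "finite ?S" "?S \<subseteq> VV" using c by (auto simp: chain_iff)
  have ap: "(r \<odot>\<^bsub>FH.C0\<^esub> c) x = r \<odot>\<^bsub>W\<^esub> c x" if "x \<in> VV" for x
   unfolding FH.C0 using FH.DS0.DS_apply(2)[OF that] by (simp add: Fh_vertex)
  have m: "r \<odot>\<^bsub>FH.C0\<^esub> c \<in> carrier FH.C0" using FH.DS0.DS_closed(2) c r unfolding FH.C0 by blast
  have "total (r \<odot>\<^bsub>FH.C0\<^esub> c) = finsum W (r \<odot>\<^bsub>FH.C0\<^esub> c) ?S"
   by (rule total_eq[OF m S]) (use r in "auto simp: ap W.smult_r_null")
  also have "\<dots> = finsum W (\<lambda>x. r \<odot>\<^bsub>W\<^esub> c x) ?S"
   by (rule W.M.finsum_cong') (use ap cW[OF c] r in auto)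
  also have "\<dots> = r \<odot>\<^bsub>W\<^esub> finsum W c ?S"
   by (rule W.finsum_smult_ldistr[OF S(1) r, symmetric]) (use cW[OF c] in auto)
  finally show ?thesis by (simp add: total_def)
 qed
qed

lemma FHsingle_apply: "y \<in> VV ==> FH.DS0.single x f y = (if y = x then f else \<zero>\<^bsub>W\<^esub>)"
 by (subst FH.DS0.single_apply) (simp_all add: Fh_vertex)

lemma FHsingle: assumes "x \<in> VV" "f \<in> FV x" shows "FH.DS0.single x f \<in> carrier FH.C0" "total (FH.DS0.single x f) = f"
proof -
 show m: "FH.DS0.single x f \<in> carrier FH.C0" by (rule FH.single_C0[OF assms(1)]) (simp add: Fh_vertex assms(2))
 have "total (FH.DS0.single x f) = finsum W (FH.DS0.single x f) {x}"
 proof (rule total_eq[OF m])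
  show "{y \<in> VV. FH.DS0.single x f y ~= \<zero>\<^bsub>W\<^esub>} \<subseteq> {x}"
  proof
   fix y assume y: "y \<in> {y \<in> VV. FH.DS0.single x f y ~= \<zero>\<^bsub>W\<^esub>}"
   thus "y \<in> {x}" using FHsingle_apply[of y x f] by (cases "y = x") simp_all
  qed
 qed (use assms(1) in simp_all)
 thus "total (FH.DS0.single x f) = f"
  using FHsingle_apply[OF assms(1), of x f] FV_carrier[OF assms] by simp
qed

text \<open>The ends of an edge lie in different orbits, so the two transition maps are the
  inclusion and its negative, and their contributions cancel.\<close>

lemma total_boundary: assumes "c \<in> boundaries v Fh" shows "total c = \<zero>\<^bsub>W\<^esub>"
proof -
 have "total c \<in> {\<zero>\<^bsub>W\<^esub>}"
 proof (rule FH.boundaries_into[OF total_linmap W_module zero_submod[OF W_module] _ assms])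
  fix x y f assume xy: "{x, y} \<in> EE" and f: "f \<in> Ob Fh {x, y}"
  have f': "f \<in> fixd {x, y}" using f by (simp add: Fh_edge[OF xy])
  have fW: "f \<in> carrier W" by (rule fixd_carrier[OF f'])
  have V: "x \<in> VV" "y \<in> VV" using edge_vertices[OF xy] by auto
  have m: "trans_map Fh {x, y} x f \<in> FV x" "trans_map Fh {x, y} y f \<in> FV y"
   using Fh_trans_mem[OF xy _ f'] by (simp_all add: Fh_trans)
  show "total (FH.DS0.single x (trans_map Fh {x, y} x f)) \<oplus>\<^bsub>W\<^esub> total (FH.DS0.single y (trans_map Fh {x, y} y f)) \<in> {\<zero>\<^bsub>W\<^esub>}"
   unfolding FHsingle(2)[OF V(1) m(1)] FHsingle(2)[OF V(2) m(2)] unfolding Fh_trans using pl_edge[OF xy] fW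
   by (simp add: W.M.r_neg W.M.l_neg)
 qed
 thus ?thesis by simp
qed

abbreviation "eps \<equiv> counit_map v p e xp V"

text \<open>\<open>total\<close> vanishes on boundaries, so it is constant on the coset; this
  justifies \<open>the_elem\<close> in the counit.\<close>

lemma eps_q: assumes c: "c \<in> carrier FH.C0" shows "eps (FH.Qt.q c) = total c"
proof -
 have m: "FH.Qt.q c \<in> carrier (rep_mod (H0 v e Fh))" unfolding FH.H0_mod FH.Qt.Q_carrier by (rule imageI[OF c])
 have "total c' = total c" if c': "c' \<in> FH.Qt.q c" for c'
 proof -
  obtain n where n: "n \<in> boundaries v Fh" "c' = n \<oplus>\<^bsub>FH.C0\<^esub> c" using c' unfolding FH.Qt.q_mem by blast
  have nC: "n \<in> carrier FH.C0" using n(1) FH.Qt.Nsub(1) by blast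
  show ?thesis using linmapD(2)[OF total_linmap nC c] total_boundary[OF n(1)] linmapD(1)[OF total_linmap c] n(2) by simp
 qed
 hence "total ` FH.Qt.q c \<subseteq> {total c}" by (intro image_subsetI) (simp only: singleton_iff)
 hence "total ` FH.Qt.q c = {total c}" using imageI[OF FH.Qt.q_self[OF c], of total] by blast
 moreover have "eps (FH.Qt.q c) = the_elem (total ` FH.Qt.q c)" unfolding counit_map_def total_def using m by simp
 ultimately show ?thesis by simp
qed

lemma eps_cls: "x \<in> VV ==> f \<in> FV x ==> eps (FH.cls x f) = f"
 using eps_q FHsingle by (simp add: FH.cls_q)

lemma eps_linmap: "linmap \<Lambda> FH.HM W eps"
proof (rule linmapI)
 show "eps w \<in> carrier W" if "w \<in> carrier FH.HM" for w
  using that linmapD(1)[OF total_linmap] unfolding FH.Qt.Q_carrier by (auto simp: eps_q)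
 show "eps (w \<oplus>\<^bsub>FH.HM\<^esub> w') = eps w \<oplus>\<^bsub>W\<^esub> eps w'" if "w \<in> carrier FH.HM" "w' \<in> carrier FH.HM" for w w'
 proof -
  obtain c c' where c: "c \<in> carrier FH.C0" "w = FH.Qt.q c" "c' \<in> carrier FH.C0" "w' = FH.Qt.q c'"
   using \<open>w \<in> _\<close> \<open>w' \<in> _\<close> unfolding FH.Qt.Q_carrier by blast
  have "c \<oplus>\<^bsub>FH.C0\<^esub> c' \<in> carrier FH.C0" using FH.DS0.DS_closed(1) c unfolding FH.C0 by blast
  thus ?thesis using c linmapD(2)[OF total_linmap c(1,3)] by (simp add: FH.Qt.Q_add eps_q)
 qed
 show "eps (r \<odot>\<^bsub>FH.HM\<^esub> w) = r \<odot>\<^bsub>W\<^esub> eps w" if r: "r \<in> carrier \<Lambda>" and w: "w \<in> carrier FH.HM" for r w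
 proof -
  obtain c where c: "c \<in> carrier FH.C0" "w = FH.Qt.q c" using w unfolding FH.Qt.Q_carrier by blast
  have "r \<odot>\<^bsub>FH.C0\<^esub> c \<in> carrier FH.C0" using FH.DS0.DS_closed(2) c r unfolding FH.C0 by blast
  thus ?thesis using c linmapD(3)[OF total_linmap r c(1)] by (simp add: FH.Qt.Q_smult[OF r c(1)] eps_q)
 qed
qed

text \<open>It suffices to look at classes of vertex vectors. There homology uses a matrix that
  agrees with \<open>g\<close> near the vertex, and by \<open>FV_act_eq\<close> the representation
  may use the same matrix.\<close>

lemma eps_equivariant: assumes g: "g \<in> GG" and w: "w \<in> carrier FH.HM" shows "eps (FH.ract g w) = \<rho> g (eps w)"
proof (rule FH.H_linmap_eq[of W "\<lambda>w. eps (FH.ract g w)" "\<lambda>w. \<rho> g (eps w)", OF _ _ W_module _ w])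
 show "linmap \<Lambda> FH.HM W (\<lambda>w. eps (FH.ract g w))" by (rule linmap_comp[OF FH.ract_linmap[OF g] eps_linmap])
 show "linmap \<Lambda> FH.HM W (\<lambda>w. \<rho> g (eps w))" by (rule linmap_comp[OF eps_linmap \<rho>_linmap[OF g]])
 fix x f assume x: "x \<in> VV" and "f \<in> Ob Fh {x}"
 hence f: "f \<in> FV x" "f \<in> Ob Fh {x}" by (simp_all add: Fh_vertex)
 obtain g' where g': "det g' ~= 0" "\<forall>z\<in>ball {x}. g z = actv g' z" using GG_vertex[OF g x] by blast
 have "FH.ract g (FH.cls x f) = FH.cls (actv g' x) (\<rho> (th g') f)"
  using FH.ract_cls'[OF g x f(2) g'(1)] g'(2) by (simp add: Fh_act_vertex)
 hence "eps (FH.ract g (FH.cls x f)) = \<rho> (th g') f"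
  using eps_cls[OF act_vertex_VV[OF g'(1) x] \<rho>_FV[OF x g'(1) f(1)]] by simp
 also have "\<dots> = \<rho> g f" using FV_act_eq[OF x f(1) g g'(1)] g'(2) by simp
 finally show "eps (FH.ract g (FH.cls x f)) = \<rho> g (eps (FH.cls x f))" using eps_cls[OF x f(1)] by simp
qed

lemma eps_surj: "eps ` carrier FH.HM = carrier W"
proof
 have N: "submodule (eps ` carrier FH.HM) \<Lambda> W" by (rule linmap_image_submod[OF eps_linmap FH.Qt.Q_module W_module])
 show "eps ` carrier FH.HM \<subseteq> carrier W" using linmapD(1)[OF eps_linmap] by blast
 have "subrep_generated \<Lambda> W (carrier hG) \<rho> (fixd {xp, xm}) = carrier W" using V by (simp add: cat_R0_def)
 moreover have "subrep_generated \<Lambda> W (carrier hG) \<rho> (fixd {xp, xm}) \<subseteq> eps ` carrier FH.HM"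
 proof (rule subrep_generated_le[OF N])
  show "\<rho> h x \<in> eps ` carrier FH.HM" if "h \<in> carrier hG" "x \<in> eps ` carrier FH.HM" for h x
  proof -
   obtain w where w: "w \<in> carrier FH.HM" "x = eps w" using \<open>x \<in> _\<close> by blast
   have h: "h \<in> GG" using \<open>h \<in> carrier hG\<close> by simp
   show ?thesis using eps_equivariant[OF h w(1)] w linmapD(1)[OF FH.ract_linmap[OF h] w(1)] by (metis image_eqI)
  qed
  show "fixd {xp, xm} \<subseteq> eps ` carrier FH.HM"
  proof
   fix f assume "f \<in> fixd {xp, xm}"
   hence f: "f \<in> FV xp" by (rule fixd_FV[OF xpm])
   show "f \<in> eps ` carrier FH.HM"
    using eps_cls[OF xpV(1) f] FH.cls_mem[OF xpV(1), of f] f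
    by (intro image_eqI[of _ _ "FH.cls xp f"]) (simp_all add: Fh_vertex)
  qed
 qed
 ultimately show "carrier W \<subseteq> eps ` carrier FH.HM" by simp
qed

lemma eps_inj: assumes nil: "\<exists>n. \<forall>w\<in>carrier FH.HM. ((add_pow FH.HM p) ^^ n) w = \<zero>\<^bsub>FH.HM\<^esub>"
 shows "inj_on eps (carrier FH.HM)"
proof (rule linmap_inj[OF eps_linmap FH.Qt.Q_module W_module])
 fix w0 assume w0: "w0 \<in> carrier FH.HM" "eps w0 = \<zero>\<^bsub>W\<^esub>"
 show "w0 = \<zero>\<^bsub>FH.HM\<^esub>"
 proof (rule ccontr)
  assume ne: "w0 ~= \<zero>\<^bsub>FH.HM\<^esub>"
  let ?N = "{w \<in> carrier FH.HM. eps w \<in> {\<zero>\<^bsub>W\<^esub>}}"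
  have N: "submodule ?N \<Lambda> FH.HM" by (rule linmap_preimage_submod[OF eps_linmap FH.Qt.Q_module W_module zero_submod[OF W_module]])
  have st: "FH.ract h w \<in> ?N" if "h \<in> hU {xp, xm}" "w \<in> ?N" for h w
  proof -
   have h: "h \<in> GG" by (rule hU_GG[OF edge_simplex[OF xpm] that(1)])
   have w: "w \<in> carrier FH.HM" "eps w = \<zero>\<^bsub>W\<^esub>" using that(2) by simp_all
   show ?thesis using eps_equivariant[OF h w(1)] linmapD(1)[OF FH.ract_linmap[OF h] w(1)] w(2)
     linmap_0[OF \<rho>_linmap[OF h] W_module W_module] by simp
  qed
  have "w0 \<in> ?N" using w0 by simp
  then obtain w where w: "w \<in> ?N" "w ~= \<zero>\<^bsub>FH.HM\<^esub>" "\<forall>h\<in>hU {xp, xm}. FH.ract h w = w"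
   using FH.fixed_in_stable_submodule[OF xpm nil N st _ ne] by blast
  have wH: "w \<in> carrier FH.HM" "eps w = \<zero>\<^bsub>W\<^esub>" using w(1) by simp_all
  \<comment> \<open>The fixed vector is the class of an edge vector \<open>f\<close>, read at
    \<open>xp\<close>, which lies in the plus orbit; so no sign intervenes and the counit returns
    \<open>f\<close> itself.\<close>
  obtain f where f: "f \<in> Ob Fh {xp, xm}" "w = FH.cls xp (trans_map Fh {xp, xm} xp f)"
   using FH.fixed_edge[OF xpm wH(1)] w(3) by blast
  have tr: "trans_map Fh {xp, xm} xp f = f" by (simp add: Fh_trans pl_xp)
  have fF: "f \<in> FV xp" using fixd_FV[OF xpm] f(1) by (simp add: Fh_edge[OF xpm])
  have "f = \<zero>\<^bsub>W\<^esub>" using eps_cls[OF xpV(1) fF] wH(2) f(2) tr by simp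
  hence "w = FH.cls xp \<zero>\<^bsub>obj Fh {xp}\<^esub>" using f(2) tr by (simp add: Fh_vertex)
  thus False using linmap_0[OF FH.cls_linmap[OF xpV(1)] FH.F_modV[OF xpV(1)] FH.Qt.Q_module] w(2) by simp
 qed
qed

end

section \<open>Morphisms\<close>

lemma linmap_into: assumes "linmap R M N f" "!!x. x \<in> carrier M ==> f x \<in> N'" shows "linmap R M (N\<lparr>carrier := N'\<rparr>) f"
 using assms by (simp add: linmap_def Pi_iff)

lemma linmap_bij_inverse: assumes "linmap R M N f" "Module.module R M" "bij_betw f (carrier M) (carrier N)"
 shows "linmap R N M (inv_into (carrier M) f)"
proof -
 interpret M: Module.module R M by (rule assms(2))
 let ?g = "inv_into (carrier M) f"
 have g: "?g y \<in> carrier M" "f (?g y) = y" if "y \<in> carrier N" for y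
  using that assms(3) by (auto simp: bij_betw_def inv_into_into f_inv_into_f)
 have eq: "?g (f x) = x" if "x \<in> carrier M" for x using that assms(3) by (simp add: bij_betw_def)
 show ?thesis
 proof (rule linmapI)
  show "?g x \<in> carrier M" if "x \<in> carrier N" for x by (rule g(1)[OF that])
  show "?g (x \<oplus>\<^bsub>N\<^esub> y) = ?g x \<oplus>\<^bsub>M\<^esub> ?g y" if "x \<in> carrier N" "y \<in> carrier N" for x y
   using eq[of "?g x \<oplus>\<^bsub>M\<^esub> ?g y"] linmapD(2)[OF assms(1) g(1)[OF that(1)] g(1)[OF that(2)]] g[OF that(1)] g[OF that(2)] by simp
  show "?g (a \<odot>\<^bsub>N\<^esub> x) = a \<odot>\<^bsub>M\<^esub> ?g x" if "a \<in> carrier R" "x \<in> carrier N" for a x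
   using eq[of "a \<odot>\<^bsub>M\<^esub> ?g x"] linmapD(3)[OF assms(1) that(1) g(1)[OF that(2)]] g[OF that(2)] that(1) by simp
 qed
qed

lemma hat_repD: assumes "hat_rep v e \<Lambda> V"
 shows "Module.module \<Lambda> (rep_mod V)" "g \<in> carrier (hat_G v e) ==> linmap \<Lambda> (rep_mod V) (rep_mod V) (rep_act V g)"
proof -
 show m: "Module.module \<Lambda> (rep_mod V)" using assms by (simp add: hat_rep_def)
 show "g \<in> carrier (hat_G v e) ==> linmap \<Lambda> (rep_mod V) (rep_mod V) (rep_act V g)"
  using assms unfolding hat_rep_def linear_on_iff[OF m] by blast
qed

lemma R_homD: assumes "\<phi> \<in> R_hom v e \<Lambda> V V'"
 shows "linmap \<Lambda> (rep_mod V) (rep_mod V') \<phi>" "\<phi> \<in> extensional (carrier (rep_mod V))"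
  "g \<in> carrier (hat_G v e) ==> w \<in> carrier (rep_mod V) ==> \<phi> (rep_act V g w) = rep_act V' g (\<phi> w)"
 using assms by (simp_all add: R_hom_def lin_maps_iff)

lemma R_homI: assumes "linmap \<Lambda> (rep_mod V) (rep_mod V') \<phi>" "\<phi> \<in> extensional (carrier (rep_mod V))"
  "!!g w. g \<in> carrier (hat_G v e) ==> w \<in> carrier (rep_mod V) ==> \<phi> (rep_act V g w) = rep_act V' g (\<phi> w)"
 shows "\<phi> \<in> R_hom v e \<Lambda> V V'"
 using assms by (simp add: R_hom_def lin_maps_iff)

lemma R_comp_apply: "w \<in> carrier (rep_mod V) ==> R_comp V \<psi> \<phi> w = \<psi> (\<phi> w)"
 by (simp add: R_comp_def compose_def)

lemma R_comp_hom: assumes "\<phi> \<in> R_hom v e \<Lambda> V V'" "\<psi> \<in> R_hom v e \<Lambda> V' V''" "hat_rep v e \<Lambda> V"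
 shows "R_comp V \<psi> \<phi> \<in> R_hom v e \<Lambda> V V''"
proof (rule R_homI)
 note V = hat_repD[OF assms(3)]
 show "linmap \<Lambda> (rep_mod V) (rep_mod V'') (R_comp V \<psi> \<phi>)"
  by (rule linmap_cong[OF linmap_comp[OF R_homD(1)[OF assms(1)] R_homD(1)[OF assms(2)]] V(1)]) (rule R_comp_apply)
 show "R_comp V \<psi> \<phi> \<in> extensional (carrier (rep_mod V))" by (simp add: R_comp_def)
 fix g w assume g: "g \<in> carrier (hat_G v e)" and w: "w \<in> carrier (rep_mod V)"
 show "R_comp V \<psi> \<phi> (rep_act V g w) = rep_act V'' g (R_comp V \<psi> \<phi> w)"
  unfolding R_comp_apply[OF w] R_comp_apply[OF linmapD(1)[OF V(2)[OF g] w]]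
   R_homD(3)[OF assms(1) g w] R_homD(3)[OF assms(2) g linmapD(1)[OF R_homD(1)[OF assms(1)] w]] ..
qed

text \<open>The inverse of a bijective morphism is automatically linear and equivariant; it only has
  to be made extensional.\<close>

lemma R_isoI: assumes "\<phi> \<in> R_hom v e \<Lambda> V V'" "hat_rep v e \<Lambda> V" "hat_rep v e \<Lambda> V'"
 "bij_betw \<phi> (carrier (rep_mod V)) (carrier (rep_mod V'))"
 shows "\<phi> \<in> R_iso v e \<Lambda> V V'"
proof -
 note V = hat_repD[OF assms(2)] and V' = hat_repD[OF assms(3)]
 let ?i = "inv_into (carrier (rep_mod V)) \<phi>"
 let ?\<psi> = "restrict ?i (carrier (rep_mod V'))"
 have lin: "linmap \<Lambda> (rep_mod V') (rep_mod V) ?i" by (rule linmap_bij_inverse[OF R_homD(1)[OF assms(1)] V(1) assms(4)])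
 have i\<phi>: "?i (\<phi> w) = w" if "w \<in> carrier (rep_mod V)" for w using that assms(4) by (simp add: bij_betw_def)
 have \<phi>i: "\<phi> (?i w) = w" if "w \<in> carrier (rep_mod V')" for w using that assms(4) by (simp add: bij_betw_def f_inv_into_f)
 have "?\<psi> \<in> R_hom v e \<Lambda> V' V"
 proof (rule R_homI)
  show "linmap \<Lambda> (rep_mod V') (rep_mod V) ?\<psi>" by (rule linmap_cong[OF lin V'(1)]) simp
  fix g w assume g: "g \<in> carrier (hat_G v e)" and w: "w \<in> carrier (rep_mod V')"
  have iw: "?i w \<in> carrier (rep_mod V)" by (rule linmapD(1)[OF lin w])
  have "?i (rep_act V' g w) = rep_act V g (?i w)"
   using i\<phi>[OF linmapD(1)[OF V(2)[OF g] iw]] R_homD(3)[OF assms(1) g iw] \<phi>i[OF w] by simp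
  thus "?\<psi> (rep_act V' g w) = rep_act V g (?\<psi> w)" using w linmapD(1)[OF V'(2)[OF g] w] by simp
 qed simp
 moreover have "R_comp V ?\<psi> \<phi> = R_id V" unfolding R_comp_def R_id_def compose_def
  by (rule restrict_ext) (use i\<phi> linmapD(1)[OF R_homD(1)[OF assms(1)]] in simp)
 moreover have "R_comp V' \<phi> ?\<psi> = R_id V'" unfolding R_comp_def R_id_def compose_def
  by (rule restrict_ext) (use \<phi>i in simp)
 ultimately show ?thesis using assms(1) unfolding R_iso_def by blast
qed

context tree_level
begin

lemma C_homD: assumes "\<phi> \<in> C_hom v \<Lambda> F F'"
 shows "\<tau> \<in> SS ==> linmap \<Lambda> (obj F \<tau>) (obj F' \<tau>) (\<phi> \<tau>)"
  "\<tau> \<in> SS ==> \<phi> \<tau> \<in> extensional (Ob F \<tau>)" "\<phi> \<in> extensional (SS)"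
  "\<tau> \<in> EE ==> x \<in> \<tau> ==> f \<in> Ob F \<tau> ==> \<phi> {x} (trans_map F \<tau> x f) = trans_map F' \<tau> x (\<phi> \<tau> f)"
  "det g ~= 0 ==> \<tau> \<in> SS ==> f \<in> Ob F \<tau> ==>
   \<phi> (act_simplex g \<tau>) (act_map F g \<tau> f) = act_map F' g \<tau> (\<phi> \<tau> f)"
 using assms by (auto simp: C_hom_def PiE_iff lin_maps_iff GL2_carrier)

lemma C_homI: assumes
  "!!\<tau>. \<tau> \<in> SS ==> linmap \<Lambda> (obj F \<tau>) (obj F' \<tau>) (\<phi> \<tau>)"
  "!!\<tau>. \<tau> \<in> SS ==> \<phi> \<tau> \<in> extensional (Ob F \<tau>)" "\<phi> \<in> extensional (SS)"
  "!!\<tau> x f. \<tau> \<in> EE ==> x \<in> \<tau> ==> f \<in> Ob F \<tau> ==> \<phi> {x} (trans_map F \<tau> x f) = trans_map F' \<tau> x (\<phi> \<tau> f)"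
  "!!g \<tau> f. det g ~= 0 ==> \<tau> \<in> SS ==> f \<in> Ob F \<tau> ==>
   \<phi> (act_simplex g \<tau>) (act_map F g \<tau> f) = act_map F' g \<tau> (\<phi> \<tau> f)"
 shows "\<phi> \<in> C_hom v \<Lambda> F F'"
 using assms by (auto simp: C_hom_def PiE_iff lin_maps_iff GL2_carrier)

lemma C_hom_eqI: assumes "\<phi> \<in> C_hom v \<Lambda> F F'" "\<psi> \<in> C_hom v \<Lambda> F F'"
 "!!\<tau> f. \<tau> \<in> SS ==> f \<in> Ob F \<tau> ==> \<phi> \<tau> f = \<psi> \<tau> f" shows "\<phi> = \<psi>"
 by (rule extensionalityI[OF C_homD(3)[OF assms(1)] C_homD(3)[OF assms(2)]],
  rule extensionalityI[OF C_homD(2)[OF assms(1)] C_homD(2)[OF assms(2)]]) (use assms(3) in auto)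

lemma C_comp_apply: "\<tau> \<in> SS ==> f \<in> Ob F \<tau> ==> C_comp v F \<psi> \<phi> \<tau> f = \<psi> \<tau> (\<phi> \<tau> f)"
 by (simp add: C_comp_def compose_def)

lemma C_id_apply: "\<tau> \<in> SS ==> f \<in> Ob F \<tau> ==> C_id v F \<tau> f = f"
 by (simp add: C_id_def)

lemma C_comp_cong: assumes "!!\<tau> f. \<tau> \<in> SS ==> f \<in> Ob F \<tau> ==> \<psi> \<tau> (\<phi> \<tau> f) = \<psi>' \<tau> (\<phi>' \<tau> f)"
 shows "C_comp v F \<psi> \<phi> = C_comp v F \<psi>' \<phi>'"
 unfolding C_comp_def compose_def by (intro restrict_ext) (rule assms)

lemma edge_vertex_simplex: "\<tau> \<in> EE ==> x \<in> \<tau> ==> {x} \<in> SS"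
 by (rule vertex_simplex[OF edge_subset])

end

context coeff
begin

lemma trans_closed: "\<tau> \<in> EE ==> x \<in> \<tau> ==> f \<in> Ob F \<tau> ==> trans_map F \<tau> x f \<in> Ob F {x}"
 by (rule linmapD(1)[OF F_tr])

lemma act_closed: "det g ~= 0 ==> \<tau> \<in> SS ==> f \<in> Ob F \<tau> ==>
  act_map F g \<tau> f \<in> carrier (obj F (act_simplex g \<tau>))"
 by (rule linmapD(1)[OF F_act])

lemma C_id_hom: "C_id v F \<in> C_hom v \<Lambda> F F"
proof (rule C_homI)
 show "linmap \<Lambda> (obj F \<tau>) (obj F \<tau>) (C_id v F \<tau>)" if "\<tau> \<in> SS" for \<tau>
  by (rule linmapI) (use F_mod[OF that] that in \<open>auto simp: C_id_def Module.module.smult_closed abelian_monoid.a_closed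
   abelian_group.axioms(1) Module.module.axioms(2)\<close>)
qed (simp_all add: C_id_def trans_closed edge_simplex edge_vertex_simplex act_closed simplex_act)

lemma C_comp_hom: assumes "\<phi> \<in> C_hom v \<Lambda> F F'" "\<psi> \<in> C_hom v \<Lambda> F' F''"
 shows "C_comp v F \<psi> \<phi> \<in> C_hom v \<Lambda> F F''"
proof (rule C_homI)
 show "linmap \<Lambda> (obj F \<tau>) (obj F'' \<tau>) (C_comp v F \<psi> \<phi> \<tau>)" if "\<tau> \<in> SS" for \<tau>
  by (rule linmap_cong[OF linmap_comp[OF C_homD(1)[OF assms(1) that] C_homD(1)[OF assms(2) that]] F_mod[OF that]])
   (rule C_comp_apply[OF that])
 show "C_comp v F \<psi> \<phi> {x} (trans_map F \<tau> x f) = trans_map F'' \<tau> x (C_comp v F \<psi> \<phi> \<tau> f)"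
  if t: "\<tau> \<in> EE" "x \<in> \<tau>" "f \<in> Ob F \<tau>" for \<tau> x f
  using C_homD(4)[OF assms(1) t] C_homD(4)[OF assms(2) t(1,2) linmapD(1)[OF C_homD(1)[OF assms(1) edge_simplex[OF t(1)]] t(3)]]
   C_comp_apply[OF edge_simplex[OF t(1)] t(3), of \<psi> \<phi>] C_comp_apply[OF edge_vertex_simplex[OF t(1,2)] trans_closed[OF t], of \<psi> \<phi>]
  by simp
 show "C_comp v F \<psi> \<phi> (act_simplex g \<tau>) (act_map F g \<tau> f) = act_map F'' g \<tau> (C_comp v F \<psi> \<phi> \<tau> f)"
  if t: "det g ~= 0" "\<tau> \<in> SS" "f \<in> Ob F \<tau>" for g \<tau> f
  using C_homD(5)[OF assms(1) t] C_homD(5)[OF assms(2) t(1,2) linmapD(1)[OF C_homD(1)[OF assms(1) t(2)] t(3)]]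
   C_comp_apply[OF t(2,3), of \<psi> \<phi>] C_comp_apply[OF simplex_act[OF t(1,2)] act_closed[OF t], of \<psi> \<phi>]
  by simp
qed (simp_all add: C_comp_def)

lemma H_hom_eqI: assumes "\<phi> \<in> R_hom v e \<Lambda> (H0 v e F) V" "\<psi> \<in> R_hom v e \<Lambda> (H0 v e F) V" "Module.module \<Lambda> (rep_mod V)"
 "!!x f. x \<in> VV ==> f \<in> Ob F {x} ==> \<phi> (cls x f) = \<psi> (cls x f)" shows "\<phi> = \<psi>"
proof (rule extensionalityI)
 note h = R_homD[OF assms(1), unfolded H0_mod] and h' = R_homD[OF assms(2), unfolded H0_mod]
 show "\<phi> \<in> extensional (carrier HM)" "\<psi> \<in> extensional (carrier HM)" by (rule h(2), rule h'(2))
 show "\<phi> w = \<psi> w" if "w \<in> carrier HM" for w by (rule H_linmap_eq[OF h(1) h'(1) assms(3,4) that])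
qed

end

locale coeff_hom = tree_level v p e + A: coeff v p e \<Lambda> F + B: coeff v p e \<Lambda> F'
 for v :: "'f::field => int" and p e :: nat and \<Lambda> :: "('l, 'c) ring_scheme"
  and F :: "('f, 'l, 'm) coeff_system" and F' :: "('f, 'l, 'n) coeff_system" +
 fixes \<phi> :: "'f tree_simplex => 'm => 'n"
 assumes hom: "\<phi> \<in> C_hom v \<Lambda> F F'"
begin

lemmas hom_lin = C_homD(1)[OF hom] and hom_tr = C_homD(4)[OF hom] and hom_act = C_homD(5)[OF hom]

lemma hom_V: "x \<in> VV ==> linmap \<Lambda> (obj F {x}) (obj F' {x}) (\<phi> {x})"
 by (rule hom_lin[OF vertex_simplex])

lemma bijective_iso: assumes bij: "!!\<tau>. \<tau> \<in> SS ==> bij_betw (\<phi> \<tau>) (Ob F \<tau>) (Ob F' \<tau>)"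
 shows "\<phi> \<in> C_iso v \<Lambda> F F'"
proof -
 define i where "i \<tau> = inv_into (Ob F \<tau>) (\<phi> \<tau>)" for \<tau>
 let ?\<psi> = "\<lambda>\<tau>\<in>SS. restrict (i \<tau>) (Ob F' \<tau>)"
 have lin: "linmap \<Lambda> (obj F' \<tau>) (obj F \<tau>) (i \<tau>)" if "\<tau> \<in> SS" for \<tau>
  unfolding i_def by (rule linmap_bij_inverse[OF hom_lin[OF that] A.F_mod[OF that] bij[OF that]])
 have i\<phi>: "i \<tau> (\<phi> \<tau> f) = f" if "\<tau> \<in> SS" "f \<in> Ob F \<tau>" for \<tau> f
  using that(2) bij[OF that(1)] by (simp add: bij_betw_def i_def)
 have \<phi>i: "\<phi> \<tau> (i \<tau> f) = f" if "\<tau> \<in> SS" "f \<in> Ob F' \<tau>" for \<tau> f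
  using that(2) bij[OF that(1)] by (simp add: bij_betw_def i_def f_inv_into_f)
 have ap: "?\<psi> \<tau> f = i \<tau> f" if "\<tau> \<in> SS" "f \<in> Ob F' \<tau>" for \<tau> f using that by simp
 have "?\<psi> \<in> C_hom v \<Lambda> F' F"
 proof (rule C_homI)
  show "linmap \<Lambda> (obj F' \<tau>) (obj F \<tau>) (?\<psi> \<tau>)" if "\<tau> \<in> SS" for \<tau>
   by (rule linmap_cong[OF lin[OF that] B.F_mod[OF that]]) (rule ap[OF that])
  show "?\<psi> {x} (trans_map F' \<tau> x f) = trans_map F \<tau> x (?\<psi> \<tau> f)" if t: "\<tau> \<in> EE" "x \<in> \<tau>" "f \<in> Ob F' \<tau>" for \<tau> x f
  proof -
   have if': "i \<tau> f \<in> Ob F \<tau>" by (rule linmapD(1)[OF lin[OF edge_simplex[OF t(1)]] t(3)])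
   have "\<phi> {x} (trans_map F \<tau> x (i \<tau> f)) = trans_map F' \<tau> x f"
    using hom_tr[OF t(1,2) if'] \<phi>i[OF edge_simplex[OF t(1)] t(3)] by simp
   hence "i {x} (trans_map F' \<tau> x f) = trans_map F \<tau> x (i \<tau> f)"
    using i\<phi>[OF edge_vertex_simplex[OF t(1,2)] A.trans_closed[OF t(1,2) if']] by simp
   thus ?thesis using ap[OF edge_vertex_simplex[OF t(1,2)] B.trans_closed[OF t]] ap[OF edge_simplex[OF t(1)] t(3)] by simp
  qed
  show "?\<psi> (act_simplex g \<tau>) (act_map F' g \<tau> f) = act_map F g \<tau> (?\<psi> \<tau> f)"
   if t: "det g ~= 0" "\<tau> \<in> SS" "f \<in> Ob F' \<tau>" for g \<tau> f
  proof -
   have if': "i \<tau> f \<in> Ob F \<tau>" by (rule linmapD(1)[OF lin[OF t(2)] t(3)])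
   have "\<phi> (act_simplex g \<tau>) (act_map F g \<tau> (i \<tau> f)) = act_map F' g \<tau> f"
    using hom_act[OF t(1,2) if'] \<phi>i[OF t(2,3)] by simp
   hence "i (act_simplex g \<tau>) (act_map F' g \<tau> f) = act_map F g \<tau> (i \<tau> f)"
    using i\<phi>[OF simplex_act[OF t(1,2)] A.act_closed[OF t(1,2) if']] by simp
   thus ?thesis using ap[OF simplex_act[OF t(1,2)] B.act_closed[OF t]] ap[OF t(2,3)] by simp
  qed
 qed simp_all
 moreover have "C_comp v F ?\<psi> \<phi> = C_id v F" unfolding C_comp_def C_id_def compose_def
  by (intro restrict_ext) (use ap i\<phi> linmapD(1)[OF hom_lin] in simp)
 moreover have "C_comp v F' \<phi> ?\<psi> = C_id v F'" unfolding C_comp_def C_id_def compose_def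
  by (intro restrict_ext) (use ap \<phi>i in simp)
 ultimately show ?thesis using hom unfolding C_iso_def by blast
qed

section \<open>The map induced on homology\<close>

definition chain_map :: "('f vertex => 'm) => 'f vertex => 'n" where
 "chain_map c = (\<lambda>x\<in>VV. \<phi> {x} (c x))"

lemma chain_map_mem: assumes "c \<in> carrier A.C0" shows "chain_map c \<in> carrier B.C0"
proof -
 have c: "\<forall>x\<in>VV. c x \<in> Ob F {x}" "finite {x \<in> VV. c x ~= \<zero>\<^bsub>obj F {x}\<^esub>}"
  using assms unfolding A.C0 A.DS0.DS_mem by blast+
 have "{x \<in> VV. chain_map c x ~= \<zero>\<^bsub>obj F' {x}\<^esub>} \<subseteq> {x \<in> VV. c x ~= \<zero>\<^bsub>obj F {x}\<^esub>}"
  using linmap_0[OF hom_V A.F_modV B.F_modV] by (auto simp: chain_map_def)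
 hence "finite {x \<in> VV. chain_map c x ~= \<zero>\<^bsub>obj F' {x}\<^esub>}" using c(2) by (rule finite_subset)
 thus ?thesis unfolding B.C0 B.DS0.DS_mem using c(1) linmapD(1)[OF hom_V] by (simp add: chain_map_def)
qed

lemma chain_map_linmap: "linmap \<Lambda> A.C0 B.C0 chain_map"
proof (rule linmapI)
 show "chain_map c \<in> carrier B.C0" if "c \<in> carrier A.C0" for c by (rule chain_map_mem[OF that])
 have cx: "c x \<in> Ob F {x}" if "c \<in> carrier A.C0" "x \<in> VV" for c x using that unfolding A.C0 A.DS0.DS_mem by blast
 show "chain_map (c \<oplus>\<^bsub>A.C0\<^esub> c') = chain_map c \<oplus>\<^bsub>B.C0\<^esub> chain_map c'" if c: "c \<in> carrier A.C0" "c' \<in> carrier A.C0" for c c'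
 proof (rule B.DS0.DS_eqI)
  have s: "c \<oplus>\<^bsub>A.C0\<^esub> c' \<in> carrier A.C0" using A.DS0.DS_closed(1) c unfolding A.C0 by blast
  show "chain_map (c \<oplus>\<^bsub>A.C0\<^esub> c') \<in> carrier B.DS0.DS" using chain_map_mem[OF s] unfolding B.C0 .
  show "chain_map c \<oplus>\<^bsub>B.C0\<^esub> chain_map c' \<in> carrier B.DS0.DS"
   using B.DS0.DS_closed(1) chain_map_mem[OF c(1)] chain_map_mem[OF c(2)] unfolding B.C0 by blast
  show "chain_map (c \<oplus>\<^bsub>A.C0\<^esub> c') x = (chain_map c \<oplus>\<^bsub>B.C0\<^esub> chain_map c') x" if x: "x \<in> VV" for x
   unfolding A.C0 B.C0 B.DS0.DS_apply(1)[OF x]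
   using linmapD(2)[OF hom_V[OF x] cx[OF c(1) x] cx[OF c(2) x]] x A.DS0.DS_apply(1)[OF x, of c c'] by (simp add: chain_map_def)
 qed
 show "chain_map (a \<odot>\<^bsub>A.C0\<^esub> c) = a \<odot>\<^bsub>B.C0\<^esub> chain_map c" if a: "a \<in> carrier \<Lambda>" and c: "c \<in> carrier A.C0" for a c
 proof (rule B.DS0.DS_eqI)
  have s: "a \<odot>\<^bsub>A.C0\<^esub> c \<in> carrier A.C0" using A.DS0.DS_closed(2) a c unfolding A.C0 by blast
  show "chain_map (a \<odot>\<^bsub>A.C0\<^esub> c) \<in> carrier B.DS0.DS" using chain_map_mem[OF s] unfolding B.C0 .
  show "a \<odot>\<^bsub>B.C0\<^esub> chain_map c \<in> carrier B.DS0.DS" using B.DS0.DS_closed(2) a chain_map_mem[OF c] unfolding B.C0 by blast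
  show "chain_map (a \<odot>\<^bsub>A.C0\<^esub> c) x = (a \<odot>\<^bsub>B.C0\<^esub> chain_map c) x" if x: "x \<in> VV" for x
   unfolding A.C0 B.C0 B.DS0.DS_apply(2)[OF x]
   using linmapD(3)[OF hom_V[OF x] a cx[OF c x]] x A.DS0.DS_apply(2)[OF x, of a c] by (simp add: chain_map_def)
 qed
qed

lemma chain_map_single: assumes "x \<in> VV" "f \<in> Ob F {x}"
 shows "chain_map (A.DS0.single x f) = B.DS0.single x (\<phi> {x} f)"
proof (rule B.DS0.DS_eqI)
 show "chain_map (A.DS0.single x f) \<in> carrier B.DS0.DS" using chain_map_mem[OF A.single_C0[OF assms]] unfolding B.C0 .
 show "B.DS0.single x (\<phi> {x} f) \<in> carrier B.DS0.DS" by (rule B.DS0.single_mem[OF assms(1) linmapD(1)[OF hom_V[OF assms(1)] assms(2)]])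
 show "chain_map (A.DS0.single x f) y = B.DS0.single x (\<phi> {x} f) y" if "y \<in> VV" for y
  using that linmap_0[OF hom_V A.F_modV B.F_modV] by (simp add: chain_map_def A.DS0.single_apply B.DS0.single_apply)
qed

lemma chain_map_boundaries: assumes "c \<in> boundaries v F" shows "chain_map c \<in> boundaries v F'"
proof (rule A.boundaries_into[OF chain_map_linmap B.C0_module B.boundaries_submod _ assms])
 fix x y f assume xy: "{x, y} \<in> EE" and f: "f \<in> Ob F {x, y}"
 have V: "x \<in> VV" "y \<in> VV" using edge_vertices[OF xy] by auto
 have pf: "\<phi> {x, y} f \<in> Ob F' {x, y}" by (rule linmapD(1)[OF hom_lin[OF edge_simplex[OF xy]] f])
 have "chain_map (A.DS0.single x (trans_map F {x, y} x f)) \<oplus>\<^bsub>B.C0\<^esub> chain_map (A.DS0.single y (trans_map F {x, y} y f)) =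
   B.bd (B.DS1.single {x, y} (\<phi> {x, y} f))"
  unfolding B.bd_single[OF xy pf]
  using chain_map_single[OF V(1) A.trans_closed[OF xy _ f]] chain_map_single[OF V(2) A.trans_closed[OF xy _ f]]
   hom_tr[OF xy _ f] by simp
 moreover have "B.DS1.single {x, y} (\<phi> {x, y} f) \<in> carrier B.C1" unfolding B.C1 by (rule B.DS1.single_mem[OF xy pf])
 ultimately show "chain_map (A.DS0.single x (trans_map F {x, y} x f)) \<oplus>\<^bsub>B.C0\<^esub> chain_map (A.DS0.single y (trans_map F {x, y} y f))
   \<in> boundaries v F'" unfolding boundaries_def by (simp only: imageI)
qed

abbreviation "hm \<equiv> H0_map v e F F' \<phi>"

lemma hm_eq: "hm = restrict (coset_map B.C0 (boundaries v F') chain_map) (carrier A.HM)"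
 unfolding H0_map_def A.H0_mod chain_map_def ..

lemma hm_linmap: "linmap \<Lambda> A.HM B.HM hm"
 by (rule linmap_cong[OF A.Qt.coset_map_linmap[OF B.Qt.module_quotient_axioms chain_map_linmap chain_map_boundaries] A.Qt.Q_module])
  (simp_all add: hm_eq)

lemma hm_cls: assumes "x \<in> VV" "f \<in> Ob F {x}" shows "hm (A.cls x f) = B.cls x (\<phi> {x} f)"
proof -
 have "hm (A.cls x f) = coset_map B.C0 (boundaries v F') chain_map (A.Qt.q (A.DS0.single x f))"
  using A.cls_mem[OF assms] unfolding hm_eq by (simp add: A.cls_q)
 also have "\<dots> = B.Qt.q (chain_map (A.DS0.single x f))"
  unfolding B.Qt.q_def
  by (rule A.Qt.coset_map_quot[OF B.Qt.module_quotient_axioms chain_map_linmap chain_map_boundaries A.single_C0[OF assms]])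
 finally show ?thesis unfolding chain_map_single[OF assms] B.cls_q .
qed

lemma hm_hom: "hm \<in> R_hom v e \<Lambda> (H0 v e F) (H0 v e F')"
proof (rule R_homI, unfold A.H0_mod B.H0_mod hG_carrier)
 show "linmap \<Lambda> A.HM B.HM hm" by (rule hm_linmap)
 show "hm \<in> extensional (carrier A.HM)" by (simp add: hm_eq)
 fix g w assume g: "g \<in> GG" and w: "w \<in> carrier A.HM"
 show "hm (A.ract g w) = B.ract g (hm w)"
 proof (rule A.H_linmap_eq[of B.HM "\<lambda>w. hm (A.ract g w)" "\<lambda>w. B.ract g (hm w)", OF _ _ B.Qt.Q_module _ w])
  show "linmap \<Lambda> A.HM B.HM (\<lambda>w. hm (A.ract g w))" by (rule linmap_comp[OF A.ract_linmap[OF g] hm_linmap])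
  show "linmap \<Lambda> A.HM B.HM (\<lambda>w. B.ract g (hm w))" by (rule linmap_comp[OF hm_linmap B.ract_linmap[OF g]])
  fix x f assume x: "x \<in> VV" and f: "f \<in> Ob F {x}"
  obtain g' where g': "det g' ~= 0" "!!z. z \<in> ball {x} ==> g z = actv g' z" using GG_vertex[OF g x] by blast
  have pf: "\<phi> {x} f \<in> Ob F' {x}" by (rule linmapD(1)[OF hom_V[OF x] f])
  have af: "act_map F g' {x} f \<in> Ob F {actv g' x}"
   using A.act_closed[OF g'(1) vertex_simplex[OF x] f] by (simp add: act_simplex_def)
  have "hm (A.ract g (A.cls x f)) = hm (A.cls (actv g' x) (act_map F g' {x} f))"
   using A.ract_cls'[OF g x f g'] by simp
  also have "\<dots> = B.cls (actv g' x) (\<phi> {actv g' x} (act_map F g' {x} f))"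
   by (rule hm_cls[OF act_vertex_VV[OF g'(1) x] af])
  also have "\<phi> {actv g' x} (act_map F g' {x} f) = act_map F' g' {x} (\<phi> {x} f)"
   using hom_act[OF g'(1) vertex_simplex[OF x] f] by (simp add: act_simplex_def)
  also have "B.cls (actv g' x) \<dots> = B.ract g (B.cls x (\<phi> {x} f))" using B.ract_cls'[OF g x pf g'] by simp
  finally show "hm (A.ract g (A.cls x f)) = B.ract g (hm (A.cls x f))" using hm_cls[OF x f] by simp
 qed
qed

end

lemma (in coeff) H0_map_id: "H0_map v e F F (C_id v F) = R_id (H0 v e F)"
proof -
 interpret h: coeff_hom v p e \<Lambda> F F "C_id v F" by unfold_locales (rule C_id_hom)
 have "R_id (H0 v e F) \<in> R_hom v e \<Lambda> (H0 v e F) (H0 v e F)"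
 proof (rule R_homI, unfold H0_mod hG_carrier)
  have ap: "R_id (H0 v e F) w = w" if "w \<in> carrier HM" for w using that by (simp add: R_id_def H0_mod)
  have id: "linmap \<Lambda> HM HM (\<lambda>w. w)" by (simp add: linmap_def)
  show "linmap \<Lambda> HM HM (R_id (H0 v e F))" by (rule linmap_cong[OF id Qt.Q_module]) (rule ap)
  show "R_id (H0 v e F) \<in> extensional (carrier HM)" by (simp add: R_id_def H0_mod)
  show "R_id (H0 v e F) (ract g w) = ract g (R_id (H0 v e F) w)" if "g \<in> GG" "w \<in> carrier HM" for g w
   using ap[OF that(2)] ap[OF linmapD(1)[OF ract_linmap[OF that(1)] that(2)]] by simp
 qed
 thus ?thesis
  by (rule H_hom_eqI[OF h.hm_hom])
   (simp_all add: H0_mod Qt.Q_module h.hm_cls C_id_apply vertex_simplex R_id_def cls_mem)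
qed

lemma (in tree_level) H0_map_comp:
 assumes "F \<in> cat_C0 v p e \<Lambda>" "F' \<in> cat_C0 v p e \<Lambda>" "F'' \<in> cat_C0 v p e \<Lambda>" "\<phi> \<in> C_hom v \<Lambda> F F'" "\<psi> \<in> C_hom v \<Lambda> F' F''"
 shows "H0_map v e F F'' (C_comp v F \<psi> \<phi>) = R_comp (H0 v e F) (H0_map v e F' F'' \<psi>) (H0_map v e F F' \<phi>)"
proof -
 interpret A: coeff v p e \<Lambda> F by unfold_locales (rule assms(1))
 interpret h: coeff_hom v p e \<Lambda> F F' \<phi> by unfold_locales (rule assms)+
 interpret k: coeff_hom v p e \<Lambda> F' F'' \<psi> by unfold_locales (rule assms)+
 interpret c: coeff_hom v p e \<Lambda> F F'' "C_comp v F \<psi> \<phi>" by unfold_locales (rule A.C_comp_hom[OF assms(4,5)])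
 show ?thesis
 proof (rule A.H_hom_eqI[OF c.hm_hom R_comp_hom[OF h.hm_hom k.hm_hom A.H0_rep]])
  show "Module.module \<Lambda> (rep_mod (H0 v e F''))" unfolding k.B.H0_mod by (rule k.B.Qt.Q_module)
  fix x f assume x: "x \<in> VV" and f: "f \<in> Ob F {x}"
  show "c.hm (A.cls x f) = R_comp (H0 v e F) k.hm h.hm (A.cls x f)"
   using c.hm_cls[OF x f] h.hm_cls[OF x f] k.hm_cls[OF x linmapD(1)[OF h.hom_V[OF x] f]] A.cls_mem[OF x f]
   by (simp add: R_comp_apply A.H0_mod C_comp_apply[OF vertex_simplex[OF x] f])
 qed
qed

locale rep_hom = tree_level v p e + A: smooth_rep v p e \<Lambda> xp xm V + B: smooth_rep v p e \<Lambda> xp xm V'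
 for v :: "'f::field => int" and p e :: nat and \<Lambda> :: "('l, 'c) ring_scheme" and xp xm :: "'f vertex"
  and V :: "('f, 'l, 'w) rep" and V' :: "('f, 'l, 'u) rep" +
 fixes \<phi> :: "'w => 'u"
 assumes hom: "\<phi> \<in> R_hom v e \<Lambda> V V'"
begin

lemmas lin = R_homD(1)[OF hom] and equi = R_homD(3)[OF hom, unfolded hG_carrier]

abbreviation "fm \<equiv> F_hat_map v p e xp V \<phi>"

lemma fm_apply: "\<tau> \<in> SS ==> f \<in> Ob A.Fh \<tau> ==> fm \<tau> f = \<phi> f"
 by (simp add: F_hat_map_def)

lemma hom_fixd: assumes "\<tau> \<in> SS" "w \<in> A.fixd \<tau>" shows "\<phi> w \<in> B.fixd \<tau>"
proof -
 have w: "w \<in> carrier A.W" by (rule A.fixd_carrier[OF assms(2)])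
 have "rep_act V' h (\<phi> w) = \<phi> w" if h: "h \<in> hU \<tau>" for h
  using equi[OF hU_GG[OF assms(1) h] w] assms(2) h by (simp add: rep_fixed_def)
 thus ?thesis using linmapD(1)[OF lin w] by (simp add: rep_fixed_def)
qed

lemma hom_FV: assumes "x \<in> VV" "w \<in> A.FV x" shows "\<phi> w \<in> B.FV x"
proof -
 have "A.FV x \<subseteq> {w \<in> carrier A.W. \<phi> w \<in> B.FV x}"
 proof (rule A.FV_le[OF linmap_preimage_submod[OF lin A.W_module B.W_module B.FV_submod[OF assms(1)]]])
  fix y assume y: "{x, y} \<in> EE"
  show "A.fixd {x, y} \<subseteq> {w \<in> carrier A.W. \<phi> w \<in> B.FV x}"
   using hom_fixd[OF edge_simplex[OF y]] B.fixd_FV[OF y] A.fixd_carrier by blast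
 qed
 thus ?thesis using assms(2) by blast
qed

lemma hom_obj: assumes "\<tau> \<in> SS" "f \<in> Ob A.Fh \<tau>" shows "\<phi> f \<in> Ob B.Fh \<tau>"
 using A.Fh_simplex_cases[OF assms(1)]
proof cases
 case 1 thus ?thesis using assms hom_fixd by (simp add: A.Fh_edge B.Fh_edge)
next
 case (2 x) thus ?thesis using assms hom_FV by (simp add: A.Fh_vertex B.Fh_vertex)
qed

lemma fm_linmap: assumes "\<tau> \<in> SS" shows "linmap \<Lambda> (obj A.Fh \<tau>) (obj B.Fh \<tau>) (fm \<tau>)"
proof -
 have eA: "obj A.Fh \<tau> = A.W\<lparr>carrier := Ob A.Fh \<tau>\<rparr>" and eB: "obj B.Fh \<tau> = B.W\<lparr>carrier := Ob B.Fh \<tau>\<rparr>"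
  by (simp_all add: F_hat_def)
 have "linmap \<Lambda> (obj A.Fh \<tau>) (obj B.Fh \<tau>) \<phi>"
 proof (rule linmapI)
  show "\<phi> x \<in> Ob B.Fh \<tau>" if "x \<in> Ob A.Fh \<tau>" for x by (rule hom_obj[OF assms that])
  show "\<phi> (x \<oplus>\<^bsub>obj A.Fh \<tau>\<^esub> y) = \<phi> x \<oplus>\<^bsub>obj B.Fh \<tau>\<^esub> \<phi> y"
   if "x \<in> Ob A.Fh \<tau>" "y \<in> Ob A.Fh \<tau>" for x y
   using linmapD(2)[OF lin A.Fh_carrier[OF assms that(1)] A.Fh_carrier[OF assms that(2)]] by (subst eA, subst eB) simp
  show "\<phi> (a \<odot>\<^bsub>obj A.Fh \<tau>\<^esub> x) = a \<odot>\<^bsub>obj B.Fh \<tau>\<^esub> \<phi> x"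
   if "a \<in> carrier \<Lambda>" "x \<in> Ob A.Fh \<tau>" for a x
   using linmapD(3)[OF lin that(1) A.Fh_carrier[OF assms that(2)]] by (subst eA, subst eB) simp
 qed
 thus ?thesis by (rule linmap_cong[OF _ A.Fh_module[OF assms]]) (rule fm_apply[OF assms])
qed

lemma fm_hom: "fm \<in> C_hom v \<Lambda> A.Fh B.Fh"
proof (rule C_homI)
 show "fm {x} (trans_map A.Fh \<tau> x f) = trans_map B.Fh \<tau> x (fm \<tau> f)" if t: "\<tau> \<in> EE" "x \<in> \<tau>" "f \<in> Ob A.Fh \<tau>" for \<tau> x f
  unfolding fm_apply[OF edge_vertex_simplex[OF t(1,2)] A.FH.trans_closed[OF t]] fm_apply[OF edge_simplex[OF t(1)] t(3)]
  using linmap_neg[OF lin A.W_module B.W_module A.Fh_carrier[OF edge_simplex[OF t(1)] t(3)]] by (simp add: A.Fh_trans B.Fh_trans)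
 show "fm (act_simplex g \<tau>) (act_map A.Fh g \<tau> f) = act_map B.Fh g \<tau> (fm \<tau> f)"
  if t: "det g ~= 0" "\<tau> \<in> SS" "f \<in> Ob A.Fh \<tau>" for g \<tau> f
 proof -
  have f: "f \<in> carrier A.W" by (rule A.Fh_carrier[OF t(2,3)])
  have 1: "\<phi> (A.\<rho> (th g) f) = B.\<rho> (th g) (\<phi> f)" by (rule equi[OF th_GG[OF t(1)] f])
  have 2: "\<phi> (\<ominus>\<^bsub>A.W\<^esub> A.\<rho> (th g) f) = \<ominus>\<^bsub>B.W\<^esub> B.\<rho> (th g) (\<phi> f)"
   using linmap_neg[OF lin A.W_module B.W_module A.\<rho>_mem[OF th_GG[OF t(1)] f]] 1 by simp
  have "\<phi> (act_map A.Fh g \<tau> f) = act_map B.Fh g \<tau> (\<phi> f)" using 1 2 by (simp add: F_hat_def)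
  thus ?thesis unfolding fm_apply[OF simplex_act[OF t(1,2)] A.FH.act_closed[OF t]] fm_apply[OF t(2,3)] .
 qed
qed (use fm_linmap in "simp_all add: F_hat_map_def")

lemma counit_natural:
 "R_comp (H0 v e A.Fh) B.eps (H0_map v e A.Fh B.Fh fm) = R_comp (H0 v e A.Fh) \<phi> A.eps"
proof -
 interpret h: coeff_hom v p e \<Lambda> A.Fh B.Fh fm by unfold_locales (rule fm_hom)
 have "B.eps (h.hm w) = \<phi> (A.eps w)" if w: "w \<in> carrier A.FH.HM" for w
 proof (rule A.FH.H_linmap_eq[of B.W "\<lambda>w. B.eps (h.hm w)" "\<lambda>w. \<phi> (A.eps w)", OF _ _ B.W_module _ w])
  show "linmap \<Lambda> A.FH.HM B.W (\<lambda>w. B.eps (h.hm w))" by (rule linmap_comp[OF h.hm_linmap B.eps_linmap])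
  show "linmap \<Lambda> A.FH.HM B.W (\<lambda>w. \<phi> (A.eps w))" by (rule linmap_comp[OF A.eps_linmap lin])
  fix x f assume x: "x \<in> VV" and f: "f \<in> Ob A.Fh {x}"
  have f': "f \<in> A.FV x" using f by (simp add: A.Fh_vertex)
  show "B.eps (h.hm (A.FH.cls x f)) = \<phi> (A.eps (A.FH.cls x f))"
   unfolding h.hm_cls[OF x f] fm_apply[OF vertex_simplex[OF x] f] A.eps_cls[OF x f'] B.eps_cls[OF x hom_FV[OF x f']] ..
 qed
 thus ?thesis unfolding R_comp_def compose_def by (intro restrict_ext) (simp add: A.FH.H0_mod)
qed

lemma F_hat_map_comp: "F_hat_map v p e xp V (R_comp V \<psi> \<phi>) = C_comp v A.Fh (F_hat_map v p e xp V' \<psi>) fm"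
proof -
 have "R_comp V \<psi> \<phi> f = F_hat_map v p e xp V' \<psi> \<tau> (fm \<tau> f)" if "\<tau> \<in> SS" "f \<in> Ob A.Fh \<tau>" for \<tau> f
  unfolding fm_apply[OF that] using hom_obj[OF that] A.Fh_carrier[OF that] that(1) by (simp add: F_hat_map_def R_comp_apply)
 thus ?thesis unfolding F_hat_map_def[of v p e xp V] C_comp_def compose_def by (intro restrict_ext) (simp add: F_hat_map_def)
qed

end

context smooth_rep
begin

lemma F_hat_map_id: "F_hat_map v p e xp V (R_id V) = C_id v Fh"
 unfolding F_hat_map_def C_id_def
 by (intro restrict_ext) (use Fh_carrier in "simp add: R_id_def")

lemma counit_hom: "eps \<in> R_hom v e \<Lambda> (H0 v e Fh) V"
proof (rule R_homI, unfold FH.H0_mod hG_carrier)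
 show "eps \<in> extensional (carrier FH.HM)" by (simp add: counit_map_def FH.H0_mod)
qed (simp_all add: eps_linmap eps_equivariant)

lemma counit_iso: assumes "\<exists>n. \<forall>w\<in>carrier FH.HM. ((add_pow FH.HM p) ^^ n) w = \<zero>\<^bsub>FH.HM\<^esub>"
 shows "eps \<in> R_iso v e \<Lambda> (H0 v e Fh) V"
 by (rule R_isoI[OF counit_hom FH.H0_rep V_rep])
  (use eps_inj[OF assms] eps_surj in "simp add: bij_betw_def FH.H0_mod")

end

section \<open>The unit and the adjunction\<close>

text \<open>Fixing the edge makes the homology of \<open>F\<close> an instance of
  \<open>smooth_rep\<close>, so that the results on \<open>F_hat\<close> apply to it.\<close>

locale pointed_coeff = coeff v p e \<Lambda> F
 for v :: "'f::field => int" and p e :: nat and \<Lambda> :: "('l, 'c) ring_scheme" and F :: "('f, 'l, 'm) coeff_system" +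
 fixes xp xm :: "'f vertex"
 assumes xpm: "{xp, xm} \<in> edges v"
begin

sublocale R: smooth_rep v p e \<Lambda> xp xm "H0 v e F"
 by unfold_locales (rule xpm, rule H0_R0[OF xpm])

abbreviation "pl x \<equiv> x \<in> SL2_orbit xp"
abbreviation "un \<equiv> unit_map v xp F"

lemma HW: "carrier R.W = carrier HM"
 by (simp add: H0_mod)

lemma un_vertex: "x \<in> VV ==> f \<in> Ob F {x} ==> un {x} f = cls x f"
 by (simp add: unit_map_def vertex_simplex edge_ne_vertex)

lemma un_edge: "{x, y} \<in> EE ==> pl x ==> f \<in> Ob F {x, y} ==> un {x, y} f = cls x (trans_map F {x, y} x f)"
 by (simp add: unit_map_def edge_simplex R.plus_vertex_eq)

lemma un_edge_minus: assumes "{x, y} \<in> EE" "\<not> pl x" "f \<in> Ob F {x, y}"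
 shows "un {x, y} f = \<ominus>\<^bsub>HM\<^esub> cls x (trans_map F {x, y} x f)"
proof -
 have c: "{x, y} = {y, x}" by (rule insert_commute)
 have "pl y" using R.pl_edge[OF assms(1)] assms(2) by simp
 hence "un {x, y} f = cls y (trans_map F {x, y} y f)" using un_edge[of y x f] assms(1,3) unfolding c by simp
 thus ?thesis using cls_edge_neg[OF assms(1,3)] by simp
qed

lemma plus_cases: assumes "\<tau> \<in> EE" obtains x y where "\<tau> = {x, y}" "{x, y} \<in> EE" "pl x"
proof -
 obtain x y where xy: "\<tau> = {x, y}" "{x, y} \<in> EE" using edge_cases[OF assms] by metis
 have c: "{x, y} = {y, x}" by (rule insert_commute)
 show thesis
 proof (cases "pl x")
  case False
  hence "pl y" using R.pl_edge[OF xy(2)] by simp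
  thus ?thesis using that[of y x] xy unfolding c by simp
 qed (use that xy in blast)
qed

text \<open>The classes from \<open>x\<close> lie in the sum because the vectors of one edge
  generate F(x) under \<open>K_group v x\<close>; conversely each summand consists of vectors fixed
  by an edge group at \<open>x\<close>, which \<open>fixed_edge\<close> places in the image.\<close>

lemma cls_bij: assumes x: "x \<in> VV" shows "bij_betw (cls x) (Ob F {x}) (R.FV x)"
 unfolding bij_betw_def
proof
 show "inj_on (cls x) (Ob F {x})" by (rule cls_inj[OF x])
 obtain y where y: "{x, y} \<in> EE" using vertex_on_edge[OF x] by blast
 have "cls x f \<in> R.FV x" if f: "f \<in> Ob F {x}" for f
 proof (rule vertex_generated[OF R.FV_submod[OF x, unfolded H0_mod] y _ _ f])
  show "ract (th k) w \<in> R.FV x" if "k \<in> K_group v x" "w \<in> R.FV x" for k w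
   using R.\<rho>_FV[OF x _ that(2), of k] K_group_props[OF x] that(1) by auto
  show "cls x (trans_map F {x, y} x f) \<in> R.FV x" if "f \<in> Ob F {x, y}" for f
  proof (rule R.fixd_FV[OF y])
   show "cls x (trans_map F {x, y} x f) \<in> R.fixd {x, y}"
    using cls_fixed_edge[OF y that] cls_mem[OF x trans_closed[OF y _ that]] by (simp add: rep_fixed_def H0_mod)
  qed
 qed
 moreover have "R.FV x \<subseteq> cls x ` Ob F {x}"
 proof (rule R.FV_le)
  show "submodule (cls x ` Ob F {x}) \<Lambda> R.W"
   unfolding H0_mod by (rule linmap_image_submod[OF cls_linmap[OF x] F_modV[OF x] Qt.Q_module])
  fix y assume y: "{x, y} \<in> EE"
  show "R.fixd {x, y} \<subseteq> cls x ` Ob F {x}"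
  proof
   fix w assume "w \<in> R.fixd {x, y}"
   hence "w \<in> carrier HM" "!!h. h \<in> hU {x, y} ==> ract h w = w" by (simp_all add: rep_fixed_def H0_mod)
   then obtain f where f: "f \<in> Ob F {x, y}" "w = cls x (trans_map F {x, y} x f)" using fixed_edge[OF y] by blast
   show "w \<in> cls x ` Ob F {x}" unfolding f(2) by (rule imageI) (rule trans_closed[OF y _ f(1)], simp)
  qed
 qed
 ultimately show "cls x ` Ob F {x} = R.FV x" by blast
qed

text \<open>Injective as a composite of two embeddings, onto by \<open>fixed_edge\<close>.\<close>

lemma cls_edge_bij: assumes xy: "{x, y} \<in> EE"
 shows "bij_betw (\<lambda>f. cls x (trans_map F {x, y} x f)) (Ob F {x, y}) (R.fixd {x, y})"
 unfolding bij_betw_def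
proof
 have x: "x \<in> VV" using edge_vertices[OF xy] by simp
 have xin: "x \<in> {x, y}" by simp
 show "inj_on (\<lambda>f. cls x (trans_map F {x, y} x f)) (Ob F {x, y})"
 proof (rule inj_onI)
  fix f f' assume f: "f \<in> Ob F {x, y}" "f' \<in> Ob F {x, y}"
   "cls x (trans_map F {x, y} x f) = cls x (trans_map F {x, y} x f')"
  have "trans_map F {x, y} x f = trans_map F {x, y} x f'"
   by (rule inj_onD[OF cls_inj[OF x] f(3) trans_closed[OF xy xin f(1)] trans_closed[OF xy xin f(2)]])
  thus "f = f'" by (rule inj_onD[OF F_inj[OF xy xin] _ f(1,2)])
 qed
 show "(\<lambda>f. cls x (trans_map F {x, y} x f)) ` Ob F {x, y} = R.fixd {x, y}"
 proof
  show "(\<lambda>f. cls x (trans_map F {x, y} x f)) ` Ob F {x, y} \<subseteq> R.fixd {x, y}"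
  proof (rule image_subsetI)
   fix f assume f: "f \<in> Ob F {x, y}"
   show "cls x (trans_map F {x, y} x f) \<in> R.fixd {x, y}"
    using cls_fixed_edge[OF xy f] cls_mem[OF x trans_closed[OF xy xin f]] by (simp add: rep_fixed_def H0_mod)
  qed
  show "R.fixd {x, y} \<subseteq> (\<lambda>f. cls x (trans_map F {x, y} x f)) ` Ob F {x, y}"
  proof
   fix w assume "w \<in> R.fixd {x, y}"
   hence "w \<in> carrier HM" "!!h. h \<in> hU {x, y} ==> ract h w = w" by (simp_all add: rep_fixed_def H0_mod)
   thus "w \<in> (\<lambda>f. cls x (trans_map F {x, y} x f)) ` Ob F {x, y}" using fixed_edge[OF xy] by blast
  qed
 qed
qed

lemma un_bij: assumes "\<tau> \<in> SS" shows "bij_betw (un \<tau>) (Ob F \<tau>) (Ob R.Fh \<tau>)"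
 using R.Fh_simplex_cases[OF assms]
proof cases
 case 1
 obtain x y where xy: "\<tau> = {x, y}" "{x, y} \<in> EE" "pl x" by (rule plus_cases[OF 1])
 have c: "Ob R.Fh \<tau> = R.fixd {x, y}" using R.Fh_edge[OF xy(2)] xy(1) by simp
 show ?thesis unfolding c unfolding xy(1)
  by (rule bij_betw_cong[THEN iffD2, OF _ cls_edge_bij[OF xy(2)]]) (rule un_edge[OF xy(2,3)])
next
 case (2 x)
 have c: "Ob R.Fh \<tau> = R.FV x" using R.Fh_vertex 2(2) by simp
 show ?thesis unfolding c unfolding 2(2)
  by (rule bij_betw_cong[THEN iffD2, OF _ cls_bij[OF 2(1)]]) (rule un_vertex[OF 2(1)])
qed

lemma un_mem: "\<tau> \<in> SS ==> f \<in> Ob F \<tau> ==> un \<tau> f \<in> Ob R.Fh \<tau>"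
 by (rule bij_betwE[OF un_bij, rule_format])

lemma un_HM: "\<tau> \<in> SS ==> f \<in> Ob F \<tau> ==> un \<tau> f \<in> carrier HM"
 unfolding HW[symmetric] by (rule R.Fh_carrier[OF _ un_mem])

lemma un_linmap: assumes "\<tau> \<in> SS" shows "linmap \<Lambda> (obj F \<tau>) (obj R.Fh \<tau>) (un \<tau>)"
proof -
 have eB: "obj R.Fh \<tau> = R.W\<lparr>carrier := Ob R.Fh \<tau>\<rparr>" by (simp add: F_hat_def)
 have "linmap \<Lambda> (obj F \<tau>) R.W (un \<tau>)" using R.Fh_simplex_cases[OF assms]
 proof cases
  case 1
  obtain x y where xy: "\<tau> = {x, y}" "{x, y} \<in> EE" "pl x" by (rule plus_cases[OF 1])
  have x: "x \<in> VV" "x \<in> {x, y}" using edge_vertices[OF xy(2)] by simp_all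
  show ?thesis unfolding xy(1) H0_mod
   by (rule linmap_cong[OF linmap_comp[OF F_tr[OF xy(2) x(2)] cls_linmap[OF x(1)]] F_modE[OF xy(2)]]) (rule un_edge[OF xy(2,3)])
 next
  case (2 x)
  show ?thesis unfolding 2(2) H0_mod
   by (rule linmap_cong[OF cls_linmap[OF 2(1)] F_modV[OF 2(1)]]) (rule un_vertex[OF 2(1)])
 qed
 thus ?thesis by (subst eB) (rule linmap_into, simp, rule un_mem[OF assms])
qed

lemma un_trans: assumes "\<tau> \<in> EE" "x \<in> \<tau>" "f \<in> Ob F \<tau>"
 shows "un {x} (trans_map F \<tau> x f) = trans_map R.Fh \<tau> x (un \<tau> f)"
proof -
 obtain y where y: "\<tau> = {x, y}" "{x, y} \<in> EE" by (rule edge_at[OF assms(1,2)])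
 have x: "x \<in> VV" using edge_vertices[OF y(2)] by simp
 note f = assms(3)[unfolded y(1)]
 have m: "trans_map F {x, y} x f \<in> Ob F {x}" by (rule trans_closed[OF y(2) _ f]) simp
 interpret H: Module.module \<Lambda> HM by (rule Qt.Q_module)
 show ?thesis
 proof (cases "pl x")
  case True thus ?thesis unfolding y(1) un_vertex[OF x m] R.Fh_trans un_edge[OF y(2) True f] by simp
 next
  case False
  thus ?thesis unfolding y(1) un_vertex[OF x m] R.Fh_trans un_edge_minus[OF y(2) False f]
   using H.M.minus_minus[OF cls_mem[OF x m]] by (simp add: H0_mod)
 qed
qed

text \<open>The unit reads an edge at its plus vertex. If \<open>g\<close> exchanges the orbits, the
  image edge is read at the other end, which costs a sign; it is the sign in the action on
  \<open>F_hat\<close>.\<close>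

lemma un_act: assumes g: "det g ~= 0" and t: "\<tau> \<in> SS" and f: "f \<in> Ob F \<tau>"
 shows "un (act_simplex g \<tau>) (act_map F g \<tau> f) = act_map R.Fh g \<tau> (un \<tau> f)"
proof -
 have key: "cls (actv g x) (act_map F g {x} a) = ract (th g) (cls x a)"
  if x: "x \<in> VV" and a: "a \<in> Ob F {x}" for x a
  using ract_cls'[OF th_GG[OF g] x a g] by (simp add: ball_mem th_apply)
 show ?thesis using R.Fh_simplex_cases[OF t]
 proof cases
  case 1
  obtain x y where xy: "\<tau> = {x, y}" "{x, y} \<in> EE" "pl x" by (rule plus_cases[OF 1])
  have x: "x \<in> VV" "x \<in> {x, y}" using edge_vertices[OF xy(2)] by simp_all
  note f = f[unfolded xy(1)]
  let ?g = "actv g"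
  have gxy: "act_simplex g {x, y} = {?g x, ?g y}" by (simp add: act_simplex_def)
  have gE: "{?g x, ?g y} \<in> EE" using edge_act[OF g xy(2)] by (simp add: gxy)
  have f': "act_map F g {x, y} f \<in> Ob F {?g x, ?g y}"
   using act_closed[OF g edge_simplex[OF xy(2)] f] by (simp only: gxy)
  have tr: "trans_map F {?g x, ?g y} (?g x) (act_map F g {x, y} f) = act_map F g {x} (trans_map F {x, y} x f)"
   using F_act_tr[OF g xy(2) x(2) f] by (simp only: gxy)
  have u: "un {x, y} f = cls x (trans_map F {x, y} x f)" by (rule un_edge[OF xy(2,3) f])
  have k: "cls (?g x) (trans_map F {?g x, ?g y} (?g x) (act_map F g {x, y} f)) = ract (th g) (un {x, y} f)"
   unfolding tr u by (rule key[OF x(1) trans_closed[OF xy(2) x(2) f]])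
  show ?thesis
  proof (cases "even (v (det g))")
   case True
   hence "pl (?g x)" using R.pl_act[OF x(1) g] xy(3) by simp
   from un_edge[OF gE this f'] show ?thesis unfolding xy(1) gxy k R.Fh_act_edge[OF xy(2) g] using True by simp
  next
   case False
   hence "\<not> pl (?g x)" using R.pl_act[OF x(1) g] xy(3) by simp
   from un_edge_minus[OF gE this f'] show ?thesis unfolding xy(1) gxy k R.Fh_act_edge[OF xy(2) g] using False by (simp add: H0_mod)
  qed
 next
  case (2 x)
  note f = f[unfolded 2(2)]
  have gx: "act_simplex g {x} = {actv g x}" by (simp add: act_simplex_def)
  have f': "act_map F g {x} f \<in> Ob F {actv g x}" using act_closed[OF g vertex_simplex[OF 2(1)] f] by (simp only: gx)
  show ?thesis unfolding 2(2) gx un_vertex[OF 2(1) f] un_vertex[OF act_vertex_VV[OF g 2(1)] f'] R.Fh_act_vertex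
   by (rule key[OF 2(1) f])
 qed
qed

lemma un_hom: "un \<in> C_hom v \<Lambda> F R.Fh"
 by (rule C_homI) (use un_linmap un_trans un_act in "simp_all add: unit_map_def")

lemma unit_iso: "un \<in> C_iso v \<Lambda> F R.Fh"
proof -
 interpret u: coeff_hom v p e \<Lambda> F R.Fh un by unfold_locales (rule un_hom)
 show ?thesis by (rule u.bijective_iso[OF un_bij])
qed

end

lemma (in tree_level) unit_natural:
 assumes xpm: "{xp, xm} \<in> EE" and F: "F \<in> cat_C0 v p e \<Lambda>" "F' \<in> cat_C0 v p e \<Lambda>" "\<phi> \<in> C_hom v \<Lambda> F F'"
  and t: "\<tau> \<in> SS" "f \<in> Ob F \<tau>"
 shows "unit_map v xp F' \<tau> (\<phi> \<tau> f) = H0_map v e F F' \<phi> (unit_map v xp F \<tau> f)"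
proof -
 interpret A: pointed_coeff v p e \<Lambda> F xp xm by unfold_locales (rule F xpm)+
 interpret B: pointed_coeff v p e \<Lambda> F' xp xm by unfold_locales (rule F xpm)+
 interpret h: coeff_hom v p e \<Lambda> F F' \<phi> by unfold_locales (rule F)
 have pf: "\<phi> \<tau> f \<in> Ob F' \<tau>" by (rule linmapD(1)[OF h.hom_lin[OF t(1)] t(2)])
 show ?thesis using A.R.Fh_simplex_cases[OF t(1)]
 proof cases
  case 1
  obtain x y where xy: "\<tau> = {x, y}" "{x, y} \<in> EE" "A.pl x" by (rule A.plus_cases[OF 1])
  have x: "x \<in> VV" "x \<in> {x, y}" using edge_vertices[OF xy(2)] by simp_all
  note f = t(2)[unfolded xy(1)] and pf = pf[unfolded xy(1)]
  show ?thesis unfolding xy(1) A.un_edge[OF xy(2,3) f] B.un_edge[OF xy(2,3) pf] h.hom_tr[OF xy(2) x(2) f, symmetric]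
   by (rule h.hm_cls[OF x(1) A.trans_closed[OF xy(2) x(2) f], symmetric])
 next
  case (2 x)
  note f = t(2)[unfolded 2(2)] and pf = pf[unfolded 2(2)]
  show ?thesis unfolding 2(2) A.un_vertex[OF 2(1) f] B.un_vertex[OF 2(1) pf] by (rule h.hm_cls[OF 2(1) f, symmetric])
 qed
qed

definition adjunct :: "('f::field => int) => nat => nat => 'f vertex => ('f, 'l, 'm) coeff_system =>
  (('f vertex => 'm) set => 'w) => 'f tree_simplex => 'm => 'w" where
 "adjunct v p e xp F \<phi> = C_comp v F (F_hat_map v p e xp (H0 v e F) \<phi>) (unit_map v xp F)"

context pointed_coeff
begin

lemma adjunct_apply: assumes "\<tau> \<in> SS" "f \<in> Ob F \<tau>" shows "adjunct v p e xp F \<phi> \<tau> f = \<phi> (un \<tau> f)"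
 unfolding adjunct_def C_comp_apply[OF assms] using un_mem[OF assms] assms(1) by (simp add: F_hat_map_def)

text \<open>Injective because classes of vertices generate homology and the transpose records
  \<open>\<phi>\<close> on them. The preimage of \<open>\<psi>\<close> is the counit after the map
  that \<open>\<psi>\<close> induces on homology. On edges the two sides agree because an edge is
  read at its plus vertex, where the transition map of \<open>F_hat\<close> is the plain
  inclusion.\<close>

lemma adjunct_bij: assumes V: "V \<in> cat_R0 v p e {xp, xm} \<Lambda>"
 shows "bij_betw (adjunct v p e xp F) (R_hom v e \<Lambda> (H0 v e F) V) (C_hom v \<Lambda> F (F_hat v p e xp V))"
proof -
 interpret V: smooth_rep v p e \<Lambda> xp xm V by unfold_locales (rule xpm V)+
 have mem: "adjunct v p e xp F \<phi> \<in> C_hom v \<Lambda> F V.Fh" if "\<phi> \<in> R_hom v e \<Lambda> (H0 v e F) V" for \<phi>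
 proof -
  interpret h: rep_hom v p e \<Lambda> xp xm "H0 v e F" V \<phi> by unfold_locales (rule that)
  show ?thesis unfolding adjunct_def by (rule C_comp_hom[OF un_hom h.fm_hom])
 qed
 show ?thesis unfolding bij_betw_def
 proof
  show "inj_on (adjunct v p e xp F) (R_hom v e \<Lambda> (H0 v e F) V)"
  proof (rule inj_onI)
   fix \<phi> \<psi> assume h: "\<phi> \<in> R_hom v e \<Lambda> (H0 v e F) V" "\<psi> \<in> R_hom v e \<Lambda> (H0 v e F) V"
    and eq: "adjunct v p e xp F \<phi> = adjunct v p e xp F \<psi>"
   show "\<phi> = \<psi>"
   proof (rule H_hom_eqI[OF h V.W_module])
    fix x f assume x: "x \<in> VV" and f: "f \<in> Ob F {x}"
    show "\<phi> (cls x f) = \<psi> (cls x f)"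
     using adjunct_apply[OF vertex_simplex[OF x] f, of \<phi>] adjunct_apply[OF vertex_simplex[OF x] f, of \<psi>] eq un_vertex[OF x f] by simp
   qed
  qed
  have "\<psi> \<in> adjunct v p e xp F ` R_hom v e \<Lambda> (H0 v e F) V" if \<psi>: "\<psi> \<in> C_hom v \<Lambda> F V.Fh" for \<psi>
  proof -
   interpret h: coeff_hom v p e \<Lambda> F V.Fh \<psi> by unfold_locales (rule \<psi>)
   let ?\<phi> = "R_comp (H0 v e F) V.eps h.hm"
   have hom: "?\<phi> \<in> R_hom v e \<Lambda> (H0 v e F) V" by (rule R_comp_hom[OF h.hm_hom V.counit_hom H0_rep])
   have ap: "?\<phi> (cls x f) = \<psi> {x} f" if x: "x \<in> VV" and f: "f \<in> Ob F {x}" for x f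
   proof -
    have "\<psi> {x} f \<in> V.FV x" using linmapD(1)[OF h.hom_V[OF x] f] by (simp add: V.Fh_vertex)
    thus ?thesis using h.hm_cls[OF x f] V.eps_cls[OF x] cls_mem[OF x f] by (simp add: R_comp_apply H0_mod)
   qed
   have "\<psi> = adjunct v p e xp F ?\<phi>"
   proof (rule C_hom_eqI[OF \<psi> mem[OF hom]])
    fix \<tau> f assume t: "\<tau> \<in> SS" "f \<in> Ob F \<tau>"
    show "\<psi> \<tau> f = adjunct v p e xp F ?\<phi> \<tau> f" unfolding adjunct_apply[OF t] using R.Fh_simplex_cases[OF t(1)]
    proof cases
     case 1
     obtain x y where xy: "\<tau> = {x, y}" "{x, y} \<in> EE" "pl x" by (rule plus_cases[OF 1])
     have x: "x \<in> VV" "x \<in> {x, y}" using edge_vertices[OF xy(2)] by simp_all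
     note f = t(2)[unfolded xy(1)]
     show "\<psi> \<tau> f = ?\<phi> (un \<tau> f)" unfolding xy(1) un_edge[OF xy(2,3) f] ap[OF x(1) trans_closed[OF xy(2) x(2) f]]
       h.hom_tr[OF xy(2) x(2) f] V.Fh_trans using xy(3) by simp
    next
     case (2 x)
     note f = t(2)[unfolded 2(2)]
     show "\<psi> \<tau> f = ?\<phi> (un \<tau> f)" unfolding 2(2) un_vertex[OF 2(1) f] ap[OF 2(1) f] ..
    qed
   qed
   thus ?thesis using hom by (rule image_eqI)
  qed
  thus "adjunct v p e xp F ` R_hom v e \<Lambda> (H0 v e F) V = C_hom v \<Lambda> F V.Fh" using mem by blast
 qed
qed

end

text \<open>Evaluated at a simplex, the identity reduces to the naturality of the unit.\<close>

lemma (in tree_level) adjunct_natural: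
 assumes xpm: "{xp, xm} \<in> EE" and F: "F \<in> cat_C0 v p e \<Lambda>" "F' \<in> cat_C0 v p e \<Lambda>" "\<alpha> \<in> C_hom v \<Lambda> F' F"
  and V: "V \<in> cat_R0 v p e {xp, xm} \<Lambda>" and \<phi>: "\<phi> \<in> R_hom v e \<Lambda> (H0 v e F) V"
 shows "adjunct v p e xp F' (R_comp (H0 v e F') \<beta> (R_comp (H0 v e F') \<phi> (H0_map v e F' F \<alpha>))) =
  C_comp v F' (F_hat_map v p e xp V \<beta>) (C_comp v F' (adjunct v p e xp F \<phi>) \<alpha>)"
proof -
 interpret A: pointed_coeff v p e \<Lambda> F xp xm by unfold_locales (rule F xpm)+
 interpret B: pointed_coeff v p e \<Lambda> F' xp xm by unfold_locales (rule F xpm)+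
 interpret V: smooth_rep v p e \<Lambda> xp xm V by unfold_locales (rule xpm V)+
 interpret h: coeff_hom v p e \<Lambda> F' F \<alpha> by unfold_locales (rule F)
 interpret k: rep_hom v p e \<Lambda> xp xm "H0 v e F" V \<phi> by unfold_locales (rule \<phi>)
 have "adjunct v p e xp F' (R_comp (H0 v e F') \<beta> (R_comp (H0 v e F') \<phi> h.hm)) \<tau> f =
   C_comp v F' (F_hat_map v p e xp V \<beta>) (C_comp v F' (adjunct v p e xp F \<phi>) \<alpha>) \<tau> f"
  if t: "\<tau> \<in> SS" "f \<in> Ob F' \<tau>" for \<tau> f
 proof -
  have af: "\<alpha> \<tau> f \<in> Ob F \<tau>" by (rule linmapD(1)[OF h.hom_lin[OF t(1)] t(2)])
  have m: "B.un \<tau> f \<in> carrier (rep_mod (H0 v e F'))" using B.un_HM[OF t] by (simp add: B.H0_mod)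
  have o: "\<phi> (A.un \<tau> (\<alpha> \<tau> f)) \<in> Ob V.Fh \<tau>" by (rule k.hom_obj[OF t(1) A.un_mem[OF t(1) af]])
  have "adjunct v p e xp F' (R_comp (H0 v e F') \<beta> (R_comp (H0 v e F') \<phi> h.hm)) \<tau> f = \<beta> (\<phi> (h.hm (B.un \<tau> f)))"
   unfolding B.adjunct_apply[OF t] R_comp_apply[OF m] ..
  also have "h.hm (B.un \<tau> f) = A.un \<tau> (\<alpha> \<tau> f)" by (rule unit_natural[OF xpm F(2,1,3) t, symmetric])
  also have "\<beta> (\<phi> (A.un \<tau> (\<alpha> \<tau> f))) = F_hat_map v p e xp V \<beta> \<tau> (\<phi> (A.un \<tau> (\<alpha> \<tau> f)))"
   using o t(1) by (simp add: F_hat_map_def)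
  finally show ?thesis unfolding C_comp_apply[OF t] A.adjunct_apply[OF t(1) af] .
 qed
 thus ?thesis unfolding adjunct_def C_comp_def[of v F'] compose_def
  by (intro restrict_ext) simp
qed

theorem theorem3p5:
  fixes v :: "'f::field \<Rightarrow> int" and p e :: nat
    and xp xm :: "'f vertex"
    and \<oo> :: "'o ring" and \<Lambda> :: "('o, 'l) module"
  assumes "nonarch_local_field v p"
    and "{xp, xm} \<in> edges v"
    and "complete_dvr \<oo>" and "residue_field_char \<oo> p"
    and "art_algebra \<oo> \<Lambda>"
    and "e \<ge> 1"
  shows
    "\<comment> \<open>(a)\<close>
     (\<forall>F \<in> (cat_C0 v p e \<Lambda> :: ('f, 'l, 'm) coeff_system set).
        H0 v e F \<in> cat_R0 v p e {xp, xm} \<Lambda>) \<and>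
     (\<forall>V \<in> (cat_R0 v p e {xp, xm} \<Lambda> :: ('f, 'l, 'w) rep set).
        F_hat v p e xp V \<in> cat_C0 v p e \<Lambda>) \<and>

     \<comment> \<open>(b) functoriality of \<open>H\<^sub>0\<close>\<close>
     (\<forall>F \<in> (cat_C0 v p e \<Lambda> :: ('f, 'l, 'm) coeff_system set).
      \<forall>F' \<in> (cat_C0 v p e \<Lambda> :: ('f, 'l, 'm) coeff_system set). \<forall>\<phi> \<in> C_hom v \<Lambda> F F'.
        H0_map v e F F' \<phi> \<in> R_hom v e \<Lambda> (H0 v e F) (H0 v e F')) \<and>
     (\<forall>F \<in> (cat_C0 v p e \<Lambda> :: ('f, 'l, 'm) coeff_system set).
        H0_map v e F F (C_id v F) = R_id (H0 v e F)) \<and>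
     (\<forall>F \<in> (cat_C0 v p e \<Lambda> :: ('f, 'l, 'm) coeff_system set).
      \<forall>F' \<in> (cat_C0 v p e \<Lambda> :: ('f, 'l, 'm) coeff_system set).
      \<forall>F'' \<in> (cat_C0 v p e \<Lambda> :: ('f, 'l, 'm) coeff_system set).
      \<forall>\<phi> \<in> C_hom v \<Lambda> F F'. \<forall>\<psi> \<in> C_hom v \<Lambda> F' F''.
        H0_map v e F F'' (C_comp v F \<psi> \<phi>) =
        R_comp (H0 v e F) (H0_map v e F' F'' \<psi>) (H0_map v e F F' \<phi>)) \<and>

     \<comment> \<open>(b) functoriality of \<open>V \<mapsto> F_hat V\<close>\<close>
     (\<forall>V \<in> (cat_R0 v p e {xp, xm} \<Lambda> :: ('f, 'l, 'w) rep set).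
      \<forall>V' \<in> (cat_R0 v p e {xp, xm} \<Lambda> :: ('f, 'l, 'w) rep set). \<forall>\<phi> \<in> R_hom v e \<Lambda> V V'.
        F_hat_map v p e xp V \<phi> \<in> C_hom v \<Lambda> (F_hat v p e xp V) (F_hat v p e xp V')) \<and>
     (\<forall>V \<in> (cat_R0 v p e {xp, xm} \<Lambda> :: ('f, 'l, 'w) rep set).
        F_hat_map v p e xp V (R_id V) = C_id v (F_hat v p e xp V)) \<and>
     (\<forall>V \<in> (cat_R0 v p e {xp, xm} \<Lambda> :: ('f, 'l, 'w) rep set).
      \<forall>V' \<in> (cat_R0 v p e {xp, xm} \<Lambda> :: ('f, 'l, 'w) rep set).
      \<forall>V'' \<in> (cat_R0 v p e {xp, xm} \<Lambda> :: ('f, 'l, 'w) rep set).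
      \<forall>\<phi> \<in> R_hom v e \<Lambda> V V'. \<forall>\<psi> \<in> R_hom v e \<Lambda> V' V''.
        F_hat_map v p e xp V (R_comp V \<psi> \<phi>) =
        C_comp v (F_hat v p e xp V) (F_hat_map v p e xp V' \<psi>) (F_hat_map v p e xp V \<phi>)) \<and>

     \<comment> \<open>(b) adjunction\<close>
     (\<exists>\<Phi> :: ('f, 'l, 'm) coeff_system \<Rightarrow> ('f, 'l, 'w) rep \<Rightarrow>
            (('f vertex \<Rightarrow> 'm) set \<Rightarrow> 'w) \<Rightarrow> 'f tree_simplex \<Rightarrow> 'm \<Rightarrow> 'w.
        (\<forall>F \<in> cat_C0 v p e \<Lambda>. \<forall>V \<in> cat_R0 v p e {xp, xm} \<Lambda>.
           bij_betw (\<Phi> F V) (R_hom v e \<Lambda> (H0 v e F) V) (C_hom v \<Lambda> F (F_hat v p e xp V))) \<and>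
        (\<forall>F \<in> cat_C0 v p e \<Lambda>. \<forall>F' \<in> cat_C0 v p e \<Lambda>.
         \<forall>V \<in> cat_R0 v p e {xp, xm} \<Lambda>. \<forall>V' \<in> cat_R0 v p e {xp, xm} \<Lambda>.
         \<forall>\<alpha> \<in> C_hom v \<Lambda> F' F. \<forall>\<beta> \<in> R_hom v e \<Lambda> V V'. \<forall>\<phi> \<in> R_hom v e \<Lambda> (H0 v e F) V.
           \<Phi> F' V' (R_comp (H0 v e F') \<beta> (R_comp (H0 v e F') \<phi> (H0_map v e F' F \<alpha>))) =
           C_comp v F' (F_hat_map v p e xp V \<beta>) (C_comp v F' (\<Phi> F V \<phi>) \<alpha>))) \<and>

     \<comment> \<open>(c) a natural isomorphism from the identity to \<open>F_hat \<circ> H\<^sub>0\<close>\<close>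
     (\<exists>\<eta> :: ('f, 'l, 'm) coeff_system \<Rightarrow> 'f tree_simplex \<Rightarrow> 'm \<Rightarrow> ('f vertex \<Rightarrow> 'm) set.
        (\<forall>F \<in> cat_C0 v p e \<Lambda>. \<eta> F \<in> C_iso v \<Lambda> F (F_hat v p e xp (H0 v e F))) \<and>
        (\<forall>F \<in> cat_C0 v p e \<Lambda>. \<forall>F' \<in> cat_C0 v p e \<Lambda>. \<forall>\<phi> \<in> C_hom v \<Lambda> F F'.
           C_comp v F (\<eta> F') \<phi> =
           C_comp v F (F_hat_map v p e xp (H0 v e F) (H0_map v e F F' \<phi>)) (\<eta> F))) \<and>

     \<comment> \<open>(c) a natural isomorphism from \<open>H\<^sub>0 \<circ> F_hat\<close> to the identity\<close>
     (\<exists>\<epsilon> :: ('f, 'l, 'w) rep \<Rightarrow> ('f vertex \<Rightarrow> 'w) set \<Rightarrow> 'w.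
        (\<forall>V \<in> cat_R0 v p e {xp, xm} \<Lambda>. \<epsilon> V \<in> R_iso v e \<Lambda> (H0 v e (F_hat v p e xp V)) V) \<and>
        (\<forall>V \<in> cat_R0 v p e {xp, xm} \<Lambda>. \<forall>V' \<in> cat_R0 v p e {xp, xm} \<Lambda>. \<forall>\<phi> \<in> R_hom v e \<Lambda> V V'.
           R_comp (H0 v e (F_hat v p e xp V)) (\<epsilon> V')
             (H0_map v e (F_hat v p e xp V) (F_hat v p e xp V') (F_hat_map v p e xp V \<phi>)) =
           R_comp (H0 v e (F_hat v p e xp V)) \<phi> (\<epsilon> V))) \<and>

     \<comment> \<open>(d)\<close>
     (\<forall>F \<in> (cat_C0 v p e \<Lambda> :: ('f, 'l, 'm) coeff_system set).
        unit_map v xp F \<in> C_iso v \<Lambda> F (F_hat v p e xp (H0 v e F))) \<and>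
     (\<forall>V \<in> (cat_R0 v p e {xp, xm} \<Lambda> :: ('f, 'l, 'w) rep set).
        counit_map v p e xp V \<in> R_iso v e \<Lambda> (H0 v e (F_hat v p e xp V)) V)"
proof -
 interpret tree_level v p e by unfold_locales (rule assms(1), rule assms(6))
 note xpm = assms(2)
 have coeff: "coeff v p e \<Lambda> F" if "F \<in> cat_C0 v p e \<Lambda>" for F :: "('f, 'l, 'm) coeff_system"
  by unfold_locales (rule that)
 have pc: "pointed_coeff v p e \<Lambda> F xp xm" if "F \<in> cat_C0 v p e \<Lambda>" for F :: "('f, 'l, 'm) coeff_system"
  by unfold_locales (rule that xpm)+
 have ch: "coeff_hom v p e \<Lambda> F F' \<phi>" if "F \<in> cat_C0 v p e \<Lambda>" "F' \<in> cat_C0 v p e \<Lambda>" "\<phi> \<in> C_hom v \<Lambda> F F'"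
  for F F' :: "('f, 'l, 'm) coeff_system" and \<phi>
  by unfold_locales (rule that)+
 have sr: "smooth_rep v p e \<Lambda> xp xm V" if "V \<in> cat_R0 v p e {xp, xm} \<Lambda>" for V :: "('f, 'l, 'w) rep"
  by unfold_locales (rule that xpm)+
 have rh: "rep_hom v p e \<Lambda> xp xm V V' \<phi>"
  if "V \<in> cat_R0 v p e {xp, xm} \<Lambda>" "V' \<in> cat_R0 v p e {xp, xm} \<Lambda>" "\<phi> \<in> R_hom v e \<Lambda> V V'"
  for V V' :: "('f, 'l, 'w) rep" and \<phi>
  by unfold_locales (rule that xpm)+
 have unit: "unit_map v xp F \<in> C_iso v \<Lambda> F (F_hat v p e xp (H0 v e F))" if "F \<in> cat_C0 v p e \<Lambda>"
  for F :: "('f, 'l, 'm) coeff_system"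
  by (rule pointed_coeff.unit_iso[OF pc[OF that]])
 have counit: "counit_map v p e xp V \<in> R_iso v e \<Lambda> (H0 v e (F_hat v p e xp V)) V" if "V \<in> cat_R0 v p e {xp, xm} \<Lambda>"
  for V :: "('f, 'l, 'w) rep"
 proof -
  interpret smooth_rep v p e \<Lambda> xp xm V by (rule sr[OF that])
  \<comment> \<open>The nilpotency of \<open>p\<close> on homology, inherited from \<Lambda>, is
    what the injectivity of the counit requires.\<close>
  show ?thesis by (rule counit_iso[OF art_algebra_p_nilpotent[OF assms(4,5) FH.Qt.Q_module]])
 qed
 show ?thesis
 proof (intro conjI ballI, goal_cases)
  case (1 F)
  show ?case by (rule coeff.H0_R0[OF coeff[OF 1] xpm])
 next
  case (2 V)
  show ?case by (rule smooth_rep.Fh_C0[OF sr[OF 2]])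
 next
  case (3 F F' \<phi>)
  show ?case by (rule coeff_hom.hm_hom[OF ch[OF 3]])
 next
  case (4 F)
  show ?case by (rule coeff.H0_map_id[OF coeff[OF 4]])
 next
  case (5 F F' F'' \<phi> \<psi>)
  show ?case by (rule H0_map_comp[OF 5])
 next
  case (6 V V' \<phi>)
  show ?case by (rule rep_hom.fm_hom[OF rh[OF 6]])
 next
  case (7 V)
  show ?case by (rule smooth_rep.F_hat_map_id[OF sr[OF 7]])
 next
  case (8 V V' V'' \<phi> \<psi>)
  show ?case by (rule rep_hom.F_hat_map_comp[OF rh[OF 8(1,2,4)]])
 next
  case 9
  show ?case
   \<comment> \<open>The transpose is given by one formula for all \<open>V\<close>.\<close>
   by (rule exI[of _ "\<lambda>F V. adjunct v p e xp F"])
    (use pointed_coeff.adjunct_bij[OF pc] adjunct_natural[OF xpm] in "intro conjI ballI; blast")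
 next
  case 10
  show ?case
  proof (intro exI[of _ "unit_map v xp"] conjI ballI)
   show "C_comp v F (unit_map v xp F') \<phi> =
     C_comp v F (F_hat_map v p e xp (H0 v e F) (H0_map v e F F' \<phi>)) (unit_map v xp F)"
    if h: "F \<in> cat_C0 v p e \<Lambda>" "F' \<in> cat_C0 v p e \<Lambda>" "\<phi> \<in> C_hom v \<Lambda> F F'" for F F' :: "('f, 'l, 'm) coeff_system" and \<phi>
   proof (rule C_comp_cong)
    fix \<tau> f assume t: "\<tau> \<in> simplices v" "f \<in> Ob F \<tau>"
    show "unit_map v xp F' \<tau> (\<phi> \<tau> f) = F_hat_map v p e xp (H0 v e F) (H0_map v e F F' \<phi>) \<tau> (unit_map v xp F \<tau> f)"
     unfolding unit_natural[OF xpm h t] using pointed_coeff.un_mem[OF pc[OF h(1)] t] t(1) by (simp add: F_hat_map_def)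
   qed
  qed (rule unit)
 next
  case 11
  show ?case
  proof (intro exI[of _ "counit_map v p e xp"] conjI ballI)
   fix V V' :: "('f, 'l, 'w) rep" and \<phi> assume h: "V \<in> cat_R0 v p e {xp, xm} \<Lambda>" "V' \<in> cat_R0 v p e {xp, xm} \<Lambda>" "\<phi> \<in> R_hom v e \<Lambda> V V'"
   show "R_comp (H0 v e (F_hat v p e xp V)) (counit_map v p e xp V')
       (H0_map v e (F_hat v p e xp V) (F_hat v p e xp V') (F_hat_map v p e xp V \<phi>)) =
      R_comp (H0 v e (F_hat v p e xp V)) \<phi> (counit_map v p e xp V)"
    by (rule rep_hom.counit_natural[OF rh[OF h]])
  qed (rule counit)
 next
  case (12 F)
  show ?case by (rule unit[OF 12])
 next
  case (13 V)
  show ?case by (rule counit[OF 13])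
 qed
qed

end
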